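(* Let $(M,\omega)$ be a symplectic manifold, $\nabla$ a torsion-free symplectic connection on $M$, $E\to M$ a complex vector bundle with connection $\nabla^E$, and $\Omega=\sum_{i\ge1}\lambda^i\Omega_i$ a formal series of closed two-forms on $M$. Let $r,r',r^E$ and $\mathcal D,\mathcal D'$ be the Fedosov elements and Fedosov derivatives built from these data (with the same $\Omega$ for $r$ and $r'$) as described in the context, and define $$\mathcal D^E:\mathcal W\otimes\Lambda^\bullet\otimes\mathcal E\to\mathcal W\otimes\Lambda^{\bullet+1}\otimes\mathcal E,\qquad \mathcal D^E=-\delta+D^E+\frac{\mathrm i}{\lambda}\mathrm{ad}(r)+r^E,$$ where $r^E$ acts by $\circ$-left multiplication. Then for all $a\in\mathcal W\otimes\Lambda^\bullet\otimes\mathcal End(\mathcal E)$, $\Psi\in\mathcal W\otimes\Lambda^\bullet\otimes\mathcal E$, $b\in\mathcal W\otimes\Lambda^\bullet$ (with $a$, $\Psi$ homogeneous of antisymmetric degrees $\deg_a a$ and $\deg_a\Psi$): $$\mathcal D^E(a\circ\Psi)=(\mathcal D'a)\circ\Psi+(-1)^{\deg_a a}\,a\circ(\mathcal D^E\Psi),$$ $$\mathcal D^E(\Psi\circ b)=(\mathcal D^E\Psi)\circ b+(-1)^{\deg_a\Psi}\,\Psi\circ(\mathcal Db),$$ and $(\mathcal D^E)^2=0$. Moreover, $$\sigma:\ker\mathcal D^E\cap\ker\deg_a\to\Gamma^\infty(E)[[\lambda]]$$ is a $\mathbb C[[\lambda]]$-linear bijection; denote its inverse by $\tau^E$. For $s\in\Gamma^\infty(E)$,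 writing $\tau^E(s)=\sum_{k=0}^\infty\tau^E(s)^{(k)}$ for the decomposition into homogeneous components of total degree $k$, one has $\tau^E(s)^{(0)}=s$ and, for all $k\ge0$, $$\tau^E(s)^{(k+1)}=\delta^{-1}\Big(D^E\tau^E(s)^{(k)}+\sum_{l=1}^{k}\Big(\frac{\mathrm i}{\lambda}\mathrm{ad}\big(r^{(l+2)}\big)+(r^E)^{(l)}\Big)\tau^E(s)^{(k-l)}\Big),$$ where $r^{(l+2)}$ and $(r^E)^{(l)}$ denote the components of total degree $l+2$ and $l$ of $r$ and $r^E$, and $(r^E)^{(l)}$ acts by $\circ$-left multiplication.
   Context: Spaces (all bundles complexified, $\lambda$ a formal parameter): $\mathcal W=\prod_{s\ge0}\Gamma^\infty(\bigvee^sT^*M)[[\lambda]]$, $\mathcal W\otimes\Lambda^\bullet=\prod_s\Gamma^\infty(\bigvee^sT^*M\otimes\bigwedge^\bullet T^*M)[[\lambda]]$, and $\mathcal W\otimes\Lambda^\bullet\otimes\mathcal E$, $\mathcal W\otimes\Lambda^\bullet\otimes\mathcal End(\mathcal E)$ are defined the same way with an additional tensor factor $E$, respectively $\mathrm{End}(E)$. $\mathcal W\otimes\Lambda^\bullet$ is regarded as a subalgebra of $\mathcal W\otimes\Lambda^\bullet\otimes\mathcal End(\mathcal E)$. Degrees: $\deg_s,\deg_a,\deg_\lambda$ are the symmetric, antisymmetric and $\lambda$-degree; the total degree is $\mathrm{Deg}=2\deg_\lambda+\deg_s$. $\ker\deg_a$ means the elements of antisymmetric degree $0$. $\sigma$ is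 the projection onto the part of symmetric and antisymmetric degree $0$. Operators: $\delta=(1\otimes dx^i)\,i_s(\partial_i)$ and $\delta^*=(dx^i\otimes1)\,i_a(\partial_i)$, with $i_s,i_a$ the symmetric and antisymmetric insertions (in $\delta$ the form $dx^i$ multiplies in the $\bigwedge$ factor, in $\delta^*$ in the $\bigvee$ factor). $\delta^{-1}a=\frac1{k+l}\delta^*a$ if $\deg_sa=ka$, $\deg_aa=la$ with $k+l\neq0$, and $\delta^{-1}a=0$ if $k=l=0$. Covariant derivatives: $D=(1\otimes dx^i)\nabla_{\partial_i}$ on $\mathcal W\otimes\Lambda^\bullet$ (so $D(f\otimes\alpha)=\nabla_{\partial_i}f\otimes dx^i\wedge\alpha+f\otimes d\alpha$), and $D^E$, $D'$ are its extensions to the $E$- and $\mathrm{End}(E)$-valued spaces using $\nabla^E$ and the induced connection $\nabla^{\mathrm{End}(E)}$. Fiberwise Weyl product: $f\circ g=\mu\circ e^{\frac{\mathrm i\lambda}{2}\Lambda^{kl}i_s(\partial_k)\otimes i_s(\partial_l)}(f\otimes g)$ for $f,g\in\mathcal W$, with $\mu$ the symmetric product and $\Lambda^{kl}=-\omega^{kl}$ the Poisson tensor ($\omega^{kl}$ the inverse matrix of $\omega_{kl}$, where $\omega=\frac12\omega_{kl}dx^k\wedge dx^l$). It is extended by $\wedge$ on forms, composition in $\mathrm{End}(E)$, and the actions $(f\otimes\alpha\otimes A)\circ(g\otimes\beta\otimes s)=f\circ g\otimes\alpha\wedge\beta\otimes As$, $(g\otimes\beta\otimes s)\circ(h\otimes\gamma)=g\circ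 h\otimes\beta\wedge\gamma\otimes s$; thus $\mathcal W\otimes\Lambda^\bullet\otimes\mathcal E$ is a bimodule for the algebras $\mathcal W\otimes\Lambda^\bullet\otimes\mathcal End(\mathcal E)$ and $\mathcal W\otimes\Lambda^\bullet$. $\mathrm{ad}$ is the super-commutator (graded by $\deg_a$) with respect to $\circ$; for $r\in\mathcal W\otimes\Lambda^1$ it is also defined on $\mathcal W\otimes\Lambda^\bullet\otimes\mathcal E$, where $r$ acts from both sides. Expressions with $1/\lambda$ are understood after allowing negative powers of $\lambda$. Curvatures: $R=\frac14\omega_{lm}R^m_{kij}\,dx^l\vee dx^k\otimes dx^i\wedge dx^j$ with $R(\partial_i,\partial_j)\partial_k=R^m_{kij}\partial_m$ the curvature of $\nabla$; $R^E=\frac12dx^i\wedge dx^j\otimes R^E_{ij}$ with $R^E_{ij}=R^E(\partial_i,\partial_j)$ the curvature endomorphisms of $\nabla^E$. Fedosov elements: by Fedosov's theorem there are unique $r\in\mathcal W\otimes\Lambda^1$ and $r'\in\mathcal W\otimes\Lambda^1\otimes\mathcal End(\mathcal E)$ of total degree $\ge3$ with $\delta r=R+Dr+\frac{\mathrm i}{\lambda}r\circ r+\Omega$, $\delta^{-1}r=0$, and $\delta r'=R-\mathrm i\lambda R^E+D'r'+\frac{\mathrm i}{\lambda}r'\circ r'+\Omega$, $\delta^{-1}r'=0$. Set $r^E=\frac{\mathrm i}{\lambda}(r'-r)$ (which contains no negative powers of $\lambda$), $\mathcal D=-\delta+D+\frac{\mathrm i}{\lambda}\mathrm{ad}(r)$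 on $\mathcal W\otimes\Lambda^\bullet$ and $\mathcal D'=-\delta+D'+\frac{\mathrm i}{\lambda}\mathrm{ad}(r')$ on $\mathcal W\otimes\Lambda^\bullet\otimes\mathcal End(\mathcal E)$; these satisfy $\mathcal D^2=0=(\mathcal D')^2$. *)

theory Defs
  imports
    "HOL-Analysis.Analysis"
    "HOL-Library.Function_Algebras"
    "HOL-Computational_Algebra.Formal_Power_Series"
begin

section \<open>Complex scalars on fibres\<close>

text \<open>A common scalar multiplication for the fibres of the trivial line bundle, of \<open>E\<close> and of
  \<open>End(E)\<close>, that is, for \<^typ>\<open>complex\<close>, \<open>complex^'k\<close> and \<open>complex^'k^'k\<close>.\<close>

class complex_fibre = real_normed_vector +
  fixes scaleC :: "complex \<Rightarrow> 'a \<Rightarrow> 'a" (infixr "*\<^sub>c" 75)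
  assumes scaleC_add_right: "a *\<^sub>c (x + y) = a *\<^sub>c x + a *\<^sub>c y"
    and scaleC_add_left: "(a + b) *\<^sub>c x = a *\<^sub>c x + b *\<^sub>c x"
    and scaleC_scaleC: "a *\<^sub>c (b *\<^sub>c x) = (a * b) *\<^sub>c x"
    and scaleC_of_real: "complex_of_real t *\<^sub>c x = t *\<^sub>R x"

instantiation complex :: complex_fibre
begin
definition scaleC_complex :: "complex \<Rightarrow> complex \<Rightarrow> complex"
  where "scaleC_complex a x = a * x"
instance
  by standard (simp_all add: scaleC_complex_def algebra_simps scaleR_conv_of_real)
end

instantiation vec :: (complex_fibre, finite) complex_fibre
begin
definition scaleC_vec :: "complex \<Rightarrow> 'a ^ 'b \<Rightarrow> 'a ^ 'b"
  where "scaleC_vec a x = (\<chi> i. a *\<^sub>c (x $ i))"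
instance
  by standard
    (simp_all add: scaleC_vec_def vec_eq_iff scaleC_add_right scaleC_add_left
      scaleC_scaleC scaleC_of_real)
end


section \<open>Smooth manifolds, tangent vectors and vector fields\<close>

text \<open>On open sets, \<open>Ck_on n\<close> is the usual class \<open>C\<^sup>n\<close>.\<close>

primrec Ck_on :: "nat \<Rightarrow> 'a::real_normed_vector set \<Rightarrow> ('a \<Rightarrow> 'b::real_normed_vector) \<Rightarrow> bool" where
  "Ck_on 0 S f = continuous_on S f"
| "Ck_on (Suc n) S f =
     ((\<forall>x\<in>S. f differentiable at x) \<and> (\<forall>v. Ck_on n S (\<lambda>x. frechet_derivative f (at x) v)))"

definition smooth_on :: "'a::real_normed_vector set \<Rightarrow> ('a \<Rightarrow> 'b::real_normed_vector) \<Rightarrow> bool"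
  where "smooth_on S f \<longleftrightarrow> (\<forall>n. Ck_on n S f)"

text \<open>The manifold is the whole type \<open>'m\<close>; a chart is a pair of its domain and its coordinate map.\<close>

type_synonym ('m, 'n) chart = "'m set \<times> ('m \<Rightarrow> real ^ 'n)"

definition chart_inv :: "('m, 'n::finite) chart \<Rightarrow> real ^ 'n \<Rightarrow> 'm"
  where "chart_inv c = inv_into (fst c) (snd c)"

definition smooth_manifold ::
  "('m::{second_countable_topology, t2_space}, 'n::finite) chart set \<Rightarrow> bool"
  where "smooth_manifold A \<longleftrightarrow>
    (\<forall>c\<in>A. open (fst c) \<and> open (snd c ` fst c) \<and>
       homeomorphism (fst c) (snd c ` fst c) (snd c) (chart_inv c)) \<and>
    (\<Union>c\<in>A. fst c) = UNIV \<and>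
    (\<forall>c\<in>A. \<forall>d\<in>A. smooth_on (snd c ` (fst c \<inter> fst d)) (snd d \<circ> chart_inv c))"

definition smooth_fun ::
  "('m, 'n::finite) chart set \<Rightarrow> 'm set \<Rightarrow> ('m \<Rightarrow> 'b::real_normed_vector) \<Rightarrow> bool"
  where "smooth_fun A U f \<longleftrightarrow> (\<forall>c\<in>A. smooth_on (snd c ` (U \<inter> fst c)) (f \<circ> chart_inv c))"

text \<open>The tangent space at \<open>p\<close> is \<open>real^'n\<close>, where \<open>v\<close> stands for the tangent vector
  \<open>v\<^sup>i \<partial>\<^sub>i\<close> at \<open>p\<close> with respect to a chart \<open>chart_at A p\<close> chosen once and for all for each point.
  Different points may use different charts, so that components have to be transported
  (\<open>chart_comp\<close>, \<open>coord_field\<close>) before points can be compared.\<close>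

definition chart_at :: "('m, 'n::finite) chart set \<Rightarrow> 'm \<Rightarrow> ('m, 'n) chart"
  where "chart_at A p = (SOME c. c \<in> A \<and> p \<in> fst c)"

definition tangent_deriv ::
  "('m, 'n::finite) chart set \<Rightarrow> 'm \<Rightarrow> real ^ 'n \<Rightarrow> ('m \<Rightarrow> 'b::real_normed_vector) \<Rightarrow> 'b"
  where "tangent_deriv A p v f =
    frechet_derivative (f \<circ> chart_inv (chart_at A p)) (at (snd (chart_at A p) p)) v"

text \<open>\<open>chart_comp A c p v\<close> are the components of the tangent vector \<open>v\<close> at \<open>p\<close> in the chart \<open>c\<close>.
  \<open>coord_field A c v\<close> is the vector field on the domain of \<open>c\<close> with constant components \<open>v\<close> in \<open>c\<close>;
  in particular \<open>coord_field A c (axis i 1)\<close> is the coordinate vector field \<open>\<partial>\<^sub>i\<close> of \<open>c\<close>.\<close>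

definition chart_comp ::
  "('m, 'n::finite) chart set \<Rightarrow> ('m, 'n) chart \<Rightarrow> 'm \<Rightarrow> real ^ 'n \<Rightarrow> real ^ 'n"
  where "chart_comp A c p v = tangent_deriv A p v (snd c)"

definition coord_field ::
  "('m, 'n::finite) chart set \<Rightarrow> ('m, 'n) chart \<Rightarrow> real ^ 'n \<Rightarrow> 'm \<Rightarrow> real ^ 'n"
  where "coord_field A c v q =
    frechet_derivative (snd (chart_at A q) \<circ> chart_inv c) (at (snd c q)) v"

definition smooth_vf :: "('m, 'n::finite) chart set \<Rightarrow> 'm set \<Rightarrow> ('m \<Rightarrow> real ^ 'n) \<Rightarrow> bool"
  where "smooth_vf A U X \<longleftrightarrow>
    (\<forall>c\<in>A. smooth_fun A (U \<inter> fst c) (\<lambda>q. chart_comp A c q (X q)))"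

definition near :: "('m::topological_space set \<Rightarrow> 'x \<Rightarrow> bool) \<Rightarrow> 'm \<Rightarrow> 'x \<Rightarrow> bool"
  where "near P p x \<longleftrightarrow> (\<exists>U. open U \<and> p \<in> U \<and> P U x)"

definition lie_bracket ::
  "('m, 'n::finite) chart set \<Rightarrow> ('m \<Rightarrow> real ^ 'n) \<Rightarrow> ('m \<Rightarrow> real ^ 'n) \<Rightarrow> 'm \<Rightarrow> real ^ 'n"
  where "lie_bracket A X Y p =
    tangent_deriv A p (X p) (\<lambda>q. chart_comp A (chart_at A p) q (Y q)) -
    tangent_deriv A p (Y p) (\<lambda>q. chart_comp A (chart_at A p) q (X q))"


section \<open>Complex vector bundles\<close>

text \<open>All fibres of \<open>E\<close> are \<open>complex^'k\<close> as vector spaces (choose a basis of every fibre). The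
  bundle structure consists of the local trivializations \<open>(U, \<phi>)\<close>: for \<open>q \<in> U\<close> the linear
  isomorphism from the fibre over \<open>q\<close> to the model fibre is the invertible matrix \<open>\<phi> q\<close>.\<close>

type_synonym ('m, 'k) triv = "'m set \<times> ('m \<Rightarrow> complex ^ 'k ^ 'k)"

definition vector_bundle ::
  "('m::topological_space, 'n::finite) chart set \<Rightarrow> ('m, 'k::finite) triv set \<Rightarrow> bool"
  where "vector_bundle A T \<longleftrightarrow>
    (\<forall>t\<in>T. open (fst t) \<and> (\<forall>q\<in>fst t. invertible (snd t q))) \<and>
    (\<Union>t\<in>T. fst t) = UNIV \<and>
    (\<forall>t\<in>T. \<forall>u\<in>T. smooth_fun A (fst t \<inter> fst u) (\<lambda>q. snd u q ** matrix_inv (snd t q)))"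

definition smooth_section ::
  "('m, 'n::finite) chart set \<Rightarrow> ('m, 'k::finite) triv set \<Rightarrow> 'm set \<Rightarrow> ('m \<Rightarrow> complex ^ 'k) \<Rightarrow> bool"
  where "smooth_section A T U s \<longleftrightarrow> (\<forall>t\<in>T. smooth_fun A (U \<inter> fst t) (\<lambda>q. snd t q *v s q))"

definition smooth_End ::
  "('m, 'n::finite) chart set \<Rightarrow> ('m, 'k::finite) triv set \<Rightarrow> 'm set \<Rightarrow> ('m \<Rightarrow> complex ^ 'k ^ 'k) \<Rightarrow> bool"
  where "smooth_End A T U B \<longleftrightarrow>
    (\<forall>t\<in>T. smooth_fun A (U \<inter> fst t) (\<lambda>q. snd t q ** B q ** matrix_inv (snd t q)))"

text \<open>A local section of \<open>E\<close>, smooth near \<open>p\<close>, with value \<open>e\<close> at \<open>p\<close>: it is constant in one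
  trivialization around \<open>p\<close>.\<close>

definition triv_at :: "('m, 'k::finite) triv set \<Rightarrow> 'm \<Rightarrow> ('m, 'k) triv"
  where "triv_at T p = (SOME t. t \<in> T \<and> p \<in> fst t)"

definition local_section :: "('m, 'k::finite) triv set \<Rightarrow> 'm \<Rightarrow> complex ^ 'k \<Rightarrow> 'm \<Rightarrow> complex ^ 'k"
  where "local_section T p e q =
    matrix_inv (snd (triv_at T p) q) *v (snd (triv_at T p) p *v e)"


section \<open>Connections\<close>

text \<open>A connection differentiates, in the direction of a tangent vector at \<open>p\<close>, every section
  that is smooth on some neighbourhood of \<open>p\<close>. The Leibniz rule for locally smooth functions
  (such as the indicator function of a neighbourhood of \<open>p\<close>) makes this depend on the germ of the
  section only. \<open>smF U\<close> is smoothness of sections of the bundle over \<open>U\<close>, and \<open>sc\<close> is the real or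
  complex scalar multiplication of its fibres.\<close>

type_synonym ('m, 'n, 'f) conn = "'m \<Rightarrow> real ^ 'n \<Rightarrow> ('m \<Rightarrow> 'f) \<Rightarrow> 'f"

definition connection ::
  "('m::topological_space, 'n::finite) chart set \<Rightarrow> ('s::real_normed_field \<Rightarrow> 'f \<Rightarrow> 'f) \<Rightarrow>
   ('m set \<Rightarrow> ('m \<Rightarrow> 'f::real_normed_vector) \<Rightarrow> bool) \<Rightarrow> ('m, 'n, 'f) conn \<Rightarrow> bool"
  where "connection A sc smF nab \<longleftrightarrow>
    (\<forall>p s. near smF p s \<longrightarrow> linear (\<lambda>v. nab p v s)) \<and>
    (\<forall>p v s t. near smF p s \<and> near smF p t \<longrightarrow>
       nab p v (\<lambda>q. s q + t q) = nab p v s + nab p v t) \<and>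
    (\<forall>p v f s. near (smooth_fun A) p f \<and> near smF p s \<longrightarrow>
       nab p v (\<lambda>q. sc (f q) (s q)) = sc (tangent_deriv A p v f) (s p) + sc (f p) (nab p v s)) \<and>
    (\<forall>U X s. open U \<and> smooth_vf A U X \<and> smF U s \<longrightarrow> smF U (\<lambda>p. nab p (X p) s))"

definition torsion_free ::
  "('m::topological_space, 'n::finite) chart set \<Rightarrow> ('m, 'n, real ^ 'n) conn \<Rightarrow> bool"
  where "torsion_free A nab \<longleftrightarrow>
    (\<forall>p X Y. near (smooth_vf A) p X \<and> near (smooth_vf A) p Y \<longrightarrow>
       nab p (X p) Y - nab p (Y p) X = lie_bracket A X Y p)"

definition curvature ::
  "('m, 'n::finite) chart set \<Rightarrow> ('m, 'n, 'f::real_normed_vector) conn \<Rightarrow>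
   ('m \<Rightarrow> real ^ 'n) \<Rightarrow> ('m \<Rightarrow> real ^ 'n) \<Rightarrow> ('m \<Rightarrow> 'f) \<Rightarrow> 'm \<Rightarrow> 'f"
  where "curvature A nab X Y s p =
    nab p (X p) (\<lambda>q. nab q (Y q) s) - nab p (Y p) (\<lambda>q. nab q (X q) s)
    - nab p (lie_bracket A X Y p) s"

text \<open>The induced connection on \<open>End(E)\<close>, given by \<open>(\<nabla>\<^sub>v B) e = \<nabla>\<^sub>v (B s) - B (\<nabla>\<^sub>v s)\<close> for a local
  section \<open>s\<close> through \<open>e\<close>.\<close>

definition conn_End ::
  "('m, 'k::finite) triv set \<Rightarrow> ('m, 'n, complex ^ 'k) conn \<Rightarrow> ('m, 'n, complex ^ 'k ^ 'k) conn"
  where "conn_End T nabE p v B =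
    matrix (\<lambda>e. nabE p v (\<lambda>q. B q *v local_section T p e q)
                - B p *v nabE p v (local_section T p e))"


section \<open>Two-forms and symplectic structures\<close>

text \<open>The last clause is \<open>d w = 0\<close>, evaluated on coordinate vector fields, whose Lie brackets vanish.\<close>

definition closed_two_form ::
  "('m, 'n::finite) chart set \<Rightarrow> ('m \<Rightarrow> real ^ 'n \<Rightarrow> real ^ 'n \<Rightarrow> 'b::real_normed_vector) \<Rightarrow> bool"
  where "closed_two_form A w \<longleftrightarrow>
    (\<forall>p. bilinear (w p) \<and> (\<forall>u v. w p u v = - w p v u)) \<and>
    (\<forall>c\<in>A. \<forall>i j. smooth_fun A (fst c)
       (\<lambda>q. w q (coord_field A c (axis i 1) q) (coord_field A c (axis j 1) q))) \<and>
    (\<forall>p x y z. let X = coord_field A (chart_at A p) in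
       tangent_deriv A p x (\<lambda>q. w q (X y q) (X z q))
       - tangent_deriv A p y (\<lambda>q. w q (X x q) (X z q))
       + tangent_deriv A p z (\<lambda>q. w q (X x q) (X y q)) = 0)"

definition symplectic_form ::
  "('m, 'n::finite) chart set \<Rightarrow> ('m \<Rightarrow> real ^ 'n \<Rightarrow> real ^ 'n \<Rightarrow> real) \<Rightarrow> bool"
  where "symplectic_form A \<omega> \<longleftrightarrow>
    closed_two_form A \<omega> \<and> (\<forall>p u. (\<forall>v. \<omega> p u v = 0) \<longrightarrow> u = 0)"

definition symplectic_conn ::
  "('m::topological_space, 'n::finite) chart set \<Rightarrow> ('m \<Rightarrow> real ^ 'n \<Rightarrow> real ^ 'n \<Rightarrow> real) \<Rightarrow>
   ('m, 'n, real ^ 'n) conn \<Rightarrow> bool"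
  where "symplectic_conn A \<omega> nab \<longleftrightarrow>
    (\<forall>p v Y Z. near (smooth_vf A) p Y \<and> near (smooth_vf A) p Z \<longrightarrow>
       tangent_deriv A p v (\<lambda>q. \<omega> q (Y q) (Z q))
       = \<omega> p (nab p v Y) (Z p) + \<omega> p (Y p) (nab p v Z))"

definition poisson :: "('m \<Rightarrow> real ^ 'n \<Rightarrow> real ^ 'n \<Rightarrow> real) \<Rightarrow> 'm \<Rightarrow> 'n::finite \<Rightarrow> 'n \<Rightarrow> real"
  where "poisson \<omega> p k l = - (matrix_inv (\<chi> i j. \<omega> p (axis i 1) (axis j 1)) $ k $ l)"


section \<open>The spaces of formal Weyl-algebra valued forms\<close>

text \<open>\<open>\<Phi> k p ys vs\<close> is the coefficient of \<open>\<lambda>\<^sup>k\<close> of \<open>\<Phi>\<close> at \<open>p\<close>, in symmetric degree \<open>length ys\<close> and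
  antisymmetric degree \<open>length vs\<close>, evaluated on the tangent vectors \<open>ys\<close> (symmetric factor) and
  \<open>vs\<close> (antisymmetric factor). Symmetric and exterior products are normalized as sums over
  shuffles without factorials, so that insertion of a vector is a (graded) derivation.
  Negative \<open>k\<close> only serves to make sense of \<open>1/\<lambda>\<close>.\<close>

type_synonym ('m, 'n, 'f) wform =
  "int \<Rightarrow> 'm \<Rightarrow> (real ^ 'n) list \<Rightarrow> (real ^ 'n) list \<Rightarrow> 'f"

text \<open>Sections with values in a bundle whose smooth sections over \<open>U\<close> are given by \<open>smF U\<close>. The
  alternating property bounds the antisymmetric degree.\<close>

definition weyl_forms ::
  "('m, 'n::finite) chart set \<Rightarrow> ('m set \<Rightarrow> ('m \<Rightarrow> 'f::real_normed_vector) \<Rightarrow> bool) \<Rightarrow>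
   ('m, 'n, 'f) wform set"
  where "weyl_forms A smF = {\<Phi>.
    (\<forall>k<0. \<Phi> k = 0) \<and>
    (\<forall>k p ys ys' vs. linear (\<lambda>u. \<Phi> k p (ys @ u # ys') vs)) \<and>
    (\<forall>k p ys vs vs'. linear (\<lambda>u. \<Phi> k p ys (vs @ u # vs'))) \<and>
    (\<forall>k p ys u w ys' vs. \<Phi> k p (ys @ u # w # ys') vs = \<Phi> k p (ys @ w # u # ys') vs) \<and>
    (\<forall>k p ys vs u w vs'. \<Phi> k p ys (vs @ u # w # vs') = - \<Phi> k p ys (vs @ w # u # vs')) \<and>
    (\<forall>k. \<forall>c\<in>A. \<forall>is js. smF (fst c)
       (\<lambda>q. \<Phi> k q (map (\<lambda>i. coord_field A c (axis i 1) q) is)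
                   (map (\<lambda>j. coord_field A c (axis j 1) q) js)))}"

definition form_degree :: "nat \<Rightarrow> ('m, 'n, 'f::zero) wform \<Rightarrow> bool"
  where "form_degree d \<Phi> \<longleftrightarrow> (\<forall>k p ys vs. length vs \<noteq> d \<longrightarrow> \<Phi> k p ys vs = 0)"

definition total_part :: "nat \<Rightarrow> ('m, 'n, 'f::zero) wform \<Rightarrow> ('m, 'n, 'f) wform"
  where "total_part d \<Phi> = (\<lambda>k p ys vs. if 2 * k + int (length ys) = int d then \<Phi> k p ys vs else 0)"

definition total_degree_ge :: "nat \<Rightarrow> ('m, 'n, 'f::zero) wform \<Rightarrow> bool"
  where "total_degree_ge d \<Phi> \<longleftrightarrow>
    (\<forall>k p ys vs. 2 * k + int (length ys) < int d \<longrightarrow> \<Phi> k p ys vs = 0)"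

definition lambda_shift :: "int \<Rightarrow> ('m, 'n, 'f) wform \<Rightarrow> ('m, 'n, 'f) wform"
  where "lambda_shift n \<Phi> = (\<lambda>k. \<Phi> (k - n))"

definition cscale :: "complex \<Rightarrow> ('m, 'n, 'f::complex_fibre) wform \<Rightarrow> ('m, 'n, 'f) wform"
  where "cscale c \<Phi> = (\<lambda>k p ys vs. c *\<^sub>c \<Phi> k p ys vs)"

abbreviation i_over_lambda :: "('m, 'n, 'f::complex_fibre) wform \<Rightarrow> ('m, 'n, 'f) wform"
  where "i_over_lambda \<Phi> \<equiv> cscale \<i> (lambda_shift (- 1) \<Phi>)"

text \<open>The action of \<open>\<complex>[[\<lambda>]]\<close> on elements without negative powers of \<open>\<lambda>\<close>.\<close>

definition fps_act :: "complex fps \<Rightarrow> ('m, 'n, 'f::complex_fibre) wform \<Rightarrow> ('m, 'n, 'f) wform"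
  where "fps_act c \<Phi> = (\<lambda>k p ys vs. \<Sum>i\<le>nat k. fps_nth c i *\<^sub>c \<Phi> (k - int i) p ys vs)"


section \<open>The operators \<open>\<delta>\<close>, \<open>\<delta>\<^sup>-\<^sup>1\<close> and \<open>\<sigma>\<close>\<close>

definition del :: "nat \<Rightarrow> 'x list \<Rightarrow> 'x list"
  where "del j xs = take j xs @ drop (Suc j) xs"

definition ins_s :: "real ^ 'n \<Rightarrow> ('m, 'n, 'f) wform \<Rightarrow> ('m, 'n, 'f) wform"
  where "ins_s u \<Phi> = (\<lambda>k p ys vs. \<Phi> k p (u # ys) vs)"

definition ins_a :: "real ^ 'n \<Rightarrow> ('m, 'n, 'f) wform \<Rightarrow> ('m, 'n, 'f) wform"
  where "ins_a u \<Phi> = (\<lambda>k p ys vs. \<Phi> k p ys (u # vs))"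

text \<open>Left multiplication by \<open>dx\<^sup>i \<otimes> 1\<close> and by \<open>1 \<otimes> dx\<^sup>i\<close>.\<close>

definition dx_s :: "'n::finite \<Rightarrow> ('m, 'n, 'f::real_normed_vector) wform \<Rightarrow> ('m, 'n, 'f) wform"
  where "dx_s i \<Phi> = (\<lambda>k p ys vs.
    \<Sum>j<length ys. ((ys ! j) $ i) *\<^sub>R \<Phi> k p (del j ys) vs)"

definition dx_a :: "'n::finite \<Rightarrow> ('m, 'n, 'f::real_normed_vector) wform \<Rightarrow> ('m, 'n, 'f) wform"
  where "dx_a i \<Phi> = (\<lambda>k p ys vs.
    \<Sum>j<length vs. ((- 1) ^ j * (vs ! j) $ i) *\<^sub>R \<Phi> k p ys (del j vs))"

definition delta :: "('m, 'n::finite, 'f::real_normed_vector) wform \<Rightarrow> ('m, 'n, 'f) wform"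
  where "delta \<Phi> = (\<Sum>i\<in>UNIV. dx_a i (ins_s (axis i 1) \<Phi>))"

definition delta_star :: "('m, 'n::finite, 'f::real_normed_vector) wform \<Rightarrow> ('m, 'n, 'f) wform"
  where "delta_star \<Phi> = (\<Sum>i\<in>UNIV. dx_s i (ins_a (axis i 1) \<Phi>))"

text \<open>\<open>delta_star\<close> preserves the sum of the symmetric and antisymmetric degree, hence this sum can be
  read off from the arguments. If it is zero, then \<open>delta_star \<Phi>\<close> vanishes there.\<close>

definition delta_inv :: "('m, 'n::finite, 'f::real_normed_vector) wform \<Rightarrow> ('m, 'n, 'f) wform"
  where "delta_inv \<Phi> = (\<lambda>k p ys vs.
    (1 / real (length ys + length vs)) *\<^sub>R delta_star \<Phi> k p ys vs)"

definition sigma_proj :: "('m, 'n, 'f) wform \<Rightarrow> nat \<Rightarrow> 'm \<Rightarrow> 'f"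
  where "sigma_proj \<Phi> = (\<lambda>k p. \<Phi> (int k) p [] [])"

definition incl0 :: "('m \<Rightarrow> 'f::zero) \<Rightarrow> ('m, 'n, 'f) wform"
  where "incl0 s = (\<lambda>k p ys vs. if k = 0 \<and> ys = [] \<and> vs = [] then s p else 0)"


section \<open>Covariant derivatives\<close>

text \<open>\<open>\<nabla>\<^bsub>\<partial>\<^sub>i\<^esub>\<close> on tensors with values in a bundle with connection \<open>nabF\<close>; at \<open>p\<close>, the arguments are
  extended to coordinate vector fields and \<open>\<partial>\<^sub>i\<close> refers to the chart \<open>chart_at A p\<close>.\<close>

definition nabla_tensor ::
  "('m, 'n::finite) chart set \<Rightarrow> ('m, 'n, real ^ 'n) conn \<Rightarrow> ('m, 'n, 'f) conn \<Rightarrow> 'n \<Rightarrow>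
   ('m, 'n, 'f::real_normed_vector) wform \<Rightarrow> ('m, 'n, 'f) wform"
  where "nabla_tensor A nab nabF i \<Phi> = (\<lambda>k p ys vs.
    let X = coord_field A (chart_at A p); v = axis i 1 in
    nabF p v (\<lambda>q. \<Phi> k q (map (\<lambda>y. X y q) ys) (map (\<lambda>y. X y q) vs))
    - (\<Sum>j<length ys. \<Phi> k p (ys[j := nab p v (X (ys ! j))]) vs)
    - (\<Sum>j<length vs. \<Phi> k p ys (vs[j := nab p v (X (vs ! j))])))"

definition cov_D ::
  "('m, 'n::finite) chart set \<Rightarrow> ('m, 'n, real ^ 'n) conn \<Rightarrow> ('m, 'n, 'f) conn \<Rightarrow>
   ('m, 'n, 'f::real_normed_vector) wform \<Rightarrow> ('m, 'n, 'f) wform"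
  where "cov_D A nab nabF \<Phi> = (\<Sum>i\<in>UNIV. dx_a i (nabla_tensor A nab nabF i \<Phi>))"


section \<open>The fibrewise Weyl product\<close>

text \<open>Sign of the shuffle that moves the positions in \<open>J\<close> to the front.\<close>

definition shuffle_sign :: "nat set \<Rightarrow> complex"
  where "shuffle_sign J = (- 1) ^ card {(i, j). i \<in> J \<and> j \<notin> J \<and> j < i}"

text \<open>The product with respect to a product \<open>m\<close> of the fibres. Here \<open>a\<close> and \<open>b\<close> are the powers of
  \<open>\<lambda>\<close> taken from the two factors, \<open>n\<close> is the order in the exponential series, \<open>zs\<close> lists the
  index pairs \<open>(k\<^sub>1, l\<^sub>1), \<dots>, (k\<^sub>n, l\<^sub>n)\<close> of the \<open>n\<close> Poisson tensors, and \<open>I\<close>, \<open>J\<close> range over the shuffles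
  of the symmetric and of the exterior product. The index set of the outer sum is finite when
  both factors contain only finitely many negative powers of \<open>\<lambda>\<close>.\<close>

definition wprod ::
  "('m \<Rightarrow> real ^ 'n \<Rightarrow> real ^ 'n \<Rightarrow> real) \<Rightarrow> ('f::zero \<Rightarrow> 'g::zero \<Rightarrow> 'h::complex_fibre) \<Rightarrow>
   ('m, 'n::finite, 'f) wform \<Rightarrow> ('m, 'n, 'g) wform \<Rightarrow> ('m, 'n, 'h) wform"
  where "wprod \<omega> m \<Phi> \<Psi> = (\<lambda>k p ys vs.
    \<Sum>(a, b) | \<Phi> a \<noteq> 0 \<and> \<Psi> b \<noteq> 0 \<and> a + b \<le> k.
      let n = nat (k - a - b) in
      ((\<i> / 2) ^ n / fact n) *\<^sub>c
      (\<Sum>zs | length zs = n. \<Sum>I \<in> Pow {..<length ys}. \<Sum>J \<in> Pow {..<length vs}.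
        (shuffle_sign J * of_real (\<Prod>(i, j) \<leftarrow> zs. poisson \<omega> p i j)) *\<^sub>c
        m (\<Phi> a p (map (\<lambda>z. axis (fst z) 1) zs @ nths ys I) (nths vs J))
          (\<Psi> b p (map (\<lambda>z. axis (snd z) 1) zs @ nths ys (- I)) (nths vs (- J)))))"

text \<open>\<open>parity \<Phi> = (-1)\<^bsup>deg\<^sub>a \<Phi>\<^esup> \<Phi>\<close>; it gives the sign of the super-commutator with a one-form.\<close>

definition parity :: "('m, 'n, 'f::real_normed_vector) wform \<Rightarrow> ('m, 'n, 'f) wform"
  where "parity \<Phi> = (\<lambda>k p ys vs. (- 1) ^ length vs *\<^sub>R \<Phi> k p ys vs)"

text \<open>The embedding of the scalar forms into the \<open>End(E)\<close>-valued forms.\<close>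

definition to_End :: "('m, 'n, complex) wform \<Rightarrow> ('m, 'n, complex ^ 'k ^ 'k::finite) wform"
  where "to_End \<Phi> = (\<lambda>k p ys vs. mat (\<Phi> k p ys vs))"


section \<open>Geometric data and Fedosov derivatives\<close>

record ('m, 'n::finite, 'k::finite) fedosov_data =
  atlas :: "('m, 'n) chart set"
  trivs :: "('m, 'k) triv set"
  sympl :: "'m \<Rightarrow> real ^ 'n \<Rightarrow> real ^ 'n \<Rightarrow> real"
  connM :: "('m, 'n, real ^ 'n) conn"
  connE :: "('m, 'n, complex ^ 'k) conn"

definition prod_W ::
  "('m, 'n::finite, 'k::finite) fedosov_data \<Rightarrow> ('m, 'n, complex) wform \<Rightarrow>
   ('m, 'n, complex) wform \<Rightarrow> ('m, 'n, complex) wform"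
  where "prod_W G = wprod (sympl G) (*)"

definition prod_End ::
  "('m, 'n::finite, 'k::finite) fedosov_data \<Rightarrow> ('m, 'n, complex ^ 'k ^ 'k) wform \<Rightarrow>
   ('m, 'n, complex ^ 'k ^ 'k) wform \<Rightarrow> ('m, 'n, complex ^ 'k ^ 'k) wform"
  where "prod_End G = wprod (sympl G) (**)"

definition lmult_E ::
  "('m, 'n::finite, 'k::finite) fedosov_data \<Rightarrow> ('m, 'n, complex ^ 'k ^ 'k) wform \<Rightarrow>
   ('m, 'n, complex ^ 'k) wform \<Rightarrow> ('m, 'n, complex ^ 'k) wform"
  where "lmult_E G = wprod (sympl G) (*v)"

definition rmult_E ::
  "('m, 'n::finite, 'k::finite) fedosov_data \<Rightarrow> ('m, 'n, complex ^ 'k) wform \<Rightarrow>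
   ('m, 'n, complex) wform \<Rightarrow> ('m, 'n, complex ^ 'k) wform"
  where "rmult_E G = wprod (sympl G) (\<lambda>s c. c *\<^sub>c s)"

definition weyl_W :: "('m, 'n::finite, 'k::finite) fedosov_data \<Rightarrow> ('m, 'n, complex) wform set"
  where "weyl_W G = weyl_forms (atlas G) (smooth_fun (atlas G))"

definition weyl_E :: "('m, 'n::finite, 'k::finite) fedosov_data \<Rightarrow> ('m, 'n, complex ^ 'k) wform set"
  where "weyl_E G = weyl_forms (atlas G) (smooth_section (atlas G) (trivs G))"

definition weyl_End ::
  "('m, 'n::finite, 'k::finite) fedosov_data \<Rightarrow> ('m, 'n, complex ^ 'k ^ 'k) wform set"
  where "weyl_End G = weyl_forms (atlas G) (smooth_End (atlas G) (trivs G))"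

definition D_W ::
  "('m, 'n::finite, 'k::finite) fedosov_data \<Rightarrow> ('m, 'n, complex) wform \<Rightarrow> ('m, 'n, complex) wform"
  where "D_W G = cov_D (atlas G) (connM G) (tangent_deriv (atlas G))"

definition D_E ::
  "('m, 'n::finite, 'k::finite) fedosov_data \<Rightarrow> ('m, 'n, complex ^ 'k) wform \<Rightarrow>
   ('m, 'n, complex ^ 'k) wform"
  where "D_E G = cov_D (atlas G) (connM G) (connE G)"

definition D_End ::
  "('m, 'n::finite, 'k::finite) fedosov_data \<Rightarrow> ('m, 'n, complex ^ 'k ^ 'k) wform \<Rightarrow>
   ('m, 'n, complex ^ 'k ^ 'k) wform"
  where "D_End G = cov_D (atlas G) (connM G) (conn_End (trivs G) (connE G))"

text \<open>Super-commutators with an element \<open>r\<close> of antisymmetric degree one.\<close>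

definition ad_W ::
  "('m, 'n::finite, 'k::finite) fedosov_data \<Rightarrow> ('m, 'n, complex) wform \<Rightarrow>
   ('m, 'n, complex) wform \<Rightarrow> ('m, 'n, complex) wform"
  where "ad_W G r b = prod_W G r b - prod_W G (parity b) r"

definition ad_End ::
  "('m, 'n::finite, 'k::finite) fedosov_data \<Rightarrow> ('m, 'n, complex ^ 'k ^ 'k) wform \<Rightarrow>
   ('m, 'n, complex ^ 'k ^ 'k) wform \<Rightarrow> ('m, 'n, complex ^ 'k ^ 'k) wform"
  where "ad_End G r a = prod_End G r a - prod_End G (parity a) r"

definition ad_E ::
  "('m, 'n::finite, 'k::finite) fedosov_data \<Rightarrow> ('m, 'n, complex) wform \<Rightarrow>
   ('m, 'n, complex ^ 'k) wform \<Rightarrow> ('m, 'n, complex ^ 'k) wform"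
  where "ad_E G r \<Psi> = lmult_E G (to_End r) \<Psi> - rmult_E G (parity \<Psi>) r"

definition curv_coeff :: "('m, 'n::finite, 'k::finite) fedosov_data \<Rightarrow> 'm \<Rightarrow> 'n \<Rightarrow> 'n \<Rightarrow> 'n \<Rightarrow> 'n \<Rightarrow> real"
  where "curv_coeff G p m k i j =
    (let X = (\<lambda>i. coord_field (atlas G) (chart_at (atlas G) p) (axis i 1)) in
     curvature (atlas G) (connM G) (X i) (X j) (X k) p $ m)"

text \<open>The first factor is the value of \<open>dx\<^sup>l \<or> dx\<^sup>k\<close>, the second one that of \<open>dx\<^sup>i \<and> dx\<^sup>j\<close>.\<close>

definition curv_R :: "('m, 'n::finite, 'k::finite) fedosov_data \<Rightarrow> ('m, 'n, complex) wform"
  where "curv_R G = (\<lambda>h p ys vs.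
    if h = 0 \<and> length ys = 2 \<and> length vs = 2 then
      of_real (1 / 4 * (\<Sum>l\<in>UNIV. \<Sum>m\<in>UNIV. \<Sum>k\<in>UNIV. \<Sum>i\<in>UNIV. \<Sum>j\<in>UNIV.
        sympl G p (axis l 1) (axis m 1) * curv_coeff G p m k i j *
        (ys!0$l * ys!1$k + ys!1$l * ys!0$k) * (vs!0$i * vs!1$j - vs!1$i * vs!0$j)))
    else 0)"

definition curv_E_coeff ::
  "('m, 'n::finite, 'k::finite) fedosov_data \<Rightarrow> 'm \<Rightarrow> 'n \<Rightarrow> 'n \<Rightarrow> complex ^ 'k ^ 'k"
  where "curv_E_coeff G p i j =
    (let X = (\<lambda>i. coord_field (atlas G) (chart_at (atlas G) p) (axis i 1)) in
     matrix (\<lambda>e. curvature (atlas G) (connE G) (X i) (X j) (local_section (trivs G) p e) p))"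

definition curv_RE ::
  "('m, 'n::finite, 'k::finite) fedosov_data \<Rightarrow> ('m, 'n, complex ^ 'k ^ 'k) wform"
  where "curv_RE G = (\<lambda>h p ys vs.
    if h = 0 \<and> ys = [] \<and> length vs = 2 then
      (1 / 2) *\<^sub>R (\<Sum>i\<in>UNIV. \<Sum>j\<in>UNIV.
        (vs!0$i * vs!1$j - vs!1$i * vs!0$j) *\<^sub>R curv_E_coeff G p i j)
    else 0)"

text \<open>The series \<open>\<Sum>\<^bsub>i\<ge>1\<^esub> \<lambda>\<^sup>i \<Omega>\<^sub>i\<close>; the value \<open>\<Omega> 0\<close> is ignored.\<close>

definition Omega_form ::
  "(nat \<Rightarrow> 'm \<Rightarrow> real ^ 'n \<Rightarrow> real ^ 'n \<Rightarrow> complex) \<Rightarrow> ('m, 'n, complex) wform"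
  where "Omega_form \<Omega> = (\<lambda>k p ys vs.
    if 1 \<le> k \<and> ys = [] \<and> length vs = 2 then \<Omega> (nat k) p (vs!0) (vs!1) else 0)"

definition fedosov_r ::
  "('m, 'n::finite, 'k::finite) fedosov_data \<Rightarrow>
   (nat \<Rightarrow> 'm \<Rightarrow> real ^ 'n \<Rightarrow> real ^ 'n \<Rightarrow> complex) \<Rightarrow> ('m, 'n, complex) wform \<Rightarrow> bool"
  where "fedosov_r G \<Omega> r \<longleftrightarrow>
    r \<in> weyl_W G \<and> form_degree 1 r \<and> total_degree_ge 3 r \<and>
    delta r = curv_R G + D_W G r + i_over_lambda (prod_W G r r) + Omega_form \<Omega> \<and>
    delta_inv r = 0"

definition fedosov_r' ::
  "('m, 'n::finite, 'k::finite) fedosov_data \<Rightarrow>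
   (nat \<Rightarrow> 'm \<Rightarrow> real ^ 'n \<Rightarrow> real ^ 'n \<Rightarrow> complex) \<Rightarrow> ('m, 'n, complex ^ 'k ^ 'k) wform \<Rightarrow> bool"
  where "fedosov_r' G \<Omega> r' \<longleftrightarrow>
    r' \<in> weyl_End G \<and> form_degree 1 r' \<and> total_degree_ge 3 r' \<and>
    delta r' = to_End (curv_R G) - cscale \<i> (lambda_shift 1 (curv_RE G)) + D_End G r'
      + i_over_lambda (prod_End G r' r') + to_End (Omega_form \<Omega>) \<and>
    delta_inv r' = 0"

definition r_E ::
  "('m, 'n, complex) wform \<Rightarrow> ('m, 'n, complex ^ 'k ^ 'k::finite) wform \<Rightarrow>
   ('m, 'n, complex ^ 'k ^ 'k) wform"
  where "r_E r r' = i_over_lambda (r' - to_End r)"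

definition Fed_W ::
  "('m, 'n::finite, 'k::finite) fedosov_data \<Rightarrow> ('m, 'n, complex) wform \<Rightarrow>
   ('m, 'n, complex) wform \<Rightarrow> ('m, 'n, complex) wform"
  where "Fed_W G r b = - delta b + D_W G b + i_over_lambda (ad_W G r b)"

definition Fed_End ::
  "('m, 'n::finite, 'k::finite) fedosov_data \<Rightarrow> ('m, 'n, complex ^ 'k ^ 'k) wform \<Rightarrow>
   ('m, 'n, complex ^ 'k ^ 'k) wform \<Rightarrow> ('m, 'n, complex ^ 'k ^ 'k) wform"
  where "Fed_End G r' a = - delta a + D_End G a + i_over_lambda (ad_End G r' a)"

definition Fed_E ::
  "('m, 'n::finite, 'k::finite) fedosov_data \<Rightarrow> ('m, 'n, complex) wform \<Rightarrow>
   ('m, 'n, complex ^ 'k ^ 'k) wform \<Rightarrow> ('m, 'n, complex ^ 'k) wform \<Rightarrow> ('m, 'n, complex ^ 'k) wform"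
  where "Fed_E G r r' \<Psi> =
    - delta \<Psi> + D_E G \<Psi> + i_over_lambda (ad_E G r \<Psi>) + lmult_E G (r_E r r') \<Psi>"


section \<open>Flat sections\<close>

definition flat_E ::
  "('m, 'n::finite, 'k::finite) fedosov_data \<Rightarrow> ('m, 'n, complex) wform \<Rightarrow>
   ('m, 'n, complex ^ 'k ^ 'k) wform \<Rightarrow> ('m, 'n, complex ^ 'k) wform set"
  where "flat_E G r r' = {\<Psi> \<in> weyl_E G. Fed_E G r r' \<Psi> = 0 \<and> form_degree 0 \<Psi>}"

definition formal_sections ::
  "('m, 'n::finite, 'k::finite) fedosov_data \<Rightarrow> (nat \<Rightarrow> 'm \<Rightarrow> complex ^ 'k) set"
  where "formal_sections G = {s. \<forall>k. smooth_section (atlas G) (trivs G) UNIV (s k)}"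

definition fps_act_sections ::
  "complex fps \<Rightarrow> (nat \<Rightarrow> 'm \<Rightarrow> complex ^ 'k::finite) \<Rightarrow> nat \<Rightarrow> 'm \<Rightarrow> complex ^ 'k"
  where "fps_act_sections c s = (\<lambda>k p. \<Sum>i\<le>k. fps_nth c i *\<^sub>c s (k - i) p)"

text \<open>\<open>tau_E\<close> is applied to a section without \<open>\<lambda>\<close>, regarded as a constant formal series.\<close>

definition tau_E ::
  "('m, 'n::finite, 'k::finite) fedosov_data \<Rightarrow> ('m, 'n, complex) wform \<Rightarrow>
   ('m, 'n, complex ^ 'k ^ 'k) wform \<Rightarrow> ('m \<Rightarrow> complex ^ 'k) \<Rightarrow> ('m, 'n, complex ^ 'k) wform"
  where "tau_E G r r' s =
    the_inv_into (flat_E G r r') sigma_proj (\<lambda>k. if k = 0 then s else 0)"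

end

theory Submission
 imports Defs
begin

text \<open>Fibrewise, the Weyl product is a sum of terms \<open>Bn\<close> of order \<open>n\<close> in the Poisson tensor, which
  are built from the shuffle product by insertions; associativity and the derivation properties of
  \<open>\<delta>\<close> and \<open>D\<close> are proved by induction on the order. The derivative in question is
  \<open>-\<delta>\<Psi> + D\<Psi> + (\<i>/\<lambda>)(r' \<circ> \<Psi> - (-1)\<^sup>d \<Psi> \<circ> r)\<close> for \<open>\<Psi>\<close> of antisymmetric degree \<open>d\<close>. It contains no negative
  powers of \<open>\<lambda>\<close>, because \<open>r\<close> and \<open>r'\<close> agree at order \<open>\<lambda>\<^sup>0\<close>, by induction on the symmetric degree. Its
  square is the curvature of \<open>D\<close>, which is \<open>(\<i>/\<lambda>)[R, \<Psi>] + R\<^sup>E \<circ> \<Psi>\<close>, minus the same expression obtained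
  from the equations for \<open>r\<close> and \<open>r'\<close>. Finally \<open>\<delta>\<delta>\<^sup>-\<^sup>1 + \<delta>\<^sup>-\<^sup>1\<delta> + \<sigma> = id\<close> turns flatness into the
  fixed point equation \<open>\<Psi> = s + \<delta>\<^sup>-\<^sup>1(\<delta>\<Psi> + D\<^sup>E\<Psi>)\<close>, whose right-hand side raises the total degree.\<close>

text \<open>A fibre element is a function of two argument lists, so it is determined by its value at
  the empty lists together with all its insertions. Operators are therefore characterised by how
  they commute with \<open>insS\<close> and \<open>insA\<close>, and most fibre identities follow by
  peeling off one argument and using the induction hypothesis for the inserted element. Signs are
  carried by \<open>par\<close>, so elements of mixed form degree can be treated at once. On the
  manifold the obstacle is that tangent vectors at different points refer to different charts.
  Derivatives are computed on the components of a form in one fixed chart, where they can be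
  iterated; independence of the chart leads back to the global operators. The total degree is
  additive under the product because each Poisson tensor adds one power of lambda and removes two
  symmetric degrees. A solution of the fixed point equation is only a candidate for a flat section:
  it is the vanishing square of the derivative that forces its defect to solve the homogeneous fixed
  point equation, and so to vanish.\<close>

type_synonym ('n, 'f) fib = "(real ^ 'n) list => (real ^ 'n) list => 'f"

definition insS :: "real ^ 'n => ('n, 'f) fib => ('n, 'f) fib"
 where "insS u f = (%ys vs. f (u # ys) vs)"

definition insA :: "real ^ 'n => ('n, 'f) fib => ('n, 'f) fib"
 where "insA u f = (%ys vs. f ys (u # vs))"

definition dxS :: "'n::finite => ('n, 'f::real_normed_vector) fib => ('n, 'f) fib"
 where "dxS i f = (%ys vs. \<Sum>j<length ys. ((ys ! j) $ i) *\<^sub>R f (del j ys) vs)"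

definition dxA :: "'n::finite => ('n, 'f::real_normed_vector) fib => ('n, 'f) fib"
 where "dxA i f = (%ys vs. \<Sum>j<length vs. ((- 1) ^ j * (vs ! j) $ i) *\<^sub>R f ys (del j vs))"

definition par :: "('n::finite, 'f::real_normed_vector) fib => ('n, 'f) fib"
 where "par f = (%ys vs. (- 1) ^ length vs *\<^sub>R f ys vs)"

definition smulC :: "complex => ('n::finite, 'f::complex_fibre) fib => ('n, 'f) fib"
 where "smulC c f = (%ys vs. c *\<^sub>c f ys vs)"

definition mu :: "('f::zero => 'g::zero => 'h::complex_fibre) => ('n::finite, 'f) fib => ('n, 'g) fib => ('n, 'h) fib"
 where "mu m f g = (%ys vs. \<Sum>I \<in> Pow {..<length ys}. \<Sum>J \<in> Pow {..<length vs}.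
   shuffle_sign J *\<^sub>c m (f (nths ys I) (nths vs J)) (g (nths ys (- I)) (nths vs (- J))))"

text \<open>One Poisson tensor is split off at a time, and the factors 1 / (n + 1) accumulate to 1 /
  n!. The powers of \<i> / 2 and of lambda from the exponential series are left to
  \<open>wterm\<close>.\<close>

fun Bn :: "('n::finite => 'n => real) => ('f::zero => 'g::zero => 'h::complex_fibre) => nat =>
  ('n, 'f) fib => ('n, 'g) fib => ('n, 'h) fib"
 where "Bn L m 0 f g = mu m f g"
 | "Bn L m (Suc n) f g = smulC (1 / of_nat (Suc n))
   (\<Sum>k\<in>UNIV. \<Sum>l\<in>UNIV. smulC (of_real (L k l)) (Bn L m n (insS (axis k 1) f) (insS (axis l 1) g)))"

subsection \<open>Scalar multiplication\<close>

lemma sum_fun_apply: "(\<Sum>i\<in>I. f i) x = (\<Sum>i\<in>I. f i x :: 'a::comm_monoid_add)"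
 by (induction I rule: infinite_finite_induct) (simp_all add: zero_fun_def plus_fun_def)

lemmas fun_ops = plus_fun_apply zero_fun_apply minus_apply uminus_apply sum_fun_apply

text \<open>The induction method turns goals into eta-long form, where these rules would break up
  the operations on functions.\<close>

declare fun_ops [simp del]

lemma additive_sum:
 assumes "!!f g. T (f + g) = T f + T g" "T 0 = 0"
 shows "T (\<Sum>i\<in>I. f i :: 'a::comm_monoid_add) = (\<Sum>i\<in>I. T (f i) :: 'b::comm_monoid_add)"
 by (induction I rule: infinite_finite_induct) (simp_all add: assms)

lemma scaleC_zero_left [simp]: "0 *\<^sub>c (x::'a::complex_fibre) = 0"
 using scaleC_of_real[of 0 x] by simp

lemma scaleC_one [simp]: "1 *\<^sub>c (x::'a::complex_fibre) = x"
 using scaleC_of_real[of 1 x] by simp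

lemma scaleC_zero_right [simp]: "c *\<^sub>c (0::'a::complex_fibre) = 0"
 using scaleC_add_right[of c 0 "0::'a"] by simp

lemma scaleC_minus_right [simp]: "c *\<^sub>c (- x::'a::complex_fibre) = - (c *\<^sub>c x)"
 using scaleC_add_right[of c x "- x"] by (simp add: add_eq_0_iff)

lemma scaleC_minus_left [simp]: "(- c) *\<^sub>c (x::'a::complex_fibre) = - (c *\<^sub>c x)"
 using scaleC_add_left[of c "- c" x] by (simp add: add_eq_0_iff)

lemma scaleC_diff_right: "c *\<^sub>c (x - y::'a::complex_fibre) = c *\<^sub>c x - c *\<^sub>c y"
 using scaleC_add_right[of c x "- y"] by simp

lemma scaleC_sum_right: "c *\<^sub>c (\<Sum>i\<in>I. f i :: 'a::complex_fibre) = (\<Sum>i\<in>I. c *\<^sub>c f i)"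
 by (induction I rule: infinite_finite_induct) (simp_all add: scaleC_add_right)

lemma scaleC_sum_left: "(\<Sum>i\<in>I. f i) *\<^sub>c (x :: 'a::complex_fibre) = (\<Sum>i\<in>I. f i *\<^sub>c x)"
 by (induction I rule: infinite_finite_induct) (simp_all add: scaleC_add_left)

lemma scaleR_scaleC: "t *\<^sub>R (x::'a::complex_fibre) = complex_of_real t *\<^sub>c x"
 by (simp add: scaleC_of_real)

text \<open>Three independent fibre types, because the same product serves the algebra of
  endomorphisms, its action on \<open>E\<close> from the left and the action of scalars on
  \<open>E\<close> from the right.\<close>

definition cbilin :: "('f::complex_fibre => 'g::complex_fibre => 'h::complex_fibre) => bool"
 where "cbilin m \<longleftrightarrow> (\<forall>x y z. m (x + y) z = m x z + m y z) \<and> (\<forall>x y z. m x (y + z) = m x y + m x z) \<and>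
  (\<forall>c x y. m (c *\<^sub>c x) y = c *\<^sub>c m x y) \<and> (\<forall>c x y. m x (c *\<^sub>c y) = c *\<^sub>c m x y)"

lemma cbilinD:
 assumes "cbilin m"
 shows "m (x + w) y = m x y + m w y" "m x (y + z) = m x y + m x z"
  "m (c *\<^sub>c x) y = c *\<^sub>c m x y" "m x (c *\<^sub>c y) = c *\<^sub>c m x y"
  "m (t *\<^sub>R x) y = t *\<^sub>R m x y" "m x (t *\<^sub>R y) = t *\<^sub>R m x y"
  "m 0 y = 0" "m x 0 = 0" "m (- x) y = - m x y" "m x (- y) = - m x y"
proof -
 show a: "m (x + w) y = m x y + m w y" "m x (y + z) = m x y + m x z"
  "m (c *\<^sub>c x) y = c *\<^sub>c m x y" "m x (c *\<^sub>c y) = c *\<^sub>c m x y" for x y z w c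
  using assms unfolding cbilin_def by auto
 show "m (t *\<^sub>R x) y = t *\<^sub>R m x y" "m x (t *\<^sub>R y) = t *\<^sub>R m x y" for t x y
  by (simp_all add: scaleR_scaleC a)
 show z: "m 0 y = 0" "m x 0 = 0" for x y
  using a(3)[of 0 0 y] a(4)[of x 0 0] by simp_all
 show "m (- x) y = - m x y" "m x (- y) = - m x y"
  using a(3)[of "-1" x y] a(4)[of x "-1" y] by simp_all
qed

lemma cbilin_sum:
 assumes "cbilin m"
 shows "m (\<Sum>i\<in>I. f i) y = (\<Sum>i\<in>I. m (f i) y)" "m x (\<Sum>i\<in>I. g i) = (\<Sum>i\<in>I. m x (g i))"
 by (induction I rule: infinite_finite_induct; simp add: cbilinD[OF assms])+

lemma cbilin_flip: "cbilin m ==> cbilin (%x y. m y x)"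
 by (simp add: cbilin_def)

lemma smulC_apply: "smulC c f ys vs = c *\<^sub>c f ys vs"
 by (simp add: smulC_def)
lemma smulC_zero_right [simp]: "smulC c 0 = 0"
 by (simp add: smulC_def fun_eq_iff fun_ops)
lemma smulC_one [simp]: "smulC 1 f = f"
 by (simp add: smulC_def)
lemma smulC_zero_left [simp]: "smulC 0 f = 0"
 by (simp add: smulC_def fun_eq_iff fun_ops)
lemma smulC_add_right: "smulC c (f + g) = smulC c f + smulC c g"
 by (simp add: smulC_def scaleC_add_right fun_eq_iff fun_ops)
lemma smulC_add_left: "smulC (c + d) f = smulC c f + smulC d f"
 by (simp add: smulC_def scaleC_add_left fun_eq_iff fun_ops)
lemma smulC_smulC [simp]: "smulC c (smulC d f) = smulC (c * d) f"
 by (simp add: smulC_def scaleC_scaleC fun_eq_iff fun_ops)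
lemma smulC_minus_right [simp]: "smulC c (- f) = - smulC c f"
 by (simp add: smulC_def fun_eq_iff fun_ops)
lemma smulC_minus_left [simp]: "smulC (- c) f = - smulC c f"
 by (simp add: smulC_def fun_eq_iff fun_ops)
lemma smulC_diff_right: "smulC c (f - g) = smulC c f - smulC c g"
 by (simp add: smulC_def scaleC_diff_right fun_eq_iff fun_ops)
lemma smulC_sum_right: "smulC c (\<Sum>i\<in>I. f i) = (\<Sum>i\<in>I. smulC c (f i))"
 by (simp add: smulC_def fun_eq_iff fun_ops scaleC_sum_right)
lemma smulC_sum_left: "smulC (\<Sum>i\<in>I. c i) f = (\<Sum>i\<in>I. smulC (c i) f)"
 by (simp add: smulC_def fun_eq_iff fun_ops scaleC_sum_left)

subsection \<open>Insertions\<close>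

lemma del_0 [simp]: "del 0 (x # xs) = xs"
 by (simp add: fun_ops del_def)
lemma del_Suc [simp]: "del (Suc j) (x # xs) = x # del j xs"
 by (simp add: fun_ops del_def)

lemma insS_linear:
 "insS u (f + g) = insS u f + insS u (g::('n::finite,'f::complex_fibre) fib)" "insS u (f - g) = insS u f - insS u g"
 "insS u (- f) = - insS u f"
 "insS u (0::('n::finite,'f) fib) = 0" "insS u (smulC c f) = smulC c (insS u f)"
 by (simp_all add: fun_ops insS_def fun_eq_iff fun_ops smulC_def)

lemma insA_linear:
 "insA u (f + g) = insA u f + insA u (g::('n::finite,'f::complex_fibre) fib)" "insA u (f - g) = insA u f - insA u g"
 "insA u (- f) = - insA u f"
 "insA u (0::('n::finite,'f) fib) = 0" "insA u (smulC c f) = smulC c (insA u f)"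
 by (simp_all add: fun_ops insA_def fun_eq_iff fun_ops smulC_def)

lemma insS_sum: "insS u (\<Sum>i\<in>I. f i) = (\<Sum>i\<in>I. insS u (f i::('n::finite,'f::complex_fibre) fib))"
 by (rule additive_sum[where T="insS u"]) (simp_all add: fun_ops insS_linear)
lemma insA_sum: "insA u (\<Sum>i\<in>I. f i) = (\<Sum>i\<in>I. insA u (f i::('n::finite,'f::complex_fibre) fib))"
 by (rule additive_sum[where T="insA u"]) (simp_all add: fun_ops insA_linear)

lemma par_linear:
 "par (f + g) = par f + par (g::('n::finite,'f::complex_fibre) fib)" "par (f - g) = par f - par g"
 "par (- f) = - par f" "par (0::('n::finite,'f) fib) = 0" "par (smulC c f) = smulC c (par f)"
 by (simp_all add: fun_ops par_def fun_eq_iff fun_ops smulC_def scaleR_scaleC scaleC_scaleC scaleC_add_right scaleC_diff_right mult.commute)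

lemma par_sum: "par (\<Sum>i\<in>I. f i) = (\<Sum>i\<in>I. par (f i::('n::finite,'f::complex_fibre) fib))"
 by (rule additive_sum[where T="par"]) (simp_all add: fun_ops par_linear)

lemma par_par [simp]: "par (par f) = f"
 by (simp add: fun_ops par_def fun_eq_iff fun_ops flip: power_mult_distrib)

lemma insS_insA: "insS u (insA v f) = insA v (insS u f)"
 by (simp add: fun_ops insS_def insA_def)
lemma insS_par: "insS u (par f) = par (insS u f)"
 by (simp add: fun_ops insS_def par_def)
lemma insA_par: "insA u (par f) = - par (insA u (f::('n::finite,'f::complex_fibre) fib))"
 by (simp add: fun_ops insA_def par_def fun_eq_iff fun_ops)

lemma dxA_Nil [simp]: "dxA i f ys [] = 0"
 by (simp add: fun_ops dxA_def)
lemma dxS_Nil [simp]: "dxS i f [] vs = 0"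
 by (simp add: fun_ops dxS_def)

text \<open>Contraction is an antiderivation of the exterior algebra. Together with
  \<open>dxA_Nil\<close> this rule determines \<open>dxA\<close> by recursion on the form arguments,
  which is how the later identities for \<open>dxA\<close> are obtained.\<close>

lemma insA_dxA: "insA u (dxA i f) = smulC (of_real (u $ i)) f - dxA i (insA u (f::('n::finite,'f::complex_fibre) fib))"
 by (simp add: fun_ops insA_def dxA_def fun_eq_iff fun_ops smulC_def sum.lessThan_Suc_shift scaleC_of_real sum_negf del: sum.lessThan_Suc)

lemma insS_dxA: "insS u (dxA i f) = dxA i (insS u f)"
 by (simp add: fun_ops insS_def dxA_def)

lemma insS_dxS: "insS u (dxS i f) = smulC (of_real (u $ i)) f + dxS i (insS u (f::('n::finite,'f::complex_fibre) fib))"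
 by (simp add: fun_ops insS_def dxS_def fun_eq_iff fun_ops smulC_def sum.lessThan_Suc_shift scaleC_of_real del: sum.lessThan_Suc)

lemma insA_dxS: "insA u (dxS i f) = dxS i (insA u f)"
 by (simp add: fun_ops insA_def dxS_def)

lemma dxA_linear:
 "dxA i (f + g) = dxA i f + dxA i (g::('n::finite,'f::complex_fibre) fib)" "dxA i (f - g) = dxA i f - dxA i g"
 "dxA i (- f) = - dxA i f" "dxA i (0::('n::finite,'f) fib) = 0" "dxA i (smulC c f) = smulC c (dxA i f)"
 by (simp_all add: fun_ops dxA_def fun_eq_iff fun_ops smulC_def scaleR_right_distrib scaleR_right_diff_distrib
   sum.distrib sum_subtractf sum_negf scaleC_sum_right)
  (simp_all add: fun_ops scaleR_scaleC scaleC_scaleC mult_ac)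

lemma dxS_linear:
 "dxS i (f + g) = dxS i f + dxS i (g::('n::finite,'f::complex_fibre) fib)" "dxS i (f - g) = dxS i f - dxS i g"
 "dxS i (- f) = - dxS i f" "dxS i (0::('n::finite,'f) fib) = 0" "dxS i (smulC c f) = smulC c (dxS i f)"
 by (simp_all add: fun_ops dxS_def fun_eq_iff fun_ops smulC_def scaleR_right_distrib scaleR_right_diff_distrib
   sum.distrib sum_subtractf sum_negf scaleC_sum_right)
  (simp_all add: fun_ops scaleR_scaleC scaleC_scaleC mult_ac)

lemma dxA_sum: "dxA i (\<Sum>j\<in>I. f j) = (\<Sum>j\<in>I. dxA i (f j::('n::finite,'f::complex_fibre) fib))"
 by (rule additive_sum[where T="dxA i"]) (simp_all add: fun_ops dxA_linear)
lemma dxS_sum: "dxS i (\<Sum>j\<in>I. f j) = (\<Sum>j\<in>I. dxS i (f j::('n::finite,'f::complex_fibre) fib))"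
 by (rule additive_sum[where T="dxS i"]) (simp_all add: fun_ops dxS_linear)

text \<open>Pattern of the inductions on argument lists: the element stays arbitrary, the identity
  is checked at the empty list, and contracting both sides with the first argument reduces it to the
  contracted element.\<close>

lemma par_dxA: "par (dxA i f) = - dxA i (par (f::('n::finite,'f::complex_fibre) fib))"
proof (intro ext)
 fix ys vs show "par (dxA i f) ys vs = (- dxA i (par f)) ys vs"
 proof (induction vs arbitrary: f)
  case Nil then show ?case by (simp add: fun_ops par_def)
 next
  case (Cons u vs)
  have "insA u (par (dxA i f)) ys vs = insA u (- dxA i (par f)) ys vs"
   using Cons[of "insA u f"]
   by (simp add: fun_ops insA_linear insA_par insA_dxA par_linear dxA_linear)
  then show ?case by (simp add: fun_ops insA_def)
 qed
qed

lemma dxA_anticomm: "dxA i (dxA j f) = - dxA j (dxA i (f::('n::finite,'f::complex_fibre) fib))"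
proof (intro ext)
 fix ys vs show "dxA i (dxA j f) ys vs = (- dxA j (dxA i f)) ys vs"
 proof (induction vs arbitrary: f)
  case Nil then show ?case by (simp add: fun_ops)
 next
  case (Cons u vs)
  have "insA u (dxA i (dxA j f)) ys vs = insA u (- dxA j (dxA i f)) ys vs"
   using Cons[of "insA u f"]
   by (simp add: fun_ops insA_linear insA_par insA_dxA par_linear dxA_linear)
  then show ?case by (simp add: fun_ops insA_def)
 qed
qed

lemma dxA_dxS: "dxA i (dxS j f) = dxS j (dxA i (f::('n::finite,'f::complex_fibre) fib))"
proof (intro ext)
 fix ys vs show "dxA i (dxS j f) ys vs = (dxS j (dxA i f)) ys vs"
 proof (induction vs arbitrary: f)
  case Nil then show ?case by (simp add: fun_ops dxS_def)
 next
  case (Cons u vs)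
  have "insA u (dxA i (dxS j f)) ys vs = insA u (dxS j (dxA i f)) ys vs"
   using Cons[of "insA u f"]
   by (simp add: fun_ops insA_linear insA_dxA dxS_linear insA_dxS)
  then show ?case by (simp add: fun_ops insA_def)
 qed
qed

subsection \<open>The shuffle product\<close>

text \<open>Splits the subsets according to whether they contain 0, that is, whether the first
  argument of a shuffle goes to the left or to the right factor.\<close>

lemma sum_Pow_Suc:
 "(\<Sum>I\<in>Pow {..<Suc n}. F I) = (\<Sum>I\<in>Pow {..<n}. F (insert 0 (Suc ` I))) + (\<Sum>I\<in>Pow {..<n}. F (Suc ` I) :: 'a::comm_monoid_add)"
proof -
 have e: "{..<Suc n} = insert 0 (Suc ` {..<n})"
  by (simp add: fun_ops lessThan_Suc_eq_insert_0)
 have i: "inj_on ((`) Suc) (Pow {..<n})" "inj_on (%I. insert 0 (Suc ` I)) (Pow {..<n})"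
  by (auto intro!: inj_onI simp: inj_image_eq_iff)
 have "Pow {..<Suc n} = (%I. insert 0 (Suc ` I)) ` Pow {..<n} \<union> ((`) Suc) ` Pow {..<n}"
  unfolding e by (subst Pow_insert) (auto simp: image_Pow_surj[symmetric] image_comp)
 moreover have "((%I. insert 0 (Suc ` I)) ` Pow {..<n}) \<inter> (((`) Suc) ` Pow {..<n}) = {}" by auto
 ultimately show ?thesis
  by (simp add: fun_ops sum.union_disjoint sum.reindex[OF i(1)] sum.reindex[OF i(2)] o_def)
qed

lemma nths_Suc_simps [simp]:
 "nths (x # xs) (insert 0 (Suc ` I)) = x # nths xs I"
 "nths (x # xs) (Suc ` I) = nths xs I"
 "nths (x # xs) (- insert 0 (Suc ` I)) = nths xs (- I)"
 "nths (x # xs) (- (Suc ` I)) = x # nths xs (- I)"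
 "nths (x # xs) (insert 0 (Suc ` I) \<inter> K) = (if 0 \<in> K then [x] else []) @ nths xs (I \<inter> {j. Suc j \<in> K})"
 by (auto simp: nths_Cons intro!: arg_cong[where f="nths xs"])

text \<open>A first vector that goes to the right factor is overtaken by each of the
  \<open>card J\<close> vectors of the left factor; one that goes to the left factor creates no
  inversion.\<close>

lemma shuffle_sign_Suc:
 assumes "J \<subseteq> {..<n}"
 shows "shuffle_sign (Suc ` J) = (- 1) ^ card J * shuffle_sign J"
  and "shuffle_sign (insert 0 (Suc ` J)) = shuffle_sign J"
proof -
 have fJ: "finite J" using assms finite_subset by blast
 let ?S = "{(i, j). i \<in> J \<and> j \<notin> J \<and> j < i}"
 have fS: "finite ?S"
  by (rule finite_subset[of _ "J \<times> {..<n}"]) (use assms fJ in auto)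
 have 1: "{(i, j). i \<in> insert 0 (Suc ` J) \<and> j \<notin> insert 0 (Suc ` J) \<and> j < i} = (%(i,j). (Suc i, Suc j)) ` ?S"
  by (auto simp: image_iff) (metis Suc_less_SucD lessE not0_implies_Suc not_less_zero)+
 show "shuffle_sign (insert 0 (Suc ` J)) = shuffle_sign J"
  unfolding shuffle_sign_def 1 by (subst card_image) (auto intro!: inj_onI)
 have 2: "{(i, j). i \<in> (Suc ` J) \<and> j \<notin> (Suc ` J) \<and> j < i} = (%(i,j). (Suc i, Suc j)) ` ?S \<union> (%i. (Suc i, 0)) ` J"
  by (auto simp: image_iff) (metis Suc_less_SucD lessE not0_implies_Suc not_less_zero)+
 have "card {(i, j). i \<in> (Suc ` J) \<and> j \<notin> (Suc ` J) \<and> j < i} = card ?S + card J"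
  unfolding 2 by (subst card_Un_disjoint) (auto simp: fS fJ card_image inj_on_def intro!: arg_cong2[where f="(+)"] card_image)
 then show "shuffle_sign (Suc ` J) = (- 1) ^ card J * shuffle_sign J"
  unfolding shuffle_sign_def by (simp add: fun_ops power_add)
qed

lemma insS_mu:
 assumes "cbilin m"
 shows "insS u (mu m f g) = mu m (insS u f) g + mu m f (insS u g)"
 by (simp add: fun_ops insS_def mu_def fun_eq_iff fun_ops sum_Pow_Suc)

lemma length_nths_sub: "J \<subseteq> {..<length vs} ==> length (nths vs J) = card J"
 by (auto simp: length_nths intro!: arg_cong[where f=card])

text \<open>The sign for passing the left factor is the operator \<open>par\<close>, so the rule
  holds for elements of mixed form degree.\<close>

lemma insA_mu:
 assumes "cbilin m"
 shows "insA u (mu m f g) = mu m (insA u f) g + mu m (par f) (insA u g)"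
 by (intro ext) (simp add: fun_ops insA_def mu_def sum_Pow_Suc sum.distrib shuffle_sign_Suc par_def
   cbilinD[OF assms] length_nths_sub scaleR_scaleC scaleC_scaleC mult.commute)

lemma mu_Nil: "mu m f g [] [] = m (f [] []) (g [] [])"
 by (simp add: fun_ops mu_def shuffle_sign_def)

lemma mu_linear:
 assumes "cbilin m"
 shows "mu m (f + f') g = mu m f g + mu m f' g" "mu m f (g + g') = mu m f g + mu m f g'"
  "mu m (smulC c f) g = smulC c (mu m f g)" "mu m f (smulC c g) = smulC c (mu m f g)"
  "mu m 0 g = 0" "mu m f 0 = 0" "mu m (- f) g = - mu m f g" "mu m f (- g) = - mu m f g"
  "mu m (f - f') g = mu m f g - mu m f' g" "mu m f (g - g') = mu m f g - mu m f g'"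
proof -
 show a: "mu m (f + f') g = mu m f g + mu m f' g" "mu m f (g + g') = mu m f g + mu m f g'" for f f' g g'
  by (simp_all add: fun_ops mu_def fun_eq_iff fun_ops cbilinD[OF assms] scaleC_add_right sum.distrib)
 show b: "mu m (smulC c f) g = smulC c (mu m f g)" "mu m f (smulC c g) = smulC c (mu m f g)" for c f g
  by (simp_all add: fun_ops mu_def fun_eq_iff fun_ops cbilinD[OF assms] smulC_def scaleC_sum_right scaleC_scaleC mult.commute)
 show "mu m 0 g = 0" "mu m f 0 = 0"
  using b(1)[of 0] b(2)[of _ 0] by (metis smulC_zero_left)+
 show c: "mu m (- f) g = - mu m f g" "mu m f (- g) = - mu m f g" for f g
  using b(1)[of "-1"] b(2)[of _ "-1"] by simp_all
 show "mu m (f - f') g = mu m f g - mu m f' g" "mu m f (g - g') = mu m f g - mu m f g'"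
  using a(1)[of f "- f'"] a(2)[of f g "- g'"] by (simp_all add: fun_ops c)
qed

lemma mu_sum:
 assumes "cbilin m"
 shows "mu m (\<Sum>i\<in>I. f i) g = (\<Sum>i\<in>I. mu m (f i) g)" "mu m f' (\<Sum>i\<in>I. g' i) = (\<Sum>i\<in>I. mu m f' (g' i))"
 by (rule additive_sum[where T="%f. mu m f g"] additive_sum[where T="mu m f'"]; simp add: mu_linear[OF assms])+

lemma par_mu:
 assumes "cbilin m"
 shows "par (mu m f g) = mu m (par f) (par g)"
proof (intro ext)
 fix ys vs show "par (mu m f g) ys vs = mu m (par f) (par g) ys vs"
 proof (induction vs arbitrary: f g)
  case Nil
  show ?case
   by (simp add: fun_ops par_def mu_def)
 next
  case (Cons u vs)
  have "insA u (par (mu m f g)) ys vs = insA u (mu m (par f) (par g)) ys vs"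
   using Cons[of "insA u f" g] Cons[of "par f" "insA u g"]
   by (simp add: fun_ops insA_linear insA_par insA_mu[OF assms] par_linear mu_linear[OF assms])
  then show ?case by (simp add: fun_ops insA_def)
 qed
qed

lemma dxA_mu_left:
 assumes "cbilin m"
 shows "mu m (dxA i f) g = dxA i (mu m f g)"
proof (intro ext)
 fix ys vs show "mu m (dxA i f) g ys vs = dxA i (mu m f g) ys vs"
 proof (induction vs arbitrary: f g)
  case Nil
  show ?case by (simp add: fun_ops mu_def cbilinD[OF assms])
 next
  case (Cons u vs)
  have "insA u (mu m (dxA i f) g) ys vs = insA u (dxA i (mu m f g)) ys vs"
   using Cons[of "insA u f" g] Cons[of "par f" "insA u g"]
   by (simp add: fun_ops insA_linear insA_mu[OF assms] insA_dxA par_dxA dxA_linear mu_linear[OF assms])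
  then show ?case by (simp add: fun_ops insA_def)
 qed
qed

lemma dxA_mu_right:
 assumes "cbilin m"
 shows "mu m f (dxA i g) = dxA i (mu m (par f) g)"
proof (intro ext)
 fix ys vs show "mu m f (dxA i g) ys vs = dxA i (mu m (par f) g) ys vs"
 proof (induction vs arbitrary: f g)
  case Nil
  show ?case by (simp add: fun_ops mu_def cbilinD[OF assms])
 next
  case (Cons u vs)
  have "insA u (mu m f (dxA i g)) ys vs = insA u (dxA i (mu m (par f) g)) ys vs"
   using Cons[of "insA u f" g] Cons[of "par f" "insA u g"]
   by (simp add: fun_ops insA_linear insA_mu[OF assms] insA_dxA insA_par dxA_linear mu_linear[OF assms] par_linear)
  then show ?case by (simp add: fun_ops insA_def)
 qed
qed

lemma dxS_mu_left:
 assumes "cbilin m"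
 shows "mu m (dxS i f) g = dxS i (mu m f g)"
proof (intro ext)
 fix ys vs show "mu m (dxS i f) g ys vs = dxS i (mu m f g) ys vs"
 proof (induction ys arbitrary: f g)
  case Nil
  show ?case by (simp add: fun_ops mu_def cbilinD[OF assms])
 next
  case (Cons u ys)
  have "insS u (mu m (dxS i f) g) ys vs = insS u (dxS i (mu m f g)) ys vs"
   using Cons[of "insS u f" g] Cons[of "f" "insS u g"]
   by (simp add: fun_ops insS_linear insS_mu[OF assms] insS_dxS dxS_linear mu_linear[OF assms])
  then show ?case by (simp add: fun_ops insS_def)
 qed
qed

text \<open>Insertions are derivations, up to parity, of both bracketings, so both sides obey the
  same recursion in the arguments and only the associativity of the fibre products remains at the
  empty lists. Four products are allowed in order to cover all mixed bracketings of endomorphisms,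
  sections and scalars.\<close>

lemma mu_assoc:
 assumes m: "cbilin m1" "cbilin m2" "cbilin m3" "cbilin m4"
  and assoc: "!!x y z. m1 (m2 x y) z = m3 x (m4 y z)"
 shows "mu m1 (mu m2 f g) h = mu m3 f (mu m4 g h)"
proof (intro ext)
 fix ys vs show "mu m1 (mu m2 f g) h ys vs = mu m3 f (mu m4 g h) ys vs"
 proof (induction ys arbitrary: f g h)
  case Nil
  show ?case
  proof (induction vs arbitrary: f g h)
   case Nil
   show ?case by (simp add: fun_ops mu_Nil assoc)
  next
   case (Cons u vs)
   have "insA u (mu m1 (mu m2 f g) h) [] vs = insA u (mu m3 f (mu m4 g h)) [] vs"
    using Cons[of "insA u f" g h] Cons[of "par f" "insA u g" h] Cons[of "par f" "par g" "insA u h"]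
    by (simp add: fun_ops insA_mu m mu_linear par_mu)
   then show ?case by (simp add: fun_ops insA_def)
  qed
 next
  case (Cons u ys)
  have "insS u (mu m1 (mu m2 f g) h) ys vs = insS u (mu m3 f (mu m4 g h)) ys vs"
   using Cons[of "insS u f" g h] Cons[of "f" "insS u g" h] Cons[of "f" "g" "insS u h"]
   by (simp add: fun_ops insS_mu m mu_linear par_mu)
  then show ?case by (simp add: fun_ops insS_def)
 qed
qed

section \<open>Graded commutativity of the shuffle product\<close>

definition fdeg :: "nat => ('n::finite, 'f::zero) fib => bool"
 where "fdeg d f \<longleftrightarrow> (\<forall>ys vs. length vs \<noteq> d \<longrightarrow> f ys vs = 0)"

lemma fdeg_par: "fdeg d f ==> par f = smulC ((- 1) ^ d) (f::('n::finite,'f::complex_fibre) fib)"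
 by (auto simp: fdeg_def par_def smulC_def fun_eq_iff fun_ops scaleR_scaleC) (metis scaleC_zero_right)

lemma fdeg_insS: "fdeg d f ==> fdeg d (insS u f)"
 by (simp add: fun_ops fdeg_def insS_def)
lemma fdeg_insA: "fdeg (Suc d) f ==> fdeg d (insA u f)"
 by (simp add: fun_ops fdeg_def insA_def)
lemma fdeg_insA_0: "fdeg 0 f ==> insA u f = 0"
 by (simp add: fun_ops fdeg_def insA_def fun_eq_iff fun_ops)

text \<open>The \<open>d\<close>-fold iterate of \<open>par\<close>: the sign picked up when a form
  of degree \<open>d\<close> moves past an element of mixed degree.\<close>

definition parn :: "nat => ('n, 'f::complex_fibre) fib => ('n::finite, 'f) fib"
 where "parn d f = (if even d then f else par f)"

lemma parn_Suc: "parn (Suc d) f = par (parn d f)" "parn (Suc d) f = parn d (par f)"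
 by (simp_all add: fun_ops parn_def)

lemma mu_comm:
 fixes f :: "('n::finite, 'f::complex_fibre) fib" and g :: "('n, 'g::complex_fibre) fib"
 assumes m: "cbilin m" and f: "fdeg d f"
 shows "mu m f g = mu (%x y. m y x) (parn d g) f"
proof (intro ext)
 let ?m = "%x y. m y x"
 have m': "cbilin ?m" using m by (rule cbilin_flip)
 fix ys vs show "mu m f g ys vs = mu ?m (parn d g) f ys vs"
  using f
 proof (induction ys arbitrary: f g)
  case Nil
  show ?case using Nil
  proof (induction vs arbitrary: f g d)
   case Nil
   have "parn d g [] [] = g [] []" by (simp add: fun_ops parn_def par_def)
   then show ?case by (simp add: fun_ops mu_Nil)
  next
   case (Cons u vs)
   have "insA u (mu m f g) [] vs = insA u (mu ?m (parn d g) f) [] vs"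
   \<comment> \<open>In degree 0 the contraction of \<open>f\<close> vanishes; otherwise it lowers
     the degree by one, which is why the degree is generalised in the induction.\<close>
   proof (cases d)
    case 0
    have "insA u f = 0" "par f = f" using fdeg_insA_0 fdeg_par[of d f] Cons.prems 0 by auto
    then show ?thesis
     using Cons.IH[of 0 f "insA u g"] Cons.prems 0
     by (simp add: fun_ops insA_mu m m' mu_linear parn_def)
   next
    case (Suc e)
    have p: "par f = smulC ((- 1) ^ d) f" using fdeg_par[of d f] Cons.prems by auto
    have "mu m (insA u f) g [] vs = mu ?m (parn e g) (insA u f) [] vs"
     using Cons.IH[of e "insA u f" g] Cons.prems Suc fdeg_insA by blast
    moreover have "mu m f (insA u g) [] vs = mu ?m (parn d (insA u g)) f [] vs"
     using Cons.IH[of d f "insA u g"] Cons.prems by blast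
    moreover have "insA u (parn d g) = smulC ((-1)^d) (parn d (insA u g))"
     by (simp add: fun_ops parn_def insA_par)
    moreover have "par (parn d g) = parn e g" using Suc by (simp add: fun_ops parn_Suc)
    ultimately show ?thesis
     by (simp add: fun_ops insA_mu m m' mu_linear p smulC_apply)
   qed
   then show ?case by (simp add: fun_ops insA_def)
  qed
 next
  case (Cons u ys)
  have "insS u (parn d g) = parn d (insS u g)" by (simp add: fun_ops parn_def insS_par)
  then have "insS u (mu m f g) ys vs = insS u (mu ?m (parn d g) f) ys vs"
   using Cons.IH[OF fdeg_insS[OF Cons.prems, of u], of g] Cons.IH[OF Cons.prems, of "insS u g"]
   by (simp add: fun_ops insS_mu m m')
  then show ?case by (simp add: fun_ops insS_def)
 qed
qed

subsection \<open>Higher orders of the Weyl product\<close>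

lemma Bn_linear:
 assumes "cbilin m"
 shows "Bn L m n (f + f') g = Bn L m n f g + Bn L m n f' g" "Bn L m n f (g + g') = Bn L m n f g + Bn L m n f g'"
  "Bn L m n (smulC c f) g = smulC c (Bn L m n f g)" "Bn L m n f (smulC c g) = smulC c (Bn L m n f g)"
  "Bn L m n 0 g = 0" "Bn L m n f 0 = 0" "Bn L m n (- f) g = - Bn L m n f g" "Bn L m n f (- g) = - Bn L m n f g"
  "Bn L m n (f - f') g = Bn L m n f g - Bn L m n f' g" "Bn L m n f (g - g') = Bn L m n f g - Bn L m n f g'"
proof -
 show a: "Bn L m n (f + f') g = Bn L m n f g + Bn L m n f' g" "Bn L m n f (g + g') = Bn L m n f g + Bn L m n f g'" for f f' g g'
  by (induction n arbitrary: f f' g g')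
   (simp_all add: mu_linear[OF assms] insS_linear smulC_add_right sum.distrib)
 show b: "Bn L m n (smulC c f) g = smulC c (Bn L m n f g)" "Bn L m n f (smulC c g) = smulC c (Bn L m n f g)" for c f g
  by (induction n arbitrary: f g)
   (simp_all add: mu_linear[OF assms] insS_linear smulC_sum_right mult.commute)
 show "Bn L m n 0 g = 0" "Bn L m n f 0 = 0"
  using b(1)[of 0] b(2)[of _ 0] by (metis smulC_zero_left)+
 show c: "Bn L m n (- f) g = - Bn L m n f g" "Bn L m n f (- g) = - Bn L m n f g" for f g
  using b(1)[of "-1"] b(2)[of _ "-1"] by simp_all
 show "Bn L m n (f - f') g = Bn L m n f g - Bn L m n f' g" "Bn L m n f (g - g') = Bn L m n f g - Bn L m n f g'"
  using a(1)[of f "- f'"] a(2)[of f g "- g'"] by (simp_all add: c)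
qed

lemma Bn_sum:
 assumes "cbilin m"
 shows "Bn L m n (\<Sum>i\<in>I. f i) g = (\<Sum>i\<in>I. Bn L m n (f i) g)" "Bn L m n f' (\<Sum>i\<in>I. g' i) = (\<Sum>i\<in>I. Bn L m n f' (g' i))"
 by (rule additive_sum[where T="%f. Bn L m n f g"] additive_sum[where T="Bn L m n f'"]; simp add: Bn_linear[OF assms])+

text \<open>The part of the symmetry of a Weyl element that makes insertions commute. Derivation
  rules and associativity for \<open>Bn\<close> rest on it alone and leave multilinearity
  aside.\<close>

definition sym2 :: "('n::finite, 'f) fib => bool"
 where "sym2 f \<longleftrightarrow> (\<forall>ys u w ys' vs. f (ys @ u # w # ys') vs = f (ys @ w # u # ys') vs)"

lemma sym2_insS: "sym2 f ==> sym2 (insS u f)"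
 unfolding sym2_def insS_def by (metis append_Cons)

lemma sym2_par: "sym2 f ==> sym2 (par f)"
 unfolding sym2_def par_def by metis

lemma sym2_comm: "sym2 f ==> insS u (insS w f) = insS w (insS u f)"
 unfolding sym2_def insS_def by (intro ext) (metis append_Nil)

text \<open>The inserted vector has to move past the basis vectors that the Poisson tensors have
  already inserted; this is where the symmetry of the arguments enters.\<close>

lemma insS_Bn:
 assumes m: "cbilin m" and "sym2 f" "sym2 g"
 shows "insS u (Bn L m n f g) = Bn L m n (insS u f) g + Bn L m n f (insS u g)"
 using assms(2,3)
proof (induction n arbitrary: f g)
 case 0 then show ?case by (simp add: insS_mu m)
next
 case (Suc n)
 then show ?case
  by (simp add: insS_linear insS_sum Suc.IH sym2_insS sym2_comm[of _ u] smulC_add_right sum.distrib)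
qed

lemma par_Bn: "cbilin m ==> par (Bn L m n f g) = Bn L m n (par f) (par g)"
 by (induction n arbitrary: f g) (simp_all add: par_mu par_linear par_sum insS_par)

lemma dxA_Bn_left: "cbilin m ==> Bn L m n (dxA i f) g = dxA i (Bn L m n f g)"
 by (induction n arbitrary: f g) (simp_all add: dxA_mu_left dxA_linear dxA_sum insS_dxA)

lemma dxA_Bn_right: "cbilin m ==> Bn L m n f (dxA i g) = dxA i (Bn L m n (par f) g)"
 by (induction n arbitrary: f g) (simp_all add: dxA_mu_right dxA_linear dxA_sum insS_dxA insS_par)

section \<open>The Koszul differential on a fibre\<close>

definition fdelta :: "('n, 'f::complex_fibre) fib => ('n::finite, 'f) fib"
 where "fdelta f = (\<Sum>i\<in>UNIV. dxA i (insS (axis i 1) f))"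

text \<open>Each summand is a derivation \<open>insS\<close> followed by multiplication with a
  one-form from the left; moving that one-form past the left factor costs
  \<open>par\<close>.\<close>

lemma fdelta_Bn:
 assumes m: "cbilin m" and "sym2 f" "sym2 g"
 shows "fdelta (Bn L m n f g) = Bn L m n (fdelta f) g + Bn L m n (par f) (fdelta g)"
 unfolding fdelta_def
 by (simp add: insS_Bn assms dxA_linear sum.distrib Bn_sum dxA_Bn_left dxA_Bn_right)

lemma fib_self_neg:
 fixes f :: "('n::finite, 'f::complex_fibre) fib"
 assumes "f = - f"
 shows "f = 0"
proof (intro ext)
 fix ys vs
 have "f ys vs = - f ys vs" using fun_cong[OF fun_cong[OF assms]] by (simp add: fun_ops)
 then have "2 *\<^sub>R f ys vs = 0" by (simp add: scaleR_2 eq_neg_iff_add_eq_0)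
 then show "f ys vs = 0 ys vs" by (simp add: fun_ops)
qed

text \<open>The exterior product of two basis one-forms is antisymmetric and the corresponding pair
  of insertions symmetric, so the double sum equals its own negative.\<close>

lemma fdelta_fdelta:
 assumes "sym2 f"
 shows "fdelta (fdelta f) = (0::('n::finite,'f::complex_fibre) fib)"
proof -
 let ?T = "%i j. dxA i (dxA j (insS (axis j 1) (insS (axis i 1) f)))"
 let ?S = "\<Sum>i\<in>UNIV. \<Sum>j\<in>UNIV. ?T i j"
 have "fdelta (fdelta f) = ?S"
  by (simp add: fdelta_def insS_sum insS_dxA dxA_sum sym2_comm[OF assms])
 moreover have "?T i j = - ?T j i" for i j
  by (subst dxA_anticomm, subst sym2_comm[OF assms]) simp
 then have "?S = (\<Sum>i\<in>UNIV. \<Sum>j\<in>UNIV. - ?T j i)"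
  by (intro sum.cong refl)
 then have "?S = - ?S"
  by (subst (asm) sum.swap) (simp add: sum_negf)
 ultimately show ?thesis
  using fib_self_neg by simp
qed

section \<open>Associativity of the fibrewise Weyl product\<close>

definition Psum :: "('n::finite => 'n => real) => (real ^ 'n => real ^ 'n => ('n, 'f::complex_fibre) fib) => ('n, 'f) fib"
 where "Psum L F = (\<Sum>k\<in>UNIV. \<Sum>l\<in>UNIV. smulC (of_real (L k l)) (F (axis k 1) (axis l 1)))"

lemma Psum_add: "Psum L (%u w. F u w + G u w) = Psum L F + Psum L G"
 by (simp add: Psum_def smulC_add_right sum.distrib)

lemma Psum_sum: "Psum L (%u w. \<Sum>i\<in>I. F i u w) = (\<Sum>i\<in>I. Psum L (F i))"
proof -
 have "Psum L (sum F I) = (\<Sum>i\<in>I. Psum L (F i))"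
  by (rule additive_sum[where T="Psum L"])
   (simp_all add: Psum_def plus_fun_apply zero_fun_apply smulC_add_right sum.distrib)
 moreover have "sum F I = (%u w. \<Sum>i\<in>I. F i u w)"
  by (intro ext) (simp add: sum_fun_apply)
 ultimately show ?thesis by simp
qed

lemma Bn_Suc_Psum: "Bn L m (Suc n) f g = smulC (1 / of_nat (Suc n)) (Psum L (%u w. Bn L m n (insS u f) (insS w g)))"
 by (simp add: Psum_def)

text \<open>The term of order n + 1 is homogeneous of that degree in the Poisson tensor; weighting
  it with its degree exposes one tensor and removes the normalising factor.\<close>

lemma euler: "smulC (of_nat (Suc n)) (Bn L m (Suc n) f g) = Psum L (%u w. Bn L m n (insS u f) (insS w g))"
 by (simp only: Bn_Suc_Psum smulC_smulC) (simp del: of_nat_Suc)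

declare Bn.simps(2) [simp del]

lemma Bn_Psum:
 assumes "cbilin m"
 shows "Bn L' m n (Psum L F) g = Psum L (%u w. Bn L' m n (F u w) g)"
  "Bn L' m n f (Psum L G) = Psum L (%u w. Bn L' m n f (G u w))"
 by (simp_all add: Psum_def Bn_sum[OF assms] Bn_linear[OF assms])

text \<open>Both bracketings satisfy the same recursion in the order; it comes from Euler's identity
  for the number of Poisson tensors.\<close>

lemma sum_weight:
 fixes F :: "nat => ('n::finite, 'f::complex_fibre) fib"
 shows "smulC (of_nat (Suc n)) (\<Sum>i\<le>Suc n. F i) =
  (\<Sum>i\<le>n. smulC (of_nat (Suc n - i)) (F i)) + (\<Sum>i\<le>n. smulC (of_nat (Suc i)) (F (Suc i)))"
proof -
 have "smulC (of_nat (Suc n)) (\<Sum>i\<le>Suc n. F i) =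
  (\<Sum>i\<le>Suc n. smulC (of_nat (Suc n - i)) (F i) + smulC (of_nat i) (F i))"
  unfolding smulC_sum_right by (intro sum.cong refl) (simp flip: smulC_add_left of_nat_add)
 also have "\<dots> = (\<Sum>i\<le>Suc n. smulC (of_nat (Suc n - i)) (F i)) + (\<Sum>i\<le>Suc n. smulC (of_nat i) (F i))"
  by (rule sum.distrib)
 also have "(\<Sum>i\<le>Suc n. smulC (of_nat (Suc n - i)) (F i)) = (\<Sum>i\<le>n. smulC (of_nat (Suc n - i)) (F i))"
  by simp
 also have "(\<Sum>i\<le>Suc n. smulC (of_nat i) (F i)) = (\<Sum>i\<le>n. smulC (of_nat (Suc i)) (F (Suc i)))"
  by (subst sum.atMost_Suc_shift) simp
 finally show ?thesis .
qed

text \<open>The weight n + 1 is the number of outer tensors plus the number of inner ones. Exposing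
  an outer tensor inserts one vector into \<open>h\<close> and the other into the product of
  \<open>f\<close> and \<open>g\<close>, hence by the Leibniz rule into \<open>f\<close> or
  \<open>g\<close>; exposing an inner tensor contracts \<open>f\<close> with \<open>g\<close>. These
  are the three pairs of factors on the right-hand side.\<close>

lemma Bn_left_bracket_Suc:
 fixes L :: "'n::finite => 'n => real"
 assumes m: "cbilin m1" "cbilin m2" and s: "sym2 f" "sym2 g"
 defines "A \<equiv> %n f g h. \<Sum>i\<le>n. Bn L m1 (n - i) (Bn L m2 i f g) h"
 shows "smulC (of_nat (Suc n)) (A (Suc n) f g h) =
  Psum L (%u w. A n (insS u f) g (insS w h) + A n f (insS u g) (insS w h) + A n (insS u f) (insS w g) h)"
proof -
 have 1: "smulC (of_nat (Suc n - i)) (Bn L m1 (Suc n - i) (Bn L m2 i f g) h) =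
  Psum L (%u w. Bn L m1 (n - i) (Bn L m2 i (insS u f) g) (insS w h) + Bn L m1 (n - i) (Bn L m2 i f (insS u g)) (insS w h))"
  if "i \<le> n" for i
  using that by (simp only: Suc_diff_le euler insS_Bn m s Bn_linear)
 have 2: "smulC (of_nat (Suc i)) (Bn L m1 (Suc n - Suc i) (Bn L m2 (Suc i) f g) h) =
  Psum L (%u w. Bn L m1 (n - i) (Bn L m2 i (insS u f) (insS w g)) h)" for i
  by (simp only: Bn_linear(3)[OF m(1), symmetric] euler Bn_Psum m diff_Suc_Suc)
 note 3 = sum.cong[OF refl 1, of "{..n}", simplified]
 show ?thesis
  unfolding A_def sum_weight Psum_add Psum_sum
  by (simp only: 3 2 Psum_add sum.distrib)
qed

lemma Bn_right_bracket_Suc: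
 fixes L :: "'n::finite => 'n => real"
 assumes m: "cbilin m3" "cbilin m4" and s: "sym2 g" "sym2 h"
 defines "A \<equiv> %n f g h. \<Sum>i\<le>n. Bn L m3 (n - i) f (Bn L m4 i g h)"
 shows "smulC (of_nat (Suc n)) (A (Suc n) f g h) =
  Psum L (%u w. A n (insS u f) g (insS w h) + A n f (insS u g) (insS w h) + A n (insS u f) (insS w g) h)"
proof -
 have 1: "smulC (of_nat (Suc n - i)) (Bn L m3 (Suc n - i) f (Bn L m4 i g h)) =
  Psum L (%u w. Bn L m3 (n - i) (insS u f) (Bn L m4 i (insS w g) h) + Bn L m3 (n - i) (insS u f) (Bn L m4 i g (insS w h)))"
  if "i \<le> n" for i
  using that by (simp only: Suc_diff_le euler insS_Bn m s Bn_linear)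
 have 2: "smulC (of_nat (Suc i)) (Bn L m3 (Suc n - Suc i) f (Bn L m4 (Suc i) g h)) =
  Psum L (%u w. Bn L m3 (n - i) f (Bn L m4 i (insS u g) (insS w h)))" for i
  by (simp only: Bn_linear(4)[OF m(1), symmetric] euler Bn_Psum m diff_Suc_Suc)
 note 3 = sum.cong[OF refl 1, of "{..n}", simplified]
 show ?thesis
  unfolding A_def sum_weight Psum_add Psum_sum
  by (simp only: 3 2 Psum_add sum.distrib) (simp only: add_ac)
qed

lemma Bn_assoc:
 assumes m: "cbilin m1" "cbilin m2" "cbilin m3" "cbilin m4"
  and assoc: "!!x y z. m1 (m2 x y) z = m3 x (m4 y z)"
  and "sym2 f" "sym2 g" "sym2 h"
 shows "(\<Sum>i\<le>n. Bn L m1 (n - i) (Bn L m2 i f g) h) = (\<Sum>i\<le>n. Bn L m3 (n - i) f (Bn L m4 i g h))"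
 using assms(6-8)
proof (induction n arbitrary: f g h)
 case 0 then show ?case by (simp add: mu_assoc[OF m assoc])
next
 case (Suc n)
 let ?n = "of_nat (Suc n) :: complex"
 have "smulC ?n (\<Sum>i\<le>Suc n. Bn L m1 (Suc n - i) (Bn L m2 i f g) h) =
   smulC ?n (\<Sum>i\<le>Suc n. Bn L m3 (Suc n - i) f (Bn L m4 i g h))"
  unfolding Bn_left_bracket_Suc[OF m(1,2) Suc.prems(1,2)] Bn_right_bracket_Suc[OF m(3,4) Suc.prems(2,3)]
  by (simp only: Suc.IH Suc.prems sym2_insS)
 then have "smulC (1 / ?n) (smulC ?n (\<Sum>i\<le>Suc n. Bn L m1 (Suc n - i) (Bn L m2 i f g) h)) =
   smulC (1 / ?n) (smulC ?n (\<Sum>i\<le>Suc n. Bn L m3 (Suc n - i) f (Bn L m4 i g h)))"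
  by (rule arg_cong)
 then show ?case
  unfolding smulC_smulC by (simp del: of_nat_Suc)
qed

section \<open>Smooth functions on open sets\<close>

text \<open>The derivatives in \<open>Ck_on\<close> are two-sided derivatives at a point; openness
  makes them depend on the values inside the set only.\<close>

lemma Ck_on_cong:
 assumes "open S" "!!x. x \<in> S ==> f x = g x" "Ck_on n S f"
 shows "Ck_on n S g"
 using assms(2,3)
proof (induction n arbitrary: f g)
 case 0 then show ?case by (simp add: continuous_on_cong[OF refl, of S f g])
next
 case (Suc n)
 have f: "(f has_derivative frechet_derivative f (at x)) (at x)" if "x \<in> S" for x
  using Suc.prems(2) that by (simp only: Ck_on.simps frechet_derivative_works[symmetric])
 have d: "(g has_derivative frechet_derivative f (at x)) (at x)" if "x \<in> S" for x
  by (rule has_derivative_transform_within_open[OF f[OF that] assms(1) that Suc.prems(1)])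
 have e: "frechet_derivative f (at x) = frechet_derivative g (at x)" if "x \<in> S" for x
  using frechet_derivative_at[OF d[OF that]] .
 have "Ck_on n S (%x. frechet_derivative g (at x) v)" for v
  by (rule Suc.IH[of "%x. frechet_derivative f (at x) v"]) (use e Suc.prems(2) in simp_all)
 then show ?case
  using d unfolding Ck_on.simps differentiable_def by blast
qed

lemma Ck_on_subset: "Ck_on n S f ==> T \<subseteq> S ==> Ck_on n T f"
 by (induction n arbitrary: f) (auto intro: continuous_on_subset)

lemma Ck_on_SucD: "Ck_on (Suc n) S f ==> Ck_on n S f"
proof (induction n arbitrary: f)
 case 0 then show ?case
  by (auto intro!: continuous_at_imp_continuous_on differentiable_imp_continuous_within)
next
 case (Suc n)
 have "f differentiable (at x)" if "x \<in> S" for x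
  using Suc.prems that by (simp only: Ck_on.simps)
 moreover have "Ck_on n S (%x. frechet_derivative f (at x) v)" for v
  by (rule Suc.IH) (use Suc.prems Ck_on.simps(2)[of "Suc n" S f] in blast)
 ultimately show ?case by (simp only: Ck_on.simps) blast
qed

lemma Ck_on_SucI:
 assumes "open S" "!!x. x \<in> S ==> (f has_derivative f' x) (at x)" "!!v. Ck_on n S (%x. f' x v)"
 shows "Ck_on (Suc n) S f"
proof -
 have "frechet_derivative f (at x) = f' x" if "x \<in> S" for x
  using frechet_derivative_at[OF assms(2)[OF that]] by simp
 then have "Ck_on n S (%x. frechet_derivative f (at x) v)" for v
  by (intro Ck_on_cong[OF assms(1) _ assms(3)]) auto
 then show ?thesis
  using assms(2) by (auto simp: differentiable_def)
qed

lemma Ck_on_Suc_has_derivative: "Ck_on (Suc n) S f ==> x \<in> S ==> (f has_derivative frechet_derivative f (at x)) (at x)"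
 using frechet_derivative_works by auto

text \<open>The order n regularity of \<open>f\<close> itself is returned as well, because the
  Leibniz rule keeps undifferentiated factors.\<close>

lemma Ck_on_SucE:
 assumes "Ck_on (Suc n) S f"
 obtains f' where "!!x. x \<in> S ==> (f has_derivative f' x) (at x)" "!!v. Ck_on n S (%x. f' x v)" "Ck_on n S f"
proof (rule that)
 show "(f has_derivative frechet_derivative f (at x)) (at x)" if "x \<in> S" for x
  using assms that by (rule Ck_on_Suc_has_derivative)
 show "Ck_on n S (%x. frechet_derivative f (at x) v)" for v
  using assms by simp
 show "Ck_on n S f"
  using assms by (rule Ck_on_SucD)
qed

lemma Ck_on_const: "open S ==> Ck_on n S (%x. c)"
 by (induction n arbitrary: c) (auto intro!: Ck_on_SucI)

lemma Ck_on_bounded_linear: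
 assumes "open S" "bounded_linear L" "Ck_on n S f"
 shows "Ck_on n S (%x. L (f x))"
 using assms(3)
proof (induction n arbitrary: f)
 case 0 then show ?case by (simp add: bounded_linear.continuous_on[OF assms(2)])
next
 case (Suc n)
 from Suc.prems obtain f' where f: "!!x. x \<in> S ==> (f has_derivative f' x) (at x)" "!!v. Ck_on n S (%x. f' x v)"
  by (rule Ck_on_SucE) blast
 show ?case
  by (rule Ck_on_SucI[OF assms(1) bounded_linear.has_derivative[OF assms(2) f(1)] Suc.IH[OF f(2)]])
qed

lemma Ck_on_add:
 assumes "open S" "Ck_on n S f" "Ck_on n S g"
 shows "Ck_on n S (%x. f x + g x)"
 using assms(2,3)
proof (induction n arbitrary: f g)
 case 0 then show ?case by (simp add: continuous_on_add)
next
 case (Suc n)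
 from Suc.prems(1) obtain f' where f: "!!x. x \<in> S ==> (f has_derivative f' x) (at x)" "!!v. Ck_on n S (%x. f' x v)"
  by (rule Ck_on_SucE) blast
 from Suc.prems(2) obtain g' where g: "!!x. x \<in> S ==> (g has_derivative g' x) (at x)" "!!v. Ck_on n S (%x. g' x v)"
  by (rule Ck_on_SucE) blast
 show ?case
  by (rule Ck_on_SucI[OF assms(1) has_derivative_add[OF f(1) g(1)] Suc.IH[OF f(2) g(2)]])
qed

lemma Ck_on_bilinear:
 assumes "open S" "bounded_bilinear h" "Ck_on n S f" "Ck_on n S g"
 shows "Ck_on n S (%x. h (f x) (g x))"
 using assms(3,4)
proof (induction n arbitrary: f g)
 case 0 then show ?case by (simp add: bounded_bilinear.continuous_on[OF assms(2)])
next
 case (Suc n)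
 from Suc.prems(1) obtain f' where f: "!!x. x \<in> S ==> (f has_derivative f' x) (at x)" "!!v. Ck_on n S (%x. f' x v)" "Ck_on n S f"
  by (rule Ck_on_SucE) blast
 from Suc.prems(2) obtain g' where g: "!!x. x \<in> S ==> (g has_derivative g' x) (at x)" "!!v. Ck_on n S (%x. g' x v)" "Ck_on n S g"
  by (rule Ck_on_SucE) blast
 show ?case
  by (rule Ck_on_SucI[OF assms(1) bounded_bilinear.FDERIV[OF assms(2) f(1) g(1)]
     Ck_on_add[OF assms(1) Suc.IH[OF f(3) g(2)] Suc.IH[OF f(2) g(3)]]])
qed

lemma Ck_on_sum:
 assumes "open S" "!!i. i \<in> I ==> Ck_on n S (f i)"
 shows "Ck_on n S (%x. \<Sum>i\<in>I. f i x)"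
 using assms(2) by (induction I rule: infinite_finite_induct) (auto intro!: Ck_on_const Ck_on_add assms(1))

lemma linear_axis_expansion:
 fixes L :: "real ^ 'n::finite => 'b::real_vector"
 assumes "linear L"
 shows "L v = (\<Sum>i\<in>UNIV. (v $ i) *\<^sub>R L (axis i 1))"
proof -
 have "L v = L (\<Sum>i\<in>UNIV. (v $ i) *\<^sub>R axis i 1)"
  by (intro arg_cong[where f=L]) (simp add: vec_eq_iff axis_def if_distrib cong: if_cong)
 also have "\<dots> = (\<Sum>i\<in>UNIV. (v $ i) *\<^sub>R L (axis i 1))"
  by (simp add: linear_sum[OF assms] linear_scale[OF assms])
 finally show ?thesis .
qed

text \<open>\<open>Ck_on\<close> controls the derivative of \<open>g\<close> in fixed directions
  only. With a finite-dimensional middle space the chain rule becomes a finite sum of components of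
  the derivative of \<open>f\<close> times partial derivatives of \<open>g\<close>, to which the
  induction hypothesis applies.\<close>

lemma Ck_on_compose:
 fixes f :: "'a::real_normed_vector => real ^ 'n::finite" and g :: "real ^ 'n => 'b::real_normed_vector"
 assumes "open S" "open T" "f ` S \<subseteq> T" "Ck_on n S f" "Ck_on n T g"
 shows "Ck_on n S (%x. g (f x))"
 using assms(4,5)
proof (induction n arbitrary: g)
 case 0 then show ?case using assms(3) by (auto intro: continuous_on_compose2)
next
 case (Suc n)
 show ?case
 proof (rule Ck_on_SucI[OF assms(1)])
  let ?D = "%x v. \<Sum>i\<in>UNIV. (frechet_derivative f (at x) v $ i) *\<^sub>R frechet_derivative g (at (f x)) (axis i 1)"
  show "((%x. g (f x)) has_derivative ?D x) (at x)" if "x \<in> S" for x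
  proof -
   have 1: "(f has_derivative frechet_derivative f (at x)) (at x)"
    using Suc.prems that by (intro Ck_on_Suc_has_derivative)
   have 2: "(g has_derivative frechet_derivative g (at (f x))) (at (f x))"
    using Suc.prems(2) that assms(3) by (intro Ck_on_Suc_has_derivative) auto
   have "((%x. g (f x)) has_derivative (%v. frechet_derivative g (at (f x)) (frechet_derivative f (at x) v))) (at x)"
    using has_derivative_compose[OF 1 2] .
   moreover have "linear (frechet_derivative g (at (f x)))"
    using 2 has_derivative_linear by blast
   from linear_axis_expansion[OF this]
   have "(%v. frechet_derivative g (at (f x)) (frechet_derivative f (at x) v)) = ?D x" by (rule ext)
   ultimately show ?thesis by (simp only:)
  qed
  show "Ck_on n S (%x. ?D x v)" for v
  proof -
   have f: "Ck_on n S (%x. frechet_derivative f (at x) v)" using Suc.prems(1) by simp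
   have g: "Ck_on n S (%x. frechet_derivative g (at (f x)) w)" for w
    using Suc.IH[OF Ck_on_SucD[OF Suc.prems(1)], of "%y. frechet_derivative g (at y) w"] Suc.prems(2) by simp
   show ?thesis
    by (intro Ck_on_sum Ck_on_bilinear[OF assms(1) bounded_bilinear_scaleR] g
      Ck_on_bounded_linear[OF assms(1) bounded_linear_vec_nth f] assms(1))
  qed
 qed
qed

lemma Ck_on_inverse:
 fixes f :: "'a::real_normed_vector => real"
 assumes "open S" "!!x. x \<in> S ==> f x \<noteq> 0" "Ck_on n S f"
 shows "Ck_on n S (%x. inverse (f x))"
 using assms(3)
proof (induction n)
 case 0 then show ?case using assms(2) by (auto intro: continuous_on_inverse)
next
 case (Suc n)
 from Suc.prems obtain f' where f: "!!x. x \<in> S ==> (f has_derivative f' x) (at x)" "!!v. Ck_on n S (%x. f' x v)" "Ck_on n S f"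
  by (rule Ck_on_SucE) blast
 show ?case
 proof (rule Ck_on_SucI[OF assms(1) Deriv.has_derivative_inverse[OF assms(2) f(1)]])
  show "Ck_on n S (%x. - (inverse (f x) * f' x v * inverse (f x)))" for v
   by (intro Ck_on_bilinear[OF assms(1) bounded_bilinear_mult] f(2) Suc.IH[OF f(3)]
    Ck_on_bounded_linear[OF assms(1) bounded_linear_minus[OF bounded_linear_ident]])
 qed
qed

lemma smooth_on_cong: "open S ==> (!!x. x \<in> S ==> f x = g x) ==> smooth_on S f ==> smooth_on S g"
 unfolding smooth_on_def by (simp add: Ck_on_cong[of S f g])
lemma smooth_on_subset: "smooth_on S f ==> T \<subseteq> S ==> smooth_on T f"
 unfolding smooth_on_def by (simp add: Ck_on_subset[of _ S f T])
lemma smooth_on_const: "open S ==> smooth_on S (%x. c)"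
 unfolding smooth_on_def by (simp add: Ck_on_const[of S _ c])
lemma smooth_on_bounded_linear: "open S ==> bounded_linear L ==> smooth_on S f ==> smooth_on S (%x. L (f x))"
 unfolding smooth_on_def by (simp add: Ck_on_bounded_linear[of S L _ f])
lemma smooth_on_add: "open S ==> smooth_on S f ==> smooth_on S g ==> smooth_on S (%x. f x + g x)"
 unfolding smooth_on_def by (simp add: Ck_on_add[of S _ f g])
lemma smooth_on_bilinear:
 "open S ==> bounded_bilinear h ==> smooth_on S f ==> smooth_on S g ==> smooth_on S (%x. h (f x) (g x))"
 unfolding smooth_on_def by (simp add: Ck_on_bilinear[of S h _ f g])
lemma smooth_on_compose:
 fixes f :: "'a::real_normed_vector => real ^ 'n::finite"
 shows "open S ==> open T ==> f ` S \<subseteq> T ==> smooth_on S f ==> smooth_on T g ==> smooth_on S (%x. g (f x))"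
 unfolding smooth_on_def by (simp add: Ck_on_compose[of S T f _ g])
lemma smooth_on_inverse:
 fixes f :: "'a::real_normed_vector => real"
 shows "open S ==> (!!x. x \<in> S ==> f x \<noteq> 0) ==> smooth_on S f ==> smooth_on S (%x. inverse (f x))"
 unfolding smooth_on_def by (simp add: Ck_on_inverse[of S f])
lemma smooth_on_has_derivative: "smooth_on S f ==> x \<in> S ==> (f has_derivative frechet_derivative f (at x)) (at x)"
 unfolding smooth_on_def by (intro Ck_on_Suc_has_derivative) auto
lemma smooth_on_frechet: "smooth_on S f ==> smooth_on S (%x. frechet_derivative f (at x) v)"
 unfolding smooth_on_def
proof
 fix n assume "\<forall>n. Ck_on n S f"
 then have "Ck_on (Suc n) S f" by blast
 then show "Ck_on n S (%x. frechet_derivative f (at x) v)" by simp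
qed
lemma smooth_on_ident: "open S ==> smooth_on S (%x. x)"
 unfolding smooth_on_def
proof
 fix n assume "open S" then show "Ck_on n S (%x. x)"
  using Ck_on_SucI[where f'="%x v. v", of S "%x. x" n, OF _ has_derivative_ident Ck_on_const]
  by (rule_tac Ck_on_SucD) simp
qed

lemma smooth_on_vec:
 fixes f :: "'a::real_normed_vector => 'b::euclidean_space ^ 'k::finite"
 assumes "open S" "!!i. smooth_on S (%x. f x $ i)"
 shows "smooth_on S f"
proof -
 have l: "bounded_linear (axis i :: 'b => 'b ^ 'k)" for i
  by (rule linear_conv_bounded_linear[THEN iffD1]) (rule linearI; simp add: axis_def vec_eq_iff)
 have "smooth_on S (%x. \<Sum>i\<in>UNIV. axis i (f x $ i))"
  using assms(2) unfolding smooth_on_def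
  by (intro allI Ck_on_sum Ck_on_bounded_linear[OF assms(1) l] assms(1)) auto
 moreover have "(\<Sum>i\<in>UNIV. axis i (f x $ i)) = f x" for x
  by (simp add: vec_eq_iff axis_def)
 ultimately show ?thesis by simp
qed

text \<open>The mean value theorem is applied twice: along \<open>u\<close> to the increment in the
  direction \<open>v\<close>, then along \<open>v\<close> to the first derivative in the direction
  \<open>u\<close>. The left-hand side is symmetric in \<open>u\<close> and \<open>v\<close>, the
  right-hand side is not.\<close>

lemma second_difference:
 fixes f :: "'a::real_normed_vector => real"
 assumes "open S" "Ck_on 2 S f" "h > 0" "cball x (h * (norm u + norm v)) \<subseteq> S"
 shows "\<exists>p \<in> cball x (h * (norm u + norm v)).
  f (x + h *\<^sub>R u + h *\<^sub>R v) - f (x + h *\<^sub>R u) - f (x + h *\<^sub>R v) + f x =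
  h * h * frechet_derivative (%y. frechet_derivative f (at y) u) (at p) v"
proof -
 let ?B = "cball x (h * (norm u + norm v))"
 have inB: "x + s *\<^sub>R u + t *\<^sub>R v \<in> ?B" if "0 \<le> s" "s \<le> h" "0 \<le> t" "t \<le> h" for s t
 proof -
  have "norm (s *\<^sub>R u + t *\<^sub>R v) \<le> s * norm u + t * norm v"
   using norm_triangle_ineq[of "s *\<^sub>R u" "t *\<^sub>R v"] that by (simp add: add.commute)
  also have "\<dots> \<le> h * (norm u + norm v)"
   using that by (simp add: distrib_left mult_right_mono add_mono)
  finally have "dist x (x + (s *\<^sub>R u + t *\<^sub>R v)) \<le> h * (norm u + norm v)"
   by (metis dist_add_cancel dist_norm norm_minus_commute add.right_neutral diff_zero)
  then show ?thesis by (simp add: add.assoc)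
 qed
 have df: "(f has_derivative frechet_derivative f (at y)) (at y)" if "y \<in> S" for y
  using assms(2) that frechet_derivative_works by (auto simp: numeral_2_eq_2)
 have ddf: "((%y. frechet_derivative f (at y) u) has_derivative frechet_derivative (%y. frechet_derivative f (at y) u) (at y)) (at y)" if "y \<in> S" for y
  using assms(2) that by (simp only: numeral_2_eq_2 Ck_on.simps frechet_derivative_works[symmetric])
 let ?g = "%s. f (x + s *\<^sub>R u + h *\<^sub>R v) - f (x + s *\<^sub>R u)"
 let ?D = "%y. frechet_derivative f (at y) u"
 have lin: "linear (frechet_derivative f (at y))" if "y \<in> S" for y
  using df[OF that] has_derivative_linear by blast
 have lin2: "linear (frechet_derivative ?D (at y))" if "y \<in> S" for y
  using ddf[OF that] has_derivative_linear by blast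
 have g: "DERIV ?g s :> ?D (x + s *\<^sub>R u + h *\<^sub>R v) - ?D (x + s *\<^sub>R u)" if "0 \<le> s" "s \<le> h" for s
 proof -
  have a: "x + s *\<^sub>R u + h *\<^sub>R v \<in> S" "x + s *\<^sub>R u \<in> S"
   using inB[of s h] inB[of s 0] that assms(3,4) by auto
  have "(?g has_derivative (%t. frechet_derivative f (at (x + s *\<^sub>R u + h *\<^sub>R v)) (t *\<^sub>R u) - frechet_derivative f (at (x + s *\<^sub>R u)) (t *\<^sub>R u))) (at s)"
   by (rule has_derivative_diff[OF
      has_derivative_compose[where f="%s. x + s *\<^sub>R u + h *\<^sub>R v" and f'="%t. t *\<^sub>R u", OF _ df[OF a(1)]]
      has_derivative_compose[where f="%s. x + s *\<^sub>R u" and f'="%t. t *\<^sub>R u", OF _ df[OF a(2)]]])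
    (auto intro!: derivative_eq_intros)
  then show ?thesis
   unfolding has_field_derivative_def
   by (rule has_derivative_eq_rhs) (rule ext, simp only: linear_scale[OF lin[OF a(1)]] linear_scale[OF lin[OF a(2)]] real_scaleR_def right_diff_distrib mult.commute)
 qed
 have "\<exists>s>0. s < h \<and> ?g h - ?g 0 = (h - 0) * (?D (x + s *\<^sub>R u + h *\<^sub>R v) - ?D (x + s *\<^sub>R u))"
  by (rule MVT2[OF assms(3) g])
 then obtain s where s: "0 < s" "s < h" "?g h - ?g 0 = (h - 0) * (?D (x + s *\<^sub>R u + h *\<^sub>R v) - ?D (x + s *\<^sub>R u))"
  by blast
 let ?k = "%t. ?D (x + s *\<^sub>R u + t *\<^sub>R v)"
 have k: "DERIV ?k t :> frechet_derivative ?D (at (x + s *\<^sub>R u + t *\<^sub>R v)) v" if "0 \<le> t" "t \<le> h" for t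
 proof -
  have a: "x + s *\<^sub>R u + t *\<^sub>R v \<in> S"
   using inB[of s t] that s assms(4) by auto
  have "(?k has_derivative (%r. frechet_derivative ?D (at (x + s *\<^sub>R u + t *\<^sub>R v)) (r *\<^sub>R v))) (at t)"
   by (rule has_derivative_compose[where f="%t. x + s *\<^sub>R u + t *\<^sub>R v" and f'="%r. r *\<^sub>R v", OF _ ddf[OF a]])
    (auto intro!: derivative_eq_intros)
  then show ?thesis
   unfolding has_field_derivative_def
   by (rule has_derivative_eq_rhs) (rule ext, simp only: linear_scale[OF lin2[OF a]] real_scaleR_def mult.commute)
 qed
 have "\<exists>t>0. t < h \<and> ?k h - ?k 0 = (h - 0) * frechet_derivative ?D (at (x + s *\<^sub>R u + t *\<^sub>R v)) v"
  by (rule MVT2[OF assms(3) k])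
 then obtain t where t: "0 < t" "t < h" "?k h - ?k 0 = (h - 0) * frechet_derivative ?D (at (x + s *\<^sub>R u + t *\<^sub>R v)) v"
  by blast
 show ?thesis
  by (rule bexI[OF _ inB[of s t]]) (use s t in \<open>auto simp: algebra_simps\<close>)
qed

lemma schwarz_real:
 fixes f :: "'a::real_normed_vector => real"
 assumes "open S" "Ck_on 2 S f" "x \<in> S"
 shows "frechet_derivative (%y. frechet_derivative f (at y) u) (at x) v =
  frechet_derivative (%y. frechet_derivative f (at y) v) (at x) u"
proof (rule ccontr)
 let ?A = "%x. frechet_derivative (%y. frechet_derivative f (at y) u) (at x) v"
 let ?B = "%x. frechet_derivative (%y. frechet_derivative f (at y) v) (at x) u"
 assume ne: "?A x \<noteq> ?B x"
 \<comment> \<open>Half of the supposed gap: two equal numbers cannot both be closer than this to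
   the two different limits.\<close>
 define e where "e = \<bar>?A x - ?B x\<bar> / 2"
 have e: "e > 0" using ne by (simp add: e_def)
 have "continuous_on S ?A" "continuous_on S ?B"
  using assms(2) by (auto simp: numeral_2_eq_2)
 then have "continuous (at x) ?A" "continuous (at x) ?B"
  using assms(1,3) continuous_on_eq_continuous_at by blast+
 then obtain d1 d2 where d: "d1 > 0" "!!y. dist y x < d1 ==> dist (?A y) (?A x) < e"
  "d2 > 0" "!!y. dist y x < d2 ==> dist (?B y) (?B x) < e"
  using e unfolding continuous_at_eps_delta by metis
 obtain d3 where d3: "d3 > 0" "ball x d3 \<subseteq> S" using assms(1,3) openE by blast
 define D where "D = Min {d1, d2, d3}"
 have D: "D > 0" "D \<le> d1" "D \<le> d2" "D \<le> d3" using d d3 by (auto simp: D_def)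
 \<comment> \<open>Makes the closed ball of the second difference strictly smaller than
   \<open>D\<close>; the added 1 keeps the denominator positive for vanishing \<open>u\<close> and
   \<open>v\<close>.\<close>
 define h where "h = D / (norm u + norm v + 1)"
 have h: "h > 0" using D by (simp add: h_def add_nonneg_pos)
 have hD: "h * (norm u + norm v) < D"
 proof -
  have "norm u + norm v + 1 > 0" by (simp add: add_nonneg_pos)
  then show ?thesis using D by (simp add: h_def field_simps)
 qed
 have sub: "cball x (h * (norm u + norm v)) \<subseteq> S" using hD D d3 by force
 obtain p where p: "p \<in> cball x (h * (norm u + norm v))"
  "f (x + h *\<^sub>R u + h *\<^sub>R v) - f (x + h *\<^sub>R u) - f (x + h *\<^sub>R v) + f x = h * h * ?A p"
  using second_difference[OF assms(1,2) h sub] by blast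
 obtain q where q: "q \<in> cball x (h * (norm u + norm v))"
  "f (x + h *\<^sub>R v + h *\<^sub>R u) - f (x + h *\<^sub>R v) - f (x + h *\<^sub>R u) + f x = h * h * ?B q"
  using second_difference[OF assms(1,2) h, of x v u] sub by (metis add.commute)
 have "h * h * ?A p = h * h * ?B q" using p(2) q(2) by (simp add: algebra_simps)
 then have "?A p = ?B q" using h by simp
 moreover have "dist (?A p) (?A x) < e" "dist (?B q) (?B x) < e"
  using p(1) q(1) hD D d by (auto simp: dist_commute)
 moreover have False if "a = b" "dist a c < e" "dist b d < e" "e = \<bar>c - d\<bar> / 2" for a b c d e :: real
  using that by (auto simp: dist_real_def abs_if split: if_splits)
 ultimately show False using e_def by metis
qed

lemma schwarz:
 fixes f :: "'a::real_normed_vector => 'b::euclidean_space"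
 assumes "open S" "smooth_on S f" "x \<in> S"
 shows "frechet_derivative (%y. frechet_derivative f (at y) u) (at x) v =
  frechet_derivative (%y. frechet_derivative f (at y) v) (at x) u"
proof (rule euclidean_eqI)
 fix b :: 'b assume "b \<in> Basis"
 let ?g = "%x. f x \<bullet> b"
 have l: "bounded_linear (%y::'b. y \<bullet> b)" by (rule bounded_linear_inner_left)
 have comp: "frechet_derivative (%x. h x \<bullet> b) (at y) w = frechet_derivative h (at y) w \<bullet> b"
  if "h differentiable (at y)" for h :: "'a => 'b" and y w
 proof -
  have "((%x. h x \<bullet> b) has_derivative (%w. frechet_derivative h (at y) w \<bullet> b)) (at y)"
   using that by (intro bounded_linear.has_derivative[OF l]) (simp add: frechet_derivative_works)
  from frechet_derivative_at[OF this, symmetric] show ?thesis by simp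
 qed
 have d1: "f differentiable (at y)" if "y \<in> S" for y
  using smooth_on_has_derivative[OF assms(2) that] by (auto simp: differentiable_def)
 have d2: "(%y. frechet_derivative f (at y) w) differentiable (at y)" if "y \<in> S" for y w
  using smooth_on_has_derivative[OF smooth_on_frechet[OF assms(2)] that] by (auto simp: differentiable_def)
 have 2: "frechet_derivative (%y. frechet_derivative ?g (at y) u) (at x) v = frechet_derivative (%y. frechet_derivative f (at y) u) (at x) v \<bullet> b" for u v
 proof -
  have "frechet_derivative (%y. frechet_derivative ?g (at y) u) (at x) = frechet_derivative (%y. frechet_derivative f (at y) u \<bullet> b) (at x)"
  proof (rule frechet_derivative_transform_within_open[OF _ assms(1,3)])
   show "(%y. frechet_derivative ?g (at y) u) differentiable (at x)"
    using smooth_on_has_derivative[OF smooth_on_frechet[OF smooth_on_bounded_linear[OF assms(1) l assms(2)]] assms(3)]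
    by (auto simp: differentiable_def)
  qed (use comp d1 in auto)
  then show ?thesis using comp d2 assms(3) by simp
 qed
 have "Ck_on 2 S ?g"
  using smooth_on_bounded_linear[OF assms(1) l assms(2)] unfolding smooth_on_def by blast
 from schwarz_real[OF assms(1) this assms(3)] show
  "frechet_derivative (%y. frechet_derivative f (at y) u) (at x) v \<bullet> b =
  frechet_derivative (%y. frechet_derivative f (at y) v) (at x) u \<bullet> b"
  by (simp add: 2)
qed

section \<open>Determinants and inverse matrices\<close>

lemma smooth_on_sum: "open S ==> (!!i. i \<in> I ==> smooth_on S (f i)) ==> smooth_on S (%x. \<Sum>i\<in>I. f i x)"
 unfolding smooth_on_def by (auto intro: Ck_on_sum)

lemma smooth_on_prod:
 fixes f :: "'i => 'a::real_normed_vector => real"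
 shows "open S ==> (!!i. i \<in> I ==> smooth_on S (f i)) ==> smooth_on S (%x. \<Prod>i\<in>I. f i x)"
 by (induction I rule: infinite_finite_induct)
  (auto intro!: smooth_on_const smooth_on_bilinear[OF _ bounded_bilinear_mult])

lemma smooth_on_det:
 fixes W :: "'a::real_normed_vector => real ^ 'n::finite ^ 'n"
 assumes "open S" "!!i j. smooth_on S (%x. W x $ i $ j)"
 shows "smooth_on S (%x. det (W x))"
 unfolding det_def
 by (intro smooth_on_sum smooth_on_bilinear[OF _ bounded_bilinear_mult] smooth_on_const smooth_on_prod assms)

lemma matrix_inv_inverse:
 fixes A :: "'a::semiring_1 ^ 'n::finite ^ 'm::finite"
 assumes "invertible A"
 shows "A ** matrix_inv A = mat 1" "matrix_inv A ** A = mat 1"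
proof -
 have "A ** matrix_inv A = mat 1 \<and> matrix_inv A ** A = mat 1"
  using assms unfolding invertible_def matrix_inv_def by (rule someI_ex)
 then show "A ** matrix_inv A = mat 1" "matrix_inv A ** A = mat 1" by auto
qed

text \<open>By Cramer's rule an entry of the inverse is a quotient of determinants of matrices with
  smooth entries, and the denominator does not vanish.\<close>

lemma smooth_on_matrix_inv:
 fixes W :: "'a::real_normed_vector => real ^ 'n::finite ^ 'n"
 assumes "open S" "!!i j. smooth_on S (%x. W x $ i $ j)" "!!x. x \<in> S ==> invertible (W x)"
 shows "smooth_on S (%x. matrix_inv (W x) $ k $ l)"
proof -
 let ?R = "%x. det (\<chi> i j. if j = k then axis l 1 $ i else W x $ i $ j) * inverse (det (W x))"
 have eq: "?R x = matrix_inv (W x) $ k $ l" if "x \<in> S" for x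
 proof -
  have inv: "invertible (W x)" using assms(3) that .
  then have d: "det (W x) \<noteq> 0" by (simp add: invertible_det_nz)
  have "W x *v (matrix_inv (W x) *v axis l 1) = axis l 1"
   by (simp add: matrix_vector_mul_assoc matrix_inv_inverse(1)[OF inv])
  then have "matrix_inv (W x) *v axis l 1 = (\<chi> k. det (\<chi> i j. if j = k then axis l 1 $ i else W x $ i $ j) / det (W x))"
   using cramer[OF d] by blast
  then have "(matrix_inv (W x) *v axis l 1) $ k = ?R x"
   by (simp add: divide_inverse)
  then show ?thesis by (simp add: matrix_vector_mul_component inner_axis)
 qed
 have "smooth_on S (%x. if j = k then axis l 1 $ i else W x $ i $ j)" for i j
  by (cases "j = k") (simp_all add: assms smooth_on_const)
 then have "smooth_on S ?R"
  using assms(3) by (intro smooth_on_bilinear[OF assms(1) bounded_bilinear_mult] smooth_on_inverse smooth_on_det assms(1,2))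
   (simp_all add: invertible_det_nz)
 then show ?thesis by (rule smooth_on_cong[OF assms(1) eq, rotated])
qed

subsection \<open>Multilinear, symmetric and alternating fibre elements\<close>

text \<open>The pointwise conditions in \<open>weyl_forms\<close>. Smooth dependence on the point is
  treated separately.\<close>

definition wfib :: "('n::finite, 'f::complex_fibre) fib => bool"
 where "wfib f \<longleftrightarrow>
  (\<forall>ys ys' vs. linear (%u. f (ys @ u # ys') vs)) \<and>
  (\<forall>ys vs vs'. linear (%u. f ys (vs @ u # vs'))) \<and>
  (\<forall>ys u w ys' vs. f (ys @ u # w # ys') vs = f (ys @ w # u # ys') vs) \<and>
  (\<forall>ys vs u w vs'. f ys (vs @ u # w # vs') = - f ys (vs @ w # u # vs'))"

lemma wfibD:
 assumes "wfib f"
 shows "linear (%u. f (ys @ u # ys') vs)" "linear (%u. f ys (vs @ u # vs'))"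
  "f (ys @ u # w # ys') vs = f (ys @ w # u # ys') vs" "f ys (vs @ u # w # vs') = - f ys (vs @ w # u # vs')"
 by (rule assms[unfolded wfib_def, THEN conjunct1, rule_format]
   assms[unfolded wfib_def, THEN conjunct2, THEN conjunct1, rule_format]
   assms[unfolded wfib_def, THEN conjunct2, THEN conjunct2, THEN conjunct1, rule_format]
   assms[unfolded wfib_def, THEN conjunct2, THEN conjunct2, THEN conjunct2, rule_format])+

lemma wfibI:
 assumes "!!ys ys' vs. linear (%u. f (ys @ u # ys') vs)" "!!ys vs vs'. linear (%u. f ys (vs @ u # vs'))"
  "!!ys u w ys' vs. f (ys @ u # w # ys') vs = f (ys @ w # u # ys') vs"
  "!!ys vs u w vs'. f ys (vs @ u # w # vs') = - f ys (vs @ w # u # vs')"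
 shows "wfib f"
 unfolding wfib_def by (intro conjI allI assms)

lemma wfib_insS:
 assumes "wfib f" shows "wfib (insS u f)"
 unfolding insS_def
proof (rule wfibI)
 fix ys ys' vs vs' :: "(real ^ 'a) list" and x w :: "real ^ 'a"
 show "linear (%x. f (u # ys @ x # ys') vs)" using wfibD(1)[OF assms, of "u # ys" ys' vs] by (simp only: append_Cons)
 show "linear (%x. f (u # ys) (vs @ x # vs'))" by (rule wfibD(2)[OF assms])
 show "f (u # ys @ x # w # ys') vs = f (u # ys @ w # x # ys') vs" using wfibD(3)[OF assms, of "u # ys" x w ys' vs] by (simp only: append_Cons)
 show "f (u # ys) (vs @ x # w # vs') = - f (u # ys) (vs @ w # x # vs')" by (rule wfibD(4)[OF assms])
qed

lemma wfib_insA: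
 assumes "wfib f" shows "wfib (insA u f)"
 unfolding insA_def
proof (rule wfibI)
 fix ys ys' vs vs' :: "(real ^ 'a) list" and x w :: "real ^ 'a"
 show "linear (%x. f (ys @ x # ys') (u # vs))" by (rule wfibD(1)[OF assms])
 show "linear (%x. f ys (u # vs @ x # vs'))" using wfibD(2)[OF assms, of ys "u # vs" vs'] by (simp only: append_Cons)
 show "f (ys @ x # w # ys') (u # vs) = f (ys @ w # x # ys') (u # vs)" by (rule wfibD(3)[OF assms])
 show "f ys (u # vs @ x # w # vs') = - f ys (u # vs @ w # x # vs')" using wfibD(4)[OF assms, of ys "u # vs" x w vs'] by (simp only: append_Cons)
qed

lemma wfib_sym2: "wfib f ==> sym2 f"
 unfolding sym2_def by (intro allI wfibD(3))

lemma wfib_insS_comm: "wfib f ==> insS u (insS w f) = insS w (insS u f)"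
 by (rule sym2_comm[OF wfib_sym2])

lemma wfib_insA_comm:
 assumes "wfib f"
 shows "insA u (insA w f) = - insA w (insA u f)"
proof (intro ext)
 fix ys vs
 have "f ys ([] @ w # u # vs) = - f ys ([] @ u # w # vs)" by (rule wfibD(4)[OF assms])
 then show "insA u (insA w f) ys vs = (- insA w (insA u f)) ys vs" by (simp add: insA_def fun_ops)
qed

lemma wfib_linear_insS: "wfib f ==> linear (%u. insS u f ys vs)"
 using wfibD(1)[of f "[]"] by (simp add: insS_def)

lemma wfib_linear_insA: "wfib f ==> linear (%u. insA u f ys vs)"
 using wfibD(2)[of f _ "[]"] by (simp add: insA_def)

text \<open>Insertions move any slot to the front, so a class closed under insertions needs only
  conditions on the first slot and on the first two insertions.\<close>

lemma wfib_coinduct: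
 assumes "P f"
  and ins: "!!f u. P f ==> P (insS u f)" "!!f u. P f ==> P (insA u f)"
  and lin: "!!f ys vs. P f ==> linear (%u. insS u f ys vs)" "!!f ys vs. P f ==> linear (%u. insA u f ys vs)"
  and comm: "!!f u w. P f ==> insS u (insS w f) = insS w (insS u f)" "!!f u w. P f ==> insA u (insA w f) = - insA w (insA u f)"
 shows "wfib f"
proof -
 have 1: "linear (%u. f (ys @ u # ys') vs)" if "P f" for f ys ys' vs
  using that
 proof (induction ys arbitrary: f)
  case Nil then show ?case using lin(1)[of f ys' vs] by (simp add: insS_def)
 next
  case (Cons w ys) then show ?case using Cons.IH[OF ins(1)[of f w]] by (simp add: insS_def)
 qed
 have 2: "linear (%u. f ys (vs @ u # vs'))" if "P f" for f ys vs' vs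
  using that
 proof (induction vs arbitrary: f)
  case Nil then show ?case using lin(2)[of f ys vs'] by (simp add: insA_def)
 next
  case (Cons w vs) then show ?case using Cons.IH[OF ins(2)[of f w]] by (simp add: insA_def)
 qed
 have 3: "f (ys @ u # w # ys') vs = f (ys @ w # u # ys') vs" if "P f" for f ys u w ys' vs
  using that
 proof (induction ys arbitrary: f)
  case Nil
  have "insS w (insS u f) ys' vs = insS u (insS w f) ys' vs" using comm(1)[OF Nil, of w u] by simp
  then show ?case by (simp add: insS_def)
 next
  case (Cons x ys) then show ?case using Cons.IH[OF ins(1)[of f x]] by (simp add: insS_def)
 qed
 have 4: "f ys (vs @ u # w # vs') = - f ys (vs @ w # u # vs')" if "P f" for f ys u w vs vs'
  using that
 proof (induction vs arbitrary: f)
  case Nil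
  have "insA w (insA u f) ys vs' = (- insA u (insA w f)) ys vs'" using comm(2)[OF Nil, of w u] by simp
  then show ?case by (simp add: insA_def fun_ops)
 next
  case (Cons x vs) then show ?case using Cons.IH[OF ins(2)[of f x]] by (simp add: insA_def)
 qed
 show ?thesis using 1[OF assms(1)] 2[OF assms(1)] 3[OF assms(1)] 4[OF assms(1)] by (rule wfibI)
qed

lemma linear_zero_fun: "linear (%u. 0)"
 by (rule linearI) simp_all

lemma wfib_add:
 assumes "wfib f" "wfib g" shows "wfib (f + g)"
 unfolding plus_fun_def
 by (rule wfibI)
  (intro linear_compose_add wfibD(1,2) assms,
   intro linear_compose_add wfibD(1,2) assms,
   subst wfibD(3)[OF assms(1)], subst wfibD(3)[OF assms(2)], rule refl,
   subst wfibD(4)[OF assms(1)], subst wfibD(4)[OF assms(2)], simp)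

lemma wfib_zero: "wfib 0"
 unfolding wfib_def by (simp add: fun_ops linear_zero_fun)

lemma linear_scaleC: "linear ((*\<^sub>c) c :: 'f::complex_fibre => 'f)"
 by (rule linearI) (simp_all add: scaleC_add_right scaleR_scaleC scaleC_scaleC mult.commute)

lemma linear_compose_scaleC: "linear f ==> linear (%u. c *\<^sub>c f u :: 'f::complex_fibre)"
 using linear_compose[OF _ linear_scaleC, of f c] by (simp add: o_def)

lemma wfib_smulC: "wfib f ==> wfib (smulC c f)"
 unfolding smulC_def
 by (rule wfibI) (intro linear_compose_scaleC wfibD(1,2), assumption,
  intro linear_compose_scaleC wfibD(1,2), assumption, subst wfibD(3), assumption, rule refl,
  subst wfibD(4), assumption, simp)

lemma wfib_neg: "wfib f ==> wfib (- f)"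
 using wfib_smulC[of f "-1"] by simp

lemma wfib_diff: "wfib f ==> wfib g ==> wfib (f - g)"
 using wfib_add[OF _ wfib_neg, of f g] by simp

lemma closed_sum:
 assumes "P 0" "!!x y. P x ==> P y ==> P (x + y)" "!!i. i \<in> I ==> P (f i)"
 shows "P (\<Sum>i\<in>I. f i :: 'a::comm_monoid_add)"
 using assms(3) by (induction I rule: infinite_finite_induct) (simp_all add: assms(1,2))

lemma wfib_sum: "(!!i. i \<in> I ==> wfib (f i)) ==> wfib (\<Sum>i\<in>I. f i)"
 by (rule closed_sum[of wfib, OF wfib_zero wfib_add])

lemma wfib_par:
 assumes "wfib f" shows "wfib (par f)"
 unfolding par_def
proof (rule wfibI)
 fix ys ys' vs vs' :: "(real ^ 'a) list" and u w :: "real ^ 'a"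
 show "linear (%u. (- 1) ^ length vs *\<^sub>R f (ys @ u # ys') vs)"
  by (intro linear_compose_scale_right wfibD(1)[OF assms])
 show "linear (%u. (- 1) ^ length (vs @ u # vs') *\<^sub>R f ys (vs @ u # vs'))"
  unfolding length_append list.size by (intro linear_compose_scale_right wfibD(2)[OF assms])
 show "(- 1) ^ length vs *\<^sub>R f (ys @ u # w # ys') vs = (- 1) ^ length vs *\<^sub>R f (ys @ w # u # ys') vs"
  by (subst wfibD(3)[OF assms]) (rule refl)
 show "(- 1) ^ length (vs @ u # w # vs') *\<^sub>R f ys (vs @ u # w # vs') = - ((- 1) ^ length (vs @ w # u # vs') *\<^sub>R f ys (vs @ w # u # vs'))"
  by (subst wfibD(4)[OF assms]) simp
qed

lemma linear_fib_ops:
 fixes F G :: "real^'n => ('n::finite, 'f::complex_fibre) fib"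
 shows "linear (%u. F u ys vs) ==> linear (%u. G u ys vs) ==> linear (%u. (F u + G u) ys vs)"
  "linear (%u. F u ys vs) ==> linear (%u. G u ys vs) ==> linear (%u. (F u - G u) ys vs)"
  "linear (%u. F u ys vs) ==> linear (%u. smulC c (F u) ys vs)"
  "(!!vs. linear (%u. F u ys vs)) ==> linear (%u. dxA i (F u) ys vs)"
  "(!!ys. linear (%u. F u ys vs)) ==> linear (%u. dxS i (F u) ys vs)"
  "linear (%u. smulC (of_real (u $ i)) f ys vs)"
 by (simp_all add: fun_ops linear_compose_add linear_compose_sub smulC_def linear_compose_scaleC dxA_def dxS_def
   linear_compose_sum linear_compose_scale_right)
  (rule linearI; simp add: scaleR_scaleC scaleC_add_left scaleC_scaleC)

lemma wfib_dxA:
 assumes "wfib f"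
 shows "wfib (dxA i f)"
proof (rule wfib_coinduct)
 \<comment> \<open>Contracting \<open>dxA i f\<close> leaves a multiple of \<open>f\<close> beside
   another element of the form \<open>dxA\<close>, so the class closed under insertions consists of
   sums of both kinds.\<close>
 let ?P = "%h. \<exists>f g. wfib f \<and> wfib g \<and> h = g + dxA i f"
 show "?P (dxA i f)"
  by (rule exI[of _ f], rule exI[of _ 0]) (simp add: wfib_zero assms)
 fix h assume "?P h"
 then obtain f g where fg: "wfib f" "wfib g" "h = g + dxA i f" by blast
 show "?P (insS u h)" for u
  by (rule exI[of _ "insS u f"], rule exI[of _ "insS u g"]) (simp add: fg wfib_insS insS_linear insS_dxA)
 show "?P (insA u h)" for u
  by (rule exI[of _ "- insA u f"], rule exI[of _ "insA u g + smulC (of_real (u $ i)) f"])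
   (simp add: fg wfib_insA wfib_add wfib_smulC wfib_neg insA_linear insA_dxA dxA_linear)
 show "linear (%u. insS u h ys vs)" for ys vs
  unfolding fg insS_linear insS_dxA by (intro linear_fib_ops wfib_linear_insS fg)
 show "linear (%u. insA u h ys vs)" for ys vs
  unfolding fg insA_linear insA_dxA by (intro linear_fib_ops wfib_linear_insA fg)
 show "insS u (insS w h) = insS w (insS u h)" for u w
  by (simp add: fg insS_linear insS_dxA wfib_insS_comm[of _ u w])
 show "insA u (insA w h) = - insA w (insA u h)" for u w
  using wfib_insA_comm[OF fg(2), of u w] wfib_insA_comm[OF fg(1), of u w]
  by (simp add: fg insA_linear insA_dxA dxA_linear algebra_simps)
qed

lemma wfib_dxS:
 assumes "wfib f"
 shows "wfib (dxS i f)"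
proof (rule wfib_coinduct)
 let ?P = "%h. \<exists>f g. wfib f \<and> wfib g \<and> h = g + dxS i f"
 show "?P (dxS i f)"
  by (rule exI[of _ f], rule exI[of _ 0]) (simp add: wfib_zero assms)
 fix h assume "?P h"
 then obtain f g where fg: "wfib f" "wfib g" "h = g + dxS i f" by blast
 show "?P (insA u h)" for u
  by (rule exI[of _ "insA u f"], rule exI[of _ "insA u g"]) (simp add: fg wfib_insA insA_linear insA_dxS)
 show "?P (insS u h)" for u
  by (rule exI[of _ "insS u f"], rule exI[of _ "insS u g + smulC (of_real (u $ i)) f"])
   (simp add: fg wfib_insS wfib_add wfib_smulC insS_linear insS_dxS)
 show "linear (%u. insS u h ys vs)" for ys vs
  unfolding fg insS_linear insS_dxS by (intro linear_fib_ops wfib_linear_insS fg)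
 show "linear (%u. insA u h ys vs)" for ys vs
  unfolding fg insA_linear insA_dxS by (intro linear_fib_ops wfib_linear_insA fg)
 show "insA u (insA w h) = - insA w (insA u h)" for u w
  using wfib_insA_comm[OF fg(2), of u w] wfib_insA_comm[OF fg(1), of u w]
  by (simp add: fg insA_linear insA_dxS dxS_linear)
 show "insS u (insS w h) = insS w (insS u h)" for u w
  using wfib_insS_comm[OF fg(2), of u w] wfib_insS_comm[OF fg(1), of u w]
  by (simp add: fg insS_linear insS_dxS dxS_linear)
qed

lemma linear_mu:
 fixes F :: "real^'n => ('n::finite, 'f::complex_fibre) fib" and G :: "real^'n => ('n::finite, 'g::complex_fibre) fib"
 assumes "cbilin m"
 shows "(!!ys vs. linear (%u. F u ys vs)) ==> linear (%u. mu m (F u) g ys vs)"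
  "(!!ys vs. linear (%u. G u ys vs)) ==> linear (%u. mu m f (G u) ys vs)"
proof -
 have 1: "linear (%x. m x y)" "linear (%x. m z x)" for y z
  by (rule linearI; simp add: cbilinD[OF assms])+
 have 2: "linear F ==> linear (%u. m (F u) y)" "linear G ==> linear (%u. m z (G u))"
  for F :: "real^'n => _" and G :: "real^'n => _" and y z
  using linear_compose[OF _ 1(1), of F y] linear_compose[OF _ 1(2), of G z] by (simp_all add: o_def)
 show "(!!ys vs. linear (%u. F u ys vs)) ==> linear (%u. mu m (F u) g ys vs)"
  "(!!ys vs. linear (%u. G u ys vs)) ==> linear (%u. mu m f (G u) ys vs)"
  unfolding mu_def by (intro linear_compose_sum ballI linear_compose_scaleC 2; assumption)+
qed

text \<open>By the Leibniz rule an insertion turns one product into a sum of two; the span is the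
  smallest class on which \<open>wfib_coinduct\<close> can be run.\<close>

inductive_set mu_span for m :: "'f::complex_fibre => 'g::complex_fibre => 'h::complex_fibre"
 where base: "wfib f ==> wfib g ==> mu m f g \<in> mu_span m"
 | add: "h \<in> mu_span m ==> h' \<in> mu_span m ==> h + h' \<in> mu_span m"

lemma wfib_mu:
 assumes m: "cbilin m" and "wfib f" "wfib g"
 shows "wfib (mu m f g)"
proof (rule wfib_coinduct[where P="%h. h \<in> mu_span m"])
 show "mu m f g \<in> mu_span m" using assms(2,3) by (rule mu_span.base)
 fix h assume h: "h \<in> mu_span m"
 show "insS u h \<in> mu_span m" for u
  using h by induction (simp_all add: insS_mu[OF m] insS_linear mu_span.intros wfib_insS)
 show "insA u h \<in> mu_span m" for u
  using h by induction (simp_all add: insA_mu[OF m] insA_linear mu_span.intros wfib_insA wfib_par)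
 show "linear (%u. insS u h ys vs)" for ys vs
  using h
 proof induction
  case (base f g)
  then show ?case
   unfolding insS_mu[OF m] by (intro linear_fib_ops linear_mu[OF m] wfib_linear_insS)
 next
  case (add h h') then show ?case unfolding insS_linear by (intro linear_fib_ops)
 qed
 show "linear (%u. insA u h ys vs)" for ys vs
  using h
 proof induction
  case (base f g)
  then show ?case
   unfolding insA_mu[OF m] by (intro linear_fib_ops linear_mu[OF m] wfib_linear_insA)
 next
  case (add h h') then show ?case unfolding insA_linear by (intro linear_fib_ops)
 qed
 show "insS u (insS w h) = insS w (insS u h)" for u w
  using h
 proof induction
  case (base f g)
  show ?case using wfib_insS_comm[OF base(1), of u w] wfib_insS_comm[OF base(2), of u w]
   by (simp add: insS_mu[OF m] insS_linear algebra_simps)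
 next
  case (add h h') then show ?case by (simp add: insS_linear)
 qed
 show "insA u (insA w h) = - insA w (insA u h)" for u w
  using h
 proof induction
  case (base f g)
  show ?case using wfib_insA_comm[OF base(1), of u w] wfib_insA_comm[OF base(2), of u w]
   by (simp add: insA_mu[OF m] insA_linear insA_par mu_linear[OF m] algebra_simps)
 next
  case (add h h') then show ?case by (simp add: insA_linear)
 qed
qed

lemma wfib_Bn:
 assumes m: "cbilin m" and "wfib f" "wfib g"
 shows "wfib (Bn L m n f g)"
 using assms(2,3)
proof (induction n arbitrary: f g)
 case 0 then show ?case by (simp add: wfib_mu[OF m])
next
 case (Suc n) then show ?case
  unfolding Bn.simps(2) by (intro wfib_smulC wfib_sum Suc.IH wfib_insS)
qed

subsection \<open>Change of frame\<close>

definition pull :: "(real ^ 'n => real ^ 'n) => ('n::finite, 'f) fib => ('n, 'f) fib"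
 where "pull T f = (%ys vs. f (map T ys) (map T vs))"

lemma pull_linear:
 "pull T (f + g) = pull T f + pull T (g::('n::finite, 'f::complex_fibre) fib)"
 "pull T (f - g) = pull T f - pull T g" "pull T (- f) = - pull T f"
 "pull T (0::('n::finite, 'f::complex_fibre) fib) = 0" "pull T (smulC c f) = smulC c (pull T f)"
 by (simp_all add: pull_def fun_eq_iff fun_ops smulC_def)

lemma pull_sum: "pull T (\<Sum>i\<in>I. f i :: ('n::finite, 'f::complex_fibre) fib) = (\<Sum>i\<in>I. pull T (f i))"
 by (rule additive_sum[where T="pull T"]) (simp_all add: pull_linear)

lemma insS_pull: "insS u (pull T f) = pull T (insS (T u) f)"
 by (simp add: insS_def pull_def)
lemma par_pull: "par (pull T f) = pull T (par f)"
 by (simp add: par_def pull_def)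

lemma pull_mu: "pull T (mu m f g) = mu m (pull T f) (pull T g)"
 by (simp add: pull_def mu_def nths_map fun_eq_iff)

lemma wfib_pull:
 assumes "wfib f" "linear T" shows "wfib (pull T f)"
proof -
 have l: "linear (%u. F (T u))" if "linear F" for F :: "_ => 'b"
  using linear_compose[OF assms(2) that] by (simp add: o_def)
 show ?thesis
  unfolding pull_def
  by (rule wfibI; unfold map_append list.map;
    rule l[OF wfibD(1)[OF assms(1)]] l[OF wfibD(2)[OF assms(1)]] wfibD(3)[OF assms(1)] wfibD(4)[OF assms(1)])
qed

lemma sum_swap4:
 "(\<Sum>k\<in>A. \<Sum>l\<in>B. \<Sum>i\<in>C. \<Sum>j\<in>D. F k l i j :: 'a::comm_monoid_add) = (\<Sum>i\<in>C. \<Sum>j\<in>D. \<Sum>k\<in>A. \<Sum>l\<in>B. F k l i j)"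
proof -
 have "(\<Sum>k\<in>A. \<Sum>l\<in>B. \<Sum>i\<in>C. \<Sum>j\<in>D. F k l i j) = (\<Sum>k\<in>A. \<Sum>i\<in>C. \<Sum>j\<in>D. \<Sum>l\<in>B. F k l i j)"
  by (intro sum.cong refl) (rule trans[OF sum.swap], intro sum.cong refl, rule sum.swap)
 also have "\<dots> = (\<Sum>i\<in>C. \<Sum>j\<in>D. \<Sum>k\<in>A. \<Sum>l\<in>B. F k l i j)"
  by (rule trans[OF sum.swap], intro sum.cong refl, rule sum.swap)
 finally show ?thesis .
qed

lemma insS_expand:
 assumes "wfib f"
 shows "insS u f = (\<Sum>i\<in>UNIV. smulC (of_real (u $ i)) (insS (axis i 1) f))"
 by (intro ext) (simp add: fun_ops smulC_def scaleC_of_real flip: linear_axis_expansion[OF wfib_linear_insS[OF assms]])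

lemma insA_expand:
 assumes "wfib f"
 shows "insA u f = (\<Sum>i\<in>UNIV. smulC (of_real (u $ i)) (insA (axis i 1) f))"
 by (intro ext) (simp add: fun_ops smulC_def scaleC_of_real flip: linear_axis_expansion[OF wfib_linear_insA[OF assms]])

text \<open>Naturality of the product: the hypothesis says that the bivector \<open>L\<close> is the
  push-forward of \<open>L'\<close> under \<open>T\<close>. Expanding the images of the basis
  vectors under \<open>T\<close> reassembles exactly the coefficients of \<open>L\<close>.\<close>

lemma pull_Bn:
 fixes f :: "('n::finite, 'f::complex_fibre) fib"
 assumes m: "cbilin m" and L: "!!i j. L i j = (\<Sum>k\<in>UNIV. \<Sum>l\<in>UNIV. L' k l * (T (axis k 1) $ i) * (T (axis l 1) $ j))"
  and "wfib f" "wfib g"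
 shows "pull T (Bn L m n f g) = Bn L' m n (pull T f) (pull T g)"
 using assms(3,4)
proof (induction n arbitrary: f g)
 case 0 then show ?case by (simp add: pull_mu)
next
 case (Suc n)
 let ?e = "%i. axis i 1 :: real^'n"
 have 1: "Psum L' (%u w. Bn L' m n (insS u (pull T f)) (insS w (pull T g))) = Psum L (%u w. pull T (Bn L m n (insS u f) (insS w g)))"
 proof -
  let ?F = "%i j. pull T (Bn L m n (insS (?e i) f) (insS (?e j) g))"
  have "Bn L' m n (insS u (pull T f)) (insS w (pull T g)) = (\<Sum>i\<in>UNIV. \<Sum>j\<in>UNIV. smulC (of_real (T u $ i * T w $ j)) (?F i j))" for u w
  proof -
   have "Bn L' m n (insS u (pull T f)) (insS w (pull T g)) = pull T (Bn L m n (insS (T u) f) (insS (T w) g))"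
    using Suc by (simp add: insS_pull wfib_insS)
   also have "\<dots> = (\<Sum>i\<in>UNIV. \<Sum>j\<in>UNIV. smulC (of_real (T u $ i * T w $ j)) (?F i j))"
    unfolding insS_expand[OF Suc.prems(1), of "T u"] insS_expand[OF Suc.prems(2), of "T w"]
    by (simp add: Bn_sum[OF m] Bn_linear[OF m] pull_sum pull_linear smulC_sum_right)
     (subst sum.swap, simp add: mult.commute)
   finally show ?thesis .
  qed
  then have "Psum L' (%u w. Bn L' m n (insS u (pull T f)) (insS w (pull T g))) =
   (\<Sum>k\<in>UNIV. \<Sum>l\<in>UNIV. \<Sum>i\<in>UNIV. \<Sum>j\<in>UNIV. smulC (of_real (L' k l * (T (?e k) $ i) * (T (?e l) $ j))) (?F i j))"
   by (simp add: Psum_def smulC_sum_right mult.assoc)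
  also have "\<dots> = (\<Sum>i\<in>UNIV. \<Sum>j\<in>UNIV. \<Sum>k\<in>UNIV. \<Sum>l\<in>UNIV. smulC (of_real (L' k l * (T (?e k) $ i) * (T (?e l) $ j))) (?F i j))"
   by (rule sum_swap4)
  also have "\<dots> = (\<Sum>i\<in>UNIV. \<Sum>j\<in>UNIV. smulC (of_real (L i j)) (?F i j))"
   by (simp add: L smulC_sum_left)
  finally show ?thesis by (simp add: Psum_def)
 qed
 have "pull T (Bn L m (Suc n) f g) = smulC (1 / of_nat (Suc n)) (Psum L (%u w. pull T (Bn L m n (insS u f) (insS w g))))"
  unfolding Bn_Suc_Psum pull_linear by (simp only: Psum_def pull_sum pull_linear)
 then show ?case unfolding Bn_Suc_Psum 1 .
qed

text \<open>The alternation of a linear family without any reference to a basis. It is compatible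
  with \<open>pull\<close> for arbitrary \<open>T\<close>, whereas the sum over \<open>dxA i\<close>
  is tied to the standard basis.\<close>

definition antiD :: "(real ^ 'n => ('n::finite, 'f::complex_fibre) fib) => ('n, 'f) fib"
 where "antiD h = (%ys vs. \<Sum>j<length vs. (- 1) ^ j *\<^sub>R h (vs ! j) ys (del j vs))"

lemma sum_dxA_antiD:
 assumes "!!ys vs. linear (%u. h u ys vs)"
 shows "(\<Sum>i\<in>UNIV. dxA i (h (axis i 1))) = antiD h"
proof (intro ext)
 fix ys vs
 have "(\<Sum>i\<in>UNIV. dxA i (h (axis i 1))) ys vs = (\<Sum>j<length vs. \<Sum>i\<in>UNIV. ((- 1) ^ j * (vs ! j) $ i) *\<^sub>R h (axis i 1) ys (del j vs))"
  by (simp add: fun_ops dxA_def) (rule sum.swap)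
 also have "\<dots> = (\<Sum>j<length vs. (- 1) ^ j *\<^sub>R h (vs ! j) ys (del j vs))"
  by (simp add: linear_axis_expansion[OF assms, of "vs ! _"] scaleR_sum_right)
 finally show "(\<Sum>i\<in>UNIV. dxA i (h (axis i 1))) ys vs = antiD h ys vs" by (simp add: antiD_def)
qed

lemma map_del: "map T (del j xs) = del j (map T xs)"
 by (simp add: del_def take_map drop_map)

lemma pull_antiD: "pull T (antiD h) = antiD (%u. pull T (h (T u)))"
 by (simp add: antiD_def pull_def map_del fun_eq_iff)

lemma fdelta_antiD: "wfib f ==> fdelta f = antiD (%u. insS u f)"
 unfolding fdelta_def by (rule sum_dxA_antiD[OF wfib_linear_insS])

lemma pull_fdelta:
 assumes "wfib f" "linear T"
 shows "pull T (fdelta f) = fdelta (pull T f)"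
 using assms by (simp add: fdelta_antiD wfib_pull pull_antiD insS_pull)

subsection \<open>The Hodge type decomposition\<close>

definition fdstar :: "('n, 'f::complex_fibre) fib => ('n::finite, 'f) fib"
 where "fdstar f = (\<Sum>i\<in>UNIV. dxS i (insA (axis i 1) f))"

definition numS :: "('n, 'f::complex_fibre) fib => ('n::finite, 'f) fib"
 where "numS f = (%ys vs. real (length ys) *\<^sub>R f ys vs)"

definition numA :: "('n, 'f::complex_fibre) fib => ('n::finite, 'f) fib"
 where "numA f = (%ys vs. real (length vs) *\<^sub>R f ys vs)"

text \<open>Contraction with the first argument returns one copy of \<open>f\<close> plus the same
  sum for the contracted element, so every argument contributes one.\<close>

lemma numA_euler:
 assumes "wfib f"
 shows "(\<Sum>i\<in>UNIV. dxA i (insA (axis i 1) f)) = numA f"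
proof (intro ext)
 fix ys vs show "(\<Sum>i\<in>UNIV. dxA i (insA (axis i 1) f)) ys vs = numA f ys vs"
  using assms
 proof (induction vs arbitrary: f)
  case Nil then show ?case by (simp add: fun_ops numA_def)
 next
  case (Cons v vs)
  have c: "dxA i (insA v (insA (axis i 1) f)) = - dxA i (insA (axis i 1) (insA v f))" for i
   by (subst wfib_insA_comm[OF Cons.prems]) (simp only: dxA_linear)
  have "insA v (\<Sum>i\<in>UNIV. dxA i (insA (axis i 1) f)) = insA v f + (\<Sum>i\<in>UNIV. dxA i (insA (axis i 1) (insA v f)))"
   by (simp only: insA_sum insA_dxA insA_expand[OF Cons.prems, of v, symmetric] c diff_minus_eq_add sum.distrib)
  then have "insA v (\<Sum>i\<in>UNIV. dxA i (insA (axis i 1) f)) ys vs = insA v f ys vs + numA (insA v f) ys vs"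
   by (simp only: plus_fun_apply Cons.IH[OF wfib_insA[OF Cons.prems, of v]])
  then show ?case by (simp add: insA_def numA_def scaleR_left_distrib)
 qed
qed

lemma numS_euler:
 assumes "wfib f"
 shows "(\<Sum>i\<in>UNIV. dxS i (insS (axis i 1) f)) = numS f"
proof (intro ext)
 fix ys vs show "(\<Sum>i\<in>UNIV. dxS i (insS (axis i 1) f)) ys vs = numS f ys vs"
  using assms
 proof (induction ys arbitrary: f)
  case Nil then show ?case by (simp add: fun_ops numS_def)
 next
  case (Cons v ys)
  have "insS v (\<Sum>i\<in>UNIV. dxS i (insS (axis i 1) f)) = insS v f + (\<Sum>i\<in>UNIV. dxS i (insS (axis i 1) (insS v f)))"
   by (simp only: insS_sum insS_dxS sum.distrib insS_expand[OF Cons.prems, of v, symmetric] wfib_insS_comm[OF Cons.prems, of v])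
  then have "insS v (\<Sum>i\<in>UNIV. dxS i (insS (axis i 1) f)) ys vs = insS v f ys vs + numS (insS v f) ys vs"
   by (simp only: plus_fun_apply Cons.IH[OF wfib_insS[OF Cons.prems, of v]])
  then show ?case by (simp add: insS_def numS_def scaleR_left_distrib)
 qed
qed

lemma hodge:
 assumes "wfib f"
 shows "fdelta (fdstar f) + fdstar (fdelta f) = numS f + numA f"
proof -
 \<comment> \<open>The mixed terms of the anticommutator. They occur with opposite signs in the two
   orders of composition, leaving only the two number operators.\<close>
 let ?X = "\<Sum>i\<in>UNIV. \<Sum>j\<in>UNIV. dxA i (dxS j (insS (axis i 1) (insA (axis j 1) f)))"
 have 1: "fdelta (fdstar f) = (\<Sum>i\<in>UNIV. dxA i (insA (axis i 1) f)) + ?X"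
 proof -
  have "insS (axis i 1) (fdstar f) = insA (axis i 1) f + (\<Sum>j\<in>UNIV. dxS j (insS (axis i 1) (insA (axis j 1) f)))" for i
   by (simp only: fdstar_def insS_sum insS_dxS sum.distrib insA_expand[OF assms, of "axis i 1", symmetric])
  then show ?thesis
   by (simp add: fdelta_def dxA_linear dxA_sum sum.distrib)
 qed
 have 2: "fdstar (fdelta f) = (\<Sum>i\<in>UNIV. dxS i (insS (axis i 1) f)) - ?X"
 proof -
  have "insA (axis i 1) (fdelta f) = insS (axis i 1) f - (\<Sum>j\<in>UNIV. dxA j (insA (axis i 1) (insS (axis j 1) f)))" for i
   by (simp only: fdelta_def insA_sum insA_dxA sum_subtractf insS_expand[OF assms, of "axis i 1", symmetric])
  then have "fdstar (fdelta f) = (\<Sum>i\<in>UNIV. dxS i (insS (axis i 1) f)) - (\<Sum>i\<in>UNIV. \<Sum>j\<in>UNIV. dxS i (dxA j (insA (axis i 1) (insS (axis j 1) f))))"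
   by (simp add: fdstar_def dxS_linear dxS_sum sum_subtractf)
  also have "(\<Sum>i\<in>UNIV. \<Sum>j\<in>UNIV. dxS i (dxA j (insA (axis i 1) (insS (axis j 1) f)))) = ?X"
   by (subst sum.swap) (simp add: insS_insA dxA_dxS)
  finally show ?thesis .
 qed
 show ?thesis unfolding 1 2 numA_euler[OF assms] numS_euler[OF assms] by simp
qed

section \<open>Calculus in charts\<close>

text \<open>In contrast to \<open>tangent_deriv\<close> the chart is fixed and \<open>v\<close>
  denotes components in it, so the result can be differentiated again as a function of the
  point.\<close>

definition chd :: "('m, 'n::finite) chart => ('m => 'b::real_normed_vector) => 'm => real ^ 'n => 'b"
 where "chd c f q v = frechet_derivative (f \<circ> chart_inv c) (at (snd c q)) v"

lemma tangent_deriv_chd: "tangent_deriv A p v f = chd (chart_at A p) f p v"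
 by (simp add: tangent_deriv_def chd_def)
lemma coord_field_chd: "coord_field A c v q = chd c (snd (chart_at A q)) q v"
 by (simp add: coord_field_def chd_def)
lemma chart_comp_chd: "chart_comp A c p v = chd (chart_at A p) (snd c) p v"
 by (simp add: chart_comp_def tangent_deriv_chd)

locale manifold =
 fixes A :: "('m::{second_countable_topology, t2_space}, 'n::finite) chart set"
 assumes smooth_manifold: "smooth_manifold A"
begin

lemma chart_homeo: "c \<in> A ==> homeomorphism (fst c) (snd c ` fst c) (snd c) (chart_inv c)"
 using smooth_manifold unfolding smooth_manifold_def by blast

lemma open_chart: "c \<in> A ==> open (fst c)" "c \<in> A ==> open (snd c ` fst c)"
 using smooth_manifold unfolding smooth_manifold_def by blast+

lemma chart_inv_left: "c \<in> A ==> q \<in> fst c ==> chart_inv c (snd c q) = q"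
 using chart_homeo unfolding homeomorphism_def by blast

lemma chart_at: "chart_at A p \<in> A" "p \<in> fst (chart_at A p)"
proof -
 have "\<exists>c. c \<in> A \<and> p \<in> fst c"
  using smooth_manifold unfolding smooth_manifold_def by blast
 from someI_ex[OF this] show "chart_at A p \<in> A" "p \<in> fst (chart_at A p)"
  unfolding chart_at_def by auto
qed

lemma open_chart_image:
 assumes "c \<in> A" "open U" shows "open (snd c ` (U \<inter> fst c))"
proof -
 have "openin (top_of_set (fst c)) (fst c \<inter> U)" using assms(2) by (rule openin_open_Int)
 then have "openin (top_of_set (snd c ` fst c)) (snd c ` (fst c \<inter> U))"
  using homeomorphism_imp_open_map[OF chart_homeo[OF assms(1)]] by blast
 then show ?thesis
  using openin_open_eq[OF open_chart(2)[OF assms(1)]] by (simp add: Int_commute)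
qed

lemma transition_smooth: "c \<in> A ==> d \<in> A ==> smooth_on (snd c ` (fst c \<inter> fst d)) (snd d \<circ> chart_inv c)"
 using smooth_manifold unfolding smooth_manifold_def by blast

lemma smooth_funD: "smooth_fun A U f ==> c \<in> A ==> smooth_on (snd c ` (U \<inter> fst c)) (f \<circ> chart_inv c)"
 unfolding smooth_fun_def by blast

lemma smooth_fun_subset: "smooth_fun A U f ==> V \<subseteq> U ==> smooth_fun A V f"
 unfolding smooth_fun_def by (meson Int_mono image_mono order_refl smooth_on_subset)

lemma smooth_fun_cong:
 assumes "open U" "!!q. q \<in> U ==> f q = g q" "smooth_fun A U f"
 shows "smooth_fun A U g"
 unfolding smooth_fun_def
proof
 fix c assume c: "c \<in> A"
 show "smooth_on (snd c ` (U \<inter> fst c)) (g \<circ> chart_inv c)"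
  by (rule smooth_on_cong[OF open_chart_image[OF c assms(1)] _ smooth_funD[OF assms(3) c]])
   (auto simp: chart_inv_left[OF c] assms(2))
qed

lemma smooth_fun_const: "open U ==> smooth_fun A U (%q. k)"
 unfolding smooth_fun_def o_def by (intro ballI smooth_on_const open_chart_image)

lemma smooth_fun_linear: "open U ==> bounded_linear L ==> smooth_fun A U f ==> smooth_fun A U (%q. L (f q))"
 unfolding smooth_fun_def o_def by (intro ballI smooth_on_bounded_linear[of _ L] open_chart_image) auto

lemma smooth_fun_add: "open U ==> smooth_fun A U f ==> smooth_fun A U g ==> smooth_fun A U (%q. f q + g q)"
 unfolding smooth_fun_def o_def by (intro ballI smooth_on_add open_chart_image) auto

lemma smooth_fun_bilinear:
 "open U ==> bounded_bilinear h ==> smooth_fun A U f ==> smooth_fun A U g ==> smooth_fun A U (%q. h (f q) (g q))"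
 unfolding smooth_fun_def o_def by (intro ballI smooth_on_bilinear[of _ h] open_chart_image) auto

lemma smooth_fun_sum: "open U ==> (!!i. i \<in> I ==> smooth_fun A U (f i)) ==> smooth_fun A U (%q. \<Sum>i\<in>I. f i q)"
 unfolding smooth_fun_def o_def by (intro ballI smooth_on_sum open_chart_image) auto

lemma smooth_fun_vec:
 fixes f :: "'m => 'b::euclidean_space ^ 'k::finite"
 shows "open U ==> (!!i. smooth_fun A U (%q. f q $ i)) ==> smooth_fun A U f"
 unfolding smooth_fun_def o_def by (intro ballI smooth_on_vec open_chart_image) auto

lemma smooth_fun_nth: "open U ==> smooth_fun A U f ==> smooth_fun A U (%q. f q $ i)"
 by (rule smooth_fun_linear[OF _ bounded_linear_vec_nth])

lemma smooth_fun_matrix_inv: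
 fixes W :: "'m => real ^ 'k::finite ^ 'k"
 assumes "open U" "!!i j. smooth_fun A U (%q. W q $ i $ j)" "!!q. q \<in> U ==> invertible (W q)"
 shows "smooth_fun A U (%q. matrix_inv (W q) $ k $ l)"
 unfolding smooth_fun_def o_def
proof
 fix c assume c: "c \<in> A"
 show "smooth_on (snd c ` (U \<inter> fst c)) (%x. matrix_inv (W (chart_inv c x)) $ k $ l)"
  using assms(2)[THEN smooth_funD, OF c] assms(3)
  by (intro smooth_on_matrix_inv open_chart_image[OF c assms(1)]) (auto simp: o_def chart_inv_left[OF c])
qed

text \<open>Smoothness in a single chart that covers \<open>U\<close> suffices, since the transition
  maps carry it to every other chart.\<close>

lemma smooth_fun_chartI:
 assumes c: "c \<in> A" and U: "open U" "U \<subseteq> fst c" and f: "smooth_on (snd c ` U) (f \<circ> chart_inv c)"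
 shows "smooth_fun A U f"
 unfolding smooth_fun_def
proof
 fix d assume d: "d \<in> A"
 have 1: "smooth_on (snd d ` (U \<inter> fst d)) (snd c \<circ> chart_inv d)"
  by (rule smooth_on_subset[OF transition_smooth[OF d c]]) (use U in auto)
 have o: "open (snd d ` (U \<inter> fst d))" by (rule open_chart_image[OF d U(1)])
 have o2: "open (snd c ` U)" using open_chart_image[OF c U(1)] U(2) by (simp add: Int_absorb2)
 have "smooth_on (snd d ` (U \<inter> fst d)) (%x. (f \<circ> chart_inv c) ((snd c \<circ> chart_inv d) x))"
  by (rule smooth_on_compose[OF o o2 _ 1 f]) (auto simp: chart_inv_left[OF d])
 then show "smooth_on (snd d ` (U \<inter> fst d)) (f \<circ> chart_inv d)"
  by (rule smooth_on_cong[OF o, rotated]) (use U in \<open>auto simp: chart_inv_left[OF d] chart_inv_left[OF c]\<close>)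
qed

lemma smooth_fun_chart: "c \<in> A ==> smooth_fun A (fst c) (snd c)"
proof (rule smooth_fun_chartI)
 assume c: "c \<in> A"
 show "smooth_on (snd c ` fst c) (snd c \<circ> chart_inv c)"
  by (rule smooth_on_cong[OF open_chart(2)[OF c] _ smooth_on_ident[OF open_chart(2)[OF c]]])
   (auto simp: chart_inv_left[OF c])
qed (auto simp: open_chart)

lemma has_chd:
 assumes "smooth_fun A U f" "open U" "q \<in> U" "c \<in> A" "q \<in> fst c"
 shows "((f \<circ> chart_inv c) has_derivative chd c f q) (at (snd c q))"
proof -
 have "snd c q \<in> snd c ` (U \<inter> fst c)" using assms by auto
 from smooth_on_has_derivative[OF smooth_funD[OF assms(1,4)] this]
 show ?thesis unfolding chd_def .
qed

lemma chd_linear: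
 assumes "smooth_fun A U f" "open U" "q \<in> U" "c \<in> A" "q \<in> fst c"
 shows "linear (chd c f q)"
 using has_chd[OF assms] has_derivative_linear by blast

lemma chdI:
 assumes "((f \<circ> chart_inv c) has_derivative D) (at (snd c q))"
 shows "chd c f q v = D v"
 unfolding chd_def using frechet_derivative_at[OF assms] by simp

text \<open>Both functions have the same candidates for a derivative, so the choice inside
  \<open>frechet_derivative\<close> gives the same value, differentiable or not.\<close>

lemma chd_cong:
 assumes "open U" "q \<in> U" "c \<in> A" "q \<in> fst c" "!!p. p \<in> U ==> f p = g p"
 shows "chd c f q = chd c g q"
proof -
 let ?S = "snd c ` (U \<inter> fst c)"
 have S: "open ?S" "snd c q \<in> ?S" using open_chart_image[OF assms(3,1)] assms by auto
 have e: "(f \<circ> chart_inv c) x = (g \<circ> chart_inv c) x" if "x \<in> ?S" for x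
  using that assms(5) by (auto simp: chart_inv_left[OF assms(3)])
 have "((f \<circ> chart_inv c) has_derivative D) (at (snd c q)) \<longleftrightarrow> ((g \<circ> chart_inv c) has_derivative D) (at (snd c q))" for D
  using has_derivative_transform_within_open[OF _ S, of "f \<circ> chart_inv c" D UNIV "g \<circ> chart_inv c"]
   has_derivative_transform_within_open[OF _ S, of "g \<circ> chart_inv c" D UNIV "f \<circ> chart_inv c"] e
  by auto
 then have "frechet_derivative (f \<circ> chart_inv c) (at (snd c q)) = frechet_derivative (g \<circ> chart_inv c) (at (snd c q))"
  unfolding frechet_derivative_def by simp
 then show ?thesis by (simp add: chd_def fun_eq_iff)
qed

lemma chd_const: "chd c (%q. k) q v = 0"
 by (rule chdI) (simp add: o_def)

lemma chd_add:
 assumes "smooth_fun A U f" "smooth_fun A U g" "open U" "q \<in> U" "c \<in> A" "q \<in> fst c"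
 shows "chd c (%q. f q + g q) q v = chd c f q v + chd c g q v"
 using has_derivative_add[OF has_chd[OF assms(1,3-)] has_chd[OF assms(2-)]]
 by (intro chdI) (simp add: o_def)

lemma chd_bounded_linear:
 assumes "bounded_linear L" "smooth_fun A U f" "open U" "q \<in> U" "c \<in> A" "q \<in> fst c"
 shows "chd c (%q. L (f q)) q v = L (chd c f q v)"
 using bounded_linear.has_derivative[OF assms(1) has_chd[OF assms(2-)]]
 by (intro chdI) (simp add: o_def)

lemma chd_bilinear:
 assumes "bounded_bilinear h" "smooth_fun A U f" "smooth_fun A U g" "open U" "q \<in> U" "c \<in> A" "q \<in> fst c"
 shows "chd c (%q. h (f q) (g q)) q v = h (f q) (chd c g q v) + h (chd c f q v) (g q)"
 using bounded_bilinear.FDERIV[OF assms(1) has_chd[OF assms(2,4-)] has_chd[OF assms(3-)]] assms(6,7)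
 by (intro chdI) (simp add: o_def chart_inv_left)

lemma chd_chain:
 assumes "smooth_fun A U f" "open U" "q \<in> U" "c \<in> A" "q \<in> fst c" "d \<in> A" "q \<in> fst d"
 shows "chd c f q v = chd d f q (chd c (snd d) q v)"
proof (rule chdI)
 let ?S = "snd c ` (fst d \<inter> fst c)"
 have S: "open ?S" "snd c q \<in> ?S" using open_chart_image[OF assms(4) open_chart(1)[OF assms(6)]] assms by auto
 have 1: "((snd d \<circ> chart_inv c) has_derivative chd c (snd d) q) (at (snd c q))"
  by (rule has_chd[OF smooth_fun_chart[OF assms(6)] open_chart(1)[OF assms(6)] assms(7,4,5)])
 have 2: "((f \<circ> chart_inv d) has_derivative chd d f q) (at ((snd d \<circ> chart_inv c) (snd c q)))"
  using has_chd[OF assms(1-3,6,7)] by (simp add: chart_inv_left[OF assms(4,5)])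
 show "((f \<circ> chart_inv c) has_derivative (%v. chd d f q (chd c (snd d) q v))) (at (snd c q))"
  by (rule has_derivative_transform_within_open[OF has_derivative_compose[OF 1 2] S])
   (auto simp: chart_inv_left[OF assms(4)] chart_inv_left[OF assms(6)])
qed

lemma chd_self: "c \<in> A ==> q \<in> fst c ==> chd c (snd c) q v = v"
proof (rule chdI)
 assume c: "c \<in> A" "q \<in> fst c"
 show "((snd c \<circ> chart_inv c) has_derivative (%v. v)) (at (snd c q))"
  by (rule has_derivative_transform_within_open[OF has_derivative_ident open_chart(2)[OF c(1)]])
   (use c in \<open>auto simp: chart_inv_left\<close>)
qed

lemma smooth_fun_chd:
 assumes "c \<in> A" "open U" "U \<subseteq> fst c" "smooth_fun A U f"
 shows "smooth_fun A U (%q. chd c f q v)"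
proof (rule smooth_fun_chartI[OF assms(1-3)])
 have o: "open (snd c ` U)" using open_chart_image[OF assms(1,2)] assms(3) by (simp add: Int_absorb2)
 have "smooth_on (snd c ` U) (f \<circ> chart_inv c)" using smooth_funD[OF assms(4,1)] assms(3) by (simp add: Int_absorb2)
 from smooth_on_frechet[OF this]
 show "smooth_on (snd c ` U) ((%q. chd c f q v) \<circ> chart_inv c)"
  by (rule smooth_on_cong[OF o, rotated])
   (use assms(3) in \<open>auto simp: chart_inv_left[OF assms(1)] chd_def\<close>)
qed

lemma chd_commute:
 fixes f :: "'m => 'b::euclidean_space"
 assumes "c \<in> A" "open U" "q \<in> U" "q \<in> fst c" "smooth_fun A U f"
 shows "chd c (%q. chd c f q u) q v = chd c (%q. chd c f q v) q u"
proof -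
 let ?S = "snd c ` (U \<inter> fst c)"
 have S: "open ?S" "snd c q \<in> ?S" using open_chart_image[OF assms(1,2)] assms by auto
 let ?g = "f \<circ> chart_inv c"
 have g: "smooth_on ?S ?g" by (rule smooth_funD[OF assms(5,1)])
 have 1: "chd c (%q. chd c f q u) q v = frechet_derivative (%y. frechet_derivative ?g (at y) u) (at (snd c q)) v" for u v
 proof (rule chdI)
  show "((%q. chd c f q u) \<circ> chart_inv c has_derivative frechet_derivative (%y. frechet_derivative ?g (at y) u) (at (snd c q))) (at (snd c q))"
   by (rule has_derivative_transform_within_open[OF smooth_on_has_derivative[OF smooth_on_frechet[OF g] S(2)] S])
    (auto simp: chart_inv_left[OF assms(1)] chd_def)
 qed
 show ?thesis unfolding 1 by (rule schwarz[OF S(1) g S(2)])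
qed

subsection \<open>Coordinate vector fields\<close>

lemma chart_comp_coord_field:
 assumes "c \<in> A" "d \<in> A" "q \<in> fst c" "q \<in> fst d"
 shows "chart_comp A d q (coord_field A c v q) = chd c (snd d) q v"
 unfolding chart_comp_chd coord_field_chd
 by (rule chd_chain[symmetric, OF smooth_fun_chart[OF assms(2)] open_chart(1)[OF assms(2)] assms(4,1,3) chart_at])

lemma chart_comp_coord_field_same: "c \<in> A ==> q \<in> fst c ==> chart_comp A c q (coord_field A c v q) = v"
 by (simp add: chart_comp_coord_field chd_self)

lemma coord_field_chart_comp: "c \<in> A ==> q \<in> fst c ==> coord_field A c (chart_comp A c q v) q = v"
 unfolding chart_comp_chd coord_field_chd
 using chd_chain[OF smooth_fun_chart[OF chart_at(1)] open_chart(1)[OF chart_at(1)] chart_at(2) chart_at(1,2), of c q v]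
 by (simp add: chd_self chart_at)

lemma coord_field_at [simp]: "coord_field A (chart_at A p) v p = v"
 by (simp add: coord_field_chd chd_self chart_at)

lemma linear_coord_field: "c \<in> A ==> q \<in> fst c ==> linear (%v. coord_field A c v q)"
 unfolding coord_field_chd
 by (rule chd_linear[OF smooth_fun_chart open_chart(1)]) (auto simp: chart_at)

lemma linear_chart_comp: "c \<in> A ==> q \<in> fst c ==> linear (chart_comp A c q)"
 unfolding chart_comp_chd[abs_def]
 by (rule chd_linear[OF smooth_fun_chart open_chart(1)]) (auto simp: chart_at)

lemma tangent_deriv_coord_field:
 assumes "smooth_fun A U f" "open U" "q \<in> U" "c \<in> A" "q \<in> fst c"
 shows "tangent_deriv A q (coord_field A c v q) f = chd c f q v"
 unfolding tangent_deriv_chd coord_field_chd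
 by (rule chd_chain[symmetric, OF assms chart_at])

lemma smooth_vfD:
 assumes "smooth_vf A U X" "c \<in> A" shows "smooth_fun A (U \<inter> fst c) (%q. chart_comp A c q (X q))"
 using assms unfolding smooth_vf_def by blast

lemma smooth_vf_coord:
 assumes c: "c \<in> A" and U: "open U" "U \<subseteq> fst c" and g: "smooth_fun A U g"
 shows "smooth_vf A U (%q. coord_field A c (g q) q)"
 unfolding smooth_vf_def
proof
 fix d assume d: "d \<in> A"
 let ?V = "U \<inter> fst d"
 have V: "open ?V" "?V \<subseteq> fst c" using U open_chart(1)[OF d] by auto
 have sd: "smooth_fun A ?V (snd d)" by (rule smooth_fun_subset[OF smooth_fun_chart[OF d]]) auto
 have "smooth_fun A ?V (%q. \<Sum>i\<in>UNIV. (g q $ i) *\<^sub>R chd c (snd d) q (axis i 1))"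
  by (intro smooth_fun_sum smooth_fun_bilinear[OF V(1) bounded_bilinear_scaleR] smooth_fun_nth V(1)
    smooth_fun_subset[OF g] smooth_fun_chd[OF c V sd]) auto
 then show "smooth_fun A ?V (%q. chart_comp A d q (coord_field A c (g q) q))"
 proof (rule smooth_fun_cong[OF V(1), rotated])
  fix q assume q: "q \<in> ?V"
  have "linear (chd c (snd d) q)"
   by (rule chd_linear[OF sd V(1) q c]) (use q V in auto)
  from linear_axis_expansion[OF this, of "g q"]
  show "(\<Sum>i\<in>UNIV. (g q $ i) *\<^sub>R chd c (snd d) q (axis i 1)) = chart_comp A d q (coord_field A c (g q) q)"
   using q U by (subst chart_comp_coord_field[OF c d]) auto
 qed
qed

text \<open>Expressed in the chart chosen at \<open>q\<close>, the two terms of the bracket are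
  mixed second derivatives of the same transition map and agree by Schwarz' theorem.\<close>

lemma lie_bracket_coord:
 assumes c: "c \<in> A" and q: "q \<in> fst c"
 shows "lie_bracket A (coord_field A c u) (coord_field A c w) q = 0"
proof -
 let ?d = "chart_at A q"
 let ?U = "fst c \<inter> fst ?d"
 have U: "open ?U" "?U \<subseteq> fst c" "q \<in> ?U" using open_chart(1)[OF c] open_chart(1)[OF chart_at(1)] q chart_at by auto
 have sd: "smooth_fun A ?U (snd ?d)" by (rule smooth_fun_subset[OF smooth_fun_chart[OF chart_at(1)]]) auto
 have "tangent_deriv A q (coord_field A c u q) (%p. chart_comp A ?d p (coord_field A c w p)) = chd c (%p. chd c (snd ?d) p w) q u" for u w
 proof -
  have e: "chart_comp A ?d p (coord_field A c w p) = chd c (snd ?d) p w" if "p \<in> ?U" for p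
   using that by (intro chart_comp_coord_field c chart_at) auto
  have "tangent_deriv A q (coord_field A c u q) (%p. chart_comp A ?d p (coord_field A c w p))
   = tangent_deriv A q (coord_field A c u q) (%p. chd c (snd ?d) p w)"
   unfolding tangent_deriv_chd by (subst chd_cong[OF U(1,3) chart_at e]) auto
  also have "\<dots> = chd c (%p. chd c (snd ?d) p w) q u"
   by (rule tangent_deriv_coord_field[OF smooth_fun_chd[OF c U(1,2) sd] U(1,3) c q])
  finally show ?thesis .
 qed
 then show ?thesis
  unfolding lie_bracket_def using chd_commute[OF c U(1,3) q sd, of u w] by simp
qed

end

section \<open>The algebra of formal forms\<close>

lemma delta_fib: "delta \<Phi> k p = fdelta (\<Phi> k p)"
 by (simp add: delta_def fdelta_def fun_ops dx_a_def dxA_def ins_s_def insS_def fun_eq_iff)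

lemma delta_star_fib: "delta_star \<Phi> k p = fdstar (\<Phi> k p)"
 by (simp add: delta_star_def fdstar_def fun_ops dx_s_def dxS_def ins_a_def insA_def fun_eq_iff)

lemma delta_inv_fib: "delta_inv \<Phi> k p ys vs = (1 / real (length ys + length vs)) *\<^sub>R fdstar (\<Phi> k p) ys vs"
 by (simp add: delta_inv_def delta_star_fib)

lemma parity_fib: "parity \<Phi> k p = par (\<Phi> k p)"
 by (simp add: parity_def par_def)

lemma cscale_fib: "cscale c \<Phi> k p = smulC c (\<Phi> k p)"
 by (simp add: cscale_def smulC_def)

lemma wform_ops: "(\<Phi> + \<Psi>) k p = \<Phi> k p + \<Psi> k p" "(\<Phi> - \<Psi>) k p = \<Phi> k p - \<Psi> k p"
  "(- \<Phi>) k p = - \<Phi> k p" "(0 :: ('m, 'n, 'f::ab_group_add) wform) k p = 0"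
 by (simp_all add: fun_ops)

lemma form_degree_fdeg: "form_degree d \<Phi> \<longleftrightarrow> (\<forall>k p. fdeg d (\<Phi> k p))"
 by (simp add: form_degree_def fdeg_def)

lemma fdelta_linear:
 "fdelta (f + g) = fdelta f + fdelta g" "fdelta (f - g) = fdelta f - fdelta g" "fdelta (- f) = - fdelta f"
 "fdelta 0 = 0" "fdelta (smulC c f) = smulC c (fdelta f)"
 by (simp_all add: fdelta_def insS_linear dxA_linear sum.distrib sum_subtractf sum_negf smulC_sum_right)

lemma fdelta_sum: "fdelta (\<Sum>i\<in>I. f i) = (\<Sum>i\<in>I. fdelta (f i))"
 by (rule additive_sum[where T=fdelta]) (simp_all add: fdelta_linear)

lemma fdstar_linear:
 "fdstar (f + g) = fdstar f + fdstar g" "fdstar (f - g) = fdstar f - fdstar g" "fdstar (- f) = - fdstar f"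
 "fdstar 0 = 0" "fdstar (smulC c f) = smulC c (fdstar f)"
 by (simp_all add: fdstar_def insA_linear dxS_linear sum.distrib sum_subtractf sum_negf smulC_sum_right)

lemma par_fdelta: "par (fdelta f) = - fdelta (par f)"
 by (simp add: fdelta_def par_sum par_dxA insS_par sum_negf)

text \<open>A lower bound on the powers of lambda. It makes the index set in \<open>wprod\<close>
  finite; over an infinite set the sum would take the default value 0 and linearity could
  fail.\<close>

definition lb :: "int => ('m, 'n, 'f::zero) wform => bool"
 where "lb N \<Phi> \<longleftrightarrow> (\<forall>k<N. \<Phi> k = 0)"

lemma lbD: "lb N \<Phi> ==> k < N ==> \<Phi> k = 0"
 by (simp add: lb_def)

lemma lb_mono: "lb N \<Phi> ==> M \<le> N ==> lb M \<Phi>"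
 by (simp add: lb_def)

lemma lb_fibI: "(!!k p. k < N ==> \<Phi> k p = 0) ==> lb N \<Phi>"
 by (simp add: lb_def fun_eq_iff fun_ops)

lemma lbD_fib: "lb N \<Phi> ==> k < N ==> \<Phi> k p = 0"
 by (simp add: lb_def fun_ops)

lemma lb_ops:
 fixes \<Phi> \<Psi> :: "('m, 'n::finite, 'f::complex_fibre) wform"
 shows "lb N \<Phi> ==> lb N \<Psi> ==> lb N (\<Phi> + \<Psi>)" "lb N \<Phi> ==> lb N \<Psi> ==> lb N (\<Phi> - \<Psi>)"
  "lb N \<Phi> ==> lb N (- \<Phi>)" "lb N (0 :: ('m, 'n, 'f) wform)" "lb N \<Phi> ==> lb N (cscale c \<Phi>)" "lb N \<Phi> ==> lb N (delta \<Phi>)"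
  "lb N \<Phi> ==> lb N (parity \<Phi>)" "lb N \<Phi> ==> lb (N + n) (lambda_shift n \<Phi>)"
 by (auto intro!: lb_fibI simp: wform_ops lbD_fib cscale_fib delta_fib parity_fib fdelta_linear par_linear)
  (auto simp: lambda_shift_def lbD_fib)

text \<open>The inner sums of \<open>wprod\<close> at order \<open>n\<close>, over lists of index
  pairs and without the factor 1 / n!. Splitting off the head of the list leads to the recursion of
  \<open>Bn\<close>.\<close>

definition zterm :: "('n::finite => 'n => real) => ('f::complex_fibre => 'g::complex_fibre => 'h::complex_fibre) => nat =>
  ('n, 'f) fib => ('n, 'g) fib => ('n, 'h) fib"
 where "zterm L m n f g = (%ys vs. \<Sum>zs | length zs = n. \<Sum>I \<in> Pow {..<length ys}. \<Sum>J \<in> Pow {..<length vs}.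
    (shuffle_sign J * of_real (\<Prod>(i, j) \<leftarrow> zs. L i j)) *\<^sub>c
    m (f (map (%z. axis (fst z) 1) zs @ nths ys I) (nths vs J))
     (g (map (%z. axis (snd z) 1) zs @ nths ys (- I)) (nths vs (- J))))"

lemma zterm_0: "zterm L m 0 f g = mu m f g"
 by (simp add: zterm_def mu_def)

lemma zterm_Suc:
 fixes L :: "'n::finite => 'n => real"
 shows "zterm L m (Suc n) f g = Psum L (%u w. zterm L m n (insS u f) (insS w g))"
proof (intro ext)
 fix ys vs :: "(real ^ 'n) list"
 let ?F = "%f g zs. \<Sum>I \<in> Pow {..<length ys}. \<Sum>J \<in> Pow {..<length vs}.
    (shuffle_sign J * of_real (\<Prod>(i, j) \<leftarrow> zs. L i j)) *\<^sub>c
    m (f (map (%z. axis (fst z) 1) zs @ nths ys I) (nths vs J))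
     (g (map (%z. axis (snd z) 1) zs @ nths ys (- I)) (nths vs (- J)))"
 have s: "{zs :: ('n \<times> 'n) list. length zs = Suc n} = (%(z, zs). z # zs) ` (UNIV \<times> {zs. length zs = n})"
  by (auto simp: length_Suc_conv image_iff)
 have inj: "inj_on (%(z, zs). z # zs) (UNIV \<times> {zs :: ('n \<times> 'n) list. length zs = n})"
  by (auto intro!: inj_onI)
 have "(\<Sum>zs | length zs = Suc n. H zs) = (\<Sum>(z, zs) \<in> UNIV \<times> {zs. length zs = n}. H (z # zs))" for H :: "('n \<times> 'n) list => 'd::comm_monoid_add"
  unfolding s sum.reindex[OF inj] by (simp add: split_def o_def)
 then have "zterm L m (Suc n) f g ys vs = (\<Sum>(z, zs) \<in> UNIV \<times> {zs. length zs = n}. ?F f g (z # zs))"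
  unfolding zterm_def by blast
 also have "\<dots> = (\<Sum>z\<in>UNIV. \<Sum>zs | length zs = n. ?F f g (z # zs))"
  by (rule sum.cartesian_product[symmetric])
 also have "\<dots> = (\<Sum>k\<in>UNIV. \<Sum>l\<in>UNIV. \<Sum>zs | length zs = n. ?F f g ((k, l) # zs))"
 proof -
  have "(\<Sum>z\<in>UNIV. H z) = (\<Sum>k\<in>UNIV. \<Sum>l\<in>UNIV. H (k, l))" for H :: "'n \<times> 'n => 'd::comm_monoid_add"
   by (simp add: sum.cartesian_product)
  then show ?thesis by blast
 qed
 also have "\<dots> = (\<Sum>k\<in>UNIV. \<Sum>l\<in>UNIV. of_real (L k l) *\<^sub>c zterm L m n (insS (axis k 1) f) (insS (axis l 1) g) ys vs)"
  unfolding zterm_def by (simp add: scaleC_sum_right insS_def scaleC_scaleC mult_ac)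
 finally show "zterm L m (Suc n) f g ys vs = Psum L (%u w. zterm L m n (insS u f) (insS w g)) ys vs"
  by (simp add: Psum_def fun_ops smulC_def)
qed

lemma zterm_Bn: "zterm L m n f g = smulC (fact n) (Bn L m n f g)"
proof (induction n arbitrary: f g)
 case 0 show ?case by (simp add: zterm_0)
next
 case (Suc n)
 have "zterm L m (Suc n) f g = smulC (fact n) (Psum L (%u w. Bn L m n (insS u f) (insS w g)))"
  unfolding zterm_Suc Suc.IH by (simp add: Psum_def smulC_sum_right mult.commute)
 also have "\<dots> = smulC (fact n) (smulC (of_nat (Suc n)) (Bn L m (Suc n) f g))"
  by (simp only: euler)
 finally show ?case by (simp add: mult.commute)
qed

text \<open>The share of the powers \<open>a\<close> and \<open>b\<close> in the coefficient of
  power \<open>k\<close>: the missing powers of lambda come from the Poisson tensors, so the order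
  is forced to be \<open>k - a - b\<close>.\<close>

definition wterm :: "('m => real ^ 'n => real ^ 'n => real) => ('f::complex_fibre => 'g::complex_fibre => 'h::complex_fibre) =>
  ('m, 'n::finite, 'f) wform => ('m, 'n, 'g) wform => int => 'm => int => int => ('n, 'h) fib"
 where "wterm \<omega> m \<Phi> \<Psi> k p a b = (if a + b \<le> k then
   smulC ((\<i> / 2) ^ nat (k - a - b)) (Bn (poisson \<omega> p) m (nat (k - a - b)) (\<Phi> a p) (\<Psi> b p)) else 0)"

text \<open>Any finite superset of the support may serve as index set, since additional pairs
  contribute 0. Products with different supports can then be compared term by term.\<close>

lemma wprod_wterm:
 assumes m: "cbilin m" and S: "finite S" "!!a b. \<Phi> a \<noteq> 0 ==> \<Psi> b \<noteq> 0 ==> a + b \<le> k ==> (a, b) \<in> S"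
 shows "wprod \<omega> m \<Phi> \<Psi> k p = (\<Sum>(a, b)\<in>S. wterm \<omega> m \<Phi> \<Psi> k p a b)"
proof -
 let ?S = "{(a, b). \<Phi> a \<noteq> 0 \<and> \<Psi> b \<noteq> 0 \<and> a + b \<le> k}"
 have "wprod \<omega> m \<Phi> \<Psi> k p = (\<Sum>(a, b)\<in>?S. smulC ((\<i> / 2) ^ nat (k - a - b) / fact (nat (k - a - b)))
   (zterm (poisson \<omega> p) m (nat (k - a - b)) (\<Phi> a p) (\<Psi> b p)))"
  by (intro ext) (simp add: wprod_def zterm_def Let_def fun_ops smulC_def split_beta)
 also have "\<dots> = (\<Sum>(a, b)\<in>?S. wterm \<omega> m \<Phi> \<Psi> k p a b)"
  by (intro sum.cong refl) (auto simp: wterm_def zterm_Bn)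
 also have "\<dots> = (\<Sum>(a, b)\<in>S. wterm \<omega> m \<Phi> \<Psi> k p a b)"
 proof (rule sum.mono_neutral_left[OF S(1)])
  show "?S \<subseteq> S" using S(2) by auto
  show "\<forall>x\<in>S - ?S. (case x of (a, b) => wterm \<omega> m \<Phi> \<Psi> k p a b) = 0"
   by (auto simp: wterm_def Bn_linear[OF m] fun_ops)
 qed
 finally show ?thesis .
qed

lemma wprod_range:
 assumes m: "cbilin m" and "lb N \<Phi>" "lb N \<Psi>" "k - N \<le> K"
 shows "wprod \<omega> m \<Phi> \<Psi> k p = (\<Sum>a\<in>{N..K}. \<Sum>b\<in>{N..K}. wterm \<omega> m \<Phi> \<Psi> k p a b)"
 unfolding sum.cartesian_product
proof (rule wprod_wterm[OF m])
 fix a b assume "\<Phi> a \<noteq> 0" "\<Psi> b \<noteq> 0" "a + b \<le> k"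
 moreover from this have "N \<le> a" "N \<le> b" using assms(2,3) unfolding lb_def by (meson not_le)+
 ultimately show "(a, b) \<in> {N..K} \<times> {N..K}" using assms(4) by auto
qed simp

lemma wprod_add:
 assumes m: "cbilin m" and "lb N \<Phi>" "lb N \<Phi>'" "lb N \<Psi>" "lb N \<Psi>'"
 shows "wprod \<omega> m (\<Phi> + \<Phi>') \<Psi> = wprod \<omega> m \<Phi> \<Psi> + wprod \<omega> m \<Phi>' \<Psi>"
  "wprod \<omega> m \<Phi> (\<Psi> + \<Psi>') = wprod \<omega> m \<Phi> \<Psi> + wprod \<omega> m \<Phi> \<Psi>'"
proof -
 have 1: "wterm \<omega> m (\<Phi> + \<Phi>') \<Psi> k p a = (%b. wterm \<omega> m \<Phi> \<Psi> k p a b + wterm \<omega> m \<Phi>' \<Psi> k p a b)"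
  "wterm \<omega> m \<Phi> (\<Psi> + \<Psi>') k p a = (%b. wterm \<omega> m \<Phi> \<Psi> k p a b + wterm \<omega> m \<Phi> \<Psi>' k p a b)" for k p a
  by (rule ext; simp add: wterm_def wform_ops Bn_linear[OF m] smulC_add_right)+
 have "wprod \<omega> m (\<Phi> + \<Phi>') \<Psi> k p = wprod \<omega> m \<Phi> \<Psi> k p + wprod \<omega> m \<Phi>' \<Psi> k p" for k p
  unfolding wprod_range[OF m lb_ops(1)[OF assms(2,3)] assms(4) order_refl] wprod_range[OF m assms(2,4) order_refl] wprod_range[OF m assms(3,4) order_refl]
  by (simp only: 1 sum.distrib)
 then show "wprod \<omega> m (\<Phi> + \<Phi>') \<Psi> = wprod \<omega> m \<Phi> \<Psi> + wprod \<omega> m \<Phi>' \<Psi>"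
  by (simp add: fun_eq_iff fun_ops)
 have "wprod \<omega> m \<Phi> (\<Psi> + \<Psi>') k p = wprod \<omega> m \<Phi> \<Psi> k p + wprod \<omega> m \<Phi> \<Psi>' k p" for k p
  unfolding wprod_range[OF m assms(2) lb_ops(1)[OF assms(4,5)] order_refl] wprod_range[OF m assms(2,4) order_refl] wprod_range[OF m assms(2,5) order_refl]
  by (simp only: 1 sum.distrib)
 then show "wprod \<omega> m \<Phi> (\<Psi> + \<Psi>') = wprod \<omega> m \<Phi> \<Psi> + wprod \<omega> m \<Phi> \<Psi>'"
  by (simp add: fun_eq_iff fun_ops)
qed

lemma cscale_neg_one: "cscale (- 1) \<Phi> = - \<Phi>"
 by (simp add: cscale_def fun_eq_iff fun_ops)
lemma cscale_cscale: "cscale c (cscale d \<Phi>) = cscale (c * d) \<Phi>"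
 by (simp add: cscale_def scaleC_scaleC)
lemma cscale_add: "cscale c (\<Phi> + \<Psi>) = cscale c \<Phi> + cscale c \<Psi>" "cscale c (\<Phi> - \<Psi>) = cscale c \<Phi> - cscale c \<Psi>"
 "cscale c (- \<Phi>) = - cscale c \<Phi>" "cscale c 0 = 0"
 by (simp_all add: cscale_def scaleC_add_right scaleC_diff_right fun_eq_iff fun_ops)
lemma lambda_shift_add: "lambda_shift n (\<Phi> + \<Psi>) = lambda_shift n \<Phi> + lambda_shift n \<Psi>"
 "lambda_shift n (\<Phi> - \<Psi>) = lambda_shift n \<Phi> - lambda_shift n \<Psi>" "lambda_shift n (- \<Phi>) = - lambda_shift n \<Phi>"
 "lambda_shift n 0 = 0" "lambda_shift n (cscale c \<Phi>) = cscale c (lambda_shift n \<Phi>)"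
 by (simp_all add: lambda_shift_def fun_eq_iff fun_ops cscale_def)
lemma lambda_shift_shift: "lambda_shift n (lambda_shift l \<Phi>) = lambda_shift (l + n) \<Phi>" "lambda_shift 0 \<Phi> = \<Phi>"
 by (simp_all add: lambda_shift_def fun_eq_iff algebra_simps)

lemma wprod_cscale:
 assumes m: "cbilin m" and "lb N \<Phi>" "lb N \<Psi>"
 shows "wprod \<omega> m (cscale c \<Phi>) \<Psi> = cscale c (wprod \<omega> m \<Phi> \<Psi>)"
  "wprod \<omega> m \<Phi> (cscale c \<Psi>) = cscale c (wprod \<omega> m \<Phi> \<Psi>)"
proof -
 have 1: "wterm \<omega> m (cscale c \<Phi>) \<Psi> k p a = (%b. smulC c (wterm \<omega> m \<Phi> \<Psi> k p a b))"
  "wterm \<omega> m \<Phi> (cscale c \<Psi>) k p a = (%b. smulC c (wterm \<omega> m \<Phi> \<Psi> k p a b))" for k p a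
  by (rule ext; simp add: wterm_def cscale_fib Bn_linear[OF m] mult.commute)+
 have "wprod \<omega> m (cscale c \<Phi>) \<Psi> k p = cscale c (wprod \<omega> m \<Phi> \<Psi>) k p"
  "wprod \<omega> m \<Phi> (cscale c \<Psi>) k p = cscale c (wprod \<omega> m \<Phi> \<Psi>) k p" for k p
  unfolding cscale_fib[of c "wprod \<omega> m \<Phi> \<Psi>"] wprod_range[OF m lb_ops(5)[OF assms(2)] assms(3) order_refl]
   wprod_range[OF m assms(2) lb_ops(5)[OF assms(3)] order_refl] wprod_range[OF m assms(2,3) order_refl]
  by (simp_all only: 1 smulC_sum_right)
 then show "wprod \<omega> m (cscale c \<Phi>) \<Psi> = cscale c (wprod \<omega> m \<Phi> \<Psi>)"
  "wprod \<omega> m \<Phi> (cscale c \<Psi>) = cscale c (wprod \<omega> m \<Phi> \<Psi>)" by blast+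
qed

lemma wprod_neg:
 assumes m: "cbilin m" and "lb N \<Phi>" "lb N \<Psi>"
 shows "wprod \<omega> m (- \<Phi>) \<Psi> = - wprod \<omega> m \<Phi> \<Psi>" "wprod \<omega> m \<Phi> (- \<Psi>) = - wprod \<omega> m \<Phi> \<Psi>"
 using wprod_cscale[OF assms, of \<omega> "- 1"] by (simp_all add: cscale_neg_one)

lemma wprod_diff:
 assumes m: "cbilin m" and "lb N \<Phi>" "lb N \<Phi>'" "lb N \<Psi>" "lb N \<Psi>'"
 shows "wprod \<omega> m (\<Phi> - \<Phi>') \<Psi> = wprod \<omega> m \<Phi> \<Psi> - wprod \<omega> m \<Phi>' \<Psi>"
  "wprod \<omega> m \<Phi> (\<Psi> - \<Psi>') = wprod \<omega> m \<Phi> \<Psi> - wprod \<omega> m \<Phi> \<Psi>'"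
 using wprod_add[OF m assms(2) lb_ops(3)[OF assms(3)] assms(4) lb_ops(3)[OF assms(5)], of \<omega>]
 by (simp_all add: wprod_neg[OF m assms(3,4)] wprod_neg[OF m assms(2,5)])

lemma wprod_shift:
 assumes m: "cbilin m" and "lb N \<Phi>" "lb N \<Psi>"
 shows "wprod \<omega> m (lambda_shift n \<Phi>) \<Psi> = lambda_shift n (wprod \<omega> m \<Phi> \<Psi>)"
  "wprod \<omega> m \<Phi> (lambda_shift n \<Psi>) = lambda_shift n (wprod \<omega> m \<Phi> \<Psi>)"
proof -
 \<comment> \<open>The shift moves the powers of one factor only, so the square of indices has to be
   translated in a single coordinate before the two sums match.\<close>
 define S where "S k = {N..k - N} \<times> {N..k - N}" for k
 have S: "finite (S k)" "!!a b. \<Phi> a \<noteq> 0 ==> \<Psi> b \<noteq> 0 ==> a + b \<le> k ==> (a, b) \<in> S k" for k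
 proof -
  fix a b assume "\<Phi> a \<noteq> 0" "\<Psi> b \<noteq> 0" "a + b \<le> k"
  moreover from this have "N \<le> a" "N \<le> b" using assms(2,3) unfolding lb_def by (meson not_le)+
  ultimately show "(a, b) \<in> S k" by (auto simp: S_def)
 qed (simp add: S_def)
 have "wprod \<omega> m (lambda_shift n \<Phi>) \<Psi> k p = lambda_shift n (wprod \<omega> m \<Phi> \<Psi>) k p" for k p
 proof -
  have "wprod \<omega> m (lambda_shift n \<Phi>) \<Psi> k p = (\<Sum>(a, b)\<in>(%(a, b). (a + n, b)) ` S (k - n). wterm \<omega> m (lambda_shift n \<Phi>) \<Psi> k p a b)"
  proof (rule wprod_wterm[OF m])
   fix a b assume "lambda_shift n \<Phi> a \<noteq> 0" "\<Psi> b \<noteq> 0" "a + b \<le> k"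
   then have "(a - n, b) \<in> S (k - n)" by (intro S(2)) (auto simp: lambda_shift_def)
   then show "(a, b) \<in> (%(a, b). (a + n, b)) ` S (k - n)" by force
  qed (simp add: S)
  also have "\<dots> = (\<Sum>(a, b)\<in>S (k - n). wterm \<omega> m (lambda_shift n \<Phi>) \<Psi> k p (a + n) b)"
   by (subst sum.reindex) (auto intro!: inj_onI simp: split_beta)
  also have "\<dots> = (\<Sum>(a, b)\<in>S (k - n). wterm \<omega> m \<Phi> \<Psi> (k - n) p a b)"
   by (intro sum.cong refl) (auto simp: wterm_def lambda_shift_def algebra_simps)
  also have "\<dots> = lambda_shift n (wprod \<omega> m \<Phi> \<Psi>) k p"
   unfolding lambda_shift_def by (rule wprod_wterm[OF m S, symmetric])
  finally show ?thesis .
 qed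
 then show "wprod \<omega> m (lambda_shift n \<Phi>) \<Psi> = lambda_shift n (wprod \<omega> m \<Phi> \<Psi>)" by blast
 have "wprod \<omega> m \<Phi> (lambda_shift n \<Psi>) k p = lambda_shift n (wprod \<omega> m \<Phi> \<Psi>) k p" for k p
 proof -
  have "wprod \<omega> m \<Phi> (lambda_shift n \<Psi>) k p = (\<Sum>(a, b)\<in>(%(a, b). (a, b + n)) ` S (k - n). wterm \<omega> m \<Phi> (lambda_shift n \<Psi>) k p a b)"
  proof (rule wprod_wterm[OF m])
   fix a b assume "\<Phi> a \<noteq> 0" "lambda_shift n \<Psi> b \<noteq> 0" "a + b \<le> k"
   then have "(a, b - n) \<in> S (k - n)" by (intro S(2)) (auto simp: lambda_shift_def)
   then show "(a, b) \<in> (%(a, b). (a, b + n)) ` S (k - n)" by force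
  qed (simp add: S)
  also have "\<dots> = (\<Sum>(a, b)\<in>S (k - n). wterm \<omega> m \<Phi> (lambda_shift n \<Psi>) k p a (b + n))"
   by (subst sum.reindex) (auto intro!: inj_onI simp: split_beta)
  also have "\<dots> = (\<Sum>(a, b)\<in>S (k - n). wterm \<omega> m \<Phi> \<Psi> (k - n) p a b)"
   by (intro sum.cong refl) (auto simp: wterm_def lambda_shift_def algebra_simps)
  also have "\<dots> = lambda_shift n (wprod \<omega> m \<Phi> \<Psi>) k p"
   unfolding lambda_shift_def by (rule wprod_wterm[OF m S, symmetric])
  finally show ?thesis .
 qed
 then show "wprod \<omega> m \<Phi> (lambda_shift n \<Psi>) = lambda_shift n (wprod \<omega> m \<Phi> \<Psi>)" by blast
qed

lemma wprod_lb: "cbilin m ==> lb 0 \<Phi> ==> lb 0 \<Psi> ==> lb 0 (wprod \<omega> m \<Phi> \<Psi>)"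
 by (rule lb_fibI) (simp add: wprod_range[OF _ _ _ order_refl])

lemma wprod_zero_order:
 assumes "cbilin m" "lb 0 \<Phi>" "lb 0 \<Psi>"
 shows "wprod \<omega> m \<Phi> \<Psi> 0 p = mu m (\<Phi> 0 p) (\<Psi> 0 p)"
 by (simp add: wprod_range[OF assms order_refl] wterm_def)

lemma parity_wprod:
 assumes m: "cbilin m" and "lb 0 \<Phi>" "lb 0 \<Psi>"
 shows "parity (wprod \<omega> m \<Phi> \<Psi>) = wprod \<omega> m (parity \<Phi>) (parity \<Psi>)"
proof -
 have 1: "par (wterm \<omega> m \<Phi> \<Psi> k p a b) = wterm \<omega> m (parity \<Phi>) (parity \<Psi>) k p a b" for k p a b
  by (simp add: wterm_def parity_fib par_linear par_Bn[OF m])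
 have "parity (wprod \<omega> m \<Phi> \<Psi>) k p = wprod \<omega> m (parity \<Phi>) (parity \<Psi>) k p" for k p
  unfolding parity_fib[of "wprod \<omega> m \<Phi> \<Psi>"] wprod_range[OF m assms(2,3) order_refl]
   wprod_range[OF m lb_ops(7)[OF assms(2)] lb_ops(7)[OF assms(3)] order_refl]
  by (simp only: 1 par_sum)
 then show ?thesis by blast
qed

lemma delta_wprod:
 assumes m: "cbilin m" and "lb 0 \<Phi>" "lb 0 \<Psi>" "!!k p. sym2 (\<Phi> k p)" "!!k p. sym2 (\<Psi> k p)"
 shows "delta (wprod \<omega> m \<Phi> \<Psi>) = wprod \<omega> m (delta \<Phi>) \<Psi> + wprod \<omega> m (parity \<Phi>) (delta \<Psi>)"
proof -
 have 1: "fdelta (wterm \<omega> m \<Phi> \<Psi> k p a b) = wterm \<omega> m (delta \<Phi>) \<Psi> k p a b + wterm \<omega> m (parity \<Phi>) (delta \<Psi>) k p a b" for k p a b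
  by (simp add: wterm_def parity_fib delta_fib fdelta_linear fdelta_Bn[OF m assms(4,5)] smulC_add_right)
 have "delta (wprod \<omega> m \<Phi> \<Psi>) k p = (wprod \<omega> m (delta \<Phi>) \<Psi> + wprod \<omega> m (parity \<Phi>) (delta \<Psi>)) k p" for k p
  unfolding delta_fib[of "wprod \<omega> m \<Phi> \<Psi>"] wform_ops wprod_range[OF m assms(2,3) order_refl]
   wprod_range[OF m lb_ops(6)[OF assms(2)] assms(3) order_refl]
   wprod_range[OF m lb_ops(7)[OF assms(2)] lb_ops(6)[OF assms(3)] order_refl]
  by (simp only: 1 fdelta_sum sum.distrib)
 then show ?thesis by blast
qed

lemma delta_delta:
 fixes \<Phi> :: "('m, 'n::finite, 'f::complex_fibre) wform"
 shows "(!!k p. sym2 (\<Phi> k p)) ==> delta (delta \<Phi>) = 0"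
 by (intro ext) (simp add: delta_fib fdelta_fdelta fun_ops)

text \<open>The intermediate power \<open>e\<close> of an inner product is written as
  \<open>a + b + i\<close>; then \<open>i\<close> is the order of the inner product in the Poisson
  tensor.\<close>

lemma sum_level:
 fixes F :: "int => 'a::comm_monoid_add"
 assumes "0 \<le> a" "0 \<le> b" "0 \<le> c"
 shows "(\<Sum>e\<in>{0..k}. if e + c \<le> k \<and> a + b \<le> e then F e else 0) =
  (if a + b + c \<le> k then \<Sum>i\<le>nat (k - a - b - c). F (a + b + int i) else 0)"
proof (cases "a + b + c \<le> k")
 case True
 have "(\<Sum>e\<in>{0..k}. if e + c \<le> k \<and> a + b \<le> e then F e else 0) = (\<Sum>e\<in>{a + b..k - c}. F e)"
  using assms by (intro sum.mono_neutral_cong_right) auto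
 also have "{a + b..k - c} = (%i. a + b + int i) ` {..nat (k - a - b - c)}"
 proof (intro set_eqI iffI)
  fix e assume e: "e \<in> {a + b..k - c}"
  then have "e = a + b + int (nat (e - a - b))" "nat (e - a - b) \<le> nat (k - a - b - c)" by auto
  then show "e \<in> (%i. a + b + int i) ` {..nat (k - a - b - c)}" by blast
 qed (use True in auto)
 also have "(\<Sum>e\<in>\<dots>. F e) = (\<Sum>i\<le>nat (k - a - b - c). F (a + b + int i))"
  by (subst sum.reindex) (auto intro!: inj_onI)
 finally show ?thesis using True by simp
next
 case False
 then show ?thesis by (intro trans[OF sum.neutral]) auto
qed

text \<open>For fixed powers \<open>a\<close>, \<open>b\<close> and \<open>c\<close> of the three
  factors, the remaining order is distributed over the two nested products. Reordering the sums
  isolates this distribution, which \<open>Bn_assoc\<close> treats.\<close>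

lemma wprod_assoc:
 assumes m: "cbilin m1" "cbilin m2" "cbilin m3" "cbilin m4"
  and assoc: "!!x y z. m1 (m2 x y) z = m3 x (m4 y z)"
  and l: "lb 0 \<Phi>" "lb 0 \<Psi>" "lb 0 \<Theta>"
  and s: "!!k p. sym2 (\<Phi> k p)" "!!k p. sym2 (\<Psi> k p)" "!!k p. sym2 (\<Theta> k p)"
 shows "wprod \<omega> m1 (wprod \<omega> m2 \<Phi> \<Psi>) \<Theta> = wprod \<omega> m3 \<Phi> (wprod \<omega> m4 \<Psi> \<Theta>)"
proof -
 have main: "wprod \<omega> m1 (wprod \<omega> m2 \<Phi> \<Psi>) \<Theta> k p = wprod \<omega> m3 \<Phi> (wprod \<omega> m4 \<Psi> \<Theta>) k p" for k p
 proof -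
  let ?L = "poisson \<omega> p" and ?R = "{0..k}"
  let ?c = "%j. (\<i> / 2) ^ nat j :: complex"
  have 1: "wterm \<omega> m1 (wprod \<omega> m2 \<Phi> \<Psi>) \<Theta> k p e c = (\<Sum>a\<in>?R. \<Sum>b\<in>?R.
    if e + c \<le> k \<and> a + b \<le> e then smulC (?c (k - a - b - c)) (Bn ?L m1 (nat (k - e - c)) (Bn ?L m2 (nat (e - a - b)) (\<Phi> a p) (\<Psi> b p)) (\<Theta> c p)) else 0)"
   if "e \<in> ?R" "c \<in> ?R" for e c
  proof (cases "e + c \<le> k")
   case True
   \<comment> \<open>The powers of \<i> / 2 depend on the total order only, so they leave the sum
     over its distribution.\<close>
   have "?c (k - e - c) * ?c (e - a - b) = ?c (k - a - b - c)" if "a + b \<le> e" for a b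
   proof -
    have "nat (k - e - c) + nat (e - a - b) = nat (k - a - b - c)" using True that by simp
    then show ?thesis by (simp flip: power_add)
   qed
   then have 2: "smulC (?c (k - e - c)) (Bn ?L m1 (nat (k - e - c)) (wterm \<omega> m2 \<Phi> \<Psi> e p a b) (\<Theta> c p)) =
     (if a + b \<le> e then smulC (?c (k - a - b - c)) (Bn ?L m1 (nat (k - e - c)) (Bn ?L m2 (nat (e - a - b)) (\<Phi> a p) (\<Psi> b p)) (\<Theta> c p)) else 0)" for a b
    by (auto simp: wterm_def Bn_linear[OF m(1)])
   have "e - 0 \<le> k" using that by simp
   from wprod_range[OF m(2) l(1,2) this] show ?thesis
    using True by (simp only: wterm_def[of \<omega> m1] if_True Bn_sum[OF m(1)] smulC_sum_right 2 simp_thms)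
  qed (simp add: wterm_def)
  have 2: "wterm \<omega> m3 \<Phi> (wprod \<omega> m4 \<Psi> \<Theta>) k p a e = (\<Sum>b\<in>?R. \<Sum>c\<in>?R.
    if e + a \<le> k \<and> b + c \<le> e then smulC (?c (k - b - c - a)) (Bn ?L m3 (nat (k - a - e)) (\<Phi> a p) (Bn ?L m4 (nat (e - b - c)) (\<Psi> b p) (\<Theta> c p))) else 0)"
   if "e \<in> ?R" "a \<in> ?R" for e a
  proof (cases "a + e \<le> k")
   case True
   have "?c (k - a - e) * ?c (e - b - c) = ?c (k - b - c - a)" if "b + c \<le> e" for b c
   proof -
    have "nat (k - a - e) + nat (e - b - c) = nat (k - b - c - a)" using True that by simp
    then show ?thesis by (simp flip: power_add)
   qed
   then have 2: "smulC (?c (k - a - e)) (Bn ?L m3 (nat (k - a - e)) (\<Phi> a p) (wterm \<omega> m4 \<Psi> \<Theta> e p b c)) =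
     (if b + c \<le> e then smulC (?c (k - b - c - a)) (Bn ?L m3 (nat (k - a - e)) (\<Phi> a p) (Bn ?L m4 (nat (e - b - c)) (\<Psi> b p) (\<Theta> c p))) else 0)" for b c
    by (auto simp: wterm_def Bn_linear[OF m(3)])
   have "e - 0 \<le> k" using that by simp
   from wprod_range[OF m(4) l(2,3) this] show ?thesis
    using True by (simp only: wterm_def[of \<omega> m3] if_True Bn_sum[OF m(3)] smulC_sum_right 2 simp_thms add.commute[of e a])
  qed (simp add: wterm_def add.commute)
  let ?T = "%a b c. if a + b + c \<le> k then smulC (?c (k - a - b - c))
    (\<Sum>i\<le>nat (k - a - b - c). Bn ?L m1 (nat (k - a - b - c) - i) (Bn ?L m2 i (\<Phi> a p) (\<Psi> b p)) (\<Theta> c p)) else 0"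
  have k0: "k - 0 \<le> k" by simp
  have "wprod \<omega> m1 (wprod \<omega> m2 \<Phi> \<Psi>) \<Theta> k p = (\<Sum>e\<in>?R. \<Sum>c\<in>?R. \<Sum>a\<in>?R. \<Sum>b\<in>?R.
    if e + c \<le> k \<and> a + b \<le> e then smulC (?c (k - a - b - c)) (Bn ?L m1 (nat (k - e - c)) (Bn ?L m2 (nat (e - a - b)) (\<Phi> a p) (\<Psi> b p)) (\<Theta> c p)) else 0)"
   unfolding wprod_range[OF m(1) wprod_lb[OF m(2) l(1,2)] l(3) k0] by (intro sum.cong refl 1)
  also have "\<dots> = (\<Sum>a\<in>?R. \<Sum>b\<in>?R. \<Sum>e\<in>?R. \<Sum>c\<in>?R.
    if e + c \<le> k \<and> a + b \<le> e then smulC (?c (k - a - b - c)) (Bn ?L m1 (nat (k - e - c)) (Bn ?L m2 (nat (e - a - b)) (\<Phi> a p) (\<Psi> b p)) (\<Theta> c p)) else 0)"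
   by (rule sum_swap4)
  also have "\<dots> = (\<Sum>a\<in>?R. \<Sum>b\<in>?R. \<Sum>c\<in>?R. ?T a b c)"
  proof (rule sum.cong[OF refl], rule sum.cong[OF refl], rule trans[OF sum.swap], rule sum.cong[OF refl])
   fix a b c assume "a \<in> ?R" "b \<in> ?R" "c \<in> ?R"
   then have nn: "0 \<le> a" "0 \<le> b" "0 \<le> c" by auto
   have e: "nat (k - (a + b + int i) - c) = nat (k - a - b - c) - i" "nat (a + b + int i - a - b) = i" for i
    using nn by auto
   show "(\<Sum>e\<in>?R. if e + c \<le> k \<and> a + b \<le> e then smulC (?c (k - a - b - c)) (Bn ?L m1 (nat (k - e - c)) (Bn ?L m2 (nat (e - a - b)) (\<Phi> a p) (\<Psi> b p)) (\<Theta> c p)) else 0) = ?T a b c"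
    unfolding sum_level[OF nn] e smulC_sum_right by simp
  qed
  also have "\<dots> = (\<Sum>a\<in>?R. \<Sum>b\<in>?R. \<Sum>c\<in>?R. if b + c + a \<le> k then smulC (?c (k - b - c - a))
    (\<Sum>i\<le>nat (k - b - c - a). Bn ?L m3 (nat (k - b - c - a) - i) (\<Phi> a p) (Bn ?L m4 i (\<Psi> b p) (\<Theta> c p))) else 0)"
  proof -
   have "k - b - c - a = k - a - b - c" for a b c by simp
   then show ?thesis by (simp only: Bn_assoc[OF m assoc s] add_ac)
  qed
  also have "\<dots> = (\<Sum>a\<in>?R. \<Sum>e\<in>?R. \<Sum>b\<in>?R. \<Sum>c\<in>?R.
    if e + a \<le> k \<and> b + c \<le> e then smulC (?c (k - b - c - a)) (Bn ?L m3 (nat (k - a - e)) (\<Phi> a p) (Bn ?L m4 (nat (e - b - c)) (\<Psi> b p) (\<Theta> c p))) else 0)"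
  proof (rule sum.cong[OF refl], rule sym, rule trans[OF sum.swap], rule sum.cong[OF refl], rule trans[OF sum.swap], rule sum.cong[OF refl])
   fix a b c assume "a \<in> ?R" "b \<in> ?R" "c \<in> ?R"
   then have nn: "0 \<le> b" "0 \<le> c" "0 \<le> a" by auto
   have e: "nat (k - a - (b + c + int i)) = nat (k - b - c - a) - i" "nat (b + c + int i - b - c) = i" for i
    using nn by auto
   show "(\<Sum>e\<in>?R. if e + a \<le> k \<and> b + c \<le> e then smulC (?c (k - b - c - a)) (Bn ?L m3 (nat (k - a - e)) (\<Phi> a p) (Bn ?L m4 (nat (e - b - c)) (\<Psi> b p) (\<Theta> c p))) else 0) =
    (if b + c + a \<le> k then smulC (?c (k - b - c - a))
    (\<Sum>i\<le>nat (k - b - c - a). Bn ?L m3 (nat (k - b - c - a) - i) (\<Phi> a p) (Bn ?L m4 i (\<Psi> b p) (\<Theta> c p))) else 0)"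
    unfolding sum_level[OF nn] e smulC_sum_right by simp
  qed
  also have "\<dots> = wprod \<omega> m3 \<Phi> (wprod \<omega> m4 \<Psi> \<Theta>) k p"
   unfolding wprod_range[OF m(3) l(1) wprod_lb[OF m(4) l(2,3)] k0] by (intro sum.cong refl 2[symmetric])
  finally show ?thesis .
 qed
 then show ?thesis by blast
qed

section \<open>Connections in a chart\<close>

subsection \<open>Derivations acting on the arguments\<close>

text \<open>The slotwise extension of an endomorphism to the arguments. With Christoffel symbols for
  \<open>G\<close> it is the zeroth-order part of the covariant derivative, with a curvature
  endomorphism it appears in the commutator of two such derivatives.\<close>

definition actS :: "(real ^ 'n => real ^ 'n) => ('n::finite, 'f::complex_fibre) fib => ('n, 'f) fib"
 where "actS G f = (%ys vs. \<Sum>j<length ys. f (ys[j := G (ys ! j)]) vs)"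

definition actA :: "(real ^ 'n => real ^ 'n) => ('n::finite, 'f::complex_fibre) fib => ('n, 'f) fib"
 where "actA G f = (%ys vs. \<Sum>j<length vs. f ys (vs[j := G (vs ! j)]))"

lemma act_ins:
 "insS w (actS G f) = insS (G w) f + actS G (insS w f)" "insA w (actS G f) = actS G (insA w f)"
 "insS w (actA G f) = actA G (insS w f)" "insA w (actA G f) = insA (G w) f + actA G (insA w f)"
 by (simp_all add: actS_def actA_def insS_def insA_def fun_eq_iff fun_ops sum.lessThan_Suc_shift del: sum.lessThan_Suc)

lemma act_Nil [simp]: "actS G f [] vs = 0" "actA G f ys [] = 0"
 by (simp_all add: actS_def actA_def)

lemma act_linear:
 "actS G (f + g) = actS G f + actS G g" "actA G (f + g) = actA G f + actA G g"
 "actS G (smulC c f) = smulC c (actS G f)" "actA G (smulC c f) = smulC c (actA G f)"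
 "actS G (- f) = - actS G f" "actA G (- f) = - actA G f" "actS G 0 = 0" "actA G 0 = 0"
 "actS G (f - g) = actS G f - actS G g" "actA G (f - g) = actA G f - actA G g"
 by (simp_all add: actS_def actA_def fun_eq_iff fun_ops smulC_def sum.distrib scaleC_sum_right sum_negf sum_subtractf)

lemma act_sum: "actS G (\<Sum>i\<in>I. f i) = (\<Sum>i\<in>I. actS G (f i))" "actA G (\<Sum>i\<in>I. f i) = (\<Sum>i\<in>I. actA G (f i))"
 by (rule additive_sum[where T="actS G"] additive_sum[where T="actA G"]; simp add: act_linear)+

lemma act_par: "actS G (par f) = par (actS G f)" "actA G (par f) = par (actA G f)"
 by (simp_all add: actS_def actA_def par_def fun_eq_iff scaleR_sum_right)

lemma actS_mu:
 assumes m: "cbilin m"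
 shows "actS G (mu m f g) = mu m (actS G f) g + mu m f (actS G g)"
proof (intro ext)
 fix ys vs show "actS G (mu m f g) ys vs = (mu m (actS G f) g + mu m f (actS G g)) ys vs"
 proof (induction ys arbitrary: f g)
  case Nil then show ?case by (simp add: mu_def fun_ops cbilinD[OF m])
 next
  case (Cons w ys)
  have "insS w (actS G (mu m f g)) ys vs = insS w (mu m (actS G f) g + mu m f (actS G g)) ys vs"
   using Cons[of "insS w f" g] Cons[of f "insS w g"]
   by (simp add: act_ins insS_mu[OF m] insS_linear act_linear mu_linear[OF m] fun_ops)
  then show ?case by (simp add: insS_def)
 qed
qed

lemma actA_mu:
 assumes m: "cbilin m"
 shows "actA G (mu m f g) = mu m (actA G f) g + mu m f (actA G g)"
proof (intro ext)
 fix ys vs show "actA G (mu m f g) ys vs = (mu m (actA G f) g + mu m f (actA G g)) ys vs"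
 proof (induction vs arbitrary: f g)
  case Nil then show ?case by (simp add: mu_def fun_ops cbilinD[OF m])
 next
  case (Cons w vs)
  have "insA w (actA G (mu m f g)) ys vs = insA w (mu m (actA G f) g + mu m f (actA G g)) ys vs"
   using Cons[of "insA w f" g] Cons[of "par f" "insA w g"]
   by (simp add: act_ins insA_mu[OF m] insA_linear act_linear mu_linear[OF m] act_par fun_ops)
  then show ?case by (simp add: insA_def)
 qed
qed

text \<open>The additional sum is the basis one-form with index \<open>i\<close> composed with
  \<open>G\<close> and expanded in the dual basis.\<close>

lemma actA_dxA:
 assumes "linear G"
 shows "actA G (dxA i f) = dxA i (actA G f) + (\<Sum>m\<in>UNIV. smulC (of_real (G (axis m 1) $ i)) (dxA m f))"
proof (intro ext)
 fix ys vs show "actA G (dxA i f) ys vs = (dxA i (actA G f) + (\<Sum>m\<in>UNIV. smulC (of_real (G (axis m 1) $ i)) (dxA m f))) ys vs"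
 proof (induction vs arbitrary: f)
  case Nil then show ?case by (simp add: fun_ops smulC_def)
 next
  case (Cons w vs)
  have "G w = (\<Sum>m\<in>UNIV. (w $ m) *\<^sub>R G (axis m 1))" by (rule linear_axis_expansion[OF assms])
  then have "complex_of_real (G w $ i) = (\<Sum>m\<in>UNIV. of_real (G (axis m 1) $ i) * of_real (w $ m))"
   by (simp add: mult.commute)
  then have 1: "smulC (of_real (G w $ i)) f = (\<Sum>m\<in>UNIV. smulC (of_real (G (axis m 1) $ i)) (smulC (of_real (w $ m)) f))"
   by (simp add: smulC_sum_left)
  have "insA w (actA G (dxA i f)) ys vs = insA w (dxA i (actA G f) + (\<Sum>m\<in>UNIV. smulC (of_real (G (axis m 1) $ i)) (dxA m f))) ys vs"
   unfolding insA_linear insA_sum act_ins insA_dxA dxA_linear act_linear smulC_diff_right sum_subtractf 1[symmetric]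
   using Cons[of "insA w f"] by (simp add: fun_ops)
  then show ?case by (simp add: insA_def)
 qed
qed

lemma actS_dxA: "actS G (dxA i f) = dxA i (actS G f)"
proof (intro ext)
 fix ys vs show "actS G (dxA i f) ys vs = dxA i (actS G f) ys vs"
 proof (induction vs arbitrary: f)
  case Nil then show ?case by (simp add: actS_def)
 next
  case (Cons w vs)
  have "insA w (actS G (dxA i f)) ys vs = insA w (dxA i (actS G f)) ys vs"
   using Cons[of "insA w f"] by (simp add: act_ins insA_dxA act_linear fun_ops)
  then show ?case by (simp add: insA_def)
 qed
qed

subsection \<open>Bundles with connection\<close>

lemma connectionD:
 assumes "connection A sc smF nab"
 shows "near smF p s ==> linear (%v. nab p v s)"
  "near smF p s ==> near smF p t ==> nab p v (%q. s q + t q) = nab p v s + nab p v t"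
  "near (smooth_fun A) p f ==> near smF p s ==> nab p v (%q. sc (f q) (s q)) = sc (tangent_deriv A p v f) (s p) + sc (f p) (nab p v s)"
  "open U ==> smooth_vf A U X ==> smF U s ==> smF U (%p. nab p (X p) s)"
proof -
 note h = assms[unfolded connection_def]
 show "near smF p s ==> linear (%v. nab p v s)"
  by (rule h[THEN conjunct1, rule_format])
 show "near smF p s ==> near smF p t ==> nab p v (%q. s q + t q) = nab p v s + nab p v t"
  by (rule h[THEN conjunct2, THEN conjunct1, rule_format], intro conjI)
 show "near (smooth_fun A) p f ==> near smF p s ==> nab p v (%q. sc (f q) (s q)) = sc (tangent_deriv A p v f) (s p) + sc (f p) (nab p v s)"
  by (rule h[THEN conjunct2, THEN conjunct2, THEN conjunct1, rule_format], intro conjI)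
 show "open U ==> smooth_vf A U X ==> smF U s ==> smF U (%p. nab p (X p) s)"
  by (rule h[THEN conjunct2, THEN conjunct2, THEN conjunct2, rule_format], intro conjI)
qed

context manifold
begin

text \<open>A connection is local because of its Leibniz rule: multiplied by the indicator function
  of \<open>U\<close> the two sections agree everywhere, and at \<open>p\<close> this factor changes
  neither derivative.\<close>

lemma connection_cong:
 fixes sc :: "'s::real_normed_field => 'f::real_normed_vector => 'f"
 assumes conn: "connection A sc smF nab" and sc: "!!x. sc 1 x = x" "!!x. sc 0 x = 0"
  and U: "open U" "p \<in> U" and s: "smF U s" "smF U t" "!!q. q \<in> U ==> s q = t q"
 shows "nab p v s = nab p v t"
proof -
 \<comment> \<open>Smooth on \<open>U\<close>, with value 1 and derivative 0 at \<open>p\<close>;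
   its jump at the boundary of \<open>U\<close> is invisible to \<open>near\<close>.\<close>
 let ?f = "%q. if q \<in> U then 1 else 0 :: 's"
 have f: "near (smooth_fun A) p ?f"
  unfolding near_def using U smooth_fun_cong[OF U(1) _ smooth_fun_const[OF U(1)], of 1 ?f] by auto
 have d: "tangent_deriv A p v ?f = 0"
  unfolding tangent_deriv_chd
  using chd_cong[OF U chart_at, of ?f "%_. 1"] by (simp add: chd_const)
 have e: "(%q. sc (?f q) (s q)) = (%q. sc (?f q) (t q))"
  using s(3) sc by auto
 have "nab p v (%q. sc (?f q) (s q)) = nab p v s" "nab p v (%q. sc (?f q) (t q)) = nab p v t"
  using connectionD(3)[OF conn f, of s v] connectionD(3)[OF conn f, of t v] s U d sc
  by (auto simp: near_def)
 then show ?thesis using e by simp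
qed

end

text \<open>The calculus uses only module properties of the smooth sections and the axioms of the
  two connections. Endomorphism-valued and scalar forms enter later as factors of products, through
  \<open>pairing\<close>.\<close>

locale cbundle = manifold A for A :: "('m::{second_countable_topology, t2_space}, 'n::finite) chart set" +
 fixes smF :: "'m set => ('m => 'f::complex_fibre) => bool" and nabF :: "('m, 'n, 'f) conn"
  and nab :: "('m, 'n, real ^ 'n) conn"
 assumes smF_subset: "smF U s ==> V \<subseteq> U ==> open V ==> smF V s"
  and smF_add: "open U ==> smF U s ==> smF U t ==> smF U (%q. s q + t q)"
  and smF_mult: "open U ==> smooth_fun A U g ==> smF U s ==> smF U (%q. g q *\<^sub>c s q)"
  and smF_cong: "open U ==> (!!q. q \<in> U ==> s q = t q) ==> smF U s ==> smF U t"
  and smF_zero: "open U ==> smF U (%q. 0)"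
  and connF: "connection A (*\<^sub>c) smF nabF"
  and connT: "connection A (*\<^sub>R) (smooth_vf A) nab"
begin

lemmas connT_D = connectionD[OF connT]
lemmas connF_D = connectionD[OF connF]

lemma smF_sum: "open U ==> (!!i. i \<in> I ==> smF U (s i)) ==> smF U (%q. \<Sum>i\<in>I. s i q)"
 by (induction I rule: infinite_finite_induct) (simp_all add: smF_zero smF_add)

lemma smooth_fun_of_real: "open U ==> smooth_fun A U g ==> smooth_fun A U (%q. complex_of_real (g q))"
 by (rule smooth_fun_linear[OF _ bounded_linear_of_real])

lemma smF_multR: "open U ==> smooth_fun A U g ==> smF U s ==> smF U (%q. g q *\<^sub>R s q)"
 unfolding scaleR_scaleC by (intro smF_mult smooth_fun_of_real)

lemma smF_scaleC: "open U ==> smF U s ==> smF U (%q. c *\<^sub>c s q)"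
 by (intro smF_mult smooth_fun_const)

lemma smF_scaleR: "open U ==> smF U s ==> smF U (%q. c *\<^sub>R s q)"
 by (intro smF_multR smooth_fun_const)

lemma smF_neg: "open U ==> smF U s ==> smF U (%q. - s q)"
 using smF_scaleR[of U s "-1"] by simp

lemma smF_diff: "open U ==> smF U s ==> smF U t ==> smF U (%q. s q - t q)"
 using smF_add[of U s "%q. - t q"] smF_neg by simp

lemma nearI: "open U ==> p \<in> U ==> P U s ==> near P p s"
 unfolding near_def by blast

lemmas near_fun = nearI[where P="smooth_fun A"]
lemmas near_vf = nearI[where P="smooth_vf A"]

lemma nabF_linear: "open U ==> p \<in> U ==> smF U s ==> linear (%v. nabF p v s)"
 by (rule connF_D(1)[OF nearI])

lemma nabF_add: "open U ==> p \<in> U ==> smF U s ==> smF U t ==> nabF p v (%q. s q + t q) = nabF p v s + nabF p v t"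
 by (rule connF_D(2)[OF nearI nearI])

lemma nabF_mult: "open U ==> p \<in> U ==> smooth_fun A U g ==> smF U s ==>
  nabF p v (%q. g q *\<^sub>c s q) = tangent_deriv A p v g *\<^sub>c s p + g p *\<^sub>c nabF p v s"
 by (rule connF_D(3)[OF nearI nearI])

lemma nabF_cong: "open U ==> p \<in> U ==> smF U s ==> (!!q. q \<in> U ==> s q = t q) ==> nabF p v s = nabF p v t"
 by (rule connection_cong[OF connF _ _ , of U]) (auto intro: smF_cong)

lemma nabF_multR:
 assumes "open U" "p \<in> U" "smooth_fun A U g" "smF U s"
 shows "nabF p v (%q. g q *\<^sub>R s q) = tangent_deriv A p v g *\<^sub>R s p + g p *\<^sub>R nabF p v s"
proof -
 have "tangent_deriv A p v (%q. complex_of_real (g q)) = of_real (tangent_deriv A p v g)"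
  unfolding tangent_deriv_chd by (rule chd_bounded_linear[OF bounded_linear_of_real assms(3,1,2) chart_at])
 then show ?thesis
  using nabF_mult[OF assms(1,2) smooth_fun_of_real[OF assms(1,3)] assms(4), of v] by (simp add: scaleR_scaleC)
qed

lemma tangent_deriv_const: "tangent_deriv A p v (%q. k) = 0"
 by (simp add: tangent_deriv_chd chd_const)

lemma nabF_scaleC: "open U ==> p \<in> U ==> smF U s ==> nabF p v (%q. c *\<^sub>c s q) = c *\<^sub>c nabF p v s"
 using nabF_mult[of U p "%q. c" s v] smooth_fun_const[of U c] by (simp add: tangent_deriv_const)

lemma nabF_scaleR: "open U ==> p \<in> U ==> smF U s ==> nabF p v (%q. c *\<^sub>R s q) = c *\<^sub>R nabF p v s"
 unfolding scaleR_scaleC by (rule nabF_scaleC)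

lemma nabF_zero: "nabF p v (%q. 0) = 0"
 using nabF_scaleC[of UNIV p "%q. 0" v 0] smF_zero[of UNIV] by simp

lemma nabF_neg: "open U ==> p \<in> U ==> smF U s ==> nabF p v (%q. - s q) = - nabF p v s"
 using nabF_scaleR[of U p s v "-1"] by simp

lemma nabF_diff: "open U ==> p \<in> U ==> smF U s ==> smF U t ==> nabF p v (%q. s q - t q) = nabF p v s - nabF p v t"
 using nabF_add[of U p s "%q. - t q" v] smF_neg nabF_neg by simp

lemma nabF_sum: "open U ==> p \<in> U ==> (!!i. i \<in> I ==> smF U (s i)) ==> nabF p v (%q. \<Sum>i\<in>I. s i q) = (\<Sum>i\<in>I. nabF p v (s i))"
proof (induction I rule: infinite_finite_induct)
 case (insert x F)
 then show ?case using nabF_add[of U p "s x" "%q. \<Sum>i\<in>F. s i q" v] smF_sum[of U F s] by simp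
qed (simp_all add: nabF_zero)

subsection \<open>Christoffel symbols\<close>

text \<open>The Christoffel symbols as a bilinear map in \<open>u\<close> and \<open>y\<close>, with
  the result in components of \<open>c\<close>, so that they can be differentiated as functions of
  the point.\<close>

definition Gam :: "('m, 'n) chart => real ^ 'n => 'm => real ^ 'n => real ^ 'n"
 where "Gam c u q y = chart_comp A c q (nab q (coord_field A c u q) (coord_field A c y))"

lemma smooth_vf_const: "c \<in> A ==> smooth_vf A (fst c) (coord_field A c y)"
 using smooth_vf_coord[OF _ open_chart(1) order_refl smooth_fun_const[OF open_chart(1), of c y]] by simp

lemma coord_field_Gam: "c \<in> A ==> q \<in> fst c ==> coord_field A c (Gam c u q y) q = nab q (coord_field A c u q) (coord_field A c y)"
 unfolding Gam_def by (rule coord_field_chart_comp)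

lemma smooth_Gam:
 assumes c: "c \<in> A" shows "smooth_fun A (fst c) (%q. Gam c u q y)"
proof -
 have "smooth_vf A (fst c) (%p. nab p (coord_field A c u p) (coord_field A c y))"
  by (rule connT_D(4)[OF open_chart(1)[OF c] smooth_vf_const[OF c] smooth_vf_const[OF c]])
 from smooth_vfD[OF this c] show ?thesis unfolding Gam_def by simp
qed

lemma nab_linear: "open U ==> p \<in> U ==> smooth_vf A U X ==> linear (%v. nab p v X)"
 by (rule connT_D(1)[OF nearI])

lemma nab_cong: "open U ==> p \<in> U ==> smooth_vf A U X ==> smooth_vf A U Y ==> (!!q. q \<in> U ==> X q = Y q) ==> nab p v X = nab p v Y"
 by (rule connection_cong[OF connT _ _ , of U]) auto

lemma smooth_vf_cong:
 assumes "open U" "!!q. q \<in> U ==> X q = Y q" "smooth_vf A U X"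
 shows "smooth_vf A U Y"
 unfolding smooth_vf_def
proof
 fix d assume d: "d \<in> A"
 show "smooth_fun A (U \<inter> fst d) (%q. chart_comp A d q (Y q))"
  by (rule smooth_fun_cong[OF open_Int[OF assms(1) open_chart(1)[OF d]] _ smooth_vfD[OF assms(3) d]])
   (simp add: assms(2))
qed

lemma coord_field_expand:
 assumes "c \<in> A" "q \<in> fst c"
 shows "coord_field A c y q = (\<Sum>i\<in>UNIV. (y $ i) *\<^sub>R coord_field A c (axis i 1) q)"
 by (rule linear_axis_expansion[OF linear_coord_field[OF assms]])

lemma smooth_vf_sum:
 assumes "c \<in> A" "open U" "U \<subseteq> fst c" "!!i. smooth_fun A U (g i)"
 shows "smooth_vf A U (%q. \<Sum>i\<in>I. g i q *\<^sub>R coord_field A c (a i) q)"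
proof -
 have "smooth_vf A U (%q. coord_field A c (\<Sum>i\<in>I. g i q *\<^sub>R a i) q)"
  by (intro smooth_vf_coord assms smooth_fun_sum smooth_fun_bilinear[OF _ bounded_bilinear_scaleR] smooth_fun_const)
 moreover have "coord_field A c (\<Sum>i\<in>I. g i q *\<^sub>R a i) q = (\<Sum>i\<in>I. g i q *\<^sub>R coord_field A c (a i) q)" if "q \<in> U" for q
 proof -
  have l: "linear (%v. coord_field A c v q)" using that assms(1,3) by (intro linear_coord_field) auto
  show ?thesis using linear_sum[OF l, of "%i. g i q *\<^sub>R a i" I] linear_scale[OF l] by simp
 qed
 ultimately show ?thesis by (rule smooth_vf_cong[OF assms(2), rotated])
qed

lemma nab_coord:
 assumes c: "c \<in> A" and U: "open U" "U \<subseteq> fst c" "p \<in> U" and g: "smooth_fun A U g"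
 shows "nab p v (%q. coord_field A c (g q) q) = coord_field A c (tangent_deriv A p v g) p + nab p v (coord_field A c (g p))"
proof -
 let ?e = "%i. coord_field A c (axis i 1)"
 have gi: "smooth_fun A U (%q. g q $ i)" for i by (rule smooth_fun_nth[OF U(1) g])
 have one: "smooth_vf A U (?e i)" for i
  using smooth_vf_coord[OF c U(1,2) smooth_fun_const[OF U(1), of "axis i 1"]] by simp
 have mult: "nab p v (%q. h q *\<^sub>R ?e i q) = tangent_deriv A p v h *\<^sub>R ?e i p + h p *\<^sub>R nab p v (?e i)" if "smooth_fun A U h" for h i
  by (rule connT_D(3)[OF near_fun[OF U(1,3) that] near_vf[OF U(1,3) one]])
 have vf: "smooth_vf A U (%q. \<Sum>i\<in>I. h i q *\<^sub>R ?e i q)" if "!!i. smooth_fun A U (h i)" for h I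
  by (rule smooth_vf_sum[OF c U(1,2) that])
 have vf1: "smooth_vf A U (%q. h q *\<^sub>R ?e i q)" if "smooth_fun A U h" for h i
  using vf[of "%_. h" "{i}"] that by simp
 have sum: "nab p v (%q. \<Sum>i\<in>I. h i q *\<^sub>R ?e i q) = (\<Sum>i\<in>I. tangent_deriv A p v (h i) *\<^sub>R ?e i p + h i p *\<^sub>R nab p v (?e i))"
  if h: "!!i. smooth_fun A U (h i)" and "finite I" for h I
  using that(2)
 proof (induction I)
  case empty
  \<comment> \<open>The zero field is read as 0 times a coordinate field, so that the Leibniz rule
    gives the value of the connection on it.\<close>
  have "nab p v (%q. 0 *\<^sub>R ?e undefined q) = 0"
   using mult[OF smooth_fun_const[OF U(1)], of 0] by (simp add: tangent_deriv_const)
  then show ?case by simp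
 next
  case (insert i I)
  have "nab p v (%q. h i q *\<^sub>R ?e i q + (\<Sum>i\<in>I. h i q *\<^sub>R ?e i q)) =
   nab p v (%q. h i q *\<^sub>R ?e i q) + nab p v (%q. \<Sum>i\<in>I. h i q *\<^sub>R ?e i q)"
   by (rule connT_D(2)[OF near_vf[OF U(1,3) vf1[OF h]] near_vf[OF U(1,3) vf[OF h]]])
  then show ?case using insert by (simp add: mult[OF h])
 qed
 have exp: "nab p v (%q. coord_field A c (h q) q) = (\<Sum>i\<in>UNIV. tangent_deriv A p v (%q. h q $ i) *\<^sub>R ?e i p + (h p $ i) *\<^sub>R nab p v (?e i))"
  if h: "smooth_fun A U h" for h
 proof -
  have "nab p v (%q. coord_field A c (h q) q) = nab p v (%q. \<Sum>i\<in>UNIV. (h q $ i) *\<^sub>R ?e i q)"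
   by (rule nab_cong[OF U(1,3) smooth_vf_coord[OF c U(1,2) h] vf])
    (use smooth_fun_nth[OF U(1) h] coord_field_expand[OF c] U(2) in auto)
  then show ?thesis using sum[of "%i q. h q $ i" UNIV] smooth_fun_nth[OF U(1) h] by simp
 qed
 have td: "tangent_deriv A p v (%q. g q $ i) = tangent_deriv A p v g $ i" for i
  unfolding tangent_deriv_chd by (rule chd_bounded_linear[OF bounded_linear_vec_nth g U(1,3) chart_at])
 have "p \<in> fst c" using U by auto
 from coord_field_expand[OF c this, of "tangent_deriv A p v g"] show ?thesis
  using exp[OF g] exp[OF smooth_fun_const[OF U(1), of "g p"]] by (simp add: td tangent_deriv_const sum.distrib)
qed

lemma linear_Gam:
 assumes "c \<in> A" "q \<in> fst c"
 shows "linear (%u. Gam c u q y)" "linear (Gam c u q)"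
proof -
 have l: "linear (%u. coord_field A c u q)" by (rule linear_coord_field[OF assms])
 have n: "linear (%v. nab q v (coord_field A c y))"
  by (rule nab_linear[OF open_chart(1)[OF assms(1)] assms(2) smooth_vf_const[OF assms(1)]])
 show "linear (%u. Gam c u q y)"
  unfolding Gam_def using linear_compose[OF linear_compose[OF l n] linear_chart_comp[OF assms]] by (simp add: o_def)
 have U: "open (fst c)" by (rule open_chart(1)[OF assms(1)])
 show "linear (Gam c u q)"
 proof (rule linearI)
  let ?v = "coord_field A c u q"
  have mult: "nab q ?v (%p. r *\<^sub>R coord_field A c b p) = r *\<^sub>R nab q ?v (coord_field A c b)" for r b
   using connT_D(3)[OF near_fun[OF U assms(2) smooth_fun_const[OF U, of r]] near_vf[OF U assms(2) smooth_vf_const[OF assms(1)]], of ?v b]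
   by (simp add: tangent_deriv_const)
  have sc: "coord_field A c (r *\<^sub>R b) p = r *\<^sub>R coord_field A c b p" if "p \<in> fst c" for r b p
   using linear_scale[OF linear_coord_field[OF assms(1) that]] by simp
  have "nab q ?v (coord_field A c (r *\<^sub>R b)) = nab q ?v (%p. r *\<^sub>R coord_field A c b p)" for r b
   by (rule nab_cong[OF U assms(2) smooth_vf_const[OF assms(1)]])
    (use smooth_vf_sum[OF assms(1) U order_refl smooth_fun_const[OF U, of r], of "%x. x" "{b}"] sc in auto)
  then show "Gam c u q (r *\<^sub>R b) = r *\<^sub>R Gam c u q b" for r b
   unfolding Gam_def by (simp add: mult linear_scale[OF linear_chart_comp[OF assms]])
  have "nab q ?v (coord_field A c (a + b)) = nab q ?v (%p. coord_field A c a p + coord_field A c b p)" for a b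
  proof (rule nab_cong[OF U assms(2) smooth_vf_const[OF assms(1)]])
   show "coord_field A c (a + b) p = coord_field A c a p + coord_field A c b p" if "p \<in> fst c" for p
    using linear_add[OF linear_coord_field[OF assms(1) that]] by simp
   then show "smooth_vf A (fst c) (%p. coord_field A c a p + coord_field A c b p)"
    by (rule smooth_vf_cong[OF U _ smooth_vf_const[OF assms(1), of "a + b"]])
  qed
  then show "Gam c u q (a + b) = Gam c u q a + Gam c u q b" for a b
   unfolding Gam_def
   using connT_D(2)[OF near_vf[OF U assms(2) smooth_vf_const[OF assms(1)]] near_vf[OF U assms(2) smooth_vf_const[OF assms(1)]], of ?v a b]
   by (simp add: linear_add[OF linear_chart_comp[OF assms]])
 qed
qed

end

lemma insS_linear_arg:
 assumes "wfib f"
 shows "insS (a + b) f = insS a f + insS b f" "insS (r *\<^sub>R a) f = smulC (of_real r) (insS a f)"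
  "insS (a - b) f = insS a f - insS b f" "insS (\<Sum>i\<in>I. g i) f = (\<Sum>i\<in>I. insS (g i) f)" "insS 0 f = 0"
proof -
 note l = wfib_linear_insS[OF assms]
 show "insS (a + b) f = insS a f + insS b f" "insS (r *\<^sub>R a) f = smulC (of_real r) (insS a f)"
  "insS (a - b) f = insS a f - insS b f" "insS (\<Sum>i\<in>I. g i) f = (\<Sum>i\<in>I. insS (g i) f)" "insS 0 f = 0"
  by (simp_all add: fun_eq_iff fun_ops smulC_def scaleC_of_real linear_add[OF l] linear_scale[OF l] linear_diff[OF l] linear_sum[OF l] linear_0[OF l])
qed

lemma insA_linear_arg:
 assumes "wfib f"
 shows "insA (a + b) f = insA a f + insA b f" "insA (r *\<^sub>R a) f = smulC (of_real r) (insA a f)"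
  "insA (a - b) f = insA a f - insA b f" "insA (\<Sum>i\<in>I. g i) f = (\<Sum>i\<in>I. insA (g i) f)" "insA 0 f = 0"
proof -
 note l = wfib_linear_insA[OF assms]
 show "insA (a + b) f = insA a f + insA b f" "insA (r *\<^sub>R a) f = smulC (of_real r) (insA a f)"
  "insA (a - b) f = insA a f - insA b f" "insA (\<Sum>i\<in>I. g i) f = (\<Sum>i\<in>I. insA (g i) f)" "insA 0 f = 0"
  by (simp_all add: fun_eq_iff fun_ops smulC_def scaleC_of_real linear_add[OF l] linear_scale[OF l] linear_diff[OF l] linear_sum[OF l] linear_0[OF l])
qed

lemma actS_expand:
 assumes "linear G" "wfib f"
 shows "actS G f = (\<Sum>k\<in>UNIV. dxS k (insS (G (axis k 1)) f))"
proof (intro ext)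
 fix ys vs show "actS G f ys vs = (\<Sum>k\<in>UNIV. dxS k (insS (G (axis k 1)) f)) ys vs"
  using assms(2)
 proof (induction ys arbitrary: f)
  case Nil then show ?case by (simp add: fun_ops)
 next
  case (Cons w ys)
  have 1: "insS (G w) f = (\<Sum>k\<in>UNIV. smulC (of_real (w $ k)) (insS (G (axis k 1)) f))"
   unfolding linear_axis_expansion[OF assms(1), of w] insS_linear_arg[OF Cons.prems] ..
  have "insS w (actS G f) ys vs = insS w (\<Sum>k\<in>UNIV. dxS k (insS (G (axis k 1)) f)) ys vs"
   unfolding act_ins insS_sum insS_dxS sum.distrib 1[symmetric] plus_fun_apply wfib_insS_comm[OF Cons.prems, of w]
    Cons.IH[OF wfib_insS[OF Cons.prems], of w] ..
  then show ?case by (simp add: insS_def)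
 qed
qed

lemma actA_expand:
 assumes "linear G" "wfib f"
 shows "actA G f = (\<Sum>k\<in>UNIV. dxA k (insA (G (axis k 1)) f))"
proof (intro ext)
 fix ys vs show "actA G f ys vs = (\<Sum>k\<in>UNIV. dxA k (insA (G (axis k 1)) f)) ys vs"
  using assms(2)
 proof (induction vs arbitrary: f)
  case Nil then show ?case by (simp add: fun_ops)
 next
  case (Cons w vs)
  have 1: "insA (G w) f = (\<Sum>k\<in>UNIV. smulC (of_real (w $ k)) (insA (G (axis k 1)) f))"
   unfolding linear_axis_expansion[OF assms(1), of w] insA_linear_arg[OF Cons.prems] ..
  have 2: "dxA k (insA w (insA u f)) = - dxA k (insA u (insA w f))" for k u
   by (subst wfib_insA_comm[OF Cons.prems]) (simp only: dxA_linear)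
  have "insA w (actA G f) ys vs = insA w (\<Sum>k\<in>UNIV. dxA k (insA (G (axis k 1)) f)) ys vs"
   unfolding act_ins insA_sum insA_dxA 2 diff_minus_eq_add sum.distrib 1[symmetric] plus_fun_apply
    Cons.IH[OF wfib_insA[OF Cons.prems], of w] ..
  then show ?case by (simp add: insA_def)
 qed
qed

lemma linear_act:
 assumes f: "wfib f" and G: "!!y. linear (%u. G u y)"
 shows "linear (%u. actS (G u) f ys vs)" "linear (%u. actA (G u) f ys vs)"
proof -
 have 1: "linear (%u. f (ys[j := G u (ys ! j)]) vs)" if "j < length ys" for j
  using linear_compose[OF G wfibD(1)[OF f, of "take j ys" "drop (Suc j) ys" vs], of "ys ! j"] that
  by (simp add: o_def upd_conv_take_nth_drop)
 have 2: "linear (%u. f ys (vs[j := G u (vs ! j)]))" if "j < length vs" for j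
  using linear_compose[OF G wfibD(2)[OF f, of ys "take j vs" "drop (Suc j) vs"], of "vs ! j"] that
  by (simp add: o_def upd_conv_take_nth_drop)
 show "linear (%u. actS (G u) f ys vs)" "linear (%u. actA (G u) f ys vs)"
  unfolding actS_def actA_def using 1 2 by (auto intro!: linear_compose_sum)
qed

context cbundle
begin

text \<open>The argument lists are fixed while the point varies. For the components of a form in one
  chart, fixed vectors stand for vector fields with constant components.\<close>

definition SF :: "'m set => ('m => ('n, 'f) fib) => bool"
 where "SF U F \<longleftrightarrow> (\<forall>ys vs. smF U (%q. F q ys vs))"

lemma SFD: "SF U F ==> smF U (%q. F q ys vs)"
 by (simp add: SF_def)

lemma SF_subset: "SF U F ==> V \<subseteq> U ==> open V ==> SF V F"
 unfolding SF_def using smF_subset by blast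

lemma SF_cong:
 assumes "open U" "!!q. q \<in> U ==> F q = G q" "SF U F" shows "SF U G"
 unfolding SF_def
proof (intro allI)
 fix ys vs show "smF U (%q. G q ys vs)"
  by (rule smF_cong[OF assms(1) _ SFD[OF assms(3), of ys vs]]) (simp add: assms(2))
qed

lemma SF_ops:
 assumes U: "open U" and F: "SF U F"
 shows "SF U G ==> SF U (%q. F q + G q)" "SF U G ==> SF U (%q. F q - G q)" "SF U (%q. - F q)"
  "SF U (%q. smulC k (F q))" "smooth_fun A U g ==> SF U (%q. smulC (of_real (g q)) (F q))"
  "SF U (%q. insS w (F q))" "SF U (%q. insA w (F q))" "SF U (%q. par (F q))"
  "SF U (%q. dxA i (F q))" "SF U (%q. dxS i (F q))"
 using F unfolding SF_def fun_ops smulC_def insS_def insA_def par_def dxA_def dxS_def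
 by (auto intro!: smF_add smF_diff smF_neg smF_scaleC smF_mult smooth_fun_of_real smF_scaleR smF_sum U)

lemma SF_zero: "open U ==> SF U (%q. 0)"
 by (simp add: SF_def fun_ops smF_zero)

lemma SF_sum: "open U ==> (!!i. i \<in> I ==> SF U (F i)) ==> SF U (%q. \<Sum>i\<in>I. F i q)"
 unfolding SF_def fun_ops by (auto intro!: smF_sum)

definition dF :: "('m, 'n) chart => real ^ 'n => ('m => 'f) => 'm => 'f"
 where "dF c u s q = nabF q (coord_field A c u q) s"

text \<open>The covariant derivative along the coordinate field with components \<open>u\<close>,
  read on components in the chart \<open>c\<close>.\<close>

definition NN :: "('m, 'n) chart => real ^ 'n => ('m => ('n, 'f) fib) => 'm => ('n, 'f) fib"
 where "NN c u F q = (%ys vs. dF c u (%p. F p ys vs) q) - actS (Gam c u q) (F q) - actA (Gam c u q) (F q)"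

definition DD :: "('m, 'n) chart => ('m => ('n, 'f) fib) => 'm => ('n, 'f) fib"
 where "DD c F q = (\<Sum>i\<in>UNIV. dxA i (NN c (axis i 1) F q))"

lemma NN_cong:
 assumes "c \<in> A" "open U" "q \<in> U" "SF U F" "!!p. p \<in> U ==> F p = G p"
 shows "NN c u F q = NN c u G q"
proof -
 have "dF c u (%p. F p ys vs) q = dF c u (%p. G p ys vs) q" for ys vs
  unfolding dF_def by (rule nabF_cong[OF assms(2,3) SFD[OF assms(4)]]) (simp add: assms(5))
 then show ?thesis unfolding NN_def using assms(5)[OF assms(3)] by simp
qed

lemma smF_dF: "c \<in> A ==> smF (fst c) s ==> smF (fst c) (dF c u s)"
 unfolding dF_def[abs_def] by (rule connF_D(4)[OF open_chart(1) smooth_vf_const])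

lemma SF_insS_var:
 assumes c: "c \<in> A" and F: "SF (fst c) F" and w: "!!p. p \<in> fst c ==> wfib (F p)" and g: "smooth_fun A (fst c) g"
 shows "SF (fst c) (%p. insS (g p) (F p))" "SF (fst c) (%p. insA (g p) (F p))"
proof -
 note U = open_chart(1)[OF c]
 have 1: "SF (fst c) (%p. \<Sum>i\<in>UNIV. smulC (of_real (g p $ i)) (insS (axis i 1) (F p)))"
  "SF (fst c) (%p. \<Sum>i\<in>UNIV. smulC (of_real (g p $ i)) (insA (axis i 1) (F p)))"
  by (intro SF_sum SF_ops U F smooth_fun_nth g)+
 show "SF (fst c) (%p. insS (g p) (F p))"
  by (rule SF_cong[OF U _ 1(1)]) (rule insS_expand[OF w, symmetric])
 show "SF (fst c) (%p. insA (g p) (F p))"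
  by (rule SF_cong[OF U _ 1(2)]) (rule insA_expand[OF w, symmetric])
qed

context
 fixes c q
 assumes c: "c \<in> A" and q: "q \<in> fst c"
begin

lemma U: "open (fst c)" by (rule open_chart(1)[OF c])

lemma dF_ops:
 assumes s: "smF (fst c) s"
 shows "smF (fst c) t ==> dF c u (%p. s p + t p) q = dF c u s q + dF c u t q"
  "smF (fst c) t ==> dF c u (%p. s p - t p) q = dF c u s q - dF c u t q"
  "dF c u (%p. - s p) q = - dF c u s q" "dF c u (%p. k *\<^sub>c s p) q = k *\<^sub>c dF c u s q"
  "dF c u (%p. r *\<^sub>R s p) q = r *\<^sub>R dF c u s q"
  "smooth_fun A (fst c) g ==> dF c u (%p. g p *\<^sub>R s p) q = chd c g q u *\<^sub>R s q + g q *\<^sub>R dF c u s q"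
 unfolding dF_def
 by (auto simp: nabF_add[OF U q s] nabF_diff[OF U q s] nabF_neg[OF U q s] nabF_scaleC[OF U q s] nabF_scaleR[OF U q s]
   nabF_multR[OF U q _ s] tangent_deriv_coord_field[OF _ U q c q])

lemma dF_sum: "(!!i. i \<in> I ==> smF (fst c) (s i)) ==> dF c u (%p. \<Sum>i\<in>I. s i p) q = (\<Sum>i\<in>I. dF c u (s i) q)"
 unfolding dF_def by (rule nabF_sum[OF U q])

lemma dF_linear: "smF (fst c) s ==> linear (%u. dF c u s q)"
 unfolding dF_def using linear_compose[OF linear_coord_field[OF c q] nabF_linear[OF U q]] by (simp add: o_def)

text \<open>In the last two rules a Christoffel term appears because an argument with constant
  components need not be parallel.\<close>

lemma NN_ops:
 assumes F: "SF (fst c) F"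
 shows "SF (fst c) G ==> NN c u (%p. F p + G p) q = NN c u F q + NN c u G q"
  "SF (fst c) G ==> NN c u (%p. F p - G p) q = NN c u F q - NN c u G q"
  "NN c u (%p. - F p) q = - NN c u F q"
  "NN c u (%p. smulC k (F p)) q = smulC k (NN c u F q)"
  "smooth_fun A (fst c) g ==> NN c u (%p. smulC (of_real (g p)) (F p)) q = smulC (of_real (chd c g q u)) (F q) + smulC (of_real (g q)) (NN c u F q)"
  "NN c u (%p. insS w (F p)) q = insS w (NN c u F q) + insS (Gam c u q w) (F q)"
  "NN c u (%p. insA w (F p)) q = insA w (NN c u F q) + insA (Gam c u q w) (F q)"
proof -
 note s = SFD[OF F]
 show "SF (fst c) G ==> NN c u (%p. F p + G p) q = NN c u F q + NN c u G q"
  by (simp add: NN_def fun_eq_iff fun_ops dF_ops[OF s] SFD act_linear)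
 show "SF (fst c) G ==> NN c u (%p. F p - G p) q = NN c u F q - NN c u G q"
  by (simp add: NN_def fun_eq_iff fun_ops dF_ops[OF s] SFD act_linear)
 show "NN c u (%p. - F p) q = - NN c u F q"
  by (simp add: NN_def fun_eq_iff fun_ops dF_ops[OF s] act_linear)
 show "NN c u (%p. smulC k (F p)) q = smulC k (NN c u F q)"
  by (simp add: NN_def fun_eq_iff fun_ops dF_ops[OF s] act_linear smulC_apply scaleC_diff_right)
 show "smooth_fun A (fst c) g ==> NN c u (%p. smulC (of_real (g p)) (F p)) q = smulC (of_real (chd c g q u)) (F q) + smulC (of_real (g q)) (NN c u F q)"
  by (simp add: NN_def fun_eq_iff fun_ops dF_ops[OF s] act_linear smulC_apply scaleC_diff_right scaleC_of_real scaleR_right_diff_distrib)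
 show "NN c u (%p. insS w (F p)) q = insS w (NN c u F q) + insS (Gam c u q w) (F q)"
  by (simp add: NN_def insS_linear act_ins) (simp add: insS_def)
 show "NN c u (%p. insA w (F p)) q = insA w (NN c u F q) + insA (Gam c u q w) (F q)"
  by (simp add: NN_def insA_linear act_ins) (simp add: insA_def)
qed

lemma NN_sum:
 assumes "!!i. i \<in> I ==> SF (fst c) (F i)"
 shows "NN c u (%p. \<Sum>i\<in>I. F i p) q = (\<Sum>i\<in>I. NN c u (F i) q)"
 using assms SFD by (simp add: NN_def fun_eq_iff fun_ops dF_sum act_sum sum_subtractf)

lemma NN_linear:
 assumes F: "SF (fst c) F" and w: "wfib (F q)"
 shows "linear (%u. NN c u F q ys vs)"
 unfolding NN_def fun_ops
 by (intro linear_compose_sub dF_linear SFD[OF F] linear_act[OF w] linear_Gam[OF c q])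

lemma wfib_NN:
 assumes F: "SF (fst c) F" and w: "!!p. p \<in> fst c ==> wfib (F p)"
 shows "wfib (NN c u F q)"
proof (rule wfib_coinduct)
 \<comment> \<open>An insertion commutes with \<open>NN\<close> up to a Christoffel term; the
   summand \<open>g\<close> absorbs these corrections, so the class is closed under
   insertions.\<close>
 let ?P = "%h. \<exists>F g. SF (fst c) F \<and> (\<forall>p\<in>fst c. wfib (F p)) \<and> wfib g \<and> h = NN c u F q + g"
 show "?P (NN c u F q)"
  by (rule exI[of _ F], rule exI[of _ 0]) (simp add: F w wfib_zero)
 fix h assume "?P h"
 then obtain F g where F: "SF (fst c) F" and w: "!!p. p \<in> fst c ==> wfib (F p)" and g: "wfib g" and h: "h = NN c u F q + g"
  by blast
 have S: "insS x h = NN c u (%p. insS x (F p)) q + (insS x g - insS (Gam c u q x) (F q))" for x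
  by (simp add: h NN_ops(6)[OF F] insS_linear)
 have a: "insA x h = NN c u (%p. insA x (F p)) q + (insA x g - insA (Gam c u q x) (F q))" for x
  by (simp add: h NN_ops(7)[OF F] insA_linear)
 show "?P (insS x h)" for x
  by (rule exI[of _ "%p. insS x (F p)"], rule exI[of _ "insS x g - insS (Gam c u q x) (F q)"])
   (simp add: S SF_ops[OF U F] wfib_insS wfib_diff w g q)
 show "?P (insA x h)" for x
  by (rule exI[of _ "%p. insA x (F p)"], rule exI[of _ "insA x g - insA (Gam c u q x) (F q)"])
   (simp add: a SF_ops[OF U F] wfib_insA wfib_diff w g q)
 have Gl: "linear (Gam c u q)" by (rule linear_Gam[OF c q])
 have lin1: "linear (%x. insS (Gam c u q x) (F q) ys vs)" "linear (%x. insA (Gam c u q x) (F q) ys vs)" for ys vs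
  using linear_compose[OF Gl wfib_linear_insS[OF w[OF q]]] linear_compose[OF Gl wfib_linear_insA[OF w[OF q]]] by (simp_all add: o_def)
 have lin2: "linear (%x. dF c u (%p. F p (ys @ x # ys') vs) q)" "linear (%x. dF c u (%p. F p ys (vs @ x # vs')) q)" for ys ys' vs vs'
 proof -
  have *: "linear (%x. dF c u (%p. H p x) q)" if H: "!!x. smF (fst c) (%p. H p x)" and l: "!!p. p \<in> fst c ==> linear (H p)" for H :: "'m => real ^ 'n => 'f"
  proof (rule linearI)
   have "dF c u (%p. H p (x + y)) q = dF c u (%p. H p x + H p y) q" for x y
    unfolding dF_def by (rule nabF_cong[OF U q H]) (rule linear_add[OF l])
   then show "dF c u (%p. H p (x + y)) q = dF c u (%p. H p x) q + dF c u (%p. H p y) q" for x y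
    by (simp add: dF_ops(1)[OF H H])
   have "dF c u (%p. H p (r *\<^sub>R x)) q = dF c u (%p. r *\<^sub>R H p x) q" for r x
    unfolding dF_def by (rule nabF_cong[OF U q H]) (rule linear_scale[OF l])
   then show "dF c u (%p. H p (r *\<^sub>R x)) q = r *\<^sub>R dF c u (%p. H p x) q" for r x
    by (simp add: dF_ops(5)[OF H])
  qed
  show "linear (%x. dF c u (%p. F p (ys @ x # ys') vs) q)" "linear (%x. dF c u (%p. F p ys (vs @ x # vs')) q)"
   by (rule *[OF SFD[OF F]], rule wfibD[OF w], assumption)+
 qed
 have lin3: "linear (%x. actS (Gam c u q) (insS x (F q)) ys vs)" "linear (%x. actA (Gam c u q) (insS x (F q)) ys vs)"
   "linear (%x. actS (Gam c u q) (insA x (F q)) ys vs)" "linear (%x. actA (Gam c u q) (insA x (F q)) ys vs)" for ys vs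
  unfolding actS_def actA_def
  by (intro linear_compose_sum ballI wfib_linear_insS wfib_linear_insA w q)+
 show "linear (%x. insS x h ys vs)" for ys vs
  unfolding S NN_def fun_ops
  using lin2(1)[of "[]" ys vs] by (intro linear_compose_add linear_compose_sub lin1 lin3 wfib_linear_insS g) (simp add: insS_def)
 show "linear (%x. insA x h ys vs)" for ys vs
  unfolding a NN_def fun_ops
  using lin2(2)[of ys "[]" vs] by (intro linear_compose_add linear_compose_sub lin1 lin3 wfib_linear_insA g) (simp add: insA_def)
 have S2: "insS y (NN c u (%p. insS x (F p)) q) = NN c u (%p. insS y (insS x (F p))) q - insS (Gam c u q y) (insS x (F q))" for x y
  by (simp add: NN_ops(6)[OF SF_ops(6)[OF U F]])
 have A2: "insA y (NN c u (%p. insA x (F p)) q) = NN c u (%p. insA y (insA x (F p))) q - insA (Gam c u q y) (insA x (F q))" for x y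
  by (simp add: NN_ops(7)[OF SF_ops(7)[OF U F]])
 show "insS y (insS x h) = insS x (insS y h)" for x y
 proof -
  have "NN c u (%p. insS y (insS x (F p))) q = NN c u (%p. insS x (insS y (F p))) q"
   by (rule NN_cong[OF c U q]) (auto intro!: SF_ops U F wfib_insS_comm w)
  then show ?thesis
   using wfib_insS_comm[OF w[OF q], of "Gam c u q y" x] wfib_insS_comm[OF w[OF q], of "Gam c u q x" y] wfib_insS_comm[OF g, of x y]
   by (simp add: S S2 insS_linear)
 qed
 show "insA y (insA x h) = - insA x (insA y h)" for x y
 proof -
  have "NN c u (%p. insA y (insA x (F p))) q = NN c u (%p. - insA x (insA y (F p))) q"
   by (rule NN_cong[OF c U q]) (auto intro!: SF_ops U F wfib_insA_comm w)
  also have "\<dots> = - NN c u (%p. insA x (insA y (F p))) q"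
   by (intro NN_ops SF_ops U F)
  finally show ?thesis
   using wfib_insA_comm[OF w[OF q], of "Gam c u q y" x] wfib_insA_comm[OF w[OF q], of "Gam c u q x" y] wfib_insA_comm[OF g, of x y]
   by (simp add: a A2 insA_linear)
 qed
qed

lemma NN_insS_var:
 assumes F: "SF (fst c) F" and w: "!!p. p \<in> fst c ==> wfib (F p)" and g: "smooth_fun A (fst c) g"
 shows "NN c u (%p. insS (g p) (F p)) q = insS (g q) (NN c u F q) + insS (chd c g q u + Gam c u q (g q)) (F q)"
proof -
 let ?G = "%i p. smulC (of_real (g p $ i)) (insS (axis i 1) (F p))"
 have "NN c u (%p. insS (g p) (F p)) q = NN c u (%p. \<Sum>i\<in>UNIV. ?G i p) q"
  by (rule NN_cong[OF c U q SF_insS_var(1)[OF c F w g]]) (auto intro: insS_expand w)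
 also have "\<dots> = (\<Sum>i\<in>UNIV. NN c u (?G i) q)"
  by (intro NN_sum SF_ops U F smooth_fun_nth g)
 also have "\<dots> = (\<Sum>i\<in>UNIV. smulC (of_real (chd c g q u $ i)) (insS (axis i 1) (F q)) + smulC (of_real (g q $ i)) (insS (axis i 1) (NN c u F q) + insS (Gam c u q (axis i 1)) (F q)))"
  by (intro sum.cong refl)
   (simp add: NN_ops(5)[OF SF_ops(6)[OF U F] smooth_fun_nth[OF U g]] NN_ops(6)[OF F] chd_bounded_linear[OF bounded_linear_vec_nth g U q c q])
 also have "\<dots> = insS (chd c g q u) (F q) + (insS (g q) (NN c u F q) + (\<Sum>i\<in>UNIV. smulC (of_real (g q $ i)) (insS (Gam c u q (axis i 1)) (F q))))"
  by (simp only: smulC_add_right sum.distrib insS_expand[OF w[OF q], of "chd c g q u", symmetric] insS_expand[OF wfib_NN[OF F w], of "g q", symmetric])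
 also have "(\<Sum>i\<in>UNIV. smulC (of_real (g q $ i)) (insS (Gam c u q (axis i 1)) (F q))) = insS (Gam c u q (g q)) (F q)"
  unfolding linear_axis_expansion[OF linear_Gam(2)[OF c q], of u "g q"] insS_linear_arg[OF w[OF q]] ..
 finally show ?thesis by (simp add: insS_linear_arg[OF w[OF q]] add_ac)
qed

lemma NN_insA_var:
 assumes F: "SF (fst c) F" and w: "!!p. p \<in> fst c ==> wfib (F p)" and g: "smooth_fun A (fst c) g"
 shows "NN c u (%p. insA (g p) (F p)) q = insA (g q) (NN c u F q) + insA (chd c g q u + Gam c u q (g q)) (F q)"
proof -
 let ?G = "%i p. smulC (of_real (g p $ i)) (insA (axis i 1) (F p))"
 have "NN c u (%p. insA (g p) (F p)) q = NN c u (%p. \<Sum>i\<in>UNIV. ?G i p) q"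
  by (rule NN_cong[OF c U q SF_insS_var(2)[OF c F w g]]) (auto intro: insA_expand w)
 also have "\<dots> = (\<Sum>i\<in>UNIV. NN c u (?G i) q)"
  by (intro NN_sum SF_ops U F smooth_fun_nth g)
 also have "\<dots> = (\<Sum>i\<in>UNIV. smulC (of_real (chd c g q u $ i)) (insA (axis i 1) (F q)) + smulC (of_real (g q $ i)) (insA (axis i 1) (NN c u F q) + insA (Gam c u q (axis i 1)) (F q)))"
  by (intro sum.cong refl)
   (simp add: NN_ops(5)[OF SF_ops(7)[OF U F] smooth_fun_nth[OF U g]] NN_ops(7)[OF F] chd_bounded_linear[OF bounded_linear_vec_nth g U q c q])
 also have "\<dots> = insA (chd c g q u) (F q) + (insA (g q) (NN c u F q) + (\<Sum>i\<in>UNIV. smulC (of_real (g q $ i)) (insA (Gam c u q (axis i 1)) (F q))))"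
  by (simp only: smulC_add_right sum.distrib insA_expand[OF w[OF q], of "chd c g q u", symmetric] insA_expand[OF wfib_NN[OF F w], of "g q", symmetric])
 also have "(\<Sum>i\<in>UNIV. smulC (of_real (g q $ i)) (insA (Gam c u q (axis i 1)) (F q))) = insA (Gam c u q (g q)) (F q)"
  unfolding linear_axis_expansion[OF linear_Gam(2)[OF c q], of u "g q"] insA_linear_arg[OF w[OF q]] ..
 finally show ?thesis by (simp add: insA_linear_arg[OF w[OF q]] add_ac)
qed

lemma NN_dxA:
 assumes F: "SF (fst c) F"
 shows "NN c u (%p. dxA i (F p)) q = dxA i (NN c u F q) - (\<Sum>m\<in>UNIV. smulC (of_real (Gam c u q (axis m 1) $ i)) (dxA m (F q)))"
proof -
 have "dF c u (%p. dxA i (F p) ys vs) q = dxA i (%ys vs. dF c u (%p. F p ys vs) q) ys vs" for ys vs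
  unfolding dxA_def by (subst dF_sum) (auto intro!: smF_scaleR U SFD[OF F] sum.cong dF_ops)
 then have 1: "(%ys vs. dF c u (%p. dxA i (F p) ys vs) q) = dxA i (%ys vs. dF c u (%p. F p ys vs) q)"
  by blast
 show ?thesis
  unfolding NN_def 1 actS_dxA actA_dxA[OF linear_Gam(2)[OF c q]] dxA_linear by simp
qed

end

lemma SF_act:
 assumes c: "c \<in> A" and F: "SF (fst c) F" and w: "!!p. p \<in> fst c ==> wfib (F p)"
 shows "SF (fst c) (%q. actS (Gam c u q) (F q))" "SF (fst c) (%q. actA (Gam c u q) (F q))"
proof -
 note U = open_chart(1)[OF c]
 have 1: "SF (fst c) (%q. \<Sum>k\<in>UNIV. dxS k (insS (Gam c u q (axis k 1)) (F q)))"
  "SF (fst c) (%q. \<Sum>k\<in>UNIV. dxA k (insA (Gam c u q (axis k 1)) (F q)))"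
  by (intro SF_sum SF_ops SF_insS_var[OF c F w] U smooth_Gam c; assumption)+
 show "SF (fst c) (%q. actS (Gam c u q) (F q))"
  by (rule SF_cong[OF U _ 1(1)]) (rule actS_expand[OF linear_Gam(2)[OF c] w, symmetric])
 show "SF (fst c) (%q. actA (Gam c u q) (F q))"
  by (rule SF_cong[OF U _ 1(2)]) (rule actA_expand[OF linear_Gam(2)[OF c] w, symmetric])
qed

lemma SF_NN:
 assumes c: "c \<in> A" and F: "SF (fst c) F" and w: "!!p. p \<in> fst c ==> wfib (F p)"
 shows "SF (fst c) (NN c u F)"
proof -
 note U = open_chart(1)[OF c]
 have 1: "SF (fst c) (%q ys vs. dF c u (%p. F p ys vs) q)"
  unfolding SF_def using smF_dF[OF c] SFD[OF F] by simp
 show ?thesis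
  unfolding NN_def[abs_def] by (intro SF_ops(2) U 1 SF_act[OF c F w]; assumption)
qed

lemma SF_DD:
 assumes c: "c \<in> A" and F: "SF (fst c) F" and w: "!!p. p \<in> fst c ==> wfib (F p)"
 shows "SF (fst c) (DD c F)"
 unfolding DD_def[abs_def] by (intro SF_sum SF_ops SF_NN[OF c F w] open_chart c)

lemma wfib_DD:
 assumes c: "c \<in> A" and q: "q \<in> fst c" and F: "SF (fst c) F" and w: "!!p. p \<in> fst c ==> wfib (F p)"
 shows "wfib (DD c F q)"
 unfolding DD_def by (intro wfib_sum wfib_dxA wfib_NN[OF c q F w])

end

context cbundle
begin

subsection \<open>Curvature\<close>

lemma Gam_sym:
 assumes tf: "torsion_free A nab" and c: "c \<in> A" and q: "q \<in> fst c"
 shows "Gam c u q y = Gam c y q u"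
proof -
 have n: "near (smooth_vf A) q (coord_field A c y)" for y
  by (rule near_vf[OF open_chart(1)[OF c] q smooth_vf_const[OF c]])
 have "nab q (coord_field A c u q) (coord_field A c y) - nab q (coord_field A c y q) (coord_field A c u) = 0"
  using tf[unfolded torsion_free_def, rule_format, OF conjI[OF n n], of u y] lie_bracket_coord[OF c q, of u y] by simp
 then show ?thesis unfolding Gam_def by simp
qed

text \<open>The curvature endomorphism of the tangent connection in components. The bracket term is
  missing because coordinate fields commute.\<close>

definition Rc :: "('m, 'n) chart => real ^ 'n => real ^ 'n => 'm => real ^ 'n => real ^ 'n"
 where "Rc c u w q y = (chd c (%p. Gam c w p y) q u + Gam c u q (Gam c w q y)) - (chd c (%p. Gam c u p y) q w + Gam c w q (Gam c u q y))"

definition Kc :: "('m, 'n) chart => real ^ 'n => real ^ 'n => ('m => 'f) => 'm => 'f"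
 where "Kc c u w s q = dF c u (dF c w s) q - dF c w (dF c u s) q"

lemma nab_nab:
 assumes c: "c \<in> A" and q: "q \<in> fst c"
 shows "nab q (coord_field A c u q) (%p. nab p (coord_field A c w p) (coord_field A c y)) =
  coord_field A c (chd c (%p. Gam c w p y) q u + Gam c u q (Gam c w q y)) q"
proof -
 note U = open_chart(1)[OF c]
 have vf: "smooth_vf A (fst c) (%p. coord_field A c (Gam c w p y) p)"
  by (rule smooth_vf_coord[OF c U order_refl smooth_Gam[OF c]])
 have vf2: "smooth_vf A (fst c) (%p. nab p (coord_field A c w p) (coord_field A c y))"
  by (rule smooth_vf_cong[OF U coord_field_Gam[OF c] vf])
 have "nab q (coord_field A c u q) (%p. nab p (coord_field A c w p) (coord_field A c y)) =
   nab q (coord_field A c u q) (%p. coord_field A c (Gam c w p y) p)"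
  by (rule nab_cong[OF U q vf2 vf]) (rule coord_field_Gam[OF c, symmetric])
 also have "\<dots> = coord_field A c (chd c (%p. Gam c w p y) q u) q + coord_field A c (Gam c u q (Gam c w q y)) q"
  by (simp only: nab_coord[OF c U order_refl q smooth_Gam[OF c]] coord_field_Gam[OF c q]
   tangent_deriv_coord_field[OF smooth_Gam[OF c] U q c q])
 also have "\<dots> = coord_field A c (chd c (%p. Gam c w p y) q u + Gam c u q (Gam c w q y)) q"
  using linear_add[OF linear_coord_field[OF c q]] by simp
 finally show ?thesis .
qed

lemma curvature_Rc:
 assumes c: "c \<in> A" and q: "q \<in> fst c"
 shows "curvature A nab (coord_field A c u) (coord_field A c w) (coord_field A c y) q = coord_field A c (Rc c u w q y) q"
proof -
 have "nab q 0 (coord_field A c y) = 0"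
  using linear_0[OF nab_linear[OF open_chart(1)[OF c] q smooth_vf_const[OF c]]] .
 then show ?thesis
  unfolding curvature_def lie_bracket_coord[OF c q] nab_nab[OF c q] Rc_def
  using linear_diff[OF linear_coord_field[OF c q]] by simp
qed

text \<open>The first Bianchi identity: by symmetry of the Christoffel symbols the derivative terms
  and the quadratic terms cancel in pairs over the cyclic sum.\<close>

lemma bianchi:
 assumes tf: "torsion_free A nab" and c: "c \<in> A" and q: "q \<in> fst c"
 shows "Rc c u w q y + Rc c w y q u + Rc c y u q w = 0"
proof -
 have "chd c (%p. Gam c a p b) q x = chd c (%p. Gam c b p a) q x" for a b x
  by (subst chd_cong[OF open_chart(1)[OF c] q c q Gam_sym[OF tf c]], assumption) (rule refl)
 moreover have "Gam c a q b = Gam c b q a" for a b by (rule Gam_sym[OF tf c q])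
 ultimately have
  "chd c (%p. Gam c w p y) q u = chd c (%p. Gam c y p w) q u" "Gam c w q y = Gam c y q w"
  "chd c (%p. Gam c u p y) q w = chd c (%p. Gam c y p u) q w" "Gam c u q y = Gam c y q u"
  "chd c (%p. Gam c w p u) q y = chd c (%p. Gam c u p w) q y" "Gam c w q u = Gam c u q w"
  by blast+
 then show ?thesis unfolding Rc_def by (simp add: algebra_simps)
qed

lemma linear_Rc:
 assumes c: "c \<in> A" and q: "q \<in> fst c"
 shows "linear (Rc c u w q)"
proof -
 note U = open_chart(1)[OF c]
 have 1: "linear (%y. chd c (%p. Gam c w p y) q u)" for w u
 proof (rule linearI)
  have "chd c (%p. Gam c w p (a + b)) q = chd c (%p. Gam c w p a + Gam c w p b) q" for a b
   by (rule chd_cong[OF U q c q]) (rule linear_add[OF linear_Gam(2)[OF c]])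
  then show "chd c (%p. Gam c w p (a + b)) q u = chd c (%p. Gam c w p a) q u + chd c (%p. Gam c w p b) q u" for a b
   by (simp add: chd_add[OF smooth_Gam[OF c] smooth_Gam[OF c] U q c q])
  have "chd c (%p. Gam c w p (r *\<^sub>R a)) q = chd c (%p. r *\<^sub>R Gam c w p a) q" for r a
   by (rule chd_cong[OF U q c q]) (rule linear_scale[OF linear_Gam(2)[OF c]])
  then show "chd c (%p. Gam c w p (r *\<^sub>R a)) q u = r *\<^sub>R chd c (%p. Gam c w p a) q u" for r a
   by (simp add: chd_bounded_linear[OF bounded_linear_scaleR_right smooth_Gam[OF c] U q c q])
 qed
 have 2: "linear (%y. Gam c u q (Gam c w q y))" for u w
  using linear_compose[OF linear_Gam(2)[OF c q] linear_Gam(2)[OF c q]] by (simp add: o_def)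
 show ?thesis
  unfolding Rc_def[abs_def] by (intro linear_compose_sub linear_compose_add 1 2)
qed

text \<open>The two terms with a single derivative are exchanged when \<open>u\<close> and
  \<open>x\<close> are exchanged, so they drop out of the commutator; the last term antisymmetrises
  to \<open>Rc\<close>.\<close>

lemma NN_NN_insS:
 assumes c: "c \<in> A" and q: "q \<in> fst c" and F: "SF (fst c) F" and w: "!!p. p \<in> fst c ==> wfib (F p)"
 shows "insS y (NN c u (NN c x F) q) = NN c u (NN c x (%p. insS y (F p))) q
   - insS (Gam c x q y) (NN c u F q) - insS (Gam c u q y) (NN c x F q)
   - insS (chd c (%p. Gam c x p y) q u + Gam c u q (Gam c x q y)) (F q)"
proof -
 note U = open_chart(1)[OF c]
 note N = SF_NN[OF c F w] and iF = SF_ops(6)[OF U F] and iw = wfib_insS[OF w]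
 have "NN c u (%p. insS y (NN c x F p)) q = NN c u (%p. NN c x (%p. insS y (F p)) p - insS (Gam c x p y) (F p)) q"
  by (rule NN_cong[OF c U q SF_ops(6)[OF U N]]) (simp_all add: NN_ops(6)[OF c _ F])
 also have "\<dots> = NN c u (NN c x (%p. insS y (F p))) q - NN c u (%p. insS (Gam c x p y) (F p)) q"
  by (rule NN_ops(2)[OF c q SF_NN[OF c iF iw] SF_insS_var(1)[OF c F w smooth_Gam[OF c]]])
 finally show ?thesis
  using NN_ops(6)[OF c q N, of u y] NN_insS_var[OF c q F w smooth_Gam[OF c], of u x y] by (simp add: algebra_simps)
qed

lemma NN_NN_insA:
 assumes c: "c \<in> A" and q: "q \<in> fst c" and F: "SF (fst c) F" and w: "!!p. p \<in> fst c ==> wfib (F p)"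
 shows "insA y (NN c u (NN c x F) q) = NN c u (NN c x (%p. insA y (F p))) q
   - insA (Gam c x q y) (NN c u F q) - insA (Gam c u q y) (NN c x F q)
   - insA (chd c (%p. Gam c x p y) q u + Gam c u q (Gam c x q y)) (F q)"
proof -
 note U = open_chart(1)[OF c]
 note N = SF_NN[OF c F w] and iF = SF_ops(7)[OF U F] and iw = wfib_insA[OF w]
 have "NN c u (%p. insA y (NN c x F p)) q = NN c u (%p. NN c x (%p. insA y (F p)) p - insA (Gam c x p y) (F p)) q"
  by (rule NN_cong[OF c U q SF_ops(7)[OF U N]]) (simp_all add: NN_ops(7)[OF c _ F])
 also have "\<dots> = NN c u (NN c x (%p. insA y (F p))) q - NN c u (%p. insA (Gam c x p y) (F p)) q"
  by (rule NN_ops(2)[OF c q SF_NN[OF c iF iw] SF_insS_var(2)[OF c F w smooth_Gam[OF c]]])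
 finally show ?thesis
  using NN_ops(7)[OF c q N, of u y] NN_insA_var[OF c q F w smooth_Gam[OF c], of u x y] by (simp add: algebra_simps)
qed

text \<open>The Ricci identity. Under insertions both sides change by the same curvature term, so it
  suffices to compare them at empty argument lists, where only the fibre connection is left.\<close>

lemma NN_comm:
 assumes c: "c \<in> A" and q: "q \<in> fst c" and F: "SF (fst c) F" and w: "!!p. p \<in> fst c ==> wfib (F p)"
 shows "NN c u (NN c x F) q - NN c x (NN c u F) q =
  (%ys vs. Kc c u x (%p. F p ys vs) q) - actS (Rc c u x q) (F q) - actA (Rc c u x q) (F q)"
proof (intro ext)
 note U = open_chart(1)[OF c]
 let ?C = "%F. NN c u (NN c x F) q - NN c x (NN c u F) q"
 let ?D = "%F. (%ys vs. Kc c u x (%p. F p ys vs) q) - actS (Rc c u x q) (F q) - actA (Rc c u x q) (F q)"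
 have CS: "insS y (?C F) = ?C (%p. insS y (F p)) - insS (Rc c u x q y) (F q)"
  if "SF (fst c) F" "!!p. p \<in> fst c ==> wfib (F p)" for F y
 proof -
  have r: "insS (Rc c u x q y) (F q) = (insS (chd c (%p. Gam c x p y) q u + Gam c u q (Gam c x q y)) (F q)) -
    insS (chd c (%p. Gam c u p y) q x + Gam c x q (Gam c u q y)) (F q)"
   unfolding Rc_def by (rule insS_linear_arg(3)[OF that(2)[OF q]])
  show ?thesis
   unfolding r insS_linear(2)
   by (subst NN_NN_insS[OF c q that], assumption, subst NN_NN_insS[OF c q that], assumption, simp)
 qed
 have CA: "insA y (?C F) = ?C (%p. insA y (F p)) - insA (Rc c u x q y) (F q)"
  if "SF (fst c) F" "!!p. p \<in> fst c ==> wfib (F p)" for F y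
 proof -
  have r: "insA (Rc c u x q y) (F q) = (insA (chd c (%p. Gam c x p y) q u + Gam c u q (Gam c x q y)) (F q)) -
    insA (chd c (%p. Gam c u p y) q x + Gam c x q (Gam c u q y)) (F q)"
   unfolding Rc_def by (rule insA_linear_arg(3)[OF that(2)[OF q]])
  show ?thesis
   unfolding r insA_linear(2)
   by (subst NN_NN_insA[OF c q that], assumption, subst NN_NN_insA[OF c q that], assumption, simp)
 qed
 have DS: "insS y (?D F) = ?D (%p. insS y (F p)) - insS (Rc c u x q y) (F q)" for F y
  by (simp add: insS_linear act_ins) (simp add: insS_def)
 have DA: "insA y (?D F) = ?D (%p. insA y (F p)) - insA (Rc c u x q y) (F q)" for F y
  by (simp add: insA_linear act_ins) (simp add: insA_def)
 fix ys vs
 show "?C F ys vs = ?D F ys vs"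
  using F w
 proof (induction ys arbitrary: F)
  case Nil
  then show ?case
  proof (induction vs arbitrary: F)
   case Nil
   show ?case by (simp add: fun_ops NN_def Kc_def[abs_def])
  next
   case (Cons y vs)
   have "?C (%p. insA y (F p)) [] vs = ?D (%p. insA y (F p)) [] vs"
    using Cons.prems by (intro Cons.IH SF_ops(7) U wfib_insA)
   moreover have "insA y (?C F) [] vs = (?C (%p. insA y (F p)) - insA (Rc c u x q y) (F q)) [] vs"
    by (rule CA[THEN fun_cong, THEN fun_cong, OF Cons.prems])
   moreover have "insA y (?D F) [] vs = (?D (%p. insA y (F p)) - insA (Rc c u x q y) (F q)) [] vs"
    by (rule DA[THEN fun_cong, THEN fun_cong])
   ultimately have "insA y (?C F) [] vs = insA y (?D F) [] vs"
    by (simp only: minus_apply)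
   then show ?case by (simp only: insA_def)
  qed
 next
  case (Cons y ys)
  have "?C (%p. insS y (F p)) ys vs = ?D (%p. insS y (F p)) ys vs"
   using Cons.prems by (intro Cons.IH SF_ops(6) U wfib_insS)
  moreover have "insS y (?C F) ys vs = (?C (%p. insS y (F p)) - insS (Rc c u x q y) (F q)) ys vs"
    by (rule CS[THEN fun_cong, THEN fun_cong, OF Cons.prems])
   moreover have "insS y (?D F) ys vs = (?D (%p. insS y (F p)) - insS (Rc c u x q y) (F q)) ys vs"
    by (rule DS[THEN fun_cong, THEN fun_cong])
   ultimately have "insS y (?C F) ys vs = insS y (?D F) ys vs"
    by (simp only: minus_apply)
  then show ?case by (simp only: insS_def)
 qed
qed

end

lemma dxA_swap_sum:
 "(\<Sum>j\<in>UNIV. \<Sum>i\<in>UNIV. dxA j (dxA i (H j i :: ('n::finite, 'f::complex_fibre) fib))) = - (\<Sum>j\<in>UNIV. \<Sum>i\<in>UNIV. dxA j (dxA i (H i j)))"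
proof -
 have "(\<Sum>j\<in>UNIV. \<Sum>i\<in>UNIV. dxA j (dxA i (H j i))) = (\<Sum>i\<in>UNIV. \<Sum>j\<in>UNIV. dxA j (dxA i (H j i)))"
  by (rule sum.swap)
 also have "\<dots> = (\<Sum>i\<in>UNIV. \<Sum>j\<in>UNIV. - dxA i (dxA j (H j i)))"
  by (intro sum.cong refl dxA_anticomm)
 finally show ?thesis by (simp only: sum_negf)
qed

lemma fib_half: "smulC (1 / 2) (f + f) = f"
proof -
 have "smulC (1 / 2) (f + f) = smulC (1 / 2 + 1 / 2) f"
  by (simp only: smulC_add_right smulC_add_left)
 then show ?thesis by simp
qed

lemma dxA_antisym_half:
 "(\<Sum>j\<in>UNIV. \<Sum>i\<in>UNIV. dxA j (dxA i (H j i :: ('n::finite, 'f::complex_fibre) fib))) =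
  smulC (1 / 2) (\<Sum>j\<in>UNIV. \<Sum>i\<in>UNIV. dxA j (dxA i (H j i - H i j)))"
proof -
 let ?S = "\<Sum>j\<in>UNIV. \<Sum>i\<in>UNIV. dxA j (dxA i (H j i))"
 have "(\<Sum>j\<in>UNIV. \<Sum>i\<in>UNIV. dxA j (dxA i (H j i - H i j))) = ?S + ?S"
  by (simp only: dxA_linear sum_subtractf) (subst (2) dxA_swap_sum[of H], simp)
 then show ?thesis using fib_half[of ?S] by simp
qed

lemma dxA_sym_zero:
 fixes H :: "'n::finite => 'n => ('n, 'f::complex_fibre) fib"
 assumes "!!i j. H i j = H j i"
 shows "(\<Sum>j\<in>UNIV. \<Sum>i\<in>UNIV. dxA j (dxA i (H j i))) = 0"
 using dxA_antisym_half[of H] assms by (simp add: dxA_linear)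

lemma fib_third:
 fixes f :: "('n::finite, 'f::complex_fibre) fib"
 assumes "f + f + f = 0" shows "f = 0"
proof (intro ext)
 fix ys vs
 have "f ys vs + f ys vs + f ys vs = 0" using fun_cong[OF fun_cong[OF assms]] by (simp add: fun_ops)
 then have "(3::real) *\<^sub>R f ys vs = 0" by (simp add: scaleR_left_distrib[of 2 1, simplified] scaleR_2)
 then show "f ys vs = 0 ys vs" by (simp add: fun_ops)
qed

text \<open>A product of three one-forms is unchanged by cyclic rotation, so three times the sum is
  the sum over the cyclic combinations, which vanish.\<close>

lemma dxA_cyclic_zero:
 fixes H :: "'n::finite => 'n => 'n => ('n, 'f::complex_fibre) fib"
 assumes "!!j i k. H j i k + H i k j + H k j i = 0"
 shows "(\<Sum>j\<in>UNIV. \<Sum>i\<in>UNIV. dxA j (dxA i (\<Sum>k\<in>UNIV. dxA k (H j i k)))) = 0"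
proof -
 let ?S = "%H. \<Sum>j\<in>UNIV. \<Sum>i\<in>UNIV. \<Sum>k\<in>UNIV. dxA j (dxA i (dxA k (H j i k :: ('n, 'f) fib)))"
 have cyc: "dxA i (dxA k (dxA j f)) = dxA j (dxA i (dxA k f))" for i j k and f :: "('n, 'f) fib"
  by (subst dxA_anticomm[of k j f], subst dxA_linear, subst dxA_anticomm[of i j]) simp
 have rot: "?S (%j i k. H i k j) = ?S H" for H
 proof -
  have "?S (%j i k. H i k j) = (\<Sum>i\<in>UNIV. \<Sum>j\<in>UNIV. \<Sum>k\<in>UNIV. dxA j (dxA i (dxA k (H i k j))))"
   by (rule sum.swap)
  also have "\<dots> = (\<Sum>i\<in>UNIV. \<Sum>k\<in>UNIV. \<Sum>j\<in>UNIV. dxA j (dxA i (dxA k (H i k j))))"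
   by (intro sum.cong refl sum.swap)
  also have "\<dots> = ?S H" by (simp only: cyc[symmetric])
  finally show ?thesis .
 qed
 have "?S H + ?S H + ?S H = ?S H + ?S (%j i k. H i k j) + ?S (%j i k. H k j i)"
  using rot[of H] rot[of "%j i k. H i k j"] by simp
 also have "\<dots> = ?S (%j i k. H j i k + H i k j + H k j i)"
  by (simp only: dxA_linear sum.distrib)
 also have "\<dots> = 0" by (simp add: assms dxA_linear)
 finally have "?S H = 0" by (rule fib_third)
 then show ?thesis by (simp add: dxA_sum)
qed

context cbundle
begin

text \<open>The Christoffel terms from differentiating the one-forms cancel since the torsion
  vanishes, and the action of the curvature on the form arguments cancels by the Bianchi identity.
  The fibre curvature and the action on the symmetric arguments remain.\<close>

lemma DD_DD:
 assumes tf: "torsion_free A nab" and c: "c \<in> A" and q: "q \<in> fst c" and F: "SF (fst c) F" and w: "!!p. p \<in> fst c ==> wfib (F p)"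
 shows "DD c (DD c F) q = smulC (1 / 2) (\<Sum>j\<in>UNIV. \<Sum>i\<in>UNIV. dxA j (dxA i
   ((%ys vs. Kc c (axis j 1) (axis i 1) (%p. F p ys vs) q) - actS (Rc c (axis j 1) (axis i 1) q) (F q))))"
proof -
 note U = open_chart(1)[OF c]
 let ?e = "%i. axis i 1 :: real ^ 'n"
 note N = SF_NN[OF c F w]
 have 1: "NN c u (DD c F) q = (\<Sum>i\<in>UNIV. dxA i (NN c u (NN c (?e i) F) q)) - (\<Sum>i\<in>UNIV. \<Sum>m\<in>UNIV. smulC (of_real (Gam c u q (?e m) $ i)) (dxA m (NN c (?e i) F q)))" for u
 proof -
  have "NN c u (DD c F) q = (\<Sum>i\<in>UNIV. NN c u (%p. dxA i (NN c (?e i) F p)) q)"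
   unfolding DD_def[abs_def] by (rule NN_sum[OF c q SF_ops(9)[OF U N]])
  then show ?thesis by (simp only: NN_dxA[OF c q N] sum_subtractf)
 qed
 \<comment> \<open>A sum symmetric in \<open>j\<close> and \<open>m\<close> against an antisymmetric
   product of one-forms.\<close>
 have 2: "(\<Sum>j\<in>UNIV. dxA j (\<Sum>i\<in>UNIV. \<Sum>m\<in>UNIV. smulC (of_real (Gam c (?e j) q (?e m) $ i)) (dxA m (NN c (?e i) F q)))) = 0"
 proof -
  have "(\<Sum>j\<in>UNIV. dxA j (\<Sum>i\<in>UNIV. \<Sum>m\<in>UNIV. smulC (of_real (Gam c (?e j) q (?e m) $ i)) (dxA m (NN c (?e i) F q)))) =
    (\<Sum>i\<in>UNIV. \<Sum>j\<in>UNIV. \<Sum>m\<in>UNIV. dxA j (dxA m (smulC (of_real (Gam c (?e j) q (?e m) $ i)) (NN c (?e i) F q))))"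
   by (simp only: dxA_sum dxA_linear) (rule sum.swap)
  also have "\<dots> = (\<Sum>i\<in>(UNIV :: 'n set). 0)"
   by (rule sum.cong[OF refl], rule dxA_sym_zero, subst Gam_sym[OF tf c q], rule refl)
  finally show ?thesis by simp
 qed
 have "DD c (DD c F) q = (\<Sum>j\<in>UNIV. dxA j (NN c (?e j) (DD c F) q))"
  by (simp only: DD_def[of c "DD c F"])
 also have "\<dots> = (\<Sum>j\<in>UNIV. \<Sum>i\<in>UNIV. dxA j (dxA i (NN c (?e j) (NN c (?e i) F) q)))"
  unfolding 1 dxA_linear sum_subtractf 2 by (simp add: dxA_sum)
 also have "\<dots> = smulC (1 / 2) (\<Sum>j\<in>UNIV. \<Sum>i\<in>UNIV. dxA j (dxA i (NN c (?e j) (NN c (?e i) F) q - NN c (?e i) (NN c (?e j) F) q)))"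
  by (rule dxA_antisym_half)
 also have "\<dots> = smulC (1 / 2) ((\<Sum>j\<in>UNIV. \<Sum>i\<in>UNIV. dxA j (dxA i
   ((%ys vs. Kc c (?e j) (?e i) (%p. F p ys vs) q) - actS (Rc c (?e j) (?e i) q) (F q)))) -
    (\<Sum>j\<in>UNIV. \<Sum>i\<in>UNIV. dxA j (dxA i (actA (Rc c (?e j) (?e i) q) (F q)))))"
 proof -
  have "NN c u (NN c x F) q - NN c x (NN c u F) q =
    (%ys vs. Kc c u x (%p. F p ys vs) q) - actS (Rc c u x q) (F q) - actA (Rc c u x q) (F q)" for u x
   by (rule NN_comm[OF c q F w])
  then show ?thesis by (simp only: dxA_linear sum_subtractf)
 qed
 also have "(\<Sum>j\<in>UNIV. \<Sum>i\<in>UNIV. dxA j (dxA i (actA (Rc c (?e j) (?e i) q) (F q)))) = 0"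
  unfolding actA_expand[OF linear_Rc[OF c q] w[OF q]]
 proof (rule dxA_cyclic_zero)
  fix j i k
  have "insA (Rc c (?e j) (?e i) q (?e k)) (F q) + insA (Rc c (?e i) (?e k) q (?e j)) (F q) + insA (Rc c (?e k) (?e j) q (?e i)) (F q)
   = insA (Rc c (?e j) (?e i) q (?e k) + Rc c (?e i) (?e k) q (?e j) + Rc c (?e k) (?e j) q (?e i)) (F q)"
   by (simp only: insA_linear_arg[OF w[OF q]])
  also have "\<dots> = 0" unfolding bianchi[OF tf c q] by (rule insA_linear_arg(5)[OF w[OF q]])
  finally show "insA (Rc c (?e j) (?e i) q (?e k)) (F q) + insA (Rc c (?e i) (?e k) q (?e j)) (F q) + insA (Rc c (?e k) (?e j) q (?e i)) (F q) = 0" .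
 qed
 finally show ?thesis by simp
qed

subsection \<open>Independence of the chart\<close>

text \<open>The Leibniz rule for a multilinear expression whose arguments also depend on the point:
  the arguments are frozen one after another, each contributing its own derivative.\<close>

lemma nabF_product:
 assumes U: "open U" "q \<in> U" and F: "SF U F" "!!p. p \<in> U ==> wfib (F p)"
  and W: "!!w. w \<in> set W ==> smooth_fun A U w" and Z: "!!w. w \<in> set Z ==> smooth_fun A U w"
 shows "smF U (%p. F p (map (%w. w p) W) (map (%w. w p) Z)) \<and>
  nabF q v (%p. F p (map (%w. w p) W) (map (%w. w p) Z)) =
  nabF q v (%p. F p (map (%w. w q) W) (map (%w. w q) Z)) +
  (\<Sum>j<length W. F q ((map (%w. w q) W)[j := tangent_deriv A q v (W ! j)]) (map (%w. w q) Z)) +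
  (\<Sum>j<length Z. F q (map (%w. w q) W) ((map (%w. w q) Z)[j := tangent_deriv A q v (Z ! j)]))"
 using F W
proof (induction W arbitrary: F)
 let ?e = "%i. axis i 1 :: real ^ 'n"
 have td: "tangent_deriv A q v (%p. w p $ i) = tangent_deriv A q v w $ i" if "smooth_fun A U w" for w :: "'m => real ^ 'n" and i
  unfolding tangent_deriv_chd by (rule chd_bounded_linear[OF bounded_linear_vec_nth that U chart_at])
 \<comment> \<open>A single moving slot is expanded in the basis, where the Leibniz rule for
   functions applies; the derivative with frozen argument stays in expanded form.\<close>
 have step: "smF U (%p. H p (w p)) \<and> nabF q v (%p. H p (w p)) = H q (tangent_deriv A q v w) + (\<Sum>i\<in>UNIV. (w q $ i) *\<^sub>R nabF q v (%p. H p (?e i)))"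
  if H: "!!i. smF U (%p. H p (?e i))" "!!p. p \<in> U ==> linear (H p)" and w: "smooth_fun A U w" for H :: "'m => real ^ 'n => 'f" and w
 proof -
  have eq: "(\<Sum>i\<in>UNIV. (w p $ i) *\<^sub>R H p (?e i)) = H p (w p)" if "p \<in> U" for p
   by (rule linear_axis_expansion[OF H(2)[OF that], symmetric])
  have sm: "smF U (%p. (w p $ i) *\<^sub>R H p (?e i))" for i
   by (intro smF_multR U smooth_fun_nth w H)
  have sm2: "smF U (%p. \<Sum>i\<in>UNIV. (w p $ i) *\<^sub>R H p (?e i))" by (intro smF_sum U sm)
  have "nabF q v (%p. H p (w p)) = nabF q v (%p. \<Sum>i\<in>UNIV. (w p $ i) *\<^sub>R H p (?e i))"
   by (rule nabF_cong[OF U sm2 eq, symmetric])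
  also have "\<dots> = (\<Sum>i\<in>UNIV. (tangent_deriv A q v w $ i) *\<^sub>R H q (?e i) + (w q $ i) *\<^sub>R nabF q v (%p. H p (?e i)))"
   by (simp add: nabF_sum[OF U sm] nabF_multR[OF U smooth_fun_nth[OF U(1) w] H(1)] td[OF w])
  finally show ?thesis
   using smF_cong[OF U(1) eq sm2] by (simp add: sum.distrib flip: linear_axis_expansion[OF H(2)[OF U(2)]])
 qed
 { case Nil
  show ?case using Nil(1,2) Z
  proof (induction Z arbitrary: F)
   case Nil then show ?case by (simp add: SFD)
  next
   case (Cons z Z)
   have IH: "smF U (%p. F p [] (x # map (%w. w p) Z)) \<and>
    nabF q v (%p. F p [] (x # map (%w. w p) Z)) = nabF q v (%p. F p [] (x # map (%w. w q) Z)) +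
     (\<Sum>j<length Z. F q [] (x # (map (%w. w q) Z)[j := tangent_deriv A q v (Z ! j)]))" for x
    using Cons.IH[of "%p. insA x (F p)"] Cons.prems U by (simp add: SF_ops wfib_insA) (simp add: insA_def)
   have z: "smooth_fun A U z" using Cons.prems by simp
   have l: "linear (%x. F p [] (x # vs))" if "p \<in> U" for p vs
    using wfibD(2)[OF Cons.prems(2)[OF that], of "[]" "[]" vs] by simp
   note s1 = step[of "%p x. F p [] (x # map (%w. w p) Z)" z, OF conjunct1[OF IH] l z]
   \<comment> \<open>The same expansion with a constant argument in the slot, used to reassemble the
     basis sum produced by \<open>s1\<close>.\<close>
   note s2 = step[of "%p x. F p [] (x # map (%w. w q) Z)" "%p. z q", OF SFD[OF Cons.prems(1)] l smooth_fun_const[OF U(1)]]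
   have "(\<Sum>i\<in>UNIV. (z q $ i) *\<^sub>R (\<Sum>j<length Z. F q [] (?e i # (map (%w. w q) Z)[j := tangent_deriv A q v (Z ! j)]))) =
    (\<Sum>j<length Z. F q [] (z q # (map (%w. w q) Z)[j := tangent_deriv A q v (Z ! j)]))"
    unfolding scaleR_sum_right by (subst sum.swap) (simp flip: linear_axis_expansion[OF l[OF U(2)]])
   then show ?case
    using s1 s2 linear_0[OF l[OF U(2)]] IH by (simp add: tangent_deriv_const sum.lessThan_Suc_shift scaleR_right_distrib sum.distrib del: sum.lessThan_Suc)
  qed
 next
  case (Cons z W)
  have IH: "smF U (%p. F p (x # map (%w. w p) W) (map (%w. w p) Z)) \<and>
    nabF q v (%p. F p (x # map (%w. w p) W) (map (%w. w p) Z)) = nabF q v (%p. F p (x # map (%w. w q) W) (map (%w. w q) Z)) +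
     (\<Sum>j<length W. F q (x # (map (%w. w q) W)[j := tangent_deriv A q v (W ! j)]) (map (%w. w q) Z)) +
     (\<Sum>j<length Z. F q (x # map (%w. w q) W) ((map (%w. w q) Z)[j := tangent_deriv A q v (Z ! j)]))" for x
   using Cons.IH[of "%p. insS x (F p)"] Cons.prems U by (simp add: SF_ops wfib_insS) (simp add: insS_def)
  have z: "smooth_fun A U z" using Cons.prems by simp
  have l: "linear (%x. F p (x # ys) vs)" if "p \<in> U" for p ys vs
   using wfibD(1)[OF Cons.prems(2)[OF that], of "[]" ys vs] by simp
  note s1 = step[of "%p x. F p (x # map (%w. w p) W) (map (%w. w p) Z)" z, OF conjunct1[OF IH] l z]
  note s2 = step[of "%p x. F p (x # map (%w. w q) W) (map (%w. w q) Z)" "%p. z q", OF SFD[OF Cons.prems(1)] l smooth_fun_const[OF U(1)]]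
  have "(\<Sum>i\<in>UNIV. (z q $ i) *\<^sub>R (\<Sum>j<length W. F q (?e i # (map (%w. w q) W)[j := tangent_deriv A q v (W ! j)]) (map (%w. w q) Z))) =
    (\<Sum>j<length W. F q (z q # (map (%w. w q) W)[j := tangent_deriv A q v (W ! j)]) (map (%w. w q) Z))"
   "(\<Sum>i\<in>UNIV. (z q $ i) *\<^sub>R (\<Sum>j<length Z. F q (?e i # map (%w. w q) W) ((map (%w. w q) Z)[j := tangent_deriv A q v (Z ! j)]))) =
    (\<Sum>j<length Z. F q (z q # map (%w. w q) W) ((map (%w. w q) Z)[j := tangent_deriv A q v (Z ! j)]))"
   unfolding scaleR_sum_right by (subst sum.swap, simp flip: linear_axis_expansion[OF l[OF U(2)]])+
  then show ?case
   using s1 s2 linear_0[OF l[OF U(2)]] IH by (simp add: tangent_deriv_const sum.lessThan_Suc_shift scaleR_right_distrib sum.distrib add_ac del: sum.lessThan_Suc)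
 }
qed

lemma coord_field_change:
 assumes "c \<in> A" "d \<in> A" "p \<in> fst c" "p \<in> fst d"
 shows "coord_field A c y p = coord_field A d (chd c (snd d) p y) p"
 using coord_field_chart_comp[OF assms(2,4), of "coord_field A c y p"] chart_comp_coord_field[OF assms] by simp

lemma smooth_transition_deriv:
 assumes "c \<in> A" "d \<in> A"
 shows "smooth_fun A (fst c \<inter> fst d) (%p. chd c (snd d) p y)"
 by (rule smooth_fun_chd[OF assms(1) _ _ smooth_fun_subset[OF smooth_fun_chart[OF assms(2)]]])
  (auto simp: open_chart assms)

text \<open>The transformation law of Christoffel symbols; the inhomogeneous term is the derivative
  of the Jacobian of the change of charts.\<close>

lemma Gam_change:
 assumes c: "c \<in> A" and d: "d \<in> A" and q: "q \<in> fst c" "q \<in> fst d"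
 shows "chd c (snd d) q (Gam c u q y) = tangent_deriv A q (coord_field A c u q) (%p. chd c (snd d) p y) +
  Gam d (chd c (snd d) q u) q (chd c (snd d) q y)"
proof -
 let ?U = "fst c \<inter> fst d" and ?g = "%p y. chd c (snd d) p y"
 have U: "open ?U" "?U \<subseteq> fst d" "q \<in> ?U" "?U \<subseteq> fst c" using q open_Int[OF open_chart(1)[OF c] open_chart(1)[OF d]] by auto
 have vf: "smooth_vf A ?U (coord_field A c y)" "smooth_vf A ?U (%p. coord_field A d (?g p y) p)"
  using smooth_vf_coord[OF c U(1,4) smooth_fun_const[OF U(1), of y]] smooth_vf_coord[OF d U(1,2) smooth_transition_deriv[OF c d]] by auto
 have "coord_field A d (?g q (Gam c u q y)) q = nab q (coord_field A c u q) (coord_field A c y)"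
  by (simp add: coord_field_change[OF c d q, symmetric] coord_field_Gam[OF c q(1)])
 also have "\<dots> = nab q (coord_field A c u q) (%p. coord_field A d (?g p y) p)"
  by (rule nab_cong[OF U(1,3) vf]) (rule coord_field_change[OF c d], auto)
 also have "\<dots> = coord_field A d (tangent_deriv A q (coord_field A c u q) (%p. ?g p y)) q + nab q (coord_field A c u q) (coord_field A d (?g q y))"
  by (rule nab_coord[OF d U(1-3) smooth_transition_deriv[OF c d]])
 also have "nab q (coord_field A c u q) (coord_field A d (?g q y)) = coord_field A d (Gam d (?g q u) q (?g q y)) q"
  by (simp add: coord_field_Gam[OF d q(2)] coord_field_change[OF c d q, of u])
 finally have "coord_field A d (?g q (Gam c u q y)) q = coord_field A d (tangent_deriv A q (coord_field A c u q) (%p. ?g p y) + Gam d (?g q u) q (?g q y)) q"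
  using linear_add[OF linear_coord_field[OF d q(2)]] by simp
 then have "chart_comp A d q (coord_field A d (?g q (Gam c u q y)) q) = chart_comp A d q (coord_field A d (tangent_deriv A q (coord_field A c u q) (%p. ?g p y) + Gam d (?g q u) q (?g q y)) q)"
  by simp
 then show ?thesis by (simp only: chart_comp_coord_field_same[OF d q(2)])
qed

lemma wfib_upd_add:
 assumes "wfib f"
 shows "j < length ys ==> f (ys[j := a + b]) vs = f (ys[j := a]) vs + f (ys[j := b]) vs"
  "j < length vs ==> f ys (vs[j := a + b]) = f ys (vs[j := a]) + f ys (vs[j := b])"
 using linear_add[OF wfibD(1)[OF assms, of "take j ys" "drop (Suc j) ys" vs], of a b]
  linear_add[OF wfibD(2)[OF assms, of ys "take j vs" "drop (Suc j) vs"], of a b]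
 by (simp_all add: upd_conv_take_nth_drop)

text \<open>By \<open>nabF_product\<close> the transported arguments contribute derivatives of the
  Jacobian, which are exactly the inhomogeneous terms in the transformation law of the Christoffel
  symbols.\<close>

lemma NN_change:
 assumes c: "c \<in> A" and d: "d \<in> A" and q: "q \<in> fst c" "q \<in> fst d"
  and F: "SF (fst d) F" "!!p. p \<in> fst d ==> wfib (F p)"
  and G: "!!p. p \<in> fst c ==> p \<in> fst d ==> G p = pull (chd c (snd d) p) (F p)" "SF (fst c) G"
 shows "NN c u G q = pull (chd c (snd d) q) (NN d (chd c (snd d) q u) F q)"
proof (intro ext)
 fix ys vs
 let ?U = "fst c \<inter> fst d" and ?g = "chd c (snd d)" and ?v = "coord_field A c u q"
 have U: "open ?U" "q \<in> ?U" "?U \<subseteq> fst c" "?U \<subseteq> fst d" using q open_Int[OF open_chart(1)[OF c] open_chart(1)[OF d]] by auto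
 have FU: "SF ?U F" "SF ?U G" using SF_subset[OF F(1)] SF_subset[OF G(2)] U by auto
 let ?W = "%ys. map (%y p. ?g p y) ys"
 have mW: "map (%w. w p) (?W ys) = map (?g p) ys" for p ys by (simp add: o_def)
 have "dF c u (%p. G p ys vs) q = nabF q ?v (%p. F p (map (%w. w p) (?W ys)) (map (%w. w p) (?W vs)))"
  unfolding dF_def mW by (rule nabF_cong[OF U(1,2) SFD[OF FU(2)]]) (simp add: G(1) pull_def)
 also have "\<dots> = nabF q ?v (%p. F p (map (?g q) ys) (map (?g q) vs)) +
  (\<Sum>j<length ys. F q ((map (?g q) ys)[j := tangent_deriv A q ?v (%p. ?g p (ys ! j))]) (map (?g q) vs)) +
  (\<Sum>j<length vs. F q (map (?g q) ys) ((map (?g q) vs)[j := tangent_deriv A q ?v (%p. ?g p (vs ! j))]))"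
  using nabF_product[OF U(1,2) FU(1), of "?W ys" "?W vs" ?v] F(2) smooth_transition_deriv[OF c d]
  unfolding mW length_map by auto
 finally have 1: "dF c u (%p. G p ys vs) q = \<dots>" .
 have 2: "nabF q ?v (%p. F p (map (?g q) ys) (map (?g q) vs)) = dF d (?g q u) (%p. F p (map (?g q) ys) (map (?g q) vs)) q"
  by (simp add: dF_def coord_field_change[OF c d q])
 have 3: "actS (Gam c u q) (G q) ys vs = (\<Sum>j<length ys. F q ((map (?g q) ys)[j := tangent_deriv A q ?v (%p. ?g p (ys ! j))]) (map (?g q) vs))
   + actS (Gam d (?g q u) q) (F q) (map (?g q) ys) (map (?g q) vs)"
  unfolding actS_def length_map sum.distrib[symmetric]
  by (intro sum.cong refl) (simp add: G(1)[OF q] pull_def map_update Gam_change[OF c d q] wfib_upd_add[OF F(2)[OF q(2)]])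
 have 4: "actA (Gam c u q) (G q) ys vs = (\<Sum>j<length vs. F q (map (?g q) ys) ((map (?g q) vs)[j := tangent_deriv A q ?v (%p. ?g p (vs ! j))]))
   + actA (Gam d (?g q u) q) (F q) (map (?g q) ys) (map (?g q) vs)"
  unfolding actA_def length_map sum.distrib[symmetric]
  by (intro sum.cong refl) (simp add: G(1)[OF q] pull_def map_update Gam_change[OF c d q] wfib_upd_add[OF F(2)[OF q(2)]])
 show "NN c u G q ys vs = pull (?g q) (NN d (?g q u) F q) ys vs"
  unfolding NN_def pull_def minus_apply 1 2 3 4 by simp
qed

lemma DD_change:
 assumes c: "c \<in> A" and d: "d \<in> A" and q: "q \<in> fst c" "q \<in> fst d"
  and F: "SF (fst d) F" "!!p. p \<in> fst d ==> wfib (F p)"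
  and G: "!!p. p \<in> fst c ==> p \<in> fst d ==> G p = pull (chd c (snd d) p) (F p)" "SF (fst c) G" "wfib (G q)"
 shows "DD c G q = pull (chd c (snd d) q) (DD d F q)"
proof -
 have "DD c G q = antiD (%u. NN c u G q)"
  unfolding DD_def by (rule sum_dxA_antiD[OF NN_linear[OF c q(1) G(2,3)]])
 also have "(%u. NN c u G q) = (%u. pull (chd c (snd d) q) (NN d (chd c (snd d) q u) F q))"
  by (rule ext, rule NN_change[OF c d q F G(1,2)])
 also have "antiD \<dots> = pull (chd c (snd d) q) (antiD (%u. NN d u F q))"
  by (rule pull_antiD[symmetric])
 also have "antiD (%u. NN d u F q) = DD d F q"
  unfolding DD_def by (rule sum_dxA_antiD[OF NN_linear[OF d q(2) F(1)], symmetric]) (rule F(2)[OF q(2)])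
 finally show ?thesis .
qed

end

section \<open>Forms in a chart\<close>

text \<open>Passes from values on tangent vectors, whose components refer to a chart depending on
  the point, to components in the single chart \<open>c\<close>.\<close>

definition frame :: "('m, 'n::finite) chart set => ('m, 'n) chart => ('m, 'n, 'f) wform => ('m, 'n, 'f) wform"
 where "frame A c \<Phi> = (%k q. pull (%y. coord_field A c y q) (\<Phi> k q))"

subsection \<open>The Poisson tensor\<close>

definition bmat :: "(real ^ 'n => real ^ 'n => real) => real ^ 'n::finite ^ 'n"
 where "bmat b = (\<chi> i j. b (axis i 1) (axis j 1))"

lemma poisson_bmat: "poisson \<omega> p k l = - (matrix_inv (bmat (\<omega> p)) $ k $ l)"
 by (simp add: poisson_def bmat_def)

lemma bilinear_expand:
 fixes b :: "real ^ 'n::finite => real ^ 'n => real"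
 assumes "bilinear b"
 shows "b u v = (\<Sum>i\<in>UNIV. \<Sum>j\<in>UNIV. u $ i * v $ j * bmat b $ i $ j)"
proof -
 have l: "linear (%u. b u v)" "linear (b u)" for u v using assms unfolding bilinear_def by auto
 have "b u v = (\<Sum>i\<in>UNIV. u $ i * b (axis i 1) v)"
  using linear_axis_expansion[OF l(1)[of v], of u] by simp
 also have "\<dots> = (\<Sum>i\<in>UNIV. u $ i * (\<Sum>j\<in>UNIV. v $ j * bmat b $ i $ j))"
 proof -
  have "b (axis i 1) v = (\<Sum>j\<in>UNIV. v $ j * bmat b $ i $ j)" for i
   using linear_axis_expansion[OF l(2)[of "axis i 1"], of v] by (simp add: bmat_def)
  then show ?thesis by simp
 qed
 finally show ?thesis by (simp add: sum_distrib_left mult.assoc)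
qed

lemma bmat_invertible:
 fixes b :: "real ^ 'n::finite => real ^ 'n => real"
 assumes b: "bilinear b" and nd: "!!v. (!!u. b u v = 0) ==> v = 0"
 shows "invertible (bmat b)"
proof -
 have "v = 0" if "bmat b *v v = 0" for v
 proof (rule nd)
  fix u
  have "(\<Sum>j\<in>UNIV. bmat b $ i $ j * v $ j) = 0" for i
   using that by (simp add: vec_eq_iff matrix_vector_mult_def)
  then have "(\<Sum>i\<in>UNIV. u $ i * (\<Sum>j\<in>UNIV. bmat b $ i $ j * v $ j)) = 0" by simp
  then show "b u v = 0"
   unfolding bilinear_expand[OF b, of u v] by (simp add: sum_distrib_left mult_ac)
 qed
 then show ?thesis
  unfolding invertible_left_inverse matrix_left_invertible_ker by blast
qed

lemma matrix_inv_unique: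
 fixes B Q :: "real ^ 'n::finite ^ 'n"
 assumes "B ** Q = mat 1" shows "matrix_inv B = Q"
proof -
 have "invertible B" using assms invertible_right_inverse by blast
 then have "matrix_inv B ** B = mat 1" by (rule matrix_inv_inverse)
 then have "matrix_inv B = matrix_inv B ** (B ** Q)" by (simp add: assms)
 also have "\<dots> = Q" by (simp add: matrix_mul_assoc \<open>matrix_inv B ** B = mat 1\<close>)
 finally show ?thesis .
qed

lemma matrix_mult_add_left: "(A + B) ** C = A ** C + B ** (C :: real ^ 'n::finite ^ 'n)"
 by (simp add: matrix_matrix_mult_def vec_eq_iff distrib_right sum.distrib)

text \<open>The Gram matrix transforms by \<open>transpose T\<close> on the left and
  \<open>T\<close> on the right, so its inverse transforms as a bivector.\<close>

lemma poisson_change: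
 fixes b :: "real ^ 'n::finite => real ^ 'n => real" and T :: "real ^ 'n => real ^ 'n"
 assumes b: "bilinear b" and T: "linear T" and inv: "invertible (bmat (%u v. b (T u) (T v)))"
 shows "matrix_inv (bmat b) $ i $ j =
  (\<Sum>k\<in>UNIV. \<Sum>l\<in>UNIV. matrix_inv (bmat (%u v. b (T u) (T v))) $ k $ l * (T (axis k 1) $ i) * (T (axis l 1) $ j))"
proof -
 let ?B' = "bmat (%u v. b (T u) (T v))" and ?B = "bmat b" and ?T = "matrix T"
 have eq: "?B' = transpose ?T ** (?B ** ?T)"
 proof (intro vec_eq_iff[THEN iffD2] allI)
  fix i j
  have "?B' $ i $ j = (\<Sum>k\<in>UNIV. \<Sum>l\<in>UNIV. T (axis i 1) $ k * T (axis j 1) $ l * ?B $ k $ l)"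
   using bilinear_expand[OF b, of "T (axis i 1)" "T (axis j 1)"] by (simp add: bmat_def)
  then show "?B' $ i $ j = (transpose ?T ** (?B ** ?T)) $ i $ j"
   by (simp add: matrix_matrix_mult_def transpose_def matrix_def sum_distrib_left mult_ac)
 qed
 have "?B' ** matrix_inv ?B' = mat 1" by (rule matrix_inv_inverse[OF inv])
 then have "transpose ?T ** (?B ** ?T ** matrix_inv ?B') = mat 1"
  by (simp add: eq matrix_mul_assoc)
 \<comment> \<open>For square matrices a one-sided inverse is two-sided, which allows
   \<open>transpose T\<close> to move to the other end of the product.\<close>
 then have "(?B ** ?T ** matrix_inv ?B') ** transpose ?T = mat 1"
  by (rule matrix_left_right_inverse[THEN iffD1])
 then have "?B ** (?T ** matrix_inv ?B' ** transpose ?T) = mat 1"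
  by (simp add: matrix_mul_assoc)
 from matrix_inv_unique[OF this] have "matrix_inv ?B = ?T ** matrix_inv ?B' ** transpose ?T" .
 then have "matrix_inv ?B $ i $ j = (\<Sum>l\<in>UNIV. \<Sum>k\<in>UNIV. T (axis k 1) $ i * matrix_inv ?B' $ k $ l * T (axis l 1) $ j)"
  by (simp add: matrix_matrix_mult_def transpose_def matrix_def sum_distrib_right)
 then show ?thesis by (subst sum.swap) (simp add: mult_ac)
qed

lemma wterm_frame:
 fixes \<Phi> :: "('m, 'n::finite, 'f::complex_fibre) wform" and \<Psi> :: "('m, 'n, 'g::complex_fibre) wform"
 assumes m: "cbilin m" and b: "bilinear (\<omega> q)" and T: "linear (%y. coord_field A c y q)"
  and inv: "invertible (bmat (%u v. \<omega> q (coord_field A c u q) (coord_field A c v q)))"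
  and w: "wfib (\<Phi> a q)" "wfib (\<Psi> b' q)"
 shows "pull (%y. coord_field A c y q) (wterm \<omega> m \<Phi> \<Psi> k q a b') =
  wterm (%q u v. \<omega> q (coord_field A c u q) (coord_field A c v q)) m (frame A c \<Phi>) (frame A c \<Psi>) k q a b'"
proof -
 let ?T = "%y. coord_field A c y q" and ?w = "%q u v. \<omega> q (coord_field A c u q) (coord_field A c v q)"
 have "poisson \<omega> q i j = (\<Sum>k\<in>UNIV. \<Sum>l\<in>UNIV. poisson ?w q k l * (?T (axis k 1) $ i) * (?T (axis l 1) $ j))" for i j
  unfolding poisson_bmat poisson_change[OF b T inv, of i j] by (simp add: sum_negf)
 from pull_Bn[OF m this w, of "nat (k - a - b')"]
 show ?thesis by (simp add: wterm_def pull_linear frame_def)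
qed

locale symplectic_bundle = cbundle A smF nabF nab
 for A :: "('m::{second_countable_topology, t2_space}, 'n::finite) chart set"
  and smF :: "'m set => ('m => 'f::complex_fibre) => bool" and nabF nab +
 fixes \<omega> :: "'m => real ^ 'n => real ^ 'n => real"
 assumes sympl: "symplectic_form A \<omega>" and symplc: "symplectic_conn A \<omega> nab"
begin

lemma omega: "bilinear (\<omega> p)" "\<omega> p u v = - \<omega> p v u"
 using sympl unfolding symplectic_form_def closed_two_form_def by blast+

lemma omega_nondeg: "(!!u. \<omega> p u v = 0) ==> v = 0"
proof -
 assume "!!u. \<omega> p u v = 0"
 then have "\<forall>u. \<omega> p v u = 0" using omega(2) by (metis neg_0_equal_iff_equal)
 then show "v = 0" using sympl unfolding symplectic_form_def by blast
qed

definition om :: "('m, 'n) chart => 'm => real ^ 'n => real ^ 'n => real"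
 where "om c = (%q u v. \<omega> q (coord_field A c u q) (coord_field A c v q))"

lemma om_at: "om (chart_at A p) p = \<omega> p"
 by (simp add: om_def)

lemma om_bilinear: "c \<in> A ==> q \<in> fst c ==> bilinear (om c q)"
 unfolding om_def bilinear_def
proof (intro conjI allI)
 assume c: "c \<in> A" "q \<in> fst c"
 note l = linear_coord_field[OF c]
 have b: "linear (%u. \<omega> q u v)" "linear (\<omega> q u)" for u v using omega(1)[of q] unfolding bilinear_def by auto
 show "linear (%v. \<omega> q (coord_field A c u q) (coord_field A c v q))" for u
  using linear_compose[OF l b(2)] by (simp add: o_def)
 show "linear (%u. \<omega> q (coord_field A c u q) (coord_field A c v q))" for v
  using linear_compose[OF l b(1)] by (simp add: o_def)
qed

lemma om_invertible:
 assumes c: "c \<in> A" "q \<in> fst c" shows "invertible (bmat (om c q))"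
proof (rule bmat_invertible[OF om_bilinear[OF c]])
 fix v assume z: "!!u. om c q u v = 0"
 have "\<omega> q w (coord_field A c v q) = 0" for w
  using z[of "chart_comp A c q w"] coord_field_chart_comp[OF c, of w] by (simp add: om_def)
 from omega_nondeg[OF this] have "coord_field A c v q = 0" .
 then have "chart_comp A c q (coord_field A c v q) = 0"
  using linear_0[OF linear_chart_comp[OF c]] by simp
 then show "v = 0" by (simp add: chart_comp_coord_field_same[OF c])
qed

lemma smooth_om: "c \<in> A ==> smooth_fun A (fst c) (%q. bmat (om c q) $ i $ j)"
 using sympl[unfolded symplectic_form_def closed_two_form_def, THEN conjunct1, THEN conjunct2, THEN conjunct1, rule_format]
 by (simp add: om_def bmat_def)

lemma smooth_poisson: "c \<in> A ==> smooth_fun A (fst c) (%q. poisson (om c) q k l)"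
 unfolding poisson_bmat
 by (rule smooth_fun_linear[OF open_chart(1) bounded_linear_minus[OF bounded_linear_ident]])
  (auto intro!: smooth_fun_matrix_inv open_chart smooth_om om_invertible)

lemma deriv_om:
 assumes c: "c \<in> A" and q: "q \<in> fst c"
 shows "chd c (%p. om c p y z) q u = om c q (Gam c u q y) z + om c q y (Gam c u q z)"
proof -
 note U = open_chart(1)[OF c]
 have n: "near (smooth_vf A) q (coord_field A c y)" for y by (rule near_vf[OF U q smooth_vf_const[OF c]])
 have sm: "smooth_fun A (fst c) (%p. om c p y z)"
 proof (rule smooth_fun_cong[OF U])
  show "(\<Sum>i\<in>UNIV. \<Sum>j\<in>UNIV. (y $ i * z $ j) *\<^sub>R bmat (om c p) $ i $ j) = om c p y z" if "p \<in> fst c" for p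
   unfolding bilinear_expand[OF om_bilinear[OF c that], of y z] by simp
  show "smooth_fun A (fst c) (%p. \<Sum>i\<in>UNIV. \<Sum>j\<in>UNIV. (y $ i * z $ j) *\<^sub>R bmat (om c p) $ i $ j)"
   by (intro smooth_fun_sum U smooth_fun_linear[OF U bounded_linear_scaleR_right] smooth_om c)
 qed
 show ?thesis
  using symplc[unfolded symplectic_conn_def, rule_format, OF conjI[OF n n], of "coord_field A c u q" y z]
   tangent_deriv_coord_field[OF sm U q c q, of u]
  by (simp add: om_def coord_field_Gam[OF c q])
qed

text \<open>The Poisson tensor is parallel: differentiating the identity between the symplectic
  matrix and its inverse expresses its derivative by that of the symplectic form, which is known
  from the symplectic connection.\<close>

lemma deriv_poisson:
 assumes c: "c \<in> A" and q: "q \<in> fst c"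
 shows "chd c (%p. poisson (om c) p m l) q u
  + (\<Sum>k\<in>UNIV. poisson (om c) q k l * Gam c u q (axis k 1) $ m)
  + (\<Sum>k\<in>UNIV. poisson (om c) q m k * Gam c u q (axis k 1) $ l) = 0"
proof -
 note U = open_chart(1)[OF c]
 let ?W = "%p. bmat (om c p)" and ?P = "%p. matrix_inv (bmat (om c p))" and ?G = "matrix (Gam c u q)"
 let ?dW = "(\<chi> i j. chd c (%p. ?W p $ i $ j) q u) :: real ^ 'n ^ 'n"
 let ?dP = "(\<chi> i j. chd c (%p. ?P p $ i $ j) q u) :: real ^ 'n ^ 'n"
 have sP: "smooth_fun A (fst c) (%p. ?P p $ i $ j)" for i j
  by (intro smooth_fun_matrix_inv U smooth_om[OF c] om_invertible[OF c])
 have PW: "?P p ** ?W p = mat 1" "?W p ** ?P p = mat 1" if "p \<in> fst c" for p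
  using matrix_inv_inverse[OF om_invertible[OF c that]] by auto
 have 1: "?P q ** ?dW + ?dP ** ?W q = 0"
 proof (intro vec_eq_iff[THEN iffD2] allI)
  fix i j
  have s1: "smooth_fun A (fst c) (%p. ?P p $ i $ k * ?W p $ k $ j)" for k
   by (rule smooth_fun_bilinear[OF U bounded_bilinear_mult sP smooth_om[OF c]])
  have "chd c (%p. \<Sum>k\<in>I. ?P p $ i $ k * ?W p $ k $ j) q u = (\<Sum>k\<in>I. chd c (%p. ?P p $ i $ k * ?W p $ k $ j) q u)" if "finite I" for I
   using that
  proof (induction I)
   case (insert x I)
   then show ?case using chd_add[OF s1 smooth_fun_sum[OF U s1] U q c q, of x "%i. i" I u] by simp
  qed (simp add: chd_const)
  then have "chd c (%p. \<Sum>k\<in>UNIV. ?P p $ i $ k * ?W p $ k $ j) q u =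
    (\<Sum>k\<in>UNIV. ?P q $ i $ k * chd c (%p. ?W p $ k $ j) q u + chd c (%p. ?P p $ i $ k) q u * ?W q $ k $ j)"
   by (simp add: chd_bilinear[OF bounded_bilinear_mult sP smooth_om[OF c] U q c q])
  moreover have "chd c (%p. \<Sum>k\<in>UNIV. ?P p $ i $ k * ?W p $ k $ j) q u = chd c (%p. mat 1 $ i $ j :: real) q u"
   by (rule arg_cong[where f="%g. g u"], rule chd_cong[OF U q c q])
    (simp add: PW(1)[symmetric] matrix_matrix_mult_def)
  ultimately show "(?P q ** ?dW + ?dP ** ?W q) $ i $ j = 0 $ i $ j"
   by (simp add: matrix_matrix_mult_def chd_const sum.distrib)
 qed
 have 2: "?dW = transpose ?G ** ?W q + ?W q ** ?G"
 proof (intro vec_eq_iff[THEN iffD2] allI)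
  fix i j
  have l: "linear (%x. om c q x y)" "linear (om c q y)" for y
   using om_bilinear[OF c q] unfolding bilinear_def by auto
  have "chd c (%p. ?W p $ i $ j) q u = om c q (Gam c u q (axis i 1)) (axis j 1) + om c q (axis i 1) (Gam c u q (axis j 1))"
   using deriv_om[OF c q, of "axis i 1" "axis j 1" u] by (simp add: bmat_def)
  also have "om c q (Gam c u q (axis i 1)) (axis j 1) = (\<Sum>k\<in>UNIV. Gam c u q (axis i 1) $ k * om c q (axis k 1) (axis j 1))"
   using linear_axis_expansion[OF l(1)[of "axis j 1"], of "Gam c u q (axis i 1)"] by simp
  also have "om c q (axis i 1) (Gam c u q (axis j 1)) = (\<Sum>k\<in>UNIV. Gam c u q (axis j 1) $ k * om c q (axis i 1) (axis k 1))"
   using linear_axis_expansion[OF l(2)[of "axis i 1"], of "Gam c u q (axis j 1)"] by simp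
  finally show "?dW $ i $ j = (transpose ?G ** ?W q + ?W q ** ?G) $ i $ j"
   by (simp add: matrix_matrix_mult_def transpose_def matrix_def bmat_def mult.commute)
 qed
 have "(?P q ** ?dW + ?dP ** ?W q) ** ?P q = 0" unfolding 1 by (simp add: matrix_matrix_mult_def vec_eq_iff)
 then have "?P q ** ?dW ** ?P q + ?dP = 0"
  by (simp add: matrix_mult_add_left matrix_mul_assoc[symmetric] PW(2)[OF q])
 then have "?P q ** transpose ?G + ?G ** ?P q + ?dP = 0"
  by (simp add: 2 matrix_mult_add_left matrix_add_ldistrib matrix_mul_assoc PW(1)[OF q])
   (simp add: matrix_mul_assoc[symmetric] PW(2)[OF q])
 then have "(?P q ** transpose ?G + ?G ** ?P q + ?dP) $ m $ l = 0" by simp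
 then have "chd c (%p. ?P p $ m $ l) q u + (\<Sum>k\<in>UNIV. ?P q $ k $ l * Gam c u q (axis k 1) $ m) + (\<Sum>k\<in>UNIV. ?P q $ m $ k * Gam c u q (axis k 1) $ l) = 0"
  by (simp add: matrix_matrix_mult_def transpose_def matrix_def mult.commute)
 moreover have "chd c (%p. poisson (om c) p m l) q u = - chd c (%p. ?P p $ m $ l) q u"
  unfolding poisson_bmat by (rule chd_bounded_linear[OF bounded_linear_minus[OF bounded_linear_ident] sP U q c q])
 ultimately show ?thesis by (simp add: poisson_bmat sum_negf)
qed

subsection \<open>The Leibniz rule\<close>

text \<open>The formula of \<open>NN\<close> for another fibre and an arbitrary derivative
  \<open>nabg\<close>; it describes how the single factors of a product are differentiated.\<close>

definition gN :: "('m, 'n, 'g::complex_fibre) conn => ('m, 'n) chart => real ^ 'n => ('m => ('n, 'g) fib) => 'm => ('n, 'g) fib"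
 where "gN nabg c u F q = (%ys vs. nabg q (coord_field A c u q) (%p. F p ys vs)) - actS (Gam c u q) (F q) - actA (Gam c u q) (F q)"

lemma gN_NN: "gN nabF c u F q = NN c u F q"
 by (simp add: gN_def NN_def dF_def)

lemma gN_insS: "gN nabg c u (%p. insS w (F p)) q = insS w (gN nabg c u F q) + insS (Gam c u q w) (F q)"
 by (simp add: gN_def insS_linear act_ins) (simp add: insS_def)

text \<open>What the Leibniz rule for the Weyl product demands of the fibre product; the factors
  themselves are not asked to form a \<open>cbundle\<close>.\<close>

definition pairing :: "('f1::complex_fibre => 'f2::complex_fibre => 'f) => ('m set => ('m => 'f1) => bool) => ('m set => ('m => 'f2) => bool) =>
  ('m, 'n, 'f1) conn => ('m, 'n, 'f2) conn => bool"
 where "pairing m sm1 sm2 nab1 nab2 \<longleftrightarrow> cbilin m \<and>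
  (\<forall>U s t. open U \<and> sm1 U s \<and> sm2 U t \<longrightarrow> smF U (%q. m (s q) (t q)) \<and>
   (\<forall>p\<in>U. \<forall>v. nabF p v (%q. m (s q) (t q)) = m (nab1 p v s) (t p) + m (s p) (nab2 p v t)))"

lemma pairingD:
 assumes "pairing m sm1 sm2 nab1 nab2"
 shows "cbilin m" "open U ==> sm1 U s ==> sm2 U t ==> smF U (%q. m (s q) (t q))"
  "open U ==> sm1 U s ==> sm2 U t ==> p \<in> U ==> nabF p v (%q. m (s q) (t q)) = m (nab1 p v s) (t p) + m (s p) (nab2 p v t)"
 using assms unfolding pairing_def by blast+

context
 fixes c and m :: "'f1::complex_fibre => 'f2::complex_fibre => 'f" and sm1 sm2 nab1 nab2
 assumes c: "c \<in> A" and pair: "pairing m sm1 sm2 nab1 nab2"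
begin

lemma SF_mu:
 assumes "!!ys vs. sm1 (fst c) (%q. F q ys vs)" "!!ys vs. sm2 (fst c) (%q. G q ys vs)"
 shows "SF (fst c) (%q. mu m (F q) (G q))"
 unfolding SF_def mu_def
 by (intro allI smF_sum smF_scaleC open_chart c pairingD(2)[OF pair] assms)

lemma SF_Bn:
 assumes "!!ys vs. sm1 (fst c) (%q. F q ys vs)" "!!ys vs. sm2 (fst c) (%q. G q ys vs)"
 shows "SF (fst c) (%q. Bn (poisson (om c) q) m n (F q) (G q))"
 using assms
proof (induction n arbitrary: F G)
 case 0 then show ?case using SF_mu by simp
next
 case (Suc n)
 have "SF (fst c) (%q. Bn (poisson (om c) q) m n (insS u (F q)) (insS w (G q)))" for u w
  by (rule Suc.IH) (simp_all add: insS_def Suc.prems)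
 then show ?case
  unfolding Bn.simps(2) by (intro SF_ops(4) SF_sum SF_ops(5) open_chart c smooth_poisson)
qed

lemma NN_mu:
 assumes q: "q \<in> fst c" and F: "!!ys vs. sm1 (fst c) (%q. F q ys vs)" "!!ys vs. sm2 (fst c) (%q. G q ys vs)"
 shows "NN c u (%q. mu m (F q) (G q)) q = mu m (gN nab1 c u F q) (G q) + mu m (F q) (gN nab2 c u G q)"
proof -
 note U = open_chart(1)[OF c] and m = pairingD(1)[OF pair]
 let ?F = "%ys vs. nab1 q (coord_field A c u q) (%p. F p ys vs)" and ?G = "%ys vs. nab2 q (coord_field A c u q) (%p. G p ys vs)"
 have sm: "smF (fst c) (%q. k *\<^sub>c m (F q ys vs) (G q ys' vs'))" for k ys vs ys' vs'
  by (intro smF_scaleC U pairingD(2)[OF pair] F)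
 have "dF c u (%p. mu m (F p) (G p) ys vs) q = (mu m ?F (G q) + mu m (F q) ?G) ys vs" for ys vs
 proof -
  have "dF c u (%p. mu m (F p) (G p) ys vs) q = (\<Sum>I \<in> Pow {..<length ys}. \<Sum>J \<in> Pow {..<length vs}.
   dF c u (%p. shuffle_sign J *\<^sub>c m (F p (nths ys I) (nths vs J)) (G p (nths ys (- I)) (nths vs (- J)))) q)"
   unfolding mu_def by (subst dF_sum[OF c q]; (intro smF_sum U sm sum.cong refl dF_sum[OF c q])?)
  also have "\<dots> = (mu m ?F (G q) + mu m (F q) ?G) ys vs"
   unfolding plus_fun_apply mu_def sum.distrib[symmetric]
   by (intro sum.cong refl, subst dF_ops(4)[OF c q pairingD(2)[OF pair U F]])
    (simp add: dF_def pairingD(3)[OF pair U F q] scaleC_add_right)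
  finally show ?thesis .
 qed
 then have 1: "(%ys vs. dF c u (%p. mu m (F p) (G p) ys vs) q) = mu m ?F (G q) + mu m (F q) ?G" by blast
 show ?thesis
  unfolding NN_def 1 gN_def actS_mu[OF m] actA_mu[OF m] mu_linear[OF m] by simp
qed

text \<open>Besides the two expected terms there are the derivative of the Poisson tensor and the
  Christoffel terms from the two inserted basis vectors. Together these form the covariant
  derivative of the Poisson tensor, which vanishes.\<close>

lemma NN_Bn:
 assumes q: "q \<in> fst c" and F: "!!ys vs. sm1 (fst c) (%q. F q ys vs)" "!!ys vs. sm2 (fst c) (%q. G q ys vs)"
  and w: "wfib (F q)" "wfib (G q)"
 shows "NN c u (%q. Bn (poisson (om c) q) m n (F q) (G q)) q =
  Bn (poisson (om c) q) m n (gN nab1 c u F q) (G q) + Bn (poisson (om c) q) m n (F q) (gN nab2 c u G q)"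
 using F w
proof (induction n arbitrary: F G)
 case 0 then show ?case using NN_mu[OF q] by simp
next
 case (Suc n)
 note U = open_chart(1)[OF c] and m = pairingD(1)[OF pair]
 let ?e = "%i. axis i 1 :: real ^ 'n" and ?L = "poisson (om c)"
 let ?B = "%a b. Bn (?L q) m n a b"
 define b where "b k l = ?B (insS (?e k) (F q)) (insS (?e l) (G q))" for k l
 define S1 where "S1 = (\<Sum>k\<in>UNIV. \<Sum>l\<in>UNIV. smulC (of_real (?L q k l)) (?B (insS (?e k) (gN nab1 c u F q)) (insS (?e l) (G q))))"
 define S2 where "S2 = (\<Sum>k\<in>UNIV. \<Sum>l\<in>UNIV. smulC (of_real (?L q k l)) (?B (insS (?e k) (F q)) (insS (?e l) (gN nab2 c u G q))))"
 have ins: "!!ys vs. sm1 (fst c) (%q. insS w (F q) ys vs)" "!!ys vs. sm2 (fst c) (%q. insS w (G q) ys vs)" for w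
  using Suc.prems(1,2) by (simp_all add: insS_def)
 have SFk: "SF (fst c) (%q. Bn (?L q) m n (insS (?e k) (F q)) (insS (?e l) (G q)))" for k l
  by (rule SF_Bn[OF ins])
 have IH: "NN c u (%q. Bn (?L q) m n (insS (?e k) (F q)) (insS (?e l) (G q))) q =
   ?B (insS (?e k) (gN nab1 c u F q)) (insS (?e l) (G q)) + (\<Sum>j\<in>UNIV. smulC (of_real (Gam c u q (?e k) $ j)) (b j l)) +
   (?B (insS (?e k) (F q)) (insS (?e l) (gN nab2 c u G q)) + (\<Sum>j\<in>UNIV. smulC (of_real (Gam c u q (?e l) $ j)) (b k j)))" for k l
  unfolding Suc.IH[OF ins wfib_insS[OF Suc.prems(3)] wfib_insS[OF Suc.prems(4)]] gN_insS Bn_linear[OF m] b_def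
   insS_expand[OF Suc.prems(3), of "Gam c u q (?e k)"] insS_expand[OF Suc.prems(4), of "Gam c u q (?e l)"] Bn_sum[OF m] ..
 have "NN c u (%q. \<Sum>k\<in>UNIV. \<Sum>l\<in>UNIV. smulC (of_real (?L q k l)) (Bn (?L q) m n (insS (?e k) (F q)) (insS (?e l) (G q)))) q =
   (\<Sum>k\<in>UNIV. \<Sum>l\<in>UNIV. NN c u (%q. smulC (of_real (?L q k l)) (Bn (?L q) m n (insS (?e k) (F q)) (insS (?e l) (G q)))) q)"
  by (subst NN_sum[OF c q]; (intro SF_sum SF_ops(5) U SFk smooth_poisson c sum.cong refl NN_sum[OF c q])?)
 also have "\<dots> = (\<Sum>k\<in>UNIV. \<Sum>l\<in>UNIV. smulC (of_real (chd c (%p. ?L p k l) q u)) (b k l)) + S1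
   + (\<Sum>k\<in>UNIV. \<Sum>l\<in>UNIV. \<Sum>j\<in>UNIV. smulC (of_real (?L q k l * Gam c u q (?e k) $ j)) (b j l)) + S2
   + (\<Sum>k\<in>UNIV. \<Sum>l\<in>UNIV. \<Sum>j\<in>UNIV. smulC (of_real (?L q k l * Gam c u q (?e l) $ j)) (b k j))"
  by (simp add: NN_ops(5)[OF c q SFk smooth_poisson[OF c]] IH smulC_add_right smulC_sum_right sum.distrib S1_def S2_def b_def add_ac)
 also have "(\<Sum>k\<in>UNIV. \<Sum>l\<in>UNIV. \<Sum>j\<in>UNIV. smulC (of_real (?L q k l * Gam c u q (?e k) $ j)) (b j l)) =
   (\<Sum>j\<in>UNIV. \<Sum>l\<in>UNIV. smulC (of_real (\<Sum>k\<in>UNIV. ?L q k l * Gam c u q (?e k) $ j)) (b j l))"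
 proof -
  have "(\<Sum>k\<in>UNIV. \<Sum>l\<in>UNIV. \<Sum>j\<in>UNIV. X k l j) = (\<Sum>j\<in>UNIV. \<Sum>l\<in>UNIV. \<Sum>k\<in>UNIV. X k l j)" for X :: "'n => 'n => 'n => ('n, 'f) fib"
  proof -
   have "(\<Sum>k\<in>UNIV. \<Sum>l\<in>UNIV. \<Sum>j\<in>UNIV. X k l j) = (\<Sum>k\<in>UNIV. \<Sum>j\<in>UNIV. \<Sum>l\<in>UNIV. X k l j)"
    by (rule sum.cong[OF refl]) (rule sum.swap)
   also have "\<dots> = (\<Sum>j\<in>UNIV. \<Sum>k\<in>UNIV. \<Sum>l\<in>UNIV. X k l j)" by (rule sum.swap)
   also have "\<dots> = (\<Sum>j\<in>UNIV. \<Sum>l\<in>UNIV. \<Sum>k\<in>UNIV. X k l j)"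
    by (rule sum.cong[OF refl]) (rule sum.swap)
   finally show ?thesis .
  qed
  then show ?thesis by (simp add: smulC_sum_left)
 qed
 also have "(\<Sum>k\<in>UNIV. \<Sum>l\<in>UNIV. \<Sum>j\<in>UNIV. smulC (of_real (?L q k l * Gam c u q (?e l) $ j)) (b k j)) =
   (\<Sum>k\<in>UNIV. \<Sum>j\<in>UNIV. smulC (of_real (\<Sum>l\<in>UNIV. ?L q k l * Gam c u q (?e l) $ j)) (b k j))"
  by (rule sum.cong[OF refl], subst sum.swap) (simp add: smulC_sum_left)
 also have "(\<Sum>k\<in>UNIV. \<Sum>l\<in>UNIV. smulC (of_real (chd c (%p. ?L p k l) q u)) (b k l)) + S1
   + (\<Sum>j\<in>UNIV. \<Sum>l\<in>UNIV. smulC (of_real (\<Sum>k\<in>UNIV. ?L q k l * Gam c u q (?e k) $ j)) (b j l)) + S2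
   + (\<Sum>k\<in>UNIV. \<Sum>j\<in>UNIV. smulC (of_real (\<Sum>l\<in>UNIV. ?L q k l * Gam c u q (?e l) $ j)) (b k j)) =
   (\<Sum>k\<in>UNIV. \<Sum>l\<in>UNIV. smulC (of_real (chd c (%p. ?L p k l) q u + (\<Sum>j\<in>UNIV. ?L q j l * Gam c u q (?e j) $ k) + (\<Sum>j\<in>UNIV. ?L q k j * Gam c u q (?e j) $ l))) (b k l)) + S1 + S2"
  by (simp only: of_real_add smulC_add_left sum.distrib add_ac)
 also have "\<dots> = S1 + S2" unfolding deriv_poisson[OF c q] by simp
 finally have "NN c u (%q. \<Sum>k\<in>UNIV. \<Sum>l\<in>UNIV. smulC (of_real (?L q k l)) (Bn (?L q) m n (insS (?e k) (F q)) (insS (?e l) (G q)))) q = S1 + S2" .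
 moreover have "SF (fst c) (%q. \<Sum>k\<in>UNIV. \<Sum>l\<in>UNIV. smulC (of_real (?L q k l)) (Bn (?L q) m n (insS (?e k) (F q)) (insS (?e l) (G q))))"
  by (intro SF_sum SF_ops(5) U SFk smooth_poisson c)
 ultimately show ?case
  unfolding Bn.simps(2) S1_def S2_def by (simp add: NN_ops(4)[OF c q] smulC_add_right)
qed

end

end

section \<open>Membership in \<open>weyl_forms\<close> and components in a chart\<close>

lemma weyl_formsD:
 assumes "\<Phi> \<in> weyl_forms A sm"
 shows "lb 0 \<Phi>" "wfib (\<Phi> k p)"
  "c \<in> A ==> sm (fst c) (%q. frame A c \<Phi> k q (map (%i. axis i 1) is) (map (%i. axis i 1) js))"
proof -
 note h = assms[unfolded weyl_forms_def mem_Collect_eq]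
 show "lb 0 \<Phi>" unfolding lb_def by (rule h[THEN conjunct1])
 show "wfib (\<Phi> k p)"
 proof (rule wfibI)
  show "linear (%u. \<Phi> k p (ys @ u # ys') vs)" for ys ys' vs
   by (rule h[THEN conjunct2, THEN conjunct1, rule_format])
  show "linear (%u. \<Phi> k p ys (vs @ u # vs'))" for ys vs vs'
   by (rule h[THEN conjunct2, THEN conjunct2, THEN conjunct1, rule_format])
  show "\<Phi> k p (ys @ u # w # ys') vs = \<Phi> k p (ys @ w # u # ys') vs" for ys u w ys' vs
   by (rule h[THEN conjunct2, THEN conjunct2, THEN conjunct2, THEN conjunct1, rule_format])
  show "\<Phi> k p ys (vs @ u # w # vs') = - \<Phi> k p ys (vs @ w # u # vs')" for ys vs u w vs'
   by (rule h[THEN conjunct2, THEN conjunct2, THEN conjunct2, THEN conjunct2, THEN conjunct1, rule_format])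
 qed
 show "c \<in> A ==> sm (fst c) (%q. frame A c \<Phi> k q (map (%i. axis i 1) is) (map (%i. axis i 1) js))"
  using h[THEN conjunct2, THEN conjunct2, THEN conjunct2, THEN conjunct2, THEN conjunct2, rule_format, of c k "is" js]
  by (simp add: frame_def pull_def o_def)
qed

lemma weyl_formsI:
 assumes "lb 0 \<Phi>" "!!k p. wfib (\<Phi> k p)"
  "!!c k ys vs. c \<in> A ==> sm (fst c) (%q. frame A c \<Phi> k q ys vs)"
 shows "\<Phi> \<in> weyl_forms A sm"
 unfolding weyl_forms_def mem_Collect_eq
proof (intro conjI allI ballI impI)
 show "k < 0 ==> \<Phi> k = 0" for k using assms(1) by (rule lbD)
 fix c k "is" js assume "c \<in> A"
 from assms(3)[OF this, of k "map (%i. axis i 1) is" "map (%i. axis i 1) js"]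
 show "sm (fst c) (%q. \<Phi> k q (map (%i. coord_field A c (axis i 1) q) is) (map (%j. coord_field A c (axis j 1) q) js))"
  by (simp add: frame_def pull_def o_def)
qed (rule wfibD[OF assms(2)])+

text \<open>\<open>weyl_forms\<close> requires smoothness on coordinate basis fields; multilinearity
  replaces the basis vectors by arbitrary constant vectors one slot at a time.\<close>

lemma weyl_frame_smooth:
 fixes \<Phi> :: "('m::topological_space, 'n::finite, 'f::complex_fibre) wform"
 assumes W: "\<Phi> \<in> weyl_forms A sm" and c: "c \<in> A" and lin: "!!q. q \<in> fst c ==> linear (%y. coord_field A c y q)"
  and U: "open (fst c)"
  and cong: "!!s t. (!!q. q \<in> fst c ==> s q = t q) ==> sm (fst c) s ==> sm (fst c) t"
  and comb: "!!(r :: 'n => real) s. (!!i. sm (fst c) (s i)) ==> sm (fst c) (%q. \<Sum>i\<in>UNIV. r i *\<^sub>R s i q)"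
 shows "sm (fst c) (%q. frame A c \<Phi> k q ys vs)"
proof -
 let ?e = "%i. axis i 1 :: real ^ 'n" and ?F = "frame A c \<Phi> k"
 have w: "wfib (?F q)" if "q \<in> fst c" for q
  unfolding frame_def by (rule wfib_pull[OF weyl_formsD(2)[OF W] lin[OF that]])
 have 1: "sm (fst c) (%q. ?F q (map ?e is @ ys) (map ?e js))" for "is" js
 proof (induction ys arbitrary: "is")
  case Nil then show ?case using weyl_formsD(3)[OF W c] by simp
 next
  case (Cons y ys)
  have "sm (fst c) (%q. ?F q (map ?e is @ ?e i # ys) (map ?e js))" for i
   using Cons[of "is @ [i]"] by simp
  from comb[OF this, of "%i. y $ i"] show ?case
   by (rule cong[rotated]) (rule linear_axis_expansion[OF wfibD(1)[OF w], symmetric])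
 qed
 have "sm (fst c) (%q. ?F q ys (map ?e js @ vs))" for js
 proof (induction vs arbitrary: js)
  case Nil then show ?case using 1[of "[]"] by simp
 next
  case (Cons y vs)
  have "sm (fst c) (%q. ?F q ys (map ?e js @ ?e i # vs))" for i
   using Cons[of "js @ [i]"] by simp
  from comb[OF this, of "%i. y $ i"] show ?case
   by (rule cong[rotated]) (rule linear_axis_expansion[OF wfibD(2)[OF w], symmetric])
 qed
 from this[of "[]"] show ?thesis by simp
qed

section \<open>Exchange of the two factors of the Weyl product\<close>

lemma Psum_flip:
 assumes L: "!!k l. L l k = - L k l"
 shows "Psum L (%u w. G w u) = - Psum L G"
proof -
 have e: "smulC (of_real (L k l)) x = - smulC (of_real (L l k)) x" for k l x
  by (subst L) simp
 have "Psum L (%u w. G w u) = (\<Sum>k\<in>UNIV. \<Sum>l\<in>UNIV. - smulC (of_real (L l k)) (G (axis l 1) (axis k 1)))"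
  unfolding Psum_def by (intro sum.cong refl e)
 also have "\<dots> = (\<Sum>l\<in>UNIV. \<Sum>k\<in>UNIV. - smulC (of_real (L l k)) (G (axis l 1) (axis k 1)))"
  by (rule sum.swap)
 finally show ?thesis by (simp only: Psum_def sum_negf)
qed

text \<open>Exchanging the factors transposes each of the \<open>n\<close> Poisson tensors, hence
  the sign; the sign of the forms is that of the shuffle product.\<close>

lemma Bn_comm:
 fixes f :: "('n::finite, 'f::complex_fibre) fib" and g :: "('n, 'g::complex_fibre) fib"
 assumes m: "cbilin m" and L: "!!k l. L l k = - L k l" and "fdeg d f"
 shows "Bn L m n f g = smulC ((- 1) ^ n) (Bn L (%x y. m y x) n (parn d g) f)"
 using assms(3)
proof (induction n arbitrary: f g)
 case 0 then show ?case using mu_comm[OF m 0] by simp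
next
 case (Suc n)
 let ?m = "%x y. m y x"
 have p: "insS u (parn d g) = parn d (insS u g)" for u by (simp add: parn_def insS_par)
 have "Psum L (%u w. Bn L m n (insS u f) (insS w g)) = smulC ((- 1) ^ n) (Psum L (%u w. Bn L ?m n (insS w (parn d g)) (insS u f)))"
  by (simp add: Psum_def Suc.IH[OF fdeg_insS[OF Suc.prems]] p smulC_sum_right mult.commute)
 also have "Psum L (%u w. Bn L ?m n (insS w (parn d g)) (insS u f)) = - Psum L (%u w. Bn L ?m n (insS u (parn d g)) (insS w f))"
  by (rule Psum_flip[OF L])
 finally show ?case
  unfolding Bn_Suc_Psum by (simp add: mult.commute)
qed

lemma fdelta_dxA: "fdelta (dxA j f) = - dxA j (fdelta f)"
proof -
 have "fdelta (dxA j f) = (\<Sum>i\<in>UNIV. dxA i (dxA j (insS (axis i 1) f)))"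
  by (simp add: fdelta_def insS_dxA)
 also have "\<dots> = (\<Sum>i\<in>UNIV. - dxA j (dxA i (insS (axis i 1) f)))"
  by (intro sum.cong refl dxA_anticomm)
 finally show ?thesis by (simp add: sum_negf fdelta_def dxA_sum)
qed

lemma wfib_fdelta: "wfib f ==> wfib (fdelta f)"
 unfolding fdelta_def by (intro wfib_sum wfib_dxA wfib_insS)

lemma wfib_fdstar: "wfib f ==> wfib (fdstar f)"
 unfolding fdstar_def by (intro wfib_sum wfib_dxS wfib_insA)

lemma wfib_numscale:
 assumes "wfib f" shows "wfib (%ys vs. r (length ys) (length vs) *\<^sub>R f ys vs)"
proof (rule wfibI)
 fix ys ys' vs vs' :: "(real ^ 'a) list" and u w :: "real ^ 'a"
 show "linear (%u. r (length (ys @ u # ys')) (length vs) *\<^sub>R f (ys @ u # ys') vs)"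
  unfolding length_append list.size by (intro linear_compose_scale_right wfibD(1)[OF assms])
 show "linear (%u. r (length ys) (length (vs @ u # vs')) *\<^sub>R f ys (vs @ u # vs'))"
  unfolding length_append list.size by (intro linear_compose_scale_right wfibD(2)[OF assms])
 show "r (length (ys @ u # w # ys')) (length vs) *\<^sub>R f (ys @ u # w # ys') vs = r (length (ys @ w # u # ys')) (length vs) *\<^sub>R f (ys @ w # u # ys') vs"
  by (subst wfibD(3)[OF assms]) simp
 show "r (length ys) (length (vs @ u # w # vs')) *\<^sub>R f ys (vs @ u # w # vs') = - (r (length ys) (length (vs @ w # u # vs')) *\<^sub>R f ys (vs @ w # u # vs'))"
  by (subst wfibD(4)[OF assms]) simp
qed

lemma pull_fdstar:
 assumes f: "wfib f" and T: "linear T"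
 shows "pull T (fdstar f) = fdstar (pull T f)"
proof -
 \<comment> \<open>A form of \<open>fdstar\<close> without basis vectors, on which a change of frame
   can act.\<close>
 have 1: "fdstar g = (%ys vs. \<Sum>j<length ys. insA (ys ! j) g (del j ys) vs)" if "wfib g" for g :: "('a, 'b) fib"
 proof (intro ext)
  fix ys vs
  have "fdstar g ys vs = (\<Sum>j<length ys. \<Sum>i\<in>UNIV. ((ys ! j) $ i) *\<^sub>R insA (axis i 1) g (del j ys) vs)"
   by (simp add: fdstar_def fun_ops dxS_def) (rule sum.swap)
  also have "\<dots> = (\<Sum>j<length ys. insA (ys ! j) g (del j ys) vs)"
   by (intro sum.cong refl) (rule linear_axis_expansion[OF wfib_linear_insA[OF that], symmetric])
  finally show "fdstar g ys vs = (\<Sum>j<length ys. insA (ys ! j) g (del j ys) vs)" .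
 qed
 show ?thesis
  unfolding 1[OF f] 1[OF wfib_pull[OF f T]]
  by (simp add: pull_def insA_def map_del fun_eq_iff)
qed

lemma wprod_zero: "wprod \<omega> m 0 \<Psi> = 0" "wprod \<omega> m \<Phi> 0 = 0"
 by (intro ext; simp add: wprod_def fun_ops)+

lemma lb_sum:
 fixes F :: "'i => ('m, 'n::finite, 'f::complex_fibre) wform"
 assumes "!!i. lb N (F i)" shows "lb N (\<Sum>i\<in>I. F i)"
 by (induction I rule: infinite_finite_induct) (simp_all add: lb_ops assms)

lemma wprod_sum:
 fixes F :: "'i => ('m, 'n::finite, 'f::complex_fibre) wform" and \<Psi> :: "('m, 'n, 'g::complex_fibre) wform"
 assumes m: "cbilin m" and F: "!!i. lb N (F i)" and G: "lb N \<Psi>"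
 shows "wprod \<omega> m (\<Sum>i\<in>I. F i) \<Psi> = (\<Sum>i\<in>I. wprod \<omega> m (F i) \<Psi>)"
proof (induction I rule: infinite_finite_induct)
 case (insert i I)
 then show ?case by (simp add: wprod_add(1)[OF m F lb_sum[OF F] G G])
qed (simp_all add: wprod_zero)

lemma wprod_sum_right:
 fixes F :: "'i => ('m, 'n::finite, 'g::complex_fibre) wform" and \<Psi> :: "('m, 'n, 'f::complex_fibre) wform"
 assumes m: "cbilin m" and F: "!!i. lb N (F i)" and G: "lb N \<Psi>"
 shows "wprod \<omega> m \<Psi> (\<Sum>i\<in>I. F i) = (\<Sum>i\<in>I. wprod \<omega> m \<Psi> (F i))"
proof (induction I rule: infinite_finite_induct)
 case (insert i I)
 then show ?case by (simp add: wprod_add(2)[OF m G G F lb_sum[OF F]])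
qed (simp_all add: wprod_zero)

context symplectic_bundle
begin

abbreviation "WF \<equiv> weyl_forms A smF"

lemma lin_coord: "c \<in> A ==> q \<in> fst c ==> linear (%y. coord_field A c y q)"
 by (rule linear_coord_field)

lemma WF_SF:
 assumes "\<Phi> \<in> WF" "c \<in> A" shows "SF (fst c) (frame A c \<Phi> k)"
 unfolding SF_def
proof (intro allI weyl_frame_smooth[OF assms lin_coord[OF assms(2)] open_chart(1)[OF assms(2)]])
 show "smF (fst c) t" if "!!q. q \<in> fst c ==> s q = t q" "smF (fst c) s" for s t
  by (rule smF_cong[OF open_chart(1)[OF assms(2)] that])
 show "smF (fst c) (%q. \<Sum>i\<in>UNIV. r i *\<^sub>R s i q)" if "!!i. smF (fst c) (s i)" for r s
  by (intro smF_sum smF_scaleR open_chart assms that)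
qed

lemma WF_D: "\<Phi> \<in> WF ==> lb 0 \<Phi>" "\<Phi> \<in> WF ==> wfib (\<Phi> k p)" "\<Phi> \<in> WF ==> sym2 (\<Phi> k p)"
 "\<Phi> \<in> WF ==> c \<in> A ==> q \<in> fst c ==> wfib (frame A c \<Phi> k q)"
 using weyl_formsD[of \<Phi> A smF] by (auto intro: wfib_sym2 wfib_pull lin_coord simp: frame_def)

lemma WF_I: "lb 0 \<Phi> ==> (!!k p. wfib (\<Phi> k p)) ==> (!!c k. c \<in> A ==> SF (fst c) (frame A c \<Phi> k)) ==> \<Phi> \<in> WF"
 by (rule weyl_formsI) (auto simp: SF_def)

lemma frame_ops:
 fixes \<Phi> :: "('m, 'n, 'g::complex_fibre) wform"
 shows "frame A c (\<Phi> + \<Psi>) k q = frame A c \<Phi> k q + frame A c \<Psi> k q" "frame A c (\<Phi> - \<Psi>) k q = frame A c \<Phi> k q - frame A c \<Psi> k q"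
 "frame A c (- \<Phi>) k q = - frame A c \<Phi> k q" "frame A c (cscale z \<Phi>) k q = smulC z (frame A c \<Phi> k q)"
 "frame A c (lambda_shift n \<Phi>) k q = frame A c \<Phi> (k - n) q" "frame A c (parity \<Phi>) k q = par (frame A c \<Phi> k q)"
 by (simp_all add: frame_def wform_ops pull_linear cscale_fib lambda_shift_def parity_fib par_pull)

lemma WF_ops:
 assumes "\<Phi> \<in> WF"
 shows "\<Psi> \<in> WF ==> \<Phi> + \<Psi> \<in> WF" "\<Psi> \<in> WF ==> \<Phi> - \<Psi> \<in> WF" "- \<Phi> \<in> WF" "cscale z \<Phi> \<in> WF" "parity \<Phi> \<in> WF"
  "lb 0 (lambda_shift n \<Phi>) ==> lambda_shift n \<Phi> \<in> WF"
proof -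
 note d = WF_D[OF assms] and s = WF_SF[OF assms]
 show "\<Phi> + \<Psi> \<in> WF" if P: "\<Psi> \<in> WF"
 proof (rule WF_I)
  show "lb 0 (\<Phi> + \<Psi>)" by (rule lb_ops(1)[OF d(1) WF_D(1)[OF P]])
  show "wfib ((\<Phi> + \<Psi>) k p)" for k p by (simp add: wform_ops wfib_add d(2) WF_D(2)[OF P])
  show "SF (fst c) (frame A c (\<Phi> + \<Psi>) k)" if "c \<in> A" for c k
   by (simp add: frame_ops[abs_def] SF_ops(1)[OF open_chart(1) s WF_SF[OF P]] that)
 qed
 show "\<Phi> - \<Psi> \<in> WF" if P: "\<Psi> \<in> WF"
 proof (rule WF_I)
  show "lb 0 (\<Phi> - \<Psi>)" by (rule lb_ops(2)[OF d(1) WF_D(1)[OF P]])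
  show "wfib ((\<Phi> - \<Psi>) k p)" for k p by (simp add: wform_ops wfib_diff d(2) WF_D(2)[OF P])
  show "SF (fst c) (frame A c (\<Phi> - \<Psi>) k)" if "c \<in> A" for c k
   by (simp add: frame_ops[abs_def] SF_ops(2)[OF open_chart(1) s WF_SF[OF P]] that)
 qed
 show "- \<Phi> \<in> WF"
 proof (rule WF_I)
  show "lb 0 (- \<Phi>)" by (rule lb_ops(3)[OF d(1)])
  show "wfib ((- \<Phi>) k p)" for k p by (simp add: wform_ops wfib_neg d(2))
  show "SF (fst c) (frame A c (- \<Phi>) k)" if "c \<in> A" for c k
   by (simp add: frame_ops[abs_def] SF_ops(3)[OF open_chart(1) s] that)
 qed
 show "cscale z \<Phi> \<in> WF"
 proof (rule WF_I)
  show "lb 0 (cscale z \<Phi>)" by (rule lb_ops(5)[OF d(1)])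
  show "wfib ((cscale z \<Phi>) k p)" for k p by (simp add: cscale_fib wfib_smulC d(2))
  show "SF (fst c) (frame A c (cscale z \<Phi>) k)" if "c \<in> A" for c k
   by (simp add: frame_ops[abs_def] SF_ops(4)[OF open_chart(1) s] that)
 qed
 show "parity \<Phi> \<in> WF"
 proof (rule WF_I)
  show "lb 0 (parity \<Phi>)" by (rule lb_ops(7)[OF d(1)])
  show "wfib ((parity \<Phi>) k p)" for k p by (simp add: parity_fib wfib_par d(2))
  show "SF (fst c) (frame A c (parity \<Phi>) k)" if "c \<in> A" for c k
   by (simp add: frame_ops[abs_def] SF_ops(8)[OF open_chart(1) s] that)
 qed
 show "lambda_shift n \<Phi> \<in> WF" if l: "lb 0 (lambda_shift n \<Phi>)"
 proof (rule WF_I)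
  show "lb 0 (lambda_shift n \<Phi>)" by (rule l)
  show "wfib ((lambda_shift n \<Phi>) k p)" for k p by (simp add: lambda_shift_def d(2))
  show "SF (fst c) (frame A c (lambda_shift n \<Phi>) k)" if "c \<in> A" for c k
   by (simp add: frame_ops[abs_def] s that)
 qed
qed

lemma frame_delta: "\<Phi> \<in> WF ==> c \<in> A ==> q \<in> fst c ==> frame A c (delta \<Phi>) k q = fdelta (frame A c \<Phi> k q)"
 by (simp add: frame_def delta_fib pull_fdelta WF_D lin_coord)

lemma WF_delta:
 assumes "\<Phi> \<in> WF" shows "delta \<Phi> \<in> WF"
proof (rule WF_I)
 show "lb 0 (delta \<Phi>)" by (rule lb_ops(6)[OF WF_D(1)[OF assms]])
 show "wfib (delta \<Phi> k p)" for k p unfolding delta_fib by (rule wfib_fdelta[OF WF_D(2)[OF assms]])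
 fix c k assume c: "c \<in> A"
 have "SF (fst c) (%q. fdelta (frame A c \<Phi> k q))"
  unfolding fdelta_def by (intro SF_sum SF_ops open_chart c WF_SF assms)
 then show "SF (fst c) (frame A c (delta \<Phi>) k)"
  by (rule SF_cong[OF open_chart(1)[OF c], rotated]) (rule frame_delta[OF assms c, symmetric])
qed

lemma WF_delta_inv:
 assumes "\<Phi> \<in> WF" shows "delta_inv \<Phi> \<in> WF"
proof (rule WF_I)
 have e: "delta_inv \<Phi> k p = (%ys vs. (1 / real (length ys + length vs)) *\<^sub>R fdstar (\<Phi> k p) ys vs)" for k p
  by (intro ext) (rule delta_inv_fib)
 show "lb 0 (delta_inv \<Phi>)"
  by (rule lb_fibI) (simp add: e lbD_fib[OF WF_D(1)[OF assms]] fdstar_linear fun_eq_iff fun_ops)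
 show "wfib (delta_inv \<Phi> k p)" for k p
  unfolding e by (rule wfib_numscale[OF wfib_fdstar[OF WF_D(2)[OF assms]], of "%a b. 1 / real (a + b)"])
 fix c k assume c: "c \<in> A"
 have "SF (fst c) (%q ys vs. (1 / real (length ys + length vs)) *\<^sub>R fdstar (frame A c \<Phi> k q) ys vs)"
 proof -
  have "SF (fst c) (%q. fdstar (frame A c \<Phi> k q))"
   unfolding fdstar_def by (intro SF_sum SF_ops open_chart c WF_SF assms)
  note SFD[OF this]
  then show ?thesis unfolding SF_def by (intro allI smF_scaleR open_chart c)
 qed
 moreover have "frame A c (delta_inv \<Phi>) k q = (%ys vs. (1 / real (length ys + length vs)) *\<^sub>R fdstar (frame A c \<Phi> k q) ys vs)" if "q \<in> fst c" for q
  unfolding frame_def pull_fdstar[OF WF_D(2)[OF assms] lin_coord[OF c that], symmetric] e by (simp add: pull_def)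
 ultimately show "SF (fst c) (frame A c (delta_inv \<Phi>) k)"
  using SF_cong[OF open_chart(1)[OF c], of "%q ys vs. (1 / real (length ys + length vs)) *\<^sub>R fdstar (frame A c \<Phi> k q) ys vs" "frame A c (delta_inv \<Phi>) k"]
  by simp
qed

subsection \<open>The covariant derivative\<close>

lemma Gam_at: "Gam (chart_at A p) u p y = nab p u (coord_field A (chart_at A p) y)"
 unfolding Gam_def using coord_field_chart_comp[OF chart_at, of p] by simp

lemma nabla_tensor_gN: "nabla_tensor A nab nabg i \<Phi> k p = gN nabg (chart_at A p) (axis i 1) (frame A (chart_at A p) \<Phi> k) p"
 by (simp add: nabla_tensor_def Let_def gN_def fun_eq_iff fun_ops frame_def pull_def actS_def actA_def Gam_at)

lemma cov_D_gN: "cov_D A nab nabg \<Phi> k p = (\<Sum>i\<in>UNIV. dxA i (gN nabg (chart_at A p) (axis i 1) (frame A (chart_at A p) \<Phi> k) p))"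
 by (simp add: cov_D_def fun_ops dx_a_def dxA_def fun_eq_iff flip: nabla_tensor_gN)

lemma cov_D_DD: "cov_D A nab nabF \<Phi> k p = DD (chart_at A p) (frame A (chart_at A p) \<Phi> k) p"
 by (simp add: cov_D_gN gN_NN DD_def)

lemma frame_at: "frame A (chart_at A p) \<Phi> k p = \<Phi> k p"
 by (simp add: frame_def pull_def)

lemma frame_frame:
 assumes "c \<in> A" "d \<in> A" "q \<in> fst c" "q \<in> fst d"
 shows "frame A c \<Phi> k q = pull (chd c (snd d) q) (frame A d \<Phi> k q)"
 by (simp add: frame_def pull_def coord_field_change[OF assms] o_def)

text \<open>\<open>cov_D\<close> works at each point in the chart chosen there; by
  \<open>DD_change\<close> its components in any other chart are given by the same formula, so the
  derivative can be iterated in one chart.\<close>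

lemma frame_cov_D:
 assumes W: "\<Phi> \<in> WF" and c: "c \<in> A" and q: "q \<in> fst c"
 shows "frame A c (cov_D A nab nabF \<Phi>) k q = DD c (frame A c \<Phi> k) q"
proof -
 let ?d = "chart_at A q"
 have "DD c (frame A c \<Phi> k) q = pull (chd c (snd ?d) q) (DD ?d (frame A ?d \<Phi> k) q)"
  by (rule DD_change[OF c chart_at(1) q chart_at(2) WF_SF[OF W chart_at(1)] _ _ WF_SF[OF W c] WF_D(4)[OF W c q]])
   (auto intro: WF_D(4)[OF W] chart_at frame_frame[OF c chart_at(1)])
 then show ?thesis
  by (simp add: frame_def[of A c "cov_D A nab nabF \<Phi>"] cov_D_DD coord_field_chd[of A c])
qed

lemma frame_zero: "lb 0 \<Phi> ==> k < 0 ==> frame A c (\<Phi> :: ('m, 'n, 'g::complex_fibre) wform) k = (%q. 0)"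
 by (rule ext) (simp add: frame_def lbD_fib pull_linear)

lemma gN_zero: "(!!p v. nabg p v (%q. 0) = 0) ==> gN nabg c u (%q. 0) q = 0"
 by (simp add: gN_def fun_ops act_linear fun_eq_iff)

lemma cov_D_lb:
 fixes \<Phi> :: "('m, 'n, 'g::complex_fibre) wform"
 assumes "!!p v. nabg p v (%q. 0) = 0" "lb 0 \<Phi>"
 shows "lb 0 (cov_D A nab nabg \<Phi>)"
 by (rule lb_fibI) (simp add: cov_D_gN frame_zero[OF assms(2)] gN_zero[where nabg=nabg, OF assms(1)] dxA_linear)

lemma WF_cov_D:
 assumes W: "\<Phi> \<in> WF" shows "cov_D A nab nabF \<Phi> \<in> WF"
proof (rule WF_I)
 show "lb 0 (cov_D A nab nabF \<Phi>)" by (rule cov_D_lb[where nabg=nabF, OF nabF_zero WF_D(1)[OF W]])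
 show "wfib (cov_D A nab nabF \<Phi> k p)" for k p
  unfolding cov_D_DD by (rule wfib_DD[OF chart_at WF_SF[OF W chart_at(1)] WF_D(4)[OF W chart_at(1)]])
 fix c k assume c: "c \<in> A"
 show "SF (fst c) (frame A c (cov_D A nab nabF \<Phi>) k)"
  by (rule SF_cong[OF open_chart(1)[OF c] _ SF_DD[OF c WF_SF[OF W c] WF_D(4)[OF W c]]])
   (rule frame_cov_D[OF W c, symmetric])
qed

lemma cov_D_ops:
 assumes "\<Phi> \<in> WF"
 shows "\<Psi> \<in> WF ==> cov_D A nab nabF (\<Phi> + \<Psi>) = cov_D A nab nabF \<Phi> + cov_D A nab nabF \<Psi>"
  "cov_D A nab nabF (- \<Phi>) = - cov_D A nab nabF \<Phi>"
  "cov_D A nab nabF (cscale z \<Phi>) = cscale z (cov_D A nab nabF \<Phi>)"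
  "cov_D A nab nabF (parity \<Phi>) = - parity (cov_D A nab nabF \<Phi>)"
proof -
 note s = WF_SF[OF assms chart_at(1)]
 show "cov_D A nab nabF (\<Phi> + \<Psi>) = cov_D A nab nabF \<Phi> + cov_D A nab nabF \<Psi>" if "\<Psi> \<in> WF"
 proof -
  have "cov_D A nab nabF (\<Phi> + \<Psi>) k p = cov_D A nab nabF \<Phi> k p + cov_D A nab nabF \<Psi> k p" for k p
   unfolding cov_D_DD DD_def frame_ops[abs_def]
   by (simp add: NN_ops(1)[OF chart_at s WF_SF[OF that chart_at(1)]] dxA_linear sum.distrib)
  then show ?thesis by (simp add: fun_eq_iff fun_ops)
 qed
 have "cov_D A nab nabF (- \<Phi>) k p = - cov_D A nab nabF \<Phi> k p" for k p
  unfolding cov_D_DD DD_def frame_ops[abs_def] by (simp add: NN_ops(3)[OF chart_at s] dxA_linear sum_negf)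
 then show "cov_D A nab nabF (- \<Phi>) = - cov_D A nab nabF \<Phi>" by (simp add: fun_eq_iff fun_ops)
 have "cov_D A nab nabF (cscale z \<Phi>) k p = smulC z (cov_D A nab nabF \<Phi> k p)" for k p
  unfolding cov_D_DD DD_def frame_ops[abs_def] by (simp add: NN_ops(4)[OF chart_at s] dxA_linear smulC_sum_right)
 then show "cov_D A nab nabF (cscale z \<Phi>) = cscale z (cov_D A nab nabF \<Phi>)" by (simp add: fun_eq_iff cscale_def smulC_def)
 have "NN (chart_at A p) u (%q. par (frame A (chart_at A p) \<Phi> k q)) p = par (NN (chart_at A p) u (frame A (chart_at A p) \<Phi> k) p)" for u k p
  by (simp add: NN_def par_linear act_par) (simp add: par_def dF_ops(5)[OF chart_at SFD[OF s]])
 then have "cov_D A nab nabF (parity \<Phi>) k p = - par (cov_D A nab nabF \<Phi> k p)" for k p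
  unfolding cov_D_DD DD_def frame_ops[abs_def] by (simp add: par_sum par_dxA sum_negf)
 then show "cov_D A nab nabF (parity \<Phi>) = - parity (cov_D A nab nabF \<Phi>)" by (simp add: fun_eq_iff fun_ops parity_def par_def)
qed

lemma cov_D_shift:
 fixes \<Phi> :: "('m, 'n, 'g::complex_fibre) wform"
 shows "cov_D A nab nabg (lambda_shift n \<Phi>) = lambda_shift n (cov_D A nab nabg \<Phi>)"
proof -
 have "frame A c (lambda_shift n \<Phi>) k = frame A c \<Phi> (k - n)" for c k by (simp add: frame_def lambda_shift_def)
 then have "cov_D A nab nabg (lambda_shift n \<Phi>) k p = cov_D A nab nabg \<Phi> (k - n) p" for k p
  by (simp add: cov_D_gN)
 then show ?thesis by (simp add: fun_eq_iff lambda_shift_def)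
qed

text \<open>The Koszul differential contracts a basis with its dual basis; the Christoffel terms
  from the inserted basis vector and from the one-form cancel.\<close>

lemma NN_fdelta:
 assumes c: "c \<in> A" and q: "q \<in> fst c" and F: "SF (fst c) F" and w: "!!p. p \<in> fst c ==> wfib (F p)"
 shows "NN c u (%p. fdelta (F p)) q = fdelta (NN c u F q)"
proof -
 note U = open_chart(1)[OF c]
 let ?G = "Gam c u q" and ?e = "%i. axis i 1 :: real ^ 'n"
 have "NN c u (%p. fdelta (F p)) q = (\<Sum>i\<in>UNIV. NN c u (%p. dxA i (insS (?e i) (F p))) q)"
  unfolding fdelta_def by (rule NN_sum[OF c q]) (intro SF_ops U F)
 also have "\<dots> = (\<Sum>i\<in>UNIV. dxA i (insS (?e i) (NN c u F q)) + dxA i (insS (?G (?e i)) (F q)) -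
   (\<Sum>m\<in>UNIV. smulC (of_real (?G (?e m) $ i)) (dxA m (insS (?e i) (F q)))))"
  by (simp add: NN_dxA[OF c q SF_ops(6)[OF U F]] NN_ops(6)[OF c q F] dxA_linear)
 also have "\<dots> = fdelta (NN c u F q) + ((\<Sum>i\<in>UNIV. dxA i (insS (?G (?e i)) (F q))) -
   (\<Sum>i\<in>UNIV. \<Sum>m\<in>UNIV. smulC (of_real (?G (?e m) $ i)) (dxA m (insS (?e i) (F q)))))"
  by (simp add: sum.distrib sum_subtractf fdelta_def)
 also have "(\<Sum>i\<in>UNIV. \<Sum>m\<in>UNIV. smulC (of_real (?G (?e m) $ i)) (dxA m (insS (?e i) (F q)))) = (\<Sum>m\<in>UNIV. dxA m (insS (?G (?e m)) (F q)))"
 proof -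
  have "dxA m (insS (?G (?e m)) (F q)) = (\<Sum>i\<in>UNIV. smulC (of_real (?G (?e m) $ i)) (dxA m (insS (?e i) (F q))))" for m
   by (subst insS_expand[OF w[OF q], of "?G (?e m)"]) (simp only: dxA_sum dxA_linear)
  then show ?thesis by (subst sum.swap) simp
 qed
 finally show ?thesis by simp
qed

lemma delta_cov_D:
 assumes W: "\<Phi> \<in> WF"
 shows "delta (cov_D A nab nabF \<Phi>) + cov_D A nab nabF (delta \<Phi>) = 0"
proof -
 have "cov_D A nab nabF (delta \<Phi>) k p = - delta (cov_D A nab nabF \<Phi>) k p" for k p
 proof -
  let ?c = "chart_at A p"
  have "NN ?c u (frame A ?c (delta \<Phi>) k) p = fdelta (NN ?c u (frame A ?c \<Phi> k) p)" for u
  proof -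
   have "NN ?c u (frame A ?c (delta \<Phi>) k) p = NN ?c u (%q. fdelta (frame A ?c \<Phi> k q)) p"
    by (rule NN_cong[OF chart_at(1) open_chart(1)[OF chart_at(1)] chart_at(2) WF_SF[OF WF_delta[OF W] chart_at(1)]])
     (rule frame_delta[OF W chart_at(1)])
   also have "\<dots> = fdelta (NN ?c u (frame A ?c \<Phi> k) p)"
    by (rule NN_fdelta[OF chart_at WF_SF[OF W chart_at(1)] WF_D(4)[OF W chart_at(1)]])
   finally show ?thesis .
  qed
  then show ?thesis
   by (simp add: cov_D_DD delta_fib DD_def fdelta_sum fdelta_dxA sum_negf)
 qed
 then show ?thesis by (simp add: fun_eq_iff fun_ops)
qed

lemma cov_D_cov_D:
 assumes tf: "torsion_free A nab" and W: "\<Phi> \<in> WF"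
 shows "cov_D A nab nabF (cov_D A nab nabF \<Phi>) k p = smulC (1 / 2) (\<Sum>j\<in>UNIV. \<Sum>i\<in>UNIV. dxA j (dxA i
   ((%ys vs. Kc (chart_at A p) (axis j 1) (axis i 1) (%q. frame A (chart_at A p) \<Phi> k q ys vs) p)
    - actS (Rc (chart_at A p) (axis j 1) (axis i 1) p) (\<Phi> k p))))"
proof -
 let ?c = "chart_at A p"
 note U = open_chart(1)[OF chart_at(1)]
 have "NN ?c u (frame A ?c (cov_D A nab nabF \<Phi>) k) p = NN ?c u (DD ?c (frame A ?c \<Phi> k)) p" for u
  by (rule NN_cong[OF chart_at(1) U chart_at(2) WF_SF[OF WF_cov_D[OF W] chart_at(1)]])
   (rule frame_cov_D[OF W chart_at(1)])
 then have "cov_D A nab nabF (cov_D A nab nabF \<Phi>) k p = DD ?c (DD ?c (frame A ?c \<Phi> k)) p"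
  by (simp add: cov_D_DD DD_def)
 also have "\<dots> = smulC (1 / 2) (\<Sum>j\<in>UNIV. \<Sum>i\<in>UNIV. dxA j (dxA i
   ((%ys vs. Kc ?c (axis j 1) (axis i 1) (%q. frame A ?c \<Phi> k q ys vs) p)
    - actS (Rc ?c (axis j 1) (axis i 1) p) (frame A ?c \<Phi> k p))))"
  by (rule DD_DD[OF tf chart_at WF_SF[OF W chart_at(1)] WF_D(4)[OF W chart_at(1)]])
 finally show ?thesis by (simp only: frame_at)
qed

subsection \<open>Products\<close>

text \<open>The two closure properties on which \<open>weyl_frame_smooth\<close> relies, required
  also of the factors of a product.\<close>

definition modsm :: "('m set => ('m => 'g::complex_fibre) => bool) => bool"
 where "modsm sm \<longleftrightarrow> (\<forall>c\<in>A. \<forall>s t. (\<forall>q\<in>fst c. s q = t q) \<and> sm (fst c) s \<longrightarrow> sm (fst c) t) \<and>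
  (\<forall>c\<in>A. \<forall>(r :: 'n => real) s. (\<forall>i. sm (fst c) (s i)) \<longrightarrow> sm (fst c) (%q. \<Sum>i\<in>UNIV. r i *\<^sub>R s i q))"

lemma modsm_frame:
 assumes "modsm sm" "\<Phi> \<in> weyl_forms A sm" "c \<in> A"
 shows "sm (fst c) (%q. frame A c \<Phi> k q ys vs)"
proof (rule weyl_frame_smooth[OF assms(2,3) lin_coord[OF assms(3)] open_chart(1)[OF assms(3)]])
 show "sm (fst c) t" if "!!q. q \<in> fst c ==> s q = t q" "sm (fst c) s" for s t
  by (rule assms(1)[unfolded modsm_def, THEN conjunct1, rule_format, OF assms(3), of s]) (auto simp: that)
 show "sm (fst c) (%q. \<Sum>i\<in>UNIV. r i *\<^sub>R s i q)" if "!!i. sm (fst c) (s i)" for r and s :: "'n => 'm => 'a"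
  by (rule assms(1)[unfolded modsm_def, THEN conjunct2, rule_format, OF assms(3)]) (rule that)
qed

context
 fixes m :: "'f1::complex_fibre => 'f2::complex_fibre => 'f" and sm1 sm2 nab1 nab2 \<Phi> \<Psi>
 assumes pair: "pairing m sm1 sm2 nab1 nab2" and mod: "modsm sm1" "modsm sm2"
  and W: "\<Phi> \<in> weyl_forms A sm1" "\<Psi> \<in> weyl_forms A sm2"
begin

lemma frame_wterm:
 assumes "c \<in> A" "q \<in> fst c"
 shows "pull (%y. coord_field A c y q) (wterm \<omega> m \<Phi> \<Psi> k q a b) = wterm (om c) m (frame A c \<Phi>) (frame A c \<Psi>) k q a b"
 unfolding om_def
 by (rule wterm_frame[where \<omega>=\<omega> and q=q and c=c, OF pairingD(1)[OF pair] omega(1) lin_coord[OF assms] om_invertible[OF assms, unfolded om_def]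
    weyl_formsD(2)[OF W(1)] weyl_formsD(2)[OF W(2)]])

lemma frame_wprod:
 assumes "c \<in> A" "q \<in> fst c"
 shows "frame A c (wprod \<omega> m \<Phi> \<Psi>) k q = (\<Sum>a\<in>{0..k}. \<Sum>b\<in>{0..k}. wterm (om c) m (frame A c \<Phi>) (frame A c \<Psi>) k q a b)"
proof -
 have k: "k - 0 \<le> k" by simp
 show ?thesis
  unfolding frame_def[of A c "wprod \<omega> m \<Phi> \<Psi>"] wprod_range[OF pairingD(1)[OF pair] weyl_formsD(1)[OF W(1)] weyl_formsD(1)[OF W(2)] k]
  by (simp only: pull_sum frame_wterm[OF assms])
qed

lemma SF_wterm:
 assumes c: "c \<in> A"
 shows "SF (fst c) (%q. wterm (om c) m (frame A c \<Phi>) (frame A c \<Psi>) k q a b)"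
proof (cases "a + b \<le> k")
 case True
 have "SF (fst c) (%q. Bn (poisson (om c) q) m n (frame A c \<Phi> a q) (frame A c \<Psi> b q))" for n
  by (rule SF_Bn[OF c pair modsm_frame[OF mod(1) W(1) c] modsm_frame[OF mod(2) W(2) c]])
 then show ?thesis using True by (simp add: wterm_def SF_ops(4) open_chart c)
qed (simp add: wterm_def SF_zero open_chart c)

lemma WF_wprod: "wprod \<omega> m \<Phi> \<Psi> \<in> WF"
proof (rule WF_I)
 note m = pairingD(1)[OF pair]
 show "lb 0 (wprod \<omega> m \<Phi> \<Psi>)" by (rule wprod_lb[OF m weyl_formsD(1)[OF W(1)] weyl_formsD(1)[OF W(2)]])
 have k: "k - 0 \<le> k" for k :: int by simp
 have "wfib (wterm \<omega> m \<Phi> \<Psi> k p a b)" for k p a b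
  by (simp add: wterm_def wfib_zero wfib_smulC wfib_Bn[OF m weyl_formsD(2)[OF W(1)] weyl_formsD(2)[OF W(2)]])
 then show "wfib (wprod \<omega> m \<Phi> \<Psi> k p)" for k p
  unfolding wprod_range[OF m weyl_formsD(1)[OF W(1)] weyl_formsD(1)[OF W(2)] k] by (intro wfib_sum)
 fix c k assume c: "c \<in> A"
 show "SF (fst c) (frame A c (wprod \<omega> m \<Phi> \<Psi>) k)"
  by (rule SF_cong[OF open_chart(1)[OF c] frame_wprod[OF c, symmetric]]) (auto intro!: SF_sum SF_wterm c open_chart)
qed

lemma gN_wprod:
 "NN (chart_at A p) u (frame A (chart_at A p) (wprod \<omega> m \<Phi> \<Psi>) k) p =
  wprod \<omega> m (%k p. gN nab1 (chart_at A p) u (frame A (chart_at A p) \<Phi> k) p) \<Psi> k p +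
  wprod \<omega> m \<Phi> (%k p. gN nab2 (chart_at A p) u (frame A (chart_at A p) \<Psi> k) p) k p"
 if z: "!!p v. nab1 p v (%q. 0) = 0" "!!p v. nab2 p v (%q. 0) = 0"
proof -
 let ?c = "chart_at A p"
 note m = pairingD(1)[OF pair] and l1 = weyl_formsD(1)[OF W(1)] and l2 = weyl_formsD(1)[OF W(2)]
 let ?N1 = "%k p. gN nab1 (chart_at A p) u (frame A (chart_at A p) \<Phi> k) p"
 let ?N2 = "%k p. gN nab2 (chart_at A p) u (frame A (chart_at A p) \<Psi> k) p"
 have l: "lb 0 ?N1" "lb 0 ?N2"
  by (rule lb_fibI; simp add: frame_zero[OF l1] frame_zero[OF l2] gN_zero[where nabg=nab1, OF z(1)] gN_zero[where nabg=nab2, OF z(2)])+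
 have k: "k - 0 \<le> k" by simp
 have t: "NN ?c u (%q. wterm (om ?c) m (frame A ?c \<Phi>) (frame A ?c \<Psi>) k q a b) p = wterm \<omega> m ?N1 \<Psi> k p a b + wterm \<omega> m \<Phi> ?N2 k p a b" for a b
 proof (cases "a + b \<le> k")
  case True
  have po: "poisson (om ?c) p = poisson \<omega> p" by (simp add: poisson_def fun_eq_iff om_at)
  note f = modsm_frame[OF mod(1) W(1) chart_at(1)] modsm_frame[OF mod(2) W(2) chart_at(1)]
  have w: "wfib (frame A ?c \<Phi> a p)" "wfib (frame A ?c \<Psi> b p)"
   using weyl_formsD(2)[OF W(1)] weyl_formsD(2)[OF W(2)] by (simp_all add: frame_at)
  show ?thesis
   using True NN_Bn[OF chart_at(1) pair chart_at(2) f w, where u=u and n="nat (k - a - b)"]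
    NN_ops(4)[OF chart_at SF_Bn[OF chart_at(1) pair f], where u=u]
   by (simp add: wterm_def po frame_at smulC_add_right)
 next
  case False
  then show ?thesis by (simp add: wterm_def gN_NN[symmetric] gN_zero nabF_zero)
 qed
 have "NN ?c u (frame A ?c (wprod \<omega> m \<Phi> \<Psi>) k) p = NN ?c u (%q. \<Sum>a\<in>{0..k}. \<Sum>b\<in>{0..k}. wterm (om ?c) m (frame A ?c \<Phi>) (frame A ?c \<Psi>) k q a b) p"
  by (rule NN_cong[OF chart_at(1) open_chart(1)[OF chart_at(1)] chart_at(2) WF_SF[OF WF_wprod chart_at(1)]])
   (rule frame_wprod[OF chart_at(1)])
 also have "\<dots> = (\<Sum>a\<in>{0..k}. \<Sum>b\<in>{0..k}. NN ?c u (%q. wterm (om ?c) m (frame A ?c \<Phi>) (frame A ?c \<Psi>) k q a b) p)"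
  by (subst NN_sum[OF chart_at]; (intro SF_sum SF_wterm chart_at open_chart sum.cong refl NN_sum[OF chart_at])?)
 also have "\<dots> = wprod \<omega> m ?N1 \<Psi> k p + wprod \<omega> m \<Phi> ?N2 k p"
  unfolding wprod_range[OF m l(1) l2 k] wprod_range[OF m l1 l(2) k] by (simp only: t sum.distrib)
 finally show ?thesis .
qed

lemma wprod_dxA:
 assumes m: "cbilin m'" and l: "lb 0 \<Phi>'" "lb 0 \<Psi>'"
 shows "dxA i (wprod \<omega> m' \<Phi>' \<Psi>' k p) = wprod \<omega> m' (%k p. dxA i (\<Phi>' k p)) \<Psi>' k p"
  "dxA i (wprod \<omega> m' \<Phi>' \<Psi>' k p) = wprod \<omega> m' (parity \<Phi>') (%k p. dxA i (\<Psi>' k p)) k p"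
proof -
 have k: "k - 0 \<le> k" by simp
 have l': "lb 0 (%k p. dxA i (\<Phi>' k p))" "lb 0 (%k p. dxA i (\<Psi>' k p))"
  by (rule lb_fibI; simp add: lbD_fib[OF l(1)] lbD_fib[OF l(2)] dxA_linear)+
 have 1: "wterm \<omega> m' (%k p. dxA i (\<Phi>' k p)) \<Psi>' k p a = (%b. dxA i (wterm \<omega> m' \<Phi>' \<Psi>' k p a b))"
  "wterm \<omega> m' (parity \<Phi>') (%k p. dxA i (\<Psi>' k p)) k p a = (%b. dxA i (wterm \<omega> m' \<Phi>' \<Psi>' k p a b))" for a
  by (rule ext; simp add: wterm_def dxA_Bn_left[OF m] dxA_Bn_right[OF m] dxA_linear parity_fib)+
 show "dxA i (wprod \<omega> m' \<Phi>' \<Psi>' k p) = wprod \<omega> m' (%k p. dxA i (\<Phi>' k p)) \<Psi>' k p"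
  unfolding wprod_range[OF m l k] wprod_range[OF m l'(1) l(2) k] by (simp only: dxA_sum 1)
 show "dxA i (wprod \<omega> m' \<Phi>' \<Psi>' k p) = wprod \<omega> m' (parity \<Phi>') (%k p. dxA i (\<Psi>' k p)) k p"
  unfolding wprod_range[OF m l k] wprod_range[OF m lb_ops(7)[OF l(1)] l'(2) k] by (simp only: dxA_sum 1)
qed

lemma cov_D_wprod:
 assumes z: "!!p v. nab1 p v (%q. 0) = 0" "!!p v. nab2 p v (%q. 0) = 0"
 shows "cov_D A nab nabF (wprod \<omega> m \<Phi> \<Psi>) = wprod \<omega> m (cov_D A nab nab1 \<Phi>) \<Psi> + wprod \<omega> m (parity \<Phi>) (cov_D A nab nab2 \<Psi>)"
proof -
 note m = pairingD(1)[OF pair] and l1 = weyl_formsD(1)[OF W(1)] and l2 = weyl_formsD(1)[OF W(2)]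
 define N1 where "N1 = (%i k p. gN nab1 (chart_at A p) (axis i 1) (frame A (chart_at A p) \<Phi> k) p)"
 define N2 where "N2 = (%i k p. gN nab2 (chart_at A p) (axis i 1) (frame A (chart_at A p) \<Psi> k) p)"
 have l: "lb 0 (N1 i)" "lb 0 (N2 i)" for i
  by (rule lb_fibI; simp add: N1_def N2_def frame_zero[OF l1] frame_zero[OF l2] gN_zero[where nabg=nab1, OF z(1)] gN_zero[where nabg=nab2, OF z(2)])+
 have l': "lb 0 (%k p. dxA i (N1 i k p))" "lb 0 (%k p. dxA i (N2 i k p))" for i
  by (rule lb_fibI; simp add: lbD_fib[OF l(1)] lbD_fib[OF l(2)] dxA_linear)+
 have c: "cov_D A nab nab1 \<Phi> = (\<Sum>i\<in>UNIV. (%k p. dxA i (N1 i k p)))" "cov_D A nab nab2 \<Psi> = (\<Sum>i\<in>UNIV. (%k p. dxA i (N2 i k p)))"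
  by (intro ext; simp add: cov_D_gN N1_def N2_def sum_fun_apply)+
 have "cov_D A nab nabF (wprod \<omega> m \<Phi> \<Psi>) k p =
   (wprod \<omega> m (cov_D A nab nab1 \<Phi>) \<Psi> + wprod \<omega> m (parity \<Phi>) (cov_D A nab nab2 \<Psi>)) k p" for k p
 proof -
  have "cov_D A nab nabF (wprod \<omega> m \<Phi> \<Psi>) k p = (\<Sum>i\<in>UNIV. dxA i (wprod \<omega> m (N1 i) \<Psi> k p + wprod \<omega> m \<Phi> (N2 i) k p))"
   unfolding cov_D_gN gN_NN gN_wprod[OF z] N1_def N2_def ..
  also have "\<dots> = (\<Sum>i\<in>UNIV. wprod \<omega> m (%k p. dxA i (N1 i k p)) \<Psi> k p) + (\<Sum>i\<in>UNIV. wprod \<omega> m (parity \<Phi>) (%k p. dxA i (N2 i k p)) k p)"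
   by (simp only: dxA_linear wprod_dxA(1)[OF m l(1) l2] wprod_dxA(2)[OF m l1 l(2)] sum.distrib)
  finally show ?thesis
   unfolding c wprod_sum[OF m l'(1) l2] wprod_sum_right[OF m l'(2) lb_ops(7)[OF l1]] by (simp add: fun_ops)
 qed
 then show ?thesis by (simp add: fun_eq_iff)
qed

end

end

subsection \<open>Supports and degrees\<close>

text \<open>A predicate on the symmetric degree and the form degree. A single calculus of supports
  then serves the form degree, the total degree and the symmetric degree at a given power of
  lambda.\<close>

definition fsupp :: "(nat => nat => bool) => ('n::finite, 'f::complex_fibre) fib => bool"
 where "fsupp P f \<longleftrightarrow> (\<forall>ys vs. \<not> P (length ys) (length vs) \<longrightarrow> f ys vs = 0)"

lemma fsuppD: "fsupp P f ==> \<not> P (length ys) (length vs) ==> f ys vs = 0"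
 by (simp add: fsupp_def)

lemma fsupp_linear:
 "fsupp P f ==> fsupp P g ==> fsupp P (f + g)" "fsupp P f ==> fsupp P g ==> fsupp P (f - g)"
 "fsupp P f ==> fsupp P (- f)" "fsupp P f ==> fsupp P (smulC c f)" "fsupp P 0" "fsupp P f ==> fsupp P (par f)"
 by (simp_all add: fsupp_def fun_ops smulC_def par_def)

lemma fsupp_sum: "(!!i. i \<in> I ==> fsupp P (f i)) ==> fsupp P (\<Sum>i\<in>I. f i)"
 by (simp add: fsupp_def fun_ops)

lemma length_nths_compl: "length (nths xs I) + length (nths xs (- I)) = length xs"
proof -
 have "card {i. i < length xs \<and> i \<in> I} + card {i. i < length xs \<and> i \<in> - I} = card ({i. i < length xs \<and> i \<in> I} \<union> {i. i < length xs \<and> i \<in> - I})"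
  by (rule card_Un_disjoint[symmetric]) auto
 also have "{i. i < length xs \<and> i \<in> I} \<union> {i. i < length xs \<and> i \<in> - I} = {..<length xs}" by auto
 finally show ?thesis by (simp add: length_nths)
qed

lemma fsupp_mu:
 fixes f :: "('n::finite, 'f::complex_fibre) fib" and g :: "('n, 'g::complex_fibre) fib"
 assumes m: "cbilin m" and f: "fsupp P f" and g: "fsupp Q g"
  and R: "!!a b a' b'. P a b ==> Q a' b' ==> R (a + a') (b + b')"
 shows "fsupp R (mu m f g)"
 unfolding fsupp_def
proof (intro allI impI)
 fix ys vs :: "(real ^ 'n) list" assume n: "\<not> R (length ys) (length vs)"
 have "m (f (nths ys I) (nths vs J)) (g (nths ys (- I)) (nths vs (- J))) = 0" for I J
 proof (cases "P (length (nths ys I)) (length (nths vs J))")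
  case True
  then have "\<not> Q (length (nths ys (- I))) (length (nths vs (- J)))"
   using R[of "length (nths ys I)" "length (nths vs J)" "length (nths ys (- I))" "length (nths vs (- J))"] n
   by (auto simp: length_nths_compl)
  then show ?thesis by (simp add: fsuppD[OF g] cbilinD[OF m])
 next
  case False
  then show ?thesis by (simp add: fsuppD[OF f] cbilinD[OF m])
 qed
 then show "mu m f g ys vs = 0" by (simp add: mu_def)
qed

lemma fsupp_insS: "fsupp P f ==> fsupp (%a b. P (Suc a) b) (insS u f)"
 by (simp add: fsupp_def insS_def)

lemma fsupp_insA: "fsupp P f ==> fsupp (%a b. P a (Suc b)) (insA u f)"
 by (simp add: fsupp_def insA_def)

lemma length_del: "j < length xs ==> Suc (length (del j xs)) = length xs"
 by (simp add: del_def)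

lemma fsupp_dxA:
 fixes f :: "('n::finite, 'f::complex_fibre) fib"
 assumes f: "fsupp P f" and R: "!!a b. P a b ==> R a (Suc b)" shows "fsupp R (dxA i f)"
 unfolding fsupp_def dxA_def
proof (intro allI impI sum.neutral ballI)
 fix ys vs :: "(real ^ 'n) list" and j assume "\<not> R (length ys) (length vs)" "j \<in> {..<length vs}"
 then have "\<not> P (length ys) (length (del j vs))" using R[of "length ys" "length (del j vs)"] by (auto simp: length_del)
 then show "((- 1) ^ j * (vs ! j) $ i) *\<^sub>R f ys (del j vs) = 0" by (simp add: fsuppD[OF f])
qed

lemma fsupp_dxS:
 fixes f :: "('n::finite, 'f::complex_fibre) fib"
 assumes f: "fsupp P f" and R: "!!a b. P a b ==> R (Suc a) b" shows "fsupp R (dxS i f)"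
 unfolding fsupp_def dxS_def
proof (intro allI impI sum.neutral ballI)
 fix ys vs :: "(real ^ 'n) list" and j assume "\<not> R (length ys) (length vs)" "j \<in> {..<length ys}"
 then have "\<not> P (length (del j ys)) (length vs)" using R[of "length (del j ys)" "length vs"] by (auto simp: length_del)
 then show "((ys ! j) $ i) *\<^sub>R f (del j ys) vs = 0" by (simp add: fsuppD[OF f])
qed

lemma fsupp_mono: "fsupp P f ==> (!!a b. P a b ==> R a b) ==> fsupp R f"
 unfolding fsupp_def by blast

text \<open>Every Poisson tensor uses up one symmetric argument of either factor: both have degree
  at least \<open>n\<close>, and the product loses 2n.\<close>

lemma fsupp_Bn:
 assumes m: "cbilin m" and "fsupp P f" "fsupp Q g"
  and "!!a b a' b'. P a b ==> Q a' b' ==> n \<le> a ==> n \<le> a' ==> R (a + a' - 2 * n) (b + b')"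
 shows "fsupp R (Bn L m n f g)"
 using assms(2-4)
proof (induction n arbitrary: P Q f g)
 case 0
 then show ?case using fsupp_mu[OF m 0(1,2), of R] by simp
next
 case (Suc n)
 have "fsupp R (Bn L m n (insS u f) (insS w g))" for u w
  by (rule Suc.IH[OF fsupp_insS[OF Suc.prems(1)] fsupp_insS[OF Suc.prems(2)]])
   (use Suc.prems(3) in fastforce)
 then show ?case unfolding Bn_Suc_Psum Psum_def by (intro fsupp_linear fsupp_sum)
qed

lemma fsupp_zero: "fsupp (%a b. False) f ==> f = 0"
 by (simp add: fsupp_def fun_eq_iff fun_ops)

definition wsupp :: "(int => nat => nat => bool) => ('m, 'n::finite, 'f::complex_fibre) wform => bool"
 where "wsupp P \<Phi> \<longleftrightarrow> (\<forall>k p. fsupp (P k) (\<Phi> k p))"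

lemma wsuppI: "(!!k p. fsupp (P k) (\<Phi> k p)) ==> wsupp P \<Phi>"
 and wsuppD: "wsupp P \<Phi> ==> fsupp (P k) (\<Phi> k p)"
 by (auto simp: wsupp_def)

lemma wsupp_conv:
 "form_degree d \<Phi> \<longleftrightarrow> wsupp (%k a b. b = d) \<Phi>"
 "total_degree_ge d \<Phi> \<longleftrightarrow> wsupp (%k a b. int d \<le> 2 * k + int a) \<Phi>"
 by (auto simp: form_degree_def total_degree_ge_def wsupp_def fsupp_def)

lemma wsupp_total_part: "wsupp (%k a b. 2 * k + int a = int d) (total_part d \<Phi>)"
 "wsupp P \<Phi> ==> wsupp P (total_part d \<Phi>)"
 by (auto simp: total_part_def wsupp_def fsupp_def)

lemma wsupp_rest: "wsupp (%k a b. 2 * k + int a \<noteq> int d) (\<Phi> - total_part d \<Phi>)"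
 by (auto simp: total_part_def wsupp_def fsupp_def fun_ops)

lemma wsupp_zero: "wsupp P \<Phi> ==> (!!k a b. \<not> P k a b) ==> \<Phi> = 0"
 by (simp add: wsupp_def fsupp_def fun_eq_iff fun_ops)

lemma wsupp_linear:
 "wsupp P \<Phi> ==> wsupp P \<Psi> ==> wsupp P (\<Phi> + \<Psi>)" "wsupp P \<Phi> ==> wsupp P \<Psi> ==> wsupp P (\<Phi> - \<Psi>)"
 "wsupp P \<Phi> ==> wsupp P (- \<Phi>)" "wsupp P \<Phi> ==> wsupp P (cscale c \<Phi>)" "wsupp P 0" "wsupp P \<Phi> ==> wsupp P (parity \<Phi>)"
 by (simp_all add: wsupp_def fsupp_def fun_ops cscale_def parity_def)

lemma wsupp_shift: "wsupp P \<Phi> ==> (!!k a b. P k a b ==> R (k + n) a b) ==> wsupp R (lambda_shift n \<Phi>)"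
 unfolding wsupp_def fsupp_def lambda_shift_def by (metis diff_add_cancel)

lemma wsupp_delta:
 assumes "wsupp P \<Phi>" and R: "!!k a b. P k (Suc a) b ==> R k a (Suc b)"
 shows "wsupp R (delta \<Phi>)"
 unfolding wsupp_def delta_fib fdelta_def
 by (intro allI fsupp_sum fsupp_dxA[OF fsupp_insS[OF wsuppD[OF assms(1)]]] R)

lemma fsupp_fdstar:
 assumes "fsupp P f" and R: "!!a b. P a (Suc b) ==> R (Suc a) b"
 shows "fsupp R (fdstar f)"
 unfolding fdstar_def by (intro fsupp_sum fsupp_dxS[OF fsupp_insA[OF assms(1)]] R)

lemma wsupp_delta_inv:
 assumes "wsupp P \<Phi>" and R: "!!k a b. P k a (Suc b) ==> R k (Suc a) b"
 shows "wsupp R (delta_inv \<Phi>)"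
proof (rule wsuppI)
 fix k p
 have "fsupp (R k) (fdstar (\<Phi> k p))" by (rule fsupp_fdstar[OF wsuppD[OF assms(1)]]) (rule R)
 then show "fsupp (R k) (delta_inv \<Phi> k p)" unfolding fsupp_def delta_inv_fib by simp
qed

lemma wsupp_cov_D:
 assumes z: "!!p v. nabg p v (%q. 0) = 0" and P: "wsupp P \<Phi>" and R: "!!k a b. P k a b ==> R k a (Suc b)"
 shows "wsupp R (cov_D A nab nabg \<Phi>)"
proof (rule wsuppI)
 fix k p
 have "fsupp (P k) (nabla_tensor A nab nabg i \<Phi> k p)" for i
  unfolding fsupp_def nabla_tensor_def Let_def by (simp add: fsuppD[OF wsuppD[OF P]] z)
 then have "fsupp (R k) (dxA i (nabla_tensor A nab nabg i \<Phi> k p))" for i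
  by (rule fsupp_dxA) (rule R)
 moreover have "cov_D A nab nabg \<Phi> k p = (\<Sum>i\<in>UNIV. dxA i (nabla_tensor A nab nabg i \<Phi> k p))"
  by (simp add: cov_D_def fun_ops dx_a_def dxA_def fun_eq_iff)
 ultimately show "fsupp (R k) (cov_D A nab nabg \<Phi> k p)" by (simp add: fsupp_sum)
qed

text \<open>At order \<open>n\<close> the power of lambda grows by \<open>n\<close> while the
  symmetric degree drops by 2n, which leaves the total degree additive.\<close>

lemma wsupp_wprod:
 assumes m: "cbilin m" and l: "lb N \<Phi>" "lb N \<Psi>" and P: "wsupp P \<Phi>" and Q: "wsupp Q \<Psi>"
  and R: "!!k a b k' a' b' n. P k a b ==> Q k' a' b' ==> n \<le> a ==> n \<le> a' ==> R (k + k' + int n) (a + a' - 2 * n) (b + b')"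
 shows "wsupp R (wprod \<omega> m \<Phi> \<Psi>)"
proof (rule wsuppI)
 fix k p
 have "fsupp (R k) (wterm \<omega> m \<Phi> \<Psi> k p i j)" for i j
 proof (cases "i + j \<le> k")
  case True
  have "R k (a + a' - 2 * nat (k - i - j)) (b + b')" if "P i a b" "Q j a' b'" "nat (k - i - j) \<le> a" "nat (k - i - j) \<le> a'" for a b a' b'
   using R[OF that] True by simp
  then have "fsupp (R k) (Bn (poisson \<omega> p) m (nat (k - i - j)) (\<Phi> i p) (\<Psi> j p))"
   by (rule fsupp_Bn[OF m wsuppD[OF P, of i p] wsuppD[OF Q, of j p]])
  then show ?thesis
   using True by (simp add: wterm_def fsupp_linear)
 qed (simp add: wterm_def fsupp_linear)
 then show "fsupp (R k) (wprod \<omega> m \<Phi> \<Psi> k p)"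
  unfolding wprod_range[OF m l order.refl] by (intro fsupp_sum)
qed

section \<open>Homogeneous components for the total degree\<close>

lemma total_part_linear:
 "total_part d (\<Phi> + \<Psi>) = total_part d \<Phi> + total_part d \<Psi>" "total_part d (\<Phi> - \<Psi>) = total_part d \<Phi> - total_part d \<Psi>"
 "total_part d (cscale c \<Phi>) = cscale c (total_part d \<Phi>)" "total_part d 0 = 0"
 for \<Phi> \<Psi> :: "('m, 'n::finite, 'f::complex_fibre) wform"
 by (simp_all add: total_part_def cscale_def fun_eq_iff fun_ops)

lemma total_part_sum: "total_part d (\<Sum>i\<in>I. F i) = (\<Sum>i\<in>I. total_part d (F i :: ('m, 'n::finite, 'f::complex_fibre) wform))"
 by (induction I rule: infinite_finite_induct) (simp_all add: total_part_linear)

lemma total_part_same: "wsupp (%k a b. 2 * k + int a = int d) \<Phi> ==> total_part d \<Phi> = \<Phi>"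
 by (force simp: wsupp_def fsupp_def total_part_def fun_eq_iff)

lemma total_part_other: "wsupp (%k a b. 2 * k + int a \<noteq> int d) \<Phi> ==> total_part d \<Phi> = 0"
 by (simp add: wsupp_def fsupp_def total_part_def fun_eq_iff fun_ops)

lemma total_part_commute:
 fixes T :: "('m, 'n::finite, 'f::complex_fibre) wform => ('m, 'n, 'g::complex_fibre) wform"
 assumes "T \<Phi> = T (total_part d \<Phi>) + T (\<Phi> - total_part d \<Phi>)"
  and "wsupp (%k a b. 2 * k + int a = int e) (T (total_part d \<Phi>))"
  and "wsupp (%k a b. 2 * k + int a \<noteq> int e) (T (\<Phi> - total_part d \<Phi>))"
 shows "total_part e (T \<Phi>) = T (total_part d \<Phi>)"
 by (subst assms(1)) (simp add: total_part_linear total_part_same[OF assms(2)] total_part_other[OF assms(3)])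

lemma total_part_lambda: "total_part d (lambda_shift (- 1) \<Phi>) = lambda_shift (- 1) (total_part (d + 2) \<Phi>)"
 by (auto simp: total_part_def lambda_shift_def fun_eq_iff)

lemma lb_total_part: "lb N \<Phi> ==> lb N (total_part d (\<Phi> :: ('m, 'n::finite, 'f::complex_fibre) wform))"
 by (simp add: lb_def total_part_def fun_eq_iff fun_ops)

lemma total_part_wprod:
 assumes m: "cbilin m" and l: "lb 0 \<Phi>" "lb 0 \<Psi>"
 shows "total_part d (wprod \<omega> m \<Phi> \<Psi>) = (\<Sum>i\<le>d. wprod \<omega> m (total_part i \<Phi>) (total_part (d - i) \<Psi>))"
proof -
 \<comment> \<open>The truncation of the left factor at total degree \<open>d\<close>. What is cut
   off has larger degree and the right factor has no negative degree, so it cannot contribute to the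
   component of degree \<open>d\<close>.\<close>
 define S where "S = (\<Sum>i\<le>d. total_part i \<Phi>)"
 have lS: "lb 0 S" unfolding S_def by (rule lb_sum[OF lb_total_part[OF l(1)]])
 have k: "wsupp (%k a b. 0 \<le> k) \<Phi>" "wsupp (%k a b. 0 \<le> k) \<Psi>"
  using l by (auto simp: wsupp_def fsupp_def lb_def fun_ops)
 have S: "S k p ys vs = (if 2 * k + int (length ys) \<le> int d then \<Phi> k p ys vs else 0)" for k p ys vs
 proof (cases "0 \<le> k")
  case True
  have "S k p ys vs = (\<Sum>i\<le>d. if i = nat (2 * k + int (length ys)) then \<Phi> k p ys vs else 0)"
   unfolding S_def fun_ops total_part_def by (intro sum.cong refl if_cong) (use True in auto)
  also have "\<dots> = (if 2 * k + int (length ys) \<le> int d then \<Phi> k p ys vs else 0)"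
   using True by (auto simp: sum.delta)
  finally show ?thesis .
 next
  case False
  then show ?thesis using lbD[OF lS, of k] lbD[OF l(1), of k] by (simp add: fun_ops)
 qed
 have rest: "wsupp (%k a b. int d < 2 * k + int a) (\<Phi> - S)"
  by (auto simp: wsupp_def fsupp_def fun_ops S)
 have 1: "total_part d (wprod \<omega> m (\<Phi> - S) \<Psi>) = 0"
  by (rule total_part_other, rule wsupp_wprod[OF m lb_ops(2)[OF l(1) lS] l(2) rest k(2)]) auto
 have 2: "total_part d (wprod \<omega> m (total_part i \<Phi>) \<Psi>) = wprod \<omega> m (total_part i \<Phi>) (total_part (d - i) \<Psi>)" if "i \<le> d" for i
 proof (rule total_part_commute)
  note li = lb_total_part[OF l(1), of i] and lj = lb_total_part[OF l(2), of "d - i"]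
  show "wprod \<omega> m (total_part i \<Phi>) \<Psi> = wprod \<omega> m (total_part i \<Phi>) (total_part (d - i) \<Psi>) + wprod \<omega> m (total_part i \<Phi>) (\<Psi> - total_part (d - i) \<Psi>)"
   using wprod_add(2)[OF m li li lj lb_ops(2)[OF l(2) lj]] by simp
  show "wsupp (%k a b. 2 * k + int a = int d) (wprod \<omega> m (total_part i \<Phi>) (total_part (d - i) \<Psi>))"
   by (rule wsupp_wprod[OF m li lj wsupp_total_part(1) wsupp_total_part(1)]) (use that in auto)
  show "wsupp (%k a b. 2 * k + int a \<noteq> int d) (wprod \<omega> m (total_part i \<Phi>) (\<Psi> - total_part (d - i) \<Psi>))"
   by (rule wsupp_wprod[OF m li lb_ops(2)[OF l(2) lj] wsupp_total_part(1) wsupp_rest]) (use that in auto)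
 qed
 have "wprod \<omega> m \<Phi> \<Psi> = wprod \<omega> m S \<Psi> + wprod \<omega> m (\<Phi> - S) \<Psi>"
  using wprod_add(1)[OF m lS lb_ops(2)[OF l(1) lS] l(2) l(2)] by simp
 then have "total_part d (wprod \<omega> m \<Phi> \<Psi>) = total_part d (wprod \<omega> m S \<Psi>)"
  by (simp add: total_part_linear 1)
 also have "\<dots> = (\<Sum>i\<le>d. total_part d (wprod \<omega> m (total_part i \<Phi>) \<Psi>))"
  unfolding S_def wprod_sum[OF m lb_total_part[OF l(1)] l(2)] total_part_sum ..
 finally show ?thesis by (simp add: 2)
qed

text \<open>The Koszul differential preserves the sum of the two degrees, so the weights in
  \<open>delta_inv\<close> commute with it.\<close>

lemma fdelta_total:
 "fdelta (%ys vs. c (length ys + length vs) *\<^sub>R g ys vs) ys vs = c (length ys + length vs) *\<^sub>R fdelta g ys vs"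
proof -
 have "length vs - Suc 0 + Suc (length ys) = length ys + length vs" if "j < length vs" for j using that by simp
 then show ?thesis
  by (simp add: fdelta_def fun_ops dxA_def insS_def scaleR_sum_right del_def algebra_simps)
qed

definition sig :: "('m, 'n::finite, 'f::complex_fibre) wform => ('m, 'n, 'f) wform"
 where "sig \<Phi> = (%k p ys vs. if ys = [] \<and> vs = [] then \<Phi> k p [] [] else 0)"

lemma wform_hodge:
 fixes \<Phi> :: "('m, 'n::finite, 'f::complex_fibre) wform"
 assumes w: "!!k p. wfib (\<Phi> k p)"
 shows "\<Phi> = delta (delta_inv \<Phi>) + delta_inv (delta \<Phi>) + sig \<Phi>"
proof (intro ext)
 fix k p and ys vs :: "(real ^ 'n) list"
 let ?f = "\<Phi> k p" and ?c = "1 / real (length ys + length vs)"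
 have e: "delta_inv \<Phi> k p = (%ys vs. (1 / real (length ys + length vs)) *\<^sub>R fdstar ?f ys vs)"
  by (intro ext) (rule delta_inv_fib)
 have "(delta (delta_inv \<Phi>) + delta_inv (delta \<Phi>) + sig \<Phi>) k p ys vs = ?c *\<^sub>R (fdelta (fdstar ?f) + fdstar (fdelta ?f)) ys vs + sig \<Phi> k p ys vs"
  using fdelta_total[of "%n. 1 / real n" "fdstar ?f" ys vs]
  by (simp add: fun_ops delta_fib delta_inv_fib e scaleR_add_right)
 also have "\<dots> = ?c *\<^sub>R (real (length ys + length vs) *\<^sub>R ?f ys vs) + sig \<Phi> k p ys vs"
  by (simp add: hodge[OF w] numS_def numA_def fun_ops scaleR_add_left)
 \<comment> \<open>In degree zero the weight is 1 / 0 = 0 and \<open>sig\<close> supplies the value;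
   in all other degrees the weight cancels the number operators.\<close>
 also have "\<dots> = ?f ys vs" by (cases "ys = [] \<and> vs = []") (auto simp: sig_def add_nonneg_eq_0_iff)
 finally show "?f ys vs = (delta (delta_inv \<Phi>) + delta_inv (delta \<Phi>) + sig \<Phi>) k p ys vs" by simp
qed

lemma delta_inv_linear:
 fixes \<Phi> \<Psi> :: "('m, 'n::finite, 'f::complex_fibre) wform"
 shows "delta_inv (\<Phi> + \<Psi>) = delta_inv \<Phi> + delta_inv \<Psi>" "delta_inv (\<Phi> - \<Psi>) = delta_inv \<Phi> - delta_inv \<Psi>" "delta_inv (- \<Phi>) = - delta_inv \<Phi>"
 "delta_inv (0 :: ('m, 'n, 'f) wform) = 0"
 by (intro ext; simp only: wform_ops plus_fun_apply minus_apply uminus_apply zero_fun_apply delta_inv_fib fdstar_linear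
   scaleR_add_right scaleR_diff_right scaleR_minus_right scaleR_zero_right)+

lemma delta_linear:
 fixes \<Phi> \<Psi> :: "('m, 'n::finite, 'f::complex_fibre) wform"
 shows "delta (\<Phi> + \<Psi>) = delta \<Phi> + delta \<Psi>" "delta (\<Phi> - \<Psi>) = delta \<Phi> - delta \<Psi>" "delta (- \<Phi>) = - delta \<Phi>"
 "delta (cscale c \<Phi>) = cscale c (delta \<Phi>)" "delta (lambda_shift n \<Phi>) = lambda_shift n (delta \<Phi>)" "delta (parity \<Phi>) = - parity (delta \<Phi>)"
proof -
 show "delta (\<Phi> + \<Psi>) = delta \<Phi> + delta \<Psi>"
 proof (intro ext)
  fix k p show "delta (\<Phi> + \<Psi>) k p ys vs = (delta \<Phi> + delta \<Psi>) k p ys vs" for ys vs by (simp only: delta_fib wform_ops fdelta_linear)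
 qed
 show "delta (\<Phi> - \<Psi>) = delta \<Phi> - delta \<Psi>"
 proof (intro ext)
  fix k p show "delta (\<Phi> - \<Psi>) k p ys vs = (delta \<Phi> - delta \<Psi>) k p ys vs" for ys vs by (simp only: delta_fib wform_ops fdelta_linear)
 qed
 have "delta (- \<Phi>) k p = (- delta \<Phi>) k p" for k p by (simp only: delta_fib wform_ops fdelta_linear)
 then show "delta (- \<Phi>) = - delta \<Phi>" by (intro ext) simp
 have "delta (cscale c \<Phi>) k p = cscale c (delta \<Phi>) k p" for k p by (simp only: delta_fib cscale_fib fdelta_linear)
 then show "delta (cscale c \<Phi>) = cscale c (delta \<Phi>)" by (intro ext) simp
 have "delta (lambda_shift n \<Phi>) k p = lambda_shift n (delta \<Phi>) k p" for k p by (simp only: delta_fib lambda_shift_def)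
 then show "delta (lambda_shift n \<Phi>) = lambda_shift n (delta \<Phi>)" by (intro ext) simp
 have "delta (parity \<Phi>) k p = (- parity (delta \<Phi>)) k p" for k p by (simp only: delta_fib parity_fib wform_ops par_fdelta minus_minus)
 then show "delta (parity \<Phi>) = - parity (delta \<Phi>)" by (intro ext) simp
qed

lemma parity_linear:
 fixes \<Phi> \<Psi> :: "('m, 'n::finite, 'f::complex_fibre) wform"
 shows "parity (\<Phi> + \<Psi>) = parity \<Phi> + parity \<Psi>" "parity (\<Phi> - \<Psi>) = parity \<Phi> - parity \<Psi>" "parity (- \<Phi>) = - parity \<Phi>"
 "parity (cscale c \<Phi>) = cscale c (parity \<Phi>)" "parity (lambda_shift n \<Phi>) = lambda_shift n (parity \<Phi>)" "parity (parity \<Phi>) = \<Phi>"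
 by (simp_all add: parity_def fun_eq_iff fun_ops scaleR_right_distrib scaleR_right_diff_distrib scaleC_add_right scaleC_diff_right cscale_def lambda_shift_def scaleR_scaleC scaleC_scaleC mult.commute)

lemma parity_form_degree: "form_degree d \<Phi> ==> parity \<Phi> = cscale ((- 1) ^ d) (\<Phi> :: ('m, 'n::finite, 'f::complex_fibre) wform)"
 unfolding form_degree_def parity_def cscale_def
 by (intro ext) (metis (no_types, lifting) of_real_1 of_real_minus of_real_power scaleC_zero_right scaleR_scaleC)

text \<open>The covariant derivative preserves the symmetric degree and the power of lambda, so at
  given arguments it sees only the corresponding part of the form.\<close>

lemma cov_D_local:
 assumes "!!q ys vs. length ys = d ==> \<Phi> k q ys vs = \<Phi>' k q ys vs" "length ys = d"
 shows "cov_D A nab nabg \<Phi> k p ys vs = cov_D A nab nabg \<Phi>' k p ys vs"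
 unfolding cov_D_def fun_ops dx_a_def nabla_tensor_def Let_def by (simp add: assms)

subsection \<open>Fibre products\<close>

lemma cbilin_bounded:
 fixes m :: "'f::{complex_fibre,euclidean_space} => 'g::{complex_fibre,euclidean_space} => 'h::complex_fibre"
 assumes "cbilin m" shows "bounded_bilinear m"
 unfolding bilinear_conv_bounded_bilinear[symmetric] bilinear_def
 by (intro conjI allI linearI; simp only: cbilinD[OF assms])

lemma cbilin_mv: "cbilin ((*v) :: complex ^ 'k::finite ^ 'k => complex ^ 'k => complex ^ 'k)"
 by (simp add: cbilin_def vec_eq_iff matrix_vector_mult_def scaleC_vec_def scaleC_complex_def sum.distrib sum_distrib_left algebra_simps)

lemma cbilin_mm: "cbilin ((**) :: complex ^ 'k::finite ^ 'k => complex ^ 'k ^ 'k => complex ^ 'k ^ 'k)"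
 by (simp add: cbilin_def vec_eq_iff matrix_matrix_mult_def scaleC_vec_def scaleC_complex_def sum.distrib sum_distrib_left algebra_simps)

lemma cbilin_times: "cbilin ((*) :: complex => complex => complex)"
 by (simp add: cbilin_def scaleC_complex_def algebra_simps)

lemma cbilin_sc: "cbilin (%c s. c *\<^sub>c s :: 'f::complex_fibre)"
 by (simp add: cbilin_def scaleC_add_left scaleC_add_right scaleC_scaleC scaleC_complex_def mult.commute)

lemmas cbilin_sc' = cbilin_flip[OF cbilin_sc]

lemma mat_mv: "mat c *v s = c *\<^sub>c (s :: complex ^ 'k::finite)"
 by (simp add: vec_eq_iff matrix_vector_mult_def mat_def scaleC_vec_def scaleC_complex_def if_distrib[of "%x. x * _"] cong: if_cong)

lemma mat_mm: "mat c ** B = c *\<^sub>c (B :: complex ^ 'k::finite ^ 'k)" "B ** mat c = c *\<^sub>c B"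
 by (simp_all add: vec_eq_iff matrix_matrix_mult_def mat_def scaleC_vec_def scaleC_complex_def if_distrib[of "%x. x * _"] if_distrib[of "%x. _ * x"] mult.commute cong: if_cong)

lemma mat_linear:
 "mat (a + b) = mat a + (mat b :: complex ^ 'k::finite ^ 'k)" "mat (a - b) = mat a - (mat b :: complex ^ 'k ^ 'k)"
 "mat (- a) = - (mat a :: complex ^ 'k ^ 'k)" "mat (r *\<^sub>R a) = r *\<^sub>R (mat a :: complex ^ 'k ^ 'k)"
 "mat (c *\<^sub>c a) = c *\<^sub>c (mat a :: complex ^ 'k ^ 'k)" "mat 0 = (0 :: complex ^ 'k ^ 'k)"
 by (simp_all add: vec_eq_iff mat_def scaleC_vec_def scaleC_complex_def)

lemma mat_sum: "mat (\<Sum>i\<in>I. f i) = (\<Sum>i\<in>I. mat (f i) :: complex ^ 'k::finite ^ 'k)"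
 by (rule additive_sum[where T=mat]) (simp_all add: mat_linear)

lemma mat_eq_0: "mat a = (0 :: complex ^ 'k::finite ^ 'k) \<longleftrightarrow> a = 0"
 by (auto simp: vec_eq_iff mat_def)

lemma matrix_mv: "matrix F *v x = (\<Sum>j\<in>UNIV. x $ j *\<^sub>c F (axis j 1))" for x :: "complex ^ 'k::finite"
 by (simp add: vec_eq_iff matrix_vector_mult_def matrix_def scaleC_vec_def scaleC_complex_def mult.commute)

lemma mv_axis: "(\<Sum>j\<in>UNIV. x $ j *\<^sub>c (M *v axis j 1)) = M *v x" for x :: "complex ^ 'k::finite"
 by (simp add: vec_eq_iff matrix_vector_mult_def scaleC_vec_def scaleC_complex_def axis_def if_distrib[of "%x. _ * x"] mult.commute cong: if_cong)

subsection \<open>Scalar forms as endomorphism-valued forms\<close>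

text \<open>Scalar matrices vanish only for the scalar 0, so both products run over the same index
  set.\<close>

lemma wprod_to_End:
 fixes \<Psi> :: "('m, 'n::finite, 'f::zero) wform" and \<Phi> :: "('m, 'n, complex) wform"
  and m :: "complex ^ 'k::finite ^ 'k => 'f => 'h::complex_fibre"
 assumes "!!x y. m (mat x) y = m' x y"
 shows "wprod \<omega> m (to_End \<Phi>) \<Psi> = wprod \<omega> m' \<Phi> \<Psi>"
proof -
 have "(to_End \<Phi> a :: 'm => (real ^ 'n) list => (real ^ 'n) list => complex ^ 'k ^ 'k) = 0 \<longleftrightarrow> \<Phi> a = 0" for a
  by (simp add: to_End_def fun_eq_iff fun_ops mat_eq_0)
 then show ?thesis by (simp add: wprod_def to_End_def assms)
qed

lemma wprod_to_End_right:
 fixes \<Psi> :: "('m, 'n::finite, 'f::zero) wform" and \<Phi> :: "('m, 'n, complex) wform"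
  and m :: "'f => complex ^ 'k::finite ^ 'k => 'h::complex_fibre"
 assumes "!!x y. m y (mat x) = m' y x"
 shows "wprod \<omega> m \<Psi> (to_End \<Phi>) = wprod \<omega> m' \<Psi> \<Phi>"
proof -
 have "(to_End \<Phi> a :: 'm => (real ^ 'n) list => (real ^ 'n) list => complex ^ 'k ^ 'k) = 0 \<longleftrightarrow> \<Phi> a = 0" for a
  by (simp add: to_End_def fun_eq_iff fun_ops mat_eq_0)
 then show ?thesis by (simp add: wprod_def to_End_def assms)
qed

lemma to_End_ops:
 "to_End (\<Phi> + \<Psi>) = to_End \<Phi> + to_End \<Psi>" "to_End (\<Phi> - \<Psi>) = to_End \<Phi> - to_End \<Psi>"
 "to_End (cscale c \<Phi>) = cscale c (to_End \<Phi>)" "to_End (lambda_shift n \<Phi>) = lambda_shift n (to_End \<Phi>)"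
 "to_End 0 = 0"
 by (simp_all add: to_End_def fun_eq_iff fun_ops mat_linear cscale_def lambda_shift_def)

lemma to_End_delta: "delta (to_End \<Phi>) = to_End (delta \<Phi>)" "delta_inv (to_End \<Phi>) = to_End (delta_inv \<Phi>)"
 by (intro ext; simp add: delta_def delta_inv_def delta_star_def dx_a_def dx_s_def ins_s_def ins_a_def to_End_def fun_ops mat_linear mat_sum)+

lemma to_End_lb: "lb N \<Phi> ==> lb N (to_End \<Phi>)"
 by (simp add: lb_def to_End_def fun_eq_iff fun_ops mat_linear)

lemma to_End_wsupp: "wsupp P \<Phi> ==> wsupp P (to_End \<Phi>)"
 by (simp add: wsupp_def fsupp_def to_End_def mat_linear)

text \<open>An element of degree zero to which \<open>dxA\<close> and \<open>dxS\<close> are applied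
  in order to write the curvatures as sums of monomials with constant coefficients.\<close>

definition cst :: "'f => ('n::finite, 'f::complex_fibre) fib"
 where "cst e = (%ys vs. if ys = [] \<and> vs = [] then e else 0)"

lemma ins_cst: "insS u (cst e) = 0" "insA u (cst e) = 0"
 by (simp_all add: insS_def insA_def cst_def fun_eq_iff fun_ops)

lemma par_cst: "par (cst e) = cst e"
 by (simp add: par_def cst_def fun_eq_iff)

lemma mu_cst:
 assumes m: "cbilin m" shows "mu m (cst e) g ys vs = m e (g ys vs)"
proof (induction ys arbitrary: g)
 case Nil
 show ?case
 proof (induction vs arbitrary: g)
  case Nil then show ?case by (simp add: mu_Nil cst_def)
 next
  case (Cons v vs)
  have "mu m (cst e) g [] (v # vs) = insA v (mu m (cst e) g) [] vs" by (simp add: insA_def)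
  also have "\<dots> = m e (insA v g [] vs)"
   by (simp add: insA_mu[OF m] ins_cst par_cst mu_linear[OF m] Cons.IH)
  finally show ?case by (simp add: insA_def)
 qed
next
 case (Cons y ys)
 have "mu m (cst e) g (y # ys) vs = insS y (mu m (cst e) g) ys vs" by (simp add: insS_def)
 also have "\<dots> = m e (insS y g ys vs)"
  by (simp add: insS_mu[OF m] ins_cst mu_linear[OF m] Cons.IH)
 finally show ?case by (simp add: insS_def)
qed

lemma fsupp_cst: "fsupp (%a b. a = 0 \<and> b = 0) (cst e)"
 by (simp add: fsupp_def cst_def)

lemma fsupp_dxA2: "fsupp (%a b. a = 0 \<and> b = 2) (dxA i (dxA j (cst e)))"
 by (rule fsupp_dxA[OF fsupp_dxA[OF fsupp_cst]]) auto

lemma dxA2_cst: "dxA i (dxA j (cst e)) [] [v, w] = (v $ i * w $ j - w $ i * v $ j) *\<^sub>R e"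
 by (simp add: dxA_def cst_def del_def lessThan_Suc scaleR_diff_left)

lemma fsupp_dxS2: "fsupp (%a b. a = 2 \<and> b = 2) (dxS l (dxS k (dxA i (dxA j (cst e)))))"
 by (rule fsupp_dxS[OF fsupp_dxS[OF fsupp_dxA2]]) auto

lemma dxS2_cst: "dxS l (dxS k (dxA i (dxA j (cst e)))) [y, z] [v, w] =
  ((y $ l * z $ k + z $ l * y $ k) * (v $ i * w $ j - w $ i * v $ j)) *\<^sub>R e"
 by (simp add: dxS_def dxA2_cst del_def lessThan_Suc scaleR_add_left algebra_simps)

subsection \<open>Tensoriality of the curvature\<close>

context cbundle
begin

context
 fixes c V q assumes c: "c \<in> A" and V: "open V" "V \<subseteq> fst c" "q \<in> V"
begin

lemma smF_dF_local: "smF V s ==> smF V (dF c u s)"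
 unfolding dF_def by (rule connF_D(4)[OF V(1) smooth_vf_coord[OF c V(1,2) smooth_fun_const[OF V(1)]]])

lemma dF_cong_local: "smF V s ==> (!!p. p \<in> V ==> s p = t p) ==> x \<in> V ==> dF c u s x = dF c u t x"
 unfolding dF_def by (rule nabF_cong[OF V(1)])

lemma Kc_cong:
 assumes s: "smF V s" and e: "!!p. p \<in> V ==> s p = t p"
 shows "Kc c u w s q = Kc c u w t q"
 unfolding Kc_def
 by (intro arg_cong2[where f="(-)"] dF_cong_local smF_dF_local s V e)

lemma Kc_sum:
 assumes s: "!!j. j \<in> I ==> smF V (s j)"
 shows "Kc c u w (%p. \<Sum>j\<in>I. s j p) q = (\<Sum>j\<in>I. Kc c u w (s j) q)"
proof -
 have "dF c u (dF c w (%p. \<Sum>j\<in>I. s j p)) q = (\<Sum>j\<in>I. dF c u (dF c w (s j)) q)" for u w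
 proof -
  have "dF c u (dF c w (%p. \<Sum>j\<in>I. s j p)) q = dF c u (%p. \<Sum>j\<in>I. dF c w (s j) p) q"
   by (rule dF_cong_local[OF smF_dF_local[OF smF_sum[OF V(1) s]] _ V(3)]) (simp_all add: dF_def nabF_sum[OF V(1) _ s])
  also have "\<dots> = (\<Sum>j\<in>I. dF c u (dF c w (s j)) q)"
   unfolding dF_def[of c u] by (rule nabF_sum[OF V(1,3) smF_dF_local[OF s]])
  finally show ?thesis .
 qed
 then show ?thesis by (simp add: Kc_def sum_subtractf)
qed

text \<open>In the commutator the terms with one derivative of \<open>g\<close> cancel pairwise, and
  the second derivatives of \<open>g\<close> commute.\<close>

lemma Kc_mult:
 assumes g: "smooth_fun A V g" and s: "smF V s"
 shows "Kc c u w (%p. g p *\<^sub>c s p) q = g q *\<^sub>c Kc c u w s q"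
proof -
 have qc: "p \<in> V ==> p \<in> fst c" for p using V(2) by blast
 have 1: "dF c w (%p. h p *\<^sub>c t p) x = chd c h x w *\<^sub>c t x + h x *\<^sub>c dF c w t x"
  if "smooth_fun A V h" "smF V t" "x \<in> V" for h t x w
  unfolding dF_def nabF_mult[OF V(1) that(3,1,2)] tangent_deriv_coord_field[OF that(1) V(1) that(3) c qc[OF that(3)]] ..
 have gw: "smooth_fun A V (%q. chd c g q w)" for w by (rule smooth_fun_chd[OF c V(1,2) g])
 have 2: "dF c u (dF c w (%p. g p *\<^sub>c s p)) q = chd c (%q. chd c g q w) q u *\<^sub>c s q + chd c g q w *\<^sub>c dF c u s q
   + (chd c g q u *\<^sub>c dF c w s q + g q *\<^sub>c dF c u (dF c w s) q)" for u w
 proof -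
  have "dF c u (dF c w (%p. g p *\<^sub>c s p)) q = dF c u (%p. chd c g p w *\<^sub>c s p + g p *\<^sub>c dF c w s p) q"
   by (rule dF_cong_local[OF smF_dF_local[OF smF_mult[OF V(1) g s]] 1[OF g s] V(3)])
  also have "\<dots> = dF c u (%p. chd c g p w *\<^sub>c s p) q + dF c u (%p. g p *\<^sub>c dF c w s p) q"
   unfolding dF_def[of c u] by (rule nabF_add[OF V(1,3) smF_mult[OF V(1) gw s] smF_mult[OF V(1) g smF_dF_local[OF s]]])
  finally show ?thesis by (simp only: 1[OF gw s V(3)] 1[OF g smF_dF_local[OF s] V(3)])
 qed
 show ?thesis
  unfolding Kc_def 2 chd_commute[OF c V(1,3) qc[OF V(3)] g, of w u] by (simp add: scaleC_diff_right algebra_simps)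
qed

end

end

lemma linear_inner_axis: "linear f ==> f x = (\<chi> i. f (axis i 1)) \<bullet> x" for f :: "real ^ 'n::finite => real"
 by (subst linear_axis_expansion[of f x]) (simp_all add: inner_vec_def mult.commute)

context symplectic_bundle
begin

lemma smooth_om_const:
 assumes c: "c \<in> A" shows "smooth_fun A (fst c) (%q. om c q y z)"
proof (rule smooth_fun_cong[OF open_chart(1)[OF c]])
 show "(\<Sum>i\<in>UNIV. \<Sum>j\<in>UNIV. (y $ i * z $ j) *\<^sub>R bmat (om c q) $ i $ j) = om c q y z" if "q \<in> fst c" for q
  using bilinear_expand[OF om_bilinear[OF c that], of y z] by simp
 show "smooth_fun A (fst c) (%q. \<Sum>i\<in>UNIV. \<Sum>j\<in>UNIV. (y $ i * z $ j) *\<^sub>R bmat (om c q) $ i $ j)"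
  by (intro smooth_fun_sum open_chart c smooth_fun_linear[OF open_chart(1)[OF c] bounded_linear_scaleR_right] smooth_om)
qed

lemma deriv_om_var:
 assumes c: "c \<in> A" and q: "q \<in> fst c" and g: "smooth_fun A (fst c) g"
 shows "chd c (%p. om c p (g p) z) q u = om c q (chd c g q u + Gam c u q (g q)) z + om c q (g q) (Gam c u q z)"
proof -
 note U = open_chart(1)[OF c]
 \<comment> \<open>Represents the linear form given by the symplectic form and \<open>z\<close> as a
   vector, so that the product rule for the inner product handles the variable argument.\<close>
 define O' where "O' = (%p. \<chi> i. om c p (axis i 1) z)"
 have lin: "linear (%x. om c p x z)" if "p \<in> fst c" for p z
  using om_bilinear[OF c that] unfolding bilinear_def by blast
 have lin2: "linear (om c p x)" if "p \<in> fst c" for p x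
  using om_bilinear[OF c that] unfolding bilinear_def by blast
 have O': "O' p \<bullet> x = om c p x z" if "p \<in> fst c" for p x
  unfolding O'_def by (rule linear_inner_axis[OF lin[OF that], symmetric])
 have smO: "smooth_fun A (fst c) O'"
  by (rule smooth_fun_vec[OF U]) (simp add: O'_def smooth_om_const[OF c])
 have "chd c O' q u = (\<chi> i. om c q (Gam c u q (axis i 1)) z + om c q (axis i 1) (Gam c u q z))"
  unfolding vec_eq_iff
 proof
  fix i
  have "chd c O' q u $ i = chd c (%q. O' q $ i) q u"
   by (rule chd_bounded_linear[OF bounded_linear_vec_nth smO U q c q, symmetric])
  then show "chd c O' q u $ i = (\<chi> i. om c q (Gam c u q (axis i 1)) z + om c q (axis i 1) (Gam c u q z)) $ i"
   by (simp add: O'_def deriv_om[OF c q])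
 qed
 moreover have l: "linear (%x. om c q (Gam c u q x) z + om c q x (Gam c u q z))"
  by (intro linear_compose_add linear_compose[OF linear_Gam(2)[OF c q] lin[OF q], unfolded o_def] lin q)
 ultimately have d: "chd c O' q u \<bullet> x = om c q (Gam c u q x) z + om c q x (Gam c u q z)" for x
  by (simp only: linear_inner_axis[OF l, of x])
 have "chd c (%p. om c p (g p) z) q u = chd c (%p. O' p \<bullet> g p) q u"
  by (rule fun_cong[OF chd_cong[OF U q c q]]) (simp add: O')
 also have "\<dots> = O' q \<bullet> chd c g q u + chd c O' q u \<bullet> g q"
  by (rule chd_bilinear[OF bounded_bilinear_inner smO g U q c q])
 finally show ?thesis by (simp add: O'[OF q] d linear_add[OF lin[OF q], of "chd c g q u"])
qed

lemma om_antisym: "om c p y z = - om c p z y"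
 unfolding om_def by (rule omega(2))

text \<open>The curvature takes values in the symplectic Lie algebra. This is the commutation of two
  derivatives of the symplectic form evaluated on constant arguments, with the connection terms
  inserted by \<open>deriv_om\<close>.\<close>

lemma Rc_sym:
 assumes c: "c \<in> A" and q: "q \<in> fst c"
 shows "om c q (Rc c u w q y) z = om c q (Rc c u w q z) y"
proof -
 note U = open_chart(1)[OF c]
 have lin: "linear (%x. om c q x z)" for z
  using om_bilinear[OF c q] unfolding bilinear_def by blast
 define X where "X = (%u w y. chd c (%p. Gam c w p y) q u + Gam c u q (Gam c w q y))"
 have 1: "chd c (%p. chd c (%q. om c q y z) p w) q u = om c q (X u w y) z + om c q (Gam c w q y) (Gam c u q z) -
   (om c q (X u w z) y + om c q (Gam c w q z) (Gam c u q y))" for u w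
 proof -
  have sm: "smooth_fun A (fst c) (%p. om c p (Gam c w p y) z)" for y z
  proof -
   have "smooth_fun A (fst c) (%p. \<Sum>i\<in>UNIV. Gam c w p y $ i * om c p (axis i 1) z)"
    by (intro smooth_fun_sum U smooth_fun_bilinear[OF U bounded_bilinear_mult] smooth_fun_nth smooth_Gam[OF c] smooth_om_const[OF c])
   then show ?thesis
   proof (rule smooth_fun_cong[OF U, rotated])
    fix p assume p: "p \<in> fst c"
    have "linear (%x. om c p x z)" using om_bilinear[OF c p] unfolding bilinear_def by blast
    from linear_axis_expansion[OF this, of "Gam c w p y"]
    show "(\<Sum>i\<in>UNIV. Gam c w p y $ i * om c p (axis i 1) z) = om c p (Gam c w p y) z" by simp
   qed
  qed
  have "chd c (%p. chd c (%q. om c q y z) p w) q u = chd c (%p. om c p (Gam c w p y) z + (- om c p (Gam c w p z) y)) q u"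
  proof (rule fun_cong[OF chd_cong[OF U q c q]])
   fix p assume "p \<in> fst c"
   then show "chd c (%q. om c q y z) p w = om c p (Gam c w p y) z + - om c p (Gam c w p z) y"
    using deriv_om[OF c, of p y z w] om_antisym[of c p y "Gam c w p z"] by simp
  qed
  also have "\<dots> = chd c (%p. om c p (Gam c w p y) z) q u + chd c (%p. - om c p (Gam c w p z) y) q u"
   by (rule chd_add[OF sm smooth_fun_linear[OF U bounded_linear_minus[OF bounded_linear_ident] sm] U q c q])
  also have "chd c (%p. - om c p (Gam c w p z) y) q u = - chd c (%p. om c p (Gam c w p z) y) q u"
   by (rule chd_bounded_linear[OF bounded_linear_minus[OF bounded_linear_ident] sm U q c q])
  finally show ?thesis by (simp add: deriv_om_var[OF c q smooth_Gam[OF c]] X_def)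
 qed
 have "chd c (%p. chd c (%q. om c q y z) p w) q u = chd c (%p. chd c (%q. om c q y z) p u) q w"
  by (rule chd_commute[OF c U q q smooth_om_const[OF c]])
 then have "om c q (X u w y) z - om c q (X w u y) z = om c q (X u w z) y - om c q (X w u z) y"
  unfolding 1 using om_antisym[of c q "Gam c w q y" "Gam c u q z"] om_antisym[of c q "Gam c w q z" "Gam c u q y"] by linarith
 moreover have "Rc c u w q x = X u w x - X w u x" for x by (simp add: Rc_def X_def)
 ultimately show ?thesis
  by (simp add: linear_diff[OF lin, of "X u w y"] linear_diff[OF lin, of "X u w z"])
qed

end

subsection \<open>Vector bundles and endomorphisms\<close>

lemma invertible_inv:
 assumes "invertible M" shows "M ** matrix_inv M = mat 1" "matrix_inv M ** M = mat 1"
 using someI_ex[OF assms[unfolded invertible_def]] unfolding matrix_inv_def by auto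

locale fedosov_bundle = manifold "atlas G"
 for G :: "('m::{second_countable_topology, t2_space}, 'n::finite, 'k::finite) fedosov_data" +
 assumes symplectic: "symplectic_form (atlas G) (sympl G)"
  and conn_M: "connection (atlas G) (*\<^sub>R) (smooth_vf (atlas G)) (connM G)"
  and sympl_conn: "symplectic_conn (atlas G) (sympl G) (connM G)"
  and vbundle: "vector_bundle (atlas G) (trivs G)"
  and conn_E: "connection (atlas G) (*\<^sub>c) (smooth_section (atlas G) (trivs G)) (connE G)"
begin

abbreviation "sec \<equiv> smooth_section (atlas G) (trivs G)"
abbreviation "endo \<equiv> smooth_End (atlas G) (trivs G)"
abbreviation "sfun \<equiv> smooth_fun (atlas G)"

lemma triv:
 "t \<in> trivs G ==> open (fst t)" "t \<in> trivs G ==> q \<in> fst t ==> invertible (snd t q)"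
 "t \<in> trivs G ==> u \<in> trivs G ==> sfun (fst t \<inter> fst u) (%q. snd u q ** matrix_inv (snd t q))"
 "triv_at (trivs G) p \<in> trivs G" "p \<in> fst (triv_at (trivs G) p)"
proof -
 note v = vbundle[unfolded vector_bundle_def]
 show "t \<in> trivs G ==> open (fst t)" "t \<in> trivs G ==> q \<in> fst t ==> invertible (snd t q)"
  "t \<in> trivs G ==> u \<in> trivs G ==> sfun (fst t \<inter> fst u) (%q. snd u q ** matrix_inv (snd t q))"
  using v by blast+
 have "\<exists>t. t \<in> trivs G \<and> p \<in> fst t" using v by blast
 from someI_ex[OF this] show "triv_at (trivs G) p \<in> trivs G" "p \<in> fst (triv_at (trivs G) p)"
  by (auto simp: triv_at_def)
qed

lemma secD: "sec U s ==> t \<in> trivs G ==> sfun (U \<inter> fst t) (%q. snd t q *v s q)"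
 and secI: "(!!t. t \<in> trivs G ==> sfun (U \<inter> fst t) (%q. snd t q *v s q)) ==> sec U s"
 by (auto simp: smooth_section_def)

lemma openI: "open U ==> t \<in> trivs G ==> open (U \<inter> fst t)"
 by (intro open_Int triv)

lemma sec_subset: "sec U s ==> V \<subseteq> U ==> sec V s"
 unfolding smooth_section_def by (meson Int_mono order_refl smooth_fun_subset)

lemma sec_cong: "open U ==> (!!q. q \<in> U ==> s q = t q) ==> sec U s ==> sec U t"
 by (rule secI, rule smooth_fun_cong[OF openI _ secD]) simp_all

sublocale E: symplectic_bundle "atlas G" "smooth_section (atlas G) (trivs G)" "connE G" "connM G" "sympl G"
proof unfold_locales
 fix U V and s t :: "'m => complex ^ 'k" and g
 show "sec U s ==> V \<subseteq> U ==> open V ==> sec V s" by (rule sec_subset)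
 show "open U ==> (!!q. q \<in> U ==> s q = t q) ==> sec U s ==> sec U t" by (rule sec_cong)
 show "sec U (%q. s q + t q)" if "open U" "sec U s" "sec U t"
  by (rule secI) (simp only: matrix_vector_right_distrib smooth_fun_add openI secD that)
 show "sec U (%q. g q *\<^sub>c s q)" if "open U" "sfun U g" "sec U s"
  by (rule secI, simp only: cbilinD[OF cbilin_mv])
   (intro smooth_fun_bilinear[OF _ cbilin_bounded[OF cbilin_sc]] openI secD that smooth_fun_subset[OF that(2)] Int_lower1)
 show "open U ==> sec U (%q. 0)"
  by (rule secI) (simp add: smooth_fun_const openI)
qed (fact conn_E conn_M symplectic sympl_conn)+

lemma endoD: "endo U B ==> t \<in> trivs G ==> sfun (U \<inter> fst t) (%q. snd t q ** B q ** matrix_inv (snd t q))"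
 and endoI: "(!!t. t \<in> trivs G ==> sfun (U \<inter> fst t) (%q. snd t q ** B q ** matrix_inv (snd t q))) ==> endo U B"
 by (auto simp: smooth_End_def)

lemma endo_subset: "endo U s ==> V \<subseteq> U ==> endo V s"
 unfolding smooth_End_def by (meson Int_mono order_refl smooth_fun_subset)

lemma modsm:
 "E.modsm sec" "E.modsm sfun" "E.modsm endo"
proof -
 note o = open_chart(1)
 show "E.modsm sec"
  unfolding E.modsm_def
  by (intro conjI ballI allI impI; (elim conjE)?)
   ((rule sec_cong[OF o]; blast), (intro E.smF_sum E.smF_scaleR o; blast))
 show "E.modsm sfun"
  unfolding E.modsm_def
  by (intro conjI ballI allI impI; (elim conjE)?)
   ((rule smooth_fun_cong[OF o]; blast), (intro smooth_fun_sum smooth_fun_linear[OF _ bounded_linear_scaleR_right] o; blast))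
 show "E.modsm endo"
  unfolding E.modsm_def
 proof (intro conjI ballI allI impI; (elim conjE)?)
  fix c s t assume c: "c \<in> atlas G" and e: "\<forall>q\<in>fst c. s q = t q" and s: "endo (fst c) s"
  show "endo (fst c) t"
   by (rule endoI, rule smooth_fun_cong[OF openI[OF o[OF c]] _ endoD[OF s]]) (simp_all add: e)
 next
  fix c and r :: "'n => real" and s :: "'n => 'm => complex ^ 'k ^ 'k" assume c: "c \<in> atlas G" and s: "\<forall>i. endo (fst c) (s i)"
  show "endo (fst c) (%q. \<Sum>i\<in>UNIV. r i *\<^sub>R s i q)"
   by (rule endoI, simp only: cbilin_sum[OF cbilin_mm] cbilinD[OF cbilin_mm])
    (intro smooth_fun_sum smooth_fun_linear[OF _ bounded_linear_scaleR_right] openI o c endoD s[rule_format])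
 qed
qed

lemma sec_local: "sec (fst (triv_at (trivs G) p)) (local_section (trivs G) p e)"
proof (rule secI)
 let ?t = "triv_at (trivs G) p"
 fix t assume t: "t \<in> trivs G"
 note U = openI[OF triv(1)[OF triv(4)] t]
 show "sfun (fst ?t \<inter> fst t) (%q. snd t q *v local_section (trivs G) p e q)"
  unfolding local_section_def matrix_vector_mul_assoc[of "snd t _"]
  by (rule smooth_fun_bilinear[OF U cbilin_bounded[OF cbilin_mv] triv(3)[OF triv(4) t] smooth_fun_const[OF U]])
qed

text \<open>The components of a section in the frame of local sections through the standard basis at
  \<open>p\<close>; the normalisation at \<open>p\<close> makes them the ordinary components
  there.\<close>

definition coef :: "'m => ('m => complex ^ 'k) => 'm => complex ^ 'k"
 where "coef p s q = matrix_inv (snd (triv_at (trivs G) p) p) *v (snd (triv_at (trivs G) p) q *v s q)"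

lemma coef_expand:
 assumes q: "q \<in> fst (triv_at (trivs G) p)"
 shows "s q = (\<Sum>j\<in>UNIV. coef p s q $ j *\<^sub>c local_section (trivs G) p (axis j 1) q)"
proof -
 let ?t = "triv_at (trivs G) p"
 have "(\<Sum>j\<in>UNIV. coef p s q $ j *\<^sub>c local_section (trivs G) p (axis j 1) q) =
   (matrix_inv (snd ?t q) ** (snd ?t p ** matrix_inv (snd ?t p)) ** snd ?t q) *v s q"
  unfolding local_section_def matrix_vector_mul_assoc mv_axis by (simp add: coef_def matrix_vector_mul_assoc matrix_mul_assoc)
 then show ?thesis
  by (simp add: invertible_inv[OF triv(2)[OF triv(4) triv(5)]] invertible_inv[OF triv(2)[OF triv(4) q]])
qed

lemma coef_at: "coef p s p = s p"
 by (simp add: coef_def matrix_vector_mul_assoc invertible_inv[OF triv(2)[OF triv(4) triv(5)]])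

lemma local_section_at: "local_section (trivs G) p e p = e"
 by (simp add: local_section_def matrix_vector_mul_assoc invertible_inv[OF triv(2)[OF triv(4) triv(5)]])

lemma coef_smooth:
 assumes "open U" "sec U s" shows "sfun (U \<inter> fst (triv_at (trivs G) p)) (%q. coef p s q $ j)"
proof (rule smooth_fun_nth)
 note U = openI[OF assms(1) triv(4)]
 show "open (U \<inter> fst (triv_at (trivs G) p))" by (rule U)
 show "sfun (U \<inter> fst (triv_at (trivs G) p)) (coef p s)"
  unfolding coef_def by (rule smooth_fun_bilinear[OF U cbilin_bounded[OF cbilin_mv] smooth_fun_const[OF U] secD[OF assms(2) triv(4)]])
qed

lemma endo_mv:
 assumes "open U" "endo U B" "sec U s" shows "sec U (%q. B q *v s q)"
proof (rule secI)
 fix t assume t: "t \<in> trivs G"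
 note U = openI[OF assms(1) t]
 show "sfun (U \<inter> fst t) (%q. snd t q *v (B q *v s q))"
 proof (rule smooth_fun_cong[OF U _ smooth_fun_bilinear[OF U cbilin_bounded[OF cbilin_mv] endoD[OF assms(2) t] secD[OF assms(3) t]]])
  fix q assume "q \<in> U \<inter> fst t"
  then show "(snd t q ** B q ** matrix_inv (snd t q)) *v (snd t q *v s q) = snd t q *v (B q *v s q)"
   by (simp add: matrix_vector_mul_assoc matrix_mul_assoc[symmetric] invertible_inv[OF triv(2)[OF t]])
 qed
qed

text \<open>\<open>conn_End\<close> is defined on local sections of the special frame. Expanding
  \<open>s\<close> in that frame, the derivatives of its coefficients occur on both sides with the
  same value of \<open>B\<close>.\<close>

lemma conn_End_Leibniz:
 assumes U: "open U" "p \<in> U" and B: "endo U B" and s: "sec U s"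
 shows "connE G p v (%q. B q *v s q) = conn_End (trivs G) (connE G) p v B *v s p + B p *v connE G p v s"
proof -
 let ?t = "triv_at (trivs G) p" and ?\<sigma> = "%j. local_section (trivs G) p (axis j 1)"
 define V where "V = U \<inter> fst ?t"
 have V: "open V" "p \<in> V" and Vt: "V \<subseteq> fst ?t" "V \<subseteq> U"
  using openI[OF U(1) triv(4)] U(2) triv(5) by (auto simp: V_def)
 have g: "sfun V (%q. coef p s q $ j)" for j unfolding V_def by (rule coef_smooth[OF U(1) s])
 have \<sigma>: "sec V (?\<sigma> j)" for j by (rule sec_subset[OF sec_local Vt(1)])
 have B\<sigma>: "sec V (%q. B q *v ?\<sigma> j q)" for j by (rule endo_mv[OF V(1) endo_subset[OF B Vt(2)] \<sigma>])
 have ex: "s q = (\<Sum>j\<in>UNIV. coef p s q $ j *\<^sub>c ?\<sigma> j q)" if "q \<in> V" for q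
  by (rule coef_expand) (use that Vt in blast)
 have 1: "connE G p v s = (\<Sum>j\<in>UNIV. tangent_deriv (atlas G) p v (%q. coef p s q $ j) *\<^sub>c ?\<sigma> j p + s p $ j *\<^sub>c connE G p v (?\<sigma> j))"
 proof -
  have "connE G p v s = connE G p v (%q. \<Sum>j\<in>UNIV. coef p s q $ j *\<^sub>c ?\<sigma> j q)"
   by (rule E.nabF_cong[OF V sec_subset[OF s Vt(2)] ex])
  also have "\<dots> = (\<Sum>j\<in>UNIV. connE G p v (%q. coef p s q $ j *\<^sub>c ?\<sigma> j q))"
   by (rule E.nabF_sum[OF V E.smF_mult[OF V(1) g \<sigma>]])
  finally show ?thesis by (simp only: E.nabF_mult[OF V g \<sigma>] coef_at)
 qed
 have "connE G p v (%q. B q *v s q) = connE G p v (%q. \<Sum>j\<in>UNIV. coef p s q $ j *\<^sub>c (B q *v ?\<sigma> j q))"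
 proof (rule E.nabF_cong[OF V endo_mv[OF V(1) endo_subset[OF B Vt(2)] sec_subset[OF s Vt(2)]]])
  fix q assume "q \<in> V"
  from ex[OF this] show "B q *v s q = (\<Sum>j\<in>UNIV. coef p s q $ j *\<^sub>c (B q *v ?\<sigma> j q))"
   by (simp only: cbilin_sum[OF cbilin_mv] cbilinD[OF cbilin_mv])
 qed
 also have "\<dots> = (\<Sum>j\<in>UNIV. connE G p v (%q. coef p s q $ j *\<^sub>c (B q *v ?\<sigma> j q)))"
  by (rule E.nabF_sum[OF V E.smF_mult[OF V(1) g B\<sigma>]])
 finally have 2: "connE G p v (%q. B q *v s q) = (\<Sum>j\<in>UNIV. tangent_deriv (atlas G) p v (%q. coef p s q $ j) *\<^sub>c (B p *v ?\<sigma> j p) +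
   s p $ j *\<^sub>c connE G p v (%q. B q *v ?\<sigma> j q))"
  by (simp only: E.nabF_mult[OF V g B\<sigma>] coef_at)
 show ?thesis
  unfolding 1 2 conn_End_def matrix_mv
  by (simp add: cbilin_sum[OF cbilin_mv] cbilinD[OF cbilin_mv] scaleC_diff_right sum.distrib sum_subtractf)
qed

lemma pairing_mv: "E.pairing (*v) endo sec (conn_End (trivs G) (connE G)) (connE G)"
 unfolding E.pairing_def by (intro conjI allI impI cbilin_mv ballI) (auto intro: endo_mv conn_End_Leibniz)

lemma pairing_sc: "E.pairing (%s c. c *\<^sub>c s) sec sfun (connE G) (tangent_deriv (atlas G))"
 unfolding E.pairing_def
 by (intro conjI allI impI cbilin_sc' ballI) (auto intro: E.smF_mult simp: E.nabF_mult)

lemma conn_End_zero: "conn_End (trivs G) (connE G) p v (%q. 0) = 0"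
proof -
 have "matrix (%e. 0) = (0 :: complex ^ 'k ^ 'k)" by (simp add: matrix_def vec_eq_iff)
 then show ?thesis by (simp add: conn_End_def E.nabF_zero)
qed

lemma conn_End_mat:
 assumes U: "open U" "p \<in> U" and f: "sfun U f"
 shows "conn_End (trivs G) (connE G) p v (%q. mat (f q)) = mat (tangent_deriv (atlas G) p v f)"
proof -
 let ?V = "U \<inter> fst (triv_at (trivs G) p)"
 have V: "open ?V" "p \<in> ?V" using openI[OF U(1) triv(4)] U(2) triv(5) by auto
 have "connE G p v (%q. f q *\<^sub>c local_section (trivs G) p e q) =
   tangent_deriv (atlas G) p v f *\<^sub>c e + f p *\<^sub>c connE G p v (local_section (trivs G) p e)" for e
  using E.nabF_mult[OF V smooth_fun_subset[OF f Int_lower1] sec_subset[OF sec_local Int_lower2]] by (simp add: local_section_at)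
 then have "conn_End (trivs G) (connE G) p v (%q. mat (f q)) = matrix (%e. tangent_deriv (atlas G) p v f *\<^sub>c e)"
  by (simp add: conn_End_def mat_mv)
 also have "\<dots> = mat (tangent_deriv (atlas G) p v f)"
  by (simp add: matrix_def mat_def vec_eq_iff scaleC_vec_def scaleC_complex_def axis_def)
 finally show ?thesis .
qed

lemma tangent_deriv_zero: "tangent_deriv (atlas G) p v (%q. 0 :: complex) = 0"
 by (simp add: tangent_deriv_chd chd_const)

lemma D_End_to_End:
 assumes r: "r \<in> weyl_W G" shows "D_End G (to_End r) = to_End (D_W G r)"
proof -
 have "nabla_tensor (atlas G) (connM G) (conn_End (trivs G) (connE G)) i (to_End r) k p ys vs =
   mat (nabla_tensor (atlas G) (connM G) (tangent_deriv (atlas G)) i r k p ys vs)" for i k p ys vs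
 proof -
  let ?c = "chart_at (atlas G) p"
  have "sfun (fst ?c) (%q. frame (atlas G) ?c r k q ys vs)"
   by (rule E.modsm_frame[OF modsm(2) r[unfolded weyl_W_def] chart_at(1)])
  from conn_End_mat[OF open_chart(1)[OF chart_at(1)] chart_at(2) this]
  show ?thesis
   by (simp add: nabla_tensor_def Let_def to_End_def frame_def pull_def mat_linear mat_sum)
 qed
 then show ?thesis
  by (intro ext) (simp add: D_End_def D_W_def cov_D_def dx_a_def to_End_def fun_ops mat_linear mat_sum)
qed

end

subsection \<open>Curvature as a commutator\<close>

lemma sum_rot2: "(\<Sum>i\<in>A. \<Sum>j\<in>B. \<Sum>k\<in>C. F i j k) = (\<Sum>k\<in>C. \<Sum>i\<in>A. \<Sum>j\<in>B. F i j k :: 'x::comm_monoid_add)"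
 by (rule trans[OF sum.cong[OF refl sum.swap] sum.swap])

lemma sum_rot3: "(\<Sum>i\<in>A. \<Sum>j\<in>B. \<Sum>k\<in>C. \<Sum>l\<in>D. F i j k l) = (\<Sum>l\<in>D. \<Sum>i\<in>A. \<Sum>j\<in>B. \<Sum>k\<in>C. F i j k l :: 'x::comm_monoid_add)"
 by (rule trans[OF sum.cong[OF refl sum_rot2] sum.swap])

lemma sum_rot4: "(\<Sum>i\<in>A. \<Sum>j\<in>B. \<Sum>k\<in>C. \<Sum>l\<in>D. \<Sum>m\<in>E. F i j k l m) = (\<Sum>m\<in>E. \<Sum>i\<in>A. \<Sum>j\<in>B. \<Sum>k\<in>C. \<Sum>l\<in>D. F i j k l m :: 'x::comm_monoid_add)"
 by (rule trans[OF sum.cong[OF refl sum_rot3] sum.swap])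

text \<open>With symmetric degree zero no Poisson tensor can contract it, and forms of even degree
  commute with everything up to the order of the fibre factors.\<close>

lemma wprod_comm_form:
 fixes \<Phi> :: "('m, 'n::finite, 'f::complex_fibre) wform" and \<Psi> :: "('m, 'n, 'g::complex_fibre) wform"
 assumes m: "cbilin m" and l: "lb 0 \<Phi>" "lb 0 \<Psi>" and P: "wsupp (%k a b. a = 0 \<and> b = 2) \<Phi>"
 shows "wprod \<omega> m \<Phi> \<Psi> = wprod \<omega> (%x y. m y x) \<Psi> \<Phi>"
proof (intro ext)
 fix k p ys vs
 note m' = cbilin_flip[OF m]
 have "wterm \<omega> m \<Phi> \<Psi> k p a b = wterm \<omega> (%x y. m y x) \<Psi> \<Phi> k p b a" for a b
 proof (cases "a + b = k")
  case True
  have "fdeg 2 (\<Phi> a p)" using P by (auto simp: wsupp_def fsupp_def fdeg_def)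
  from mu_comm[OF m this] True show ?thesis by (simp add: wterm_def parn_def)
 next
  case False
  have "Bn L m (Suc n) (\<Phi> a p) g = 0" for n L and g :: "('n, 'g) fib"
   by (rule fsupp_zero, rule fsupp_Bn[OF m wsuppD[OF P, of a p], where Q="%_ _. True"]) (auto simp: fsupp_def)
  moreover have "Bn L (%x y. m y x) (Suc n) g (\<Phi> a p) = 0" for n L and g :: "('n, 'g) fib"
   by (rule fsupp_zero, rule fsupp_Bn[OF m' _ wsuppD[OF P, of a p], where P="%_ _. True"]) (auto simp: fsupp_def)
  moreover have "a + b \<le> k ==> \<exists>n. nat (k - a - b) = Suc n \<and> nat (k - b - a) = Suc n"
   using False by (intro exI[of _ "nat (k - a - b - 1)"]) auto
  ultimately show ?thesis by (auto simp: wterm_def add.commute)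
 qed
 then have "wprod \<omega> m \<Phi> \<Psi> k p = wprod \<omega> (%x y. m y x) \<Psi> \<Phi> k p"
  unfolding wprod_range[OF m l order.refl] wprod_range[OF m' l(2,1) order.refl] by (subst sum.swap) simp
 then show "wprod \<omega> m \<Phi> \<Psi> k p ys vs = wprod \<omega> (%x y. m y x) \<Psi> \<Phi> k p ys vs" by simp
qed

lemma smulC_diff_left: "smulC (c - d) f = smulC c f - smulC d f"
 using smulC_add_left[of c "- d" f] by simp

lemma sum_single:
 fixes f :: "int => int => 'x::comm_monoid_add"
 assumes "!!a b. a \<in> {0..k} ==> b \<in> {0..k} ==> (a, b) \<noteq> (a0, b0) ==> f a b = 0" "a0 \<in> {0..k}" "b0 \<in> {0..k}"
 shows "(\<Sum>a\<in>{0..k}. \<Sum>b\<in>{0..k}. f a b) = f a0 b0"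
proof -
 have "(\<Sum>a\<in>{0..k}. \<Sum>b\<in>{0..k}. f a b) = (\<Sum>a\<in>{0..k}. if a = a0 then f a0 b0 else 0)"
 proof (intro sum.cong refl)
  fix a assume a: "a \<in> {0..k}"
  have "(\<Sum>b\<in>{0..k}. f a b) = (\<Sum>b\<in>{0..k}. if b = b0 then (if a = a0 then f a0 b0 else 0) else 0)"
   by (intro sum.cong refl) (use assms(1)[OF a] in auto)
  then show "(\<Sum>b\<in>{0..k}. f a b) = (if a = a0 then f a0 b0 else 0)" using assms(3) by (simp add: sum.delta)
 qed
 then show ?thesis using assms(2) by (simp add: sum.delta)
qed

text \<open>Only the first order of the exponential series survives: even orders commute, and higher
  orders exceed the symmetric degree of \<open>\<Phi>\<close>.\<close>

lemma commutator_quadratic: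
 fixes \<Phi> :: "('m, 'n::finite, 'f::complex_fibre) wform" and \<Psi> :: "('m, 'n, 'g::complex_fibre) wform"
 assumes m: "cbilin m" and l: "lb 0 \<Psi>" and P: "wsupp (%k a b. k = 0 \<and> a = 2 \<and> b = 2) \<Phi>"
  and anti: "!!k l. poisson \<omega> p l k = - poisson \<omega> p k l"
 shows "(i_over_lambda (wprod \<omega> m \<Phi> \<Psi> - wprod \<omega> (%x y. m y x) \<Psi> \<Phi>)) k p = - Bn (poisson \<omega> p) m 1 (\<Phi> 0 p) (\<Psi> k p)"
proof -
 note m' = cbilin_flip[OF m]
 let ?L = "poisson \<omega> p" and ?k = "k + 1"
 have l0: "lb 0 \<Phi>" by (rule lb_fibI, rule fsupp_zero, rule fsupp_mono[OF wsuppD[OF P]]) auto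
 have z: "\<Phi> a p = 0" if "a \<noteq> 0" for a
  by (rule fsupp_zero, rule fsupp_mono[OF wsuppD[OF P]]) (use that in auto)
 have fd: "fdeg 2 (\<Phi> a p)" for a using P by (auto simp: wsupp_def fsupp_def fdeg_def)
 define T where "T = (%a b. wterm \<omega> m \<Phi> \<Psi> ?k p a b - wterm \<omega> (%x y. m y x) \<Psi> \<Phi> ?k p b a)"
 have T: "T a b = smulC ((\<i> / 2) ^ nat (?k - a - b) * (1 - (- 1) ^ nat (?k - a - b))) (Bn ?L m (nat (?k - a - b)) (\<Phi> a p) (\<Psi> b p))"
  if "a + b \<le> ?k" for a b
 proof -
  let ?n = "nat (?k - a - b)"
  have "Bn ?L m ?n (\<Phi> a p) (\<Psi> b p) = smulC ((- 1) ^ ?n) (Bn ?L (%x y. m y x) ?n (\<Psi> b p) (\<Phi> a p))"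
   using Bn_comm[OF m anti fd[of a], where n="?n" and g="\<Psi> b p"] by (simp add: parn_def)
  then have "Bn ?L (%x y. m y x) ?n (\<Psi> b p) (\<Phi> a p) = smulC ((- 1) ^ ?n) (Bn ?L m ?n (\<Phi> a p) (\<Psi> b p))"
   by (simp flip: power_mult_distrib)
  moreover have "T a b = smulC ((\<i> / 2) ^ ?n) (Bn ?L m ?n (\<Phi> a p) (\<Psi> b p)) - smulC ((\<i> / 2) ^ ?n) (Bn ?L (%x y. m y x) ?n (\<Psi> b p) (\<Phi> a p))"
  proof -
   have e: "?k - b - a = ?k - a - b" by simp
   show ?thesis unfolding T_def wterm_def e using that by (simp only: add.commute[of b a] if_True)
  qed
  ultimately show ?thesis
   by (simp only: smulC_smulC right_diff_distrib smulC_diff_left mult_1_right)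
 qed
 have "(wprod \<omega> m \<Phi> \<Psi> - wprod \<omega> (%x y. m y x) \<Psi> \<Phi>) ?k p = (\<Sum>a\<in>{0..?k}. \<Sum>b\<in>{0..?k}. T a b)"
  unfolding wform_ops wprod_range[OF m l0 l order.refl] wprod_range[OF m' l l0 order.refl] T_def sum_subtractf
  by (subst (2) sum.swap) simp
 \<comment> \<open>At order one the coefficient is \<i> / 2 times 2; the second factor \<i> from the
   prefactor later produces the sign in the claim.\<close>
 also have "\<dots> = smulC \<i> (Bn ?L m 1 (\<Phi> 0 p) (\<Psi> k p))"
 proof (cases "0 \<le> k")
  case True
  have "(\<Sum>a\<in>{0..?k}. \<Sum>b\<in>{0..?k}. T a b) = T 0 k"
  proof (rule sum_single)
   fix a b assume "a \<in> {0..?k}" "b \<in> {0..?k}" and ne: "(a, b) \<noteq> (0, k)"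
   show "T a b = 0"
   proof (cases "a + b \<le> ?k \<and> a = 0")
    case True
    let ?n = "nat (?k - a - b)"
    have "n \<noteq> 1 ==> even n \<or> 3 \<le> n" for n :: nat by presburger
    moreover have "?n \<noteq> 1" using True ne by auto
    ultimately have "even ?n \<or> 3 \<le> ?n" by blast
    then show ?thesis
    proof
     assume "3 \<le> ?n"
     then have "Bn ?L m ?n (\<Phi> a p) (\<Psi> b p) = 0"
      by (intro fsupp_zero fsupp_Bn[OF m wsuppD[OF P, of a p], where Q="%_ _. True"]) (auto simp: fsupp_def)
     then show ?thesis using T[of a b] True by simp
    qed (use T[of a b] True in simp)
   next
    case False
    then show ?thesis using T[of a b] z[of a] by (auto simp: Bn_linear[OF m] T_def wterm_def add.commute)
   qed
  qed (use True in auto)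
  then show ?thesis using T[of 0 k] by simp
 next
  case False
  then have "T a b = 0" if "a \<in> {0..?k}" "b \<in> {0..?k}" for a b
  proof -
   have "a = 0" "b = 0" "k = - 1" using that False by auto
   then show ?thesis using T[of 0 0] by simp
  qed
  then show ?thesis using False by (simp add: lbD_fib[OF l] Bn_linear[OF m])
 qed
 finally show ?thesis by (simp add: cscale_fib lambda_shift_def)
qed

context symplectic_bundle
begin

lemma bmat_inv: "bmat (\<omega> p) ** matrix_inv (bmat (\<omega> p)) = mat 1" "matrix_inv (bmat (\<omega> p)) ** bmat (\<omega> p) = mat 1"
 using invertible_inv[OF om_invertible[OF chart_at, of p]] by (simp_all add: om_at)

lemma poisson_antisym: "poisson \<omega> p l k = - poisson \<omega> p k l"
proof -
 let ?B = "bmat (\<omega> p)" and ?Q = "matrix_inv (bmat (\<omega> p))"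
 have "transpose ?B $ i $ j = (- ?B) $ i $ j" for i j
  by (simp add: transpose_def bmat_def) (rule omega(2))
 then have t: "transpose ?B = - ?B" unfolding vec_eq_iff by blast
 have "transpose ?B ** transpose ?Q = mat 1"
  by (simp only: matrix_transpose_mul[symmetric] bmat_inv transpose_mat)
 then have "?B ** (- transpose ?Q) = mat 1"
  unfolding t by (simp add: matrix_matrix_mult_def vec_eq_iff)
 from matrix_inv_unique[OF this] have "?Q $ l $ k = (- transpose ?Q) $ l $ k" by simp
 then show ?thesis by (simp add: poisson_bmat transpose_def)
qed

text \<open>The Poisson tensor raises the index that the symplectic form lowers; the sign in its
  definition is compensated by the antisymmetry of the form.\<close>

lemma poisson_dual: "(\<Sum>a\<in>UNIV. poisson \<omega> p a b * \<omega> p (axis a 1) x) = x $ b"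
proof -
 have lin: "linear (%x. \<omega> p x z)" for z using omega(1)[of p] unfolding bilinear_def by blast
 have "\<omega> p (axis a 1) x = - (\<Sum>m\<in>UNIV. x $ m * bmat (\<omega> p) $ m $ a)" for a
  unfolding omega(2)[of p "axis a 1" x] by (subst linear_axis_expansion[OF lin, of x]) (simp add: bmat_def)
 then have "(\<Sum>a\<in>UNIV. poisson \<omega> p a b * \<omega> p (axis a 1) x) = (\<Sum>a\<in>UNIV. \<Sum>m\<in>UNIV. x $ m * (bmat (\<omega> p) $ m $ a * matrix_inv (bmat (\<omega> p)) $ a $ b))"
  by (simp add: poisson_bmat sum_distrib_left sum_negf mult_ac)
 also have "\<dots> = (\<Sum>m\<in>UNIV. x $ m * (bmat (\<omega> p) ** matrix_inv (bmat (\<omega> p))) $ m $ b)"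
  by (subst sum.swap) (simp add: matrix_matrix_mult_def sum_distrib_left)
 finally show ?thesis by (simp add: bmat_inv mat_def if_distrib cong: if_cong)
qed

end

context fedosov_bundle
begin

text \<open>\<open>curv_E_coeff\<close> evaluates the curvature on special local sections; since the
  commutator is tensorial, this determines it on every smooth section near \<open>p\<close>.\<close>

lemma curv_tensor:
 assumes s: "sec (fst (chart_at (atlas G) p)) s"
 shows "E.Kc (chart_at (atlas G) p) (axis i 1) (axis j 1) s p = curv_E_coeff G p i j *v s p"
proof -
 let ?c = "chart_at (atlas G) p" and ?t = "triv_at (trivs G) p" and ?\<sigma> = "%j. local_section (trivs G) p (axis j 1)"
 define V where "V = fst ?c \<inter> fst ?t"
 have V: "open V" "V \<subseteq> fst ?c" "p \<in> V" and Vt: "V \<subseteq> fst ?t"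
  using openI[OF open_chart(1)[OF chart_at(1)] triv(4)] chart_at(2) triv(5) by (auto simp: V_def)
 have g: "sfun V (%q. coef p s q $ j)" for j unfolding V_def by (rule coef_smooth[OF open_chart(1)[OF chart_at(1)] s])
 have \<sigma>: "sec V (local_section (trivs G) p e)" for e by (rule sec_subset[OF sec_local Vt])
 have "E.Kc ?c (axis i 1) (axis j 1) s p = E.Kc ?c (axis i 1) (axis j 1) (%q. \<Sum>j\<in>UNIV. coef p s q $ j *\<^sub>c ?\<sigma> j q) p"
  by (rule E.Kc_cong[OF chart_at(1) V sec_subset[OF s V(2)]]) (rule coef_expand, use Vt in blast)
 also have "\<dots> = (\<Sum>l\<in>UNIV. E.Kc ?c (axis i 1) (axis j 1) (%q. coef p s q $ l *\<^sub>c ?\<sigma> l q) p)"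
  by (rule E.Kc_sum[OF chart_at(1) V E.smF_mult[OF V(1) g \<sigma>]])
 also have "\<dots> = (\<Sum>l\<in>UNIV. s p $ l *\<^sub>c E.Kc ?c (axis i 1) (axis j 1) (?\<sigma> l) p)"
  by (simp only: E.Kc_mult[OF chart_at(1) V g \<sigma>] coef_at)
 also have "\<dots> = curv_E_coeff G p i j *v s p"
  by (simp add: curv_E_coeff_def Let_def matrix_mv curvature_def E.Kc_def E.dF_def[abs_def] lie_bracket_coord[OF chart_at]
    linear_0[OF E.nabF_linear[OF V(1,3) \<sigma>]])
 finally show ?thesis .
qed

lemma curv_RE_fib: "curv_RE G 0 p = smulC (1 / 2) (\<Sum>i\<in>UNIV. \<Sum>j\<in>UNIV. dxA i (dxA j (cst (curv_E_coeff G p i j))))"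
proof (intro ext)
 fix ys vs
 show "curv_RE G 0 p ys vs = smulC (1 / 2) (\<Sum>i\<in>UNIV. \<Sum>j\<in>UNIV. dxA i (dxA j (cst (curv_E_coeff G p i j)))) ys vs"
 proof (cases "ys = [] \<and> length vs = 2")
  case True
  then obtain v w where "vs = [v, w]" by (auto simp: numeral_2_eq_2 length_Suc_conv)
  then show ?thesis using True by (simp add: curv_RE_def smulC_apply fun_ops dxA2_cst scaleR_scaleC[of "1 / 2"])
 next
  case False
  then have "dxA i (dxA j (cst e)) ys vs = 0" for i j and e :: "complex ^ 'k ^ 'k" by (intro fsuppD[OF fsupp_dxA2]) auto
  then show ?thesis using False by (auto simp: curv_RE_def smulC_apply fun_ops)
 qed
qed

lemma curv_RE_supp: "wsupp (%k a b. k = 0 \<and> a = 0 \<and> b = 2) (curv_RE G)"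
 by (auto simp: wsupp_def fsupp_def curv_RE_def)

lemma lb_RE: "lb 0 (curv_RE G)" and lb_R: "lb 0 (curv_R G)"
 by (auto simp: lb_def curv_RE_def curv_R_def fun_eq_iff fun_ops)

lemma lmult_RE:
 assumes l: "lb 0 \<Psi>"
 shows "lmult_E G (curv_RE G) \<Psi> k p = smulC (1 / 2) (\<Sum>i\<in>UNIV. \<Sum>j\<in>UNIV. dxA i (dxA j (%ys vs. curv_E_coeff G p i j *v \<Psi> k p ys vs)))"
proof (cases "0 \<le> k")
 case True
 note m = cbilin_mv
 have "lmult_E G (curv_RE G) \<Psi> k p = wterm (sympl G) (*v) (curv_RE G) \<Psi> k p 0 k"
  unfolding lmult_E_def wprod_range[OF m lb_RE l order.refl] diff_0_right
 proof (rule sum_single)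
  fix a b assume ab: "a \<in> {0..k}" "b \<in> {0..k}" "(a, b) \<noteq> (0, k)"
  have "Bn L (*v) n (curv_RE G a p) (\<Psi> b p) = 0" if "a \<noteq> 0 \<or> n > 0" for L n
   by (rule fsupp_zero, rule fsupp_Bn[OF m wsuppD[OF curv_RE_supp], where Q="%_ _. True"]) (use that in \<open>auto simp: fsupp_def\<close>)
  moreover have "a + b \<le> k ==> a \<noteq> 0 \<or> nat (k - a - b) > 0" using ab by auto
  ultimately show "wterm (sympl G) (*v) (curv_RE G) \<Psi> k p a b = 0" by (simp add: wterm_def)
 qed (use True in auto)
 also have "\<dots> = mu (*v) (curv_RE G 0 p) (\<Psi> k p)" by (simp add: wterm_def)
 also have "\<dots> = smulC (1 / 2) (\<Sum>i\<in>UNIV. \<Sum>j\<in>UNIV. dxA i (dxA j (mu (*v) (cst (curv_E_coeff G p i j)) (\<Psi> k p))))"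
  unfolding curv_RE_fib by (simp add: mu_linear[OF m] mu_sum[OF m] dxA_mu_left[OF m])
 also have "\<dots> = smulC (1 / 2) (\<Sum>i\<in>UNIV. \<Sum>j\<in>UNIV. dxA i (dxA j (%ys vs. curv_E_coeff G p i j *v \<Psi> k p ys vs)))"
 proof -
  have "mu (*v) (cst (curv_E_coeff G p i j)) (\<Psi> k p) = (%ys vs. curv_E_coeff G p i j *v \<Psi> k p ys vs)" for i j
   by (intro ext) (rule mu_cst[OF m])
  then show ?thesis by simp
 qed
 finally show ?thesis .
next
 case False
 then have z: "\<Psi> k p = 0" using lbD_fib[OF l] by simp
 have "(%ys vs. curv_E_coeff G p i j *v \<Psi> k p ys vs) = 0" for i j unfolding z by (simp add: fun_eq_iff fun_ops)
 moreover have "lmult_E G (curv_RE G) \<Psi> k p = 0"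
  using False lbD_fib[OF wprod_lb[OF cbilin_mv lb_RE l]] by (simp add: lmult_E_def)
 ultimately show ?thesis by (simp add: dxA_linear)
qed

text \<open>The curvature with its upper index lowered by the symplectic form. Its symmetry in
  \<open>l\<close> and \<open>k\<close> is what fits the curvature into the symmetric
  factor.\<close>

definition Scoef :: "'m => 'n => 'n => 'n => 'n => real"
 where "Scoef p l k i j = sympl G p (axis l 1) (E.Rc (chart_at (atlas G) p) (axis i 1) (axis j 1) p (axis k 1))"

lemma Scoef_sym: "Scoef p l k i j = Scoef p k l i j"
 using E.Rc_sym[OF chart_at, of p "axis i 1" "axis j 1" "axis l 1" "axis k 1"]
  E.omega(2)[of p "axis l 1"] E.omega(2)[of p "axis k 1"]
 by (simp add: Scoef_def E.om_at)

lemma curv_R_supp: "wsupp (%k a b. k = 0 \<and> a = 2 \<and> b = 2) (curv_R G)"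
 by (auto simp: wsupp_def fsupp_def curv_R_def)

lemma curv_R_fib: "curv_R G 0 p = smulC (1 / 4) (\<Sum>l\<in>UNIV. \<Sum>k\<in>UNIV. \<Sum>i\<in>UNIV. \<Sum>j\<in>UNIV.
  smulC (of_real (Scoef p l k i j)) (dxS l (dxS k (dxA i (dxA j (cst 1))))))"
proof (intro ext)
 fix ys vs
 show "curv_R G 0 p ys vs = smulC (1 / 4) (\<Sum>l\<in>UNIV. \<Sum>k\<in>UNIV. \<Sum>i\<in>UNIV. \<Sum>j\<in>UNIV.
  smulC (of_real (Scoef p l k i j)) (dxS l (dxS k (dxA i (dxA j (cst 1)))))) ys vs"
 proof (cases "length ys = 2 \<and> length vs = 2")
  case True
  then obtain v w y z where vw: "vs = [v, w]" "ys = [y, z]" by (auto simp: numeral_2_eq_2 length_Suc_conv)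
  have lin: "linear (sympl G p u)" for u using E.omega(1)[of p] unfolding bilinear_def by blast
  have S: "Scoef p l k i j = (\<Sum>m\<in>UNIV. sympl G p (axis l 1) (axis m 1) * curv_coeff G p m k i j)" for l k i j
   unfolding Scoef_def
   by (subst linear_axis_expansion[OF lin])
    (simp add: curv_coeff_def Let_def E.curvature_Rc[OF chart_at] mult.commute)
  have "(\<Sum>m\<in>UNIV. \<Sum>k\<in>UNIV. \<Sum>i\<in>UNIV. \<Sum>j\<in>UNIV. sympl G p (axis l 1) (axis m 1) * curv_coeff G p m k i j * (y $ l * z $ k + z $ l * y $ k) * (v $ i * w $ j - w $ i * v $ j)) =
   (\<Sum>k\<in>UNIV. \<Sum>i\<in>UNIV. \<Sum>j\<in>UNIV. Scoef p l k i j * ((y $ l * z $ k + z $ l * y $ k) * (v $ i * w $ j - w $ i * v $ j)))" for l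
  proof -
   let ?F = "%k i j m. sympl G p (axis l 1) (axis m 1) * curv_coeff G p m k i j * (y $ l * z $ k + z $ l * y $ k) * (v $ i * w $ j - w $ i * v $ j)"
   have "(\<Sum>m\<in>UNIV. \<Sum>k\<in>UNIV. \<Sum>i\<in>UNIV. \<Sum>j\<in>UNIV. ?F k i j m) = (\<Sum>k\<in>UNIV. \<Sum>i\<in>UNIV. \<Sum>j\<in>UNIV. \<Sum>m\<in>UNIV. ?F k i j m)"
    by (rule sum_rot3[symmetric])
   then show ?thesis by (simp only: S sum_distrib_right mult.assoc)
  qed
  then show ?thesis
   using True by (simp add: vw curv_R_def smulC_apply fun_ops dxS2_cst scaleC_complex_def scaleR_conv_of_real mult.commute[of "of_real (Scoef _ _ _ _ _)"])
 next
  case False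
  then have "dxS l (dxS k (dxA i (dxA j (cst (1::complex))))) ys vs = 0" for l k i j by (intro fsuppD[OF fsupp_dxS2]) auto
  then show ?thesis using False by (auto simp add: curv_R_def smulC_apply fun_ops)
 qed
qed

text \<open>The vector can enter either symmetric slot, and both give the same by
  \<open>Scoef_sym\<close>; hence 1 / 4 becomes 1 / 2.\<close>

lemma insS_curv_R: "insS (axis a 1) (curv_R G 0 p) = smulC (1 / 2) (\<Sum>k\<in>UNIV. \<Sum>i\<in>UNIV. \<Sum>j\<in>UNIV.
  smulC (of_real (Scoef p a k i j)) (dxS k (dxA i (dxA j (cst 1)))))"
proof -
 define H where "H = (%l k x. \<Sum>i\<in>UNIV. \<Sum>j\<in>UNIV. smulC (of_real (Scoef p l k i j)) (dxS x (dxA i (dxA j (cst (1::complex))))))"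
 have 1: "insS (axis a 1) (dxS l (dxS k (dxA i (dxA j (cst 1))))) =
   smulC (if l = a then 1 else 0) (dxS k (dxA i (dxA j (cst (1::complex))))) + smulC (if k = a then 1 else 0) (dxS l (dxA i (dxA j (cst 1))))" for l k i j
  by (simp add: insS_dxS insS_dxA ins_cst dxA_linear dxS_linear axis_def)
 have 2: "(\<Sum>i\<in>UNIV. \<Sum>j\<in>UNIV. smulC (of_real (Scoef p l k i j)) (insS (axis a 1) (dxS l (dxS k (dxA i (dxA j (cst 1))))))) =
   (if l = a then H l k k else 0) + (if k = a then H l k l else 0)" for l k
  unfolding 1 H_def by (simp add: smulC_add_right sum.distrib)
 have "insS (axis a 1) (curv_R G 0 p) = smulC (1 / 4) (\<Sum>l\<in>UNIV. \<Sum>k\<in>UNIV. (if l = a then H l k k else 0) + (if k = a then H l k l else 0))"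
  unfolding curv_R_fib by (simp only: insS_linear insS_sum 2)
 also have "\<dots> = smulC (1 / 4) ((\<Sum>k\<in>UNIV. H a k k) + (\<Sum>l\<in>UNIV. H l a l))"
 proof -
  have "(\<Sum>l\<in>UNIV. \<Sum>k\<in>UNIV. if l = a then H l k k else 0) = (\<Sum>k\<in>UNIV. H a k k)"
   by (subst sum.swap) simp
  then show ?thesis by (simp only: sum.distrib) simp
 qed
 also have "(\<Sum>l\<in>UNIV. H l a l) = (\<Sum>k\<in>UNIV. H a k k)"
  by (simp add: H_def Scoef_sym[of p _ a])
 also have "smulC (1 / 4) ((\<Sum>k\<in>UNIV. H a k k) + (\<Sum>k\<in>UNIV. H a k k)) = smulC (1 / 2) (\<Sum>k\<in>UNIV. H a k k)"
  by (simp only: smulC_add_right smulC_add_left[symmetric]) simp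
 finally show ?thesis by (simp add: H_def)
qed

text \<open>One contraction raises the lowered index again, so the quadratic element acts at first
  order as the derivation given by the curvature endomorphism.\<close>

lemma Bn_curv_R:
 fixes g :: "('n, 'f::complex_fibre) fib"
 assumes g: "wfib g"
 shows "Bn (poisson (sympl G) p) (%c s. c *\<^sub>c s) 1 (curv_R G 0 p) g =
  smulC (1 / 2) (\<Sum>i\<in>UNIV. \<Sum>j\<in>UNIV. dxA i (dxA j (actS (E.Rc (chart_at (atlas G) p) (axis i 1) (axis j 1) p) g)))"
proof -
 let ?R = "%i j. E.Rc (chart_at (atlas G) p) (axis i 1) (axis j 1) p" and ?L = "poisson (sympl G) p"
 let ?sc = "%c s. c *\<^sub>c s :: 'f"
 note m = cbilin_sc[where 'f='f]
 have c1: "mu ?sc (cst 1) h = h" for h :: "('n, 'f) fib"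
  by (intro ext) (simp add: mu_cst[OF m])
 have 1: "mu ?sc (insS (axis a 1) (curv_R G 0 p)) h = smulC (1 / 2) (\<Sum>k\<in>UNIV. \<Sum>i\<in>UNIV. \<Sum>j\<in>UNIV.
   smulC (of_real (Scoef p a k i j)) (dxS k (dxA i (dxA j h))))" for a h
  unfolding insS_curv_R by (simp add: mu_linear[OF m] mu_sum[OF m] dxA_mu_left[OF m] dxS_mu_left[OF m] c1)
 have 2: "actS (?R i j) g = (\<Sum>k\<in>UNIV. \<Sum>b\<in>UNIV. \<Sum>a\<in>UNIV. smulC (of_real (?L a b * Scoef p a k i j)) (dxS k (insS (axis b 1) g)))" for i j
 proof -
  have "dxS k (insS (?R i j (axis k 1)) g) = (\<Sum>b\<in>UNIV. \<Sum>a\<in>UNIV. smulC (of_real (?L a b * Scoef p a k i j)) (dxS k (insS (axis b 1) g)))" for k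
  proof -
   have "?R i j (axis k 1) $ b = (\<Sum>a\<in>UNIV. ?L a b * Scoef p a k i j)" for b
    unfolding Scoef_def by (rule E.poisson_dual[symmetric])
   then have e: "smulC (of_real (?R i j (axis k 1) $ b)) f = (\<Sum>a\<in>UNIV. smulC (of_real (?L a b * Scoef p a k i j)) f)" for b and f :: "('n, 'f) fib"
    by (simp add: smulC_sum_left)
   show ?thesis
    by (subst insS_expand[OF g, of "?R i j (axis k 1)"]) (simp only: dxS_sum dxS_linear e)
  qed
  then show ?thesis by (simp only: actS_expand[OF E.linear_Rc[OF chart_at] g])
 qed
 let ?F = "%i j k b a. smulC (of_real (?L a b * Scoef p a k i j)) (dxA i (dxA j (dxS k (insS (axis b 1) g))))"
 have 3: "smulC (of_real (?L a b)) (mu ?sc (insS (axis a 1) (curv_R G 0 p)) (insS (axis b 1) g)) =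
   smulC (1 / 2) (\<Sum>k\<in>UNIV. \<Sum>i\<in>UNIV. \<Sum>j\<in>UNIV. ?F i j k b a)" for a b
  unfolding 1 by (simp add: smulC_sum_right dxA_dxS mult_ac)
 have "Bn ?L ?sc 1 (curv_R G 0 p) g = (\<Sum>a\<in>UNIV. \<Sum>b\<in>UNIV. smulC (of_real (?L a b)) (mu ?sc (insS (axis a 1) (curv_R G 0 p)) (insS (axis b 1) g)))"
  using Bn_Suc_Psum[of ?L ?sc 0 "curv_R G 0 p" g] by (simp add: Psum_def)
 also have "\<dots> = smulC (1 / 2) (\<Sum>a\<in>UNIV. \<Sum>b\<in>UNIV. \<Sum>k\<in>UNIV. \<Sum>i\<in>UNIV. \<Sum>j\<in>UNIV. ?F i j k b a)"
  by (simp only: 3 smulC_sum_right[symmetric])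
 also have "(\<Sum>a\<in>UNIV. \<Sum>b\<in>UNIV. \<Sum>k\<in>UNIV. \<Sum>i\<in>UNIV. \<Sum>j\<in>UNIV. ?F i j k b a) = (\<Sum>a\<in>UNIV. \<Sum>b\<in>UNIV. \<Sum>i\<in>UNIV. \<Sum>j\<in>UNIV. \<Sum>k\<in>UNIV. ?F i j k b a)"
  by (rule sum.cong[OF refl sum.cong[OF refl sum_rot2[symmetric]]])
 also have "\<dots> = (\<Sum>a\<in>UNIV. \<Sum>i\<in>UNIV. \<Sum>j\<in>UNIV. \<Sum>k\<in>UNIV. \<Sum>b\<in>UNIV. ?F i j k b a)"
  by (rule sum.cong[OF refl sum_rot3[symmetric]])
 also have "\<dots> = (\<Sum>i\<in>UNIV. \<Sum>j\<in>UNIV. \<Sum>k\<in>UNIV. \<Sum>b\<in>UNIV. \<Sum>a\<in>UNIV. ?F i j k b a)"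
  by (rule sum_rot4[symmetric])
 also have "\<dots> = (\<Sum>i\<in>UNIV. \<Sum>j\<in>UNIV. dxA i (dxA j (actS (?R i j) g)))"
  unfolding 2 by (simp only: dxA_sum dxA_linear)
 finally show ?thesis .
qed

lemma D_E_D_E:
 assumes tf: "torsion_free (atlas G) (connM G)" and W: "\<Psi> \<in> weyl_E G"
 shows "D_E G (D_E G \<Psi>) = i_over_lambda (wprod (sympl G) (%c s. c *\<^sub>c s) (curv_R G) \<Psi> - rmult_E G \<Psi> (curv_R G)) + lmult_E G (curv_RE G) \<Psi>"
proof -
 have "D_E G (D_E G \<Psi>) k p = (i_over_lambda (wprod (sympl G) (%c s. c *\<^sub>c s) (curv_R G) \<Psi> - rmult_E G \<Psi> (curv_R G)) + lmult_E G (curv_RE G) \<Psi>) k p" for k p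
 proof -
  let ?c = "chart_at (atlas G) p" and ?A = "atlas G"
  have W': "\<Psi> \<in> E.WF" using W by (simp add: weyl_E_def)
  note l = E.WF_D(1)[OF W']
  have K: "(%ys vs. E.Kc ?c (axis j 1) (axis i 1) (%q. frame ?A ?c \<Psi> k q ys vs) p) = (%ys vs. curv_E_coeff G p j i *v \<Psi> k p ys vs)" for i j
   by (intro ext) (simp add: curv_tensor[OF E.SFD[OF E.WF_SF[OF W' chart_at(1)]]] E.frame_at)
  have "D_E G (D_E G \<Psi>) k p = smulC (1 / 2) (\<Sum>j\<in>UNIV. \<Sum>i\<in>UNIV. dxA j (dxA i (%ys vs. curv_E_coeff G p j i *v \<Psi> k p ys vs)))
   - smulC (1 / 2) (\<Sum>j\<in>UNIV. \<Sum>i\<in>UNIV. dxA j (dxA i (actS (E.Rc ?c (axis j 1) (axis i 1) p) (\<Psi> k p))))"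
   unfolding D_E_def E.cov_D_cov_D[OF tf W'] K by (simp only: dxA_linear sum_subtractf smulC_diff_right)
  also have "\<dots> = lmult_E G (curv_RE G) \<Psi> k p - Bn (poisson (sympl G) p) (%c s. c *\<^sub>c s) 1 (curv_R G 0 p) (\<Psi> k p)"
   by (simp only: lmult_RE[OF l] Bn_curv_R[OF E.WF_D(2)[OF W']])
  finally show ?thesis
   using commutator_quadratic[OF cbilin_sc l curv_R_supp E.poisson_antisym, of k]
   by (simp add: wform_ops rmult_E_def)
 qed
 then show ?thesis by (intro ext) simp
qed

end

subsection \<open>Flat sections of a perturbation of the Koszul differential\<close>

lemma delta_zero: "delta (0 :: ('m, 'n::finite, 'f::complex_fibre) wform) = 0"
 by (intro ext) (simp only: delta_fib wform_ops fdelta_linear)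

lemma wfib_cst: "wfib (cst e)"
 by (rule wfibI) (simp_all add: cst_def linear_zero_fun)

lemma total_degree_all:
 assumes "!!d. total_degree_ge d \<Psi>" shows "\<Psi> = (0 :: ('m, 'n::finite, 'f::complex_fibre) wform)"
proof (intro ext)
 fix k p ys vs
 show "\<Psi> k p ys vs = 0 k p ys vs"
  using assms[of "nat (2 * k + int (length ys)) + 1"] unfolding total_degree_ge_def fun_ops by force
qed

lemma total_degree_delta_inv: "total_degree_ge d \<Psi> ==> total_degree_ge (Suc d) (delta_inv (\<Psi> :: ('m, 'n::finite, 'f::complex_fibre) wform))"
 unfolding wsupp_conv by (erule wsupp_delta_inv) simp

lemma total_degree_linear:
 "total_degree_ge d \<Psi> ==> total_degree_ge d \<Phi> ==> total_degree_ge d (\<Psi> + (\<Phi> :: ('m, 'n::finite, 'f::complex_fibre) wform))"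
 "total_degree_ge d \<Psi> ==> total_degree_ge d \<Phi> ==> total_degree_ge d (\<Psi> - (\<Phi> :: ('m, 'n::finite, 'f::complex_fibre) wform))"
 unfolding wsupp_conv by (rule wsupp_linear; assumption)+

lemma form_degree_delta_inv: "form_degree (Suc d) \<Psi> ==> form_degree d (delta_inv (\<Psi> :: ('m, 'n::finite, 'f::complex_fibre) wform))"
 unfolding wsupp_conv by (erule wsupp_delta_inv) simp

lemma delta_inv_form_degree_0:
 fixes \<Psi> :: "('m, 'n::finite, 'f::complex_fibre) wform"
 assumes "form_degree 0 \<Psi>" shows "delta_inv \<Psi> = 0"
proof -
 have "wsupp (%k a b. False) (delta_inv \<Psi>)"
  by (rule wsupp_delta_inv[OF assms[unfolded wsupp_conv]]) simp
 then show ?thesis by (rule wsupp_zero) simp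
qed

definition incl :: "(nat => 'm => 'f) => ('m, 'n::finite, 'f::complex_fibre) wform"
 where "incl s = (%k p. cst (if 0 \<le> k then s (nat k) p else 0))"

context symplectic_bundle
begin

text \<open>\<open>K\<close> is the derivative without its leading part \<open>- delta\<close>. It
  does not lower the total degree, while \<open>delta_inv\<close> raises it; \<open>K_sq\<close> is
  the vanishing of the square of \<open>K - delta\<close>.\<close>

context
 fixes K :: "('m, 'n, 'f) wform => ('m, 'n, 'f) wform"
 assumes K_WF: "!!\<Psi>. \<Psi> \<in> WF ==> K \<Psi> \<in> WF"
  and K_diff: "!!\<Phi> \<Psi>. \<Phi> \<in> WF ==> \<Psi> \<in> WF ==> K (\<Phi> - \<Psi>) = K \<Phi> - K \<Psi>"
  and K_deg: "!!d \<Psi>. \<Psi> \<in> WF ==> total_degree_ge d \<Psi> ==> total_degree_ge d (K \<Psi>)"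
  and K_form: "!!d \<Psi>. \<Psi> \<in> WF ==> form_degree d \<Psi> ==> form_degree (Suc d) (K \<Psi>)"
  and K_sq: "!!\<Psi>. \<Psi> \<in> WF ==> K (K \<Psi> - delta \<Psi>) = delta (K \<Psi> - delta \<Psi>)"
begin

lemma WF_degree_0: "\<Psi> \<in> WF ==> total_degree_ge 0 \<Psi>"
proof -
 assume W: "\<Psi> \<in> WF"
 show ?thesis
  unfolding total_degree_ge_def
 proof (intro allI impI)
  fix k p and ys vs :: "(real ^ 'n) list" assume "2 * k + int (length ys) < int 0"
  then have "k < 0" by simp
  then show "\<Psi> k p ys vs = 0" using lbD_fib[OF WF_D(1)[OF W]] by (simp add: fun_ops)
 qed
qed

text \<open>Every use of the equation raises the lower bound on the total degree by one, whereas
  each single value has a fixed finite degree.\<close>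

lemma fixed_zero:
 assumes W: "\<Psi> \<in> WF" and e: "\<Psi> = delta_inv (K \<Psi>)" shows "\<Psi> = 0"
proof (rule total_degree_all)
 fix d show "total_degree_ge d \<Psi>"
 proof (induction d)
  case 0 show ?case by (rule WF_degree_0[OF W])
 next
  case (Suc d) show ?case by (subst e) (rule total_degree_delta_inv[OF K_deg[OF W Suc]])
 qed
qed

lemma flat_expand:
 assumes W: "\<Psi> \<in> WF" and f: "form_degree 0 \<Psi>" and e: "delta \<Psi> = K \<Psi>"
 shows "\<Psi> = delta_inv (K \<Psi>) + sig \<Psi>"
 using wform_hodge[of \<Psi>, OF WF_D(2)[OF W]] unfolding delta_inv_form_degree_0[OF f] delta_zero e by simp

lemma flat_unique:
 assumes W: "\<Psi> \<in> WF" and f: "form_degree 0 \<Psi>" and e: "delta \<Psi> = K \<Psi>" and s: "sigma_proj \<Psi> = (%k p. 0)"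
 shows "\<Psi> = 0"
proof (rule fixed_zero[OF W])
 have "\<Psi> k p [] [] = 0" for k p
 proof (cases "0 \<le> k")
  case True
  then show ?thesis using fun_cong[OF fun_cong[OF s, of "nat k"], of p] by (simp add: sigma_proj_def)
 next
  case False
  then show ?thesis using lbD_fib[OF WF_D(1)[OF W]] by (simp add: fun_ops)
 qed
 then have "sig \<Psi> = 0" by (intro ext) (simp add: sig_def fun_ops)
 then show "\<Psi> = delta_inv (K \<Psi>)" using flat_expand[OF W f e] by simp
qed

text \<open>Iteration solves the fixed point equation with prescribed degree zero part. Flatness is
  then a separate question about the defect, settled by the Hodge decomposition and
  \<open>K_sq\<close>.\<close>

lemma flat_exists:
 assumes s: "!!k. smF UNIV (s k)"
 shows "\<exists>\<Psi>\<in>WF. form_degree 0 \<Psi> \<and> delta \<Psi> = K \<Psi> \<and> sigma_proj \<Psi> = s"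
proof -
 have iW: "incl s \<in> WF"
 proof (rule WF_I)
  show "lb 0 (incl s)" by (rule lb_fibI) (simp add: incl_def cst_def fun_eq_iff fun_ops)
  show "wfib (incl s k p)" for k p by (simp add: incl_def wfib_cst)
  show "SF (fst c) (frame A c (incl s) k)" if c: "c \<in> A" for c k
   unfolding SF_def
  proof (intro allI)
   fix ys vs
   show "smF (fst c) (%q. frame A c (incl s) k q ys vs)"
   proof (cases "0 \<le> k \<and> ys = [] \<and> vs = []")
    case True
    then show ?thesis
     using smF_subset[OF s subset_UNIV open_chart(1)[OF c], of "nat k"] by (simp add: frame_def pull_def incl_def cst_def)
   next
    case False
    then have "(%q. frame A c (incl s) k q ys vs) = (%q. 0)" by (auto simp: frame_def pull_def incl_def cst_def)
    then show ?thesis using smF_zero[OF open_chart(1)[OF c]] by simp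
   qed
  qed
 qed
 have i0: "form_degree 0 (incl s)" by (auto simp: form_degree_def incl_def cst_def)
 have di: "delta (incl s) = 0"
  by (intro ext) (simp add: delta_fib fdelta_def incl_def ins_cst dxA_linear fun_ops)
 \<comment> \<open>Successive approximations; by \<open>step\<close> each new one agrees with its
   predecessor in more total degrees.\<close>
 define It where "It = (%N. ((%\<Psi>. incl s + delta_inv (K \<Psi>)) ^^ N) (incl s))"
 have It_simps: "It 0 = incl s" "It (Suc N) = incl s + delta_inv (K (It N))" for N
  by (simp_all add: It_def)
 have ItW: "It N \<in> WF" for N
  by (induction N) (simp_all add: It_simps iW WF_ops(1) WF_delta_inv K_WF)
 have It0: "form_degree 0 (It N)" for N
  by (induction N) (auto simp: It_simps i0 wsupp_conv intro!: wsupp_linear form_degree_delta_inv[unfolded wsupp_conv] K_form[unfolded wsupp_conv] ItW i0[unfolded wsupp_conv])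
 have step: "total_degree_ge (Suc N) (It (Suc N) - It N)" for N
 proof (induction N)
  case 0
  show ?case using total_degree_delta_inv[OF K_deg[OF iW WF_degree_0[OF iW]]] by (simp add: It_simps)
 next
  case (Suc N)
  have "It (Suc (Suc N)) - It (Suc N) = delta_inv (K (It (Suc N) - It N))"
   by (simp only: It_simps(2)[of "Suc N"] It_simps(2)[of N] K_diff[OF ItW ItW, of "Suc N" N, unfolded It_simps(2)[of N]] delta_inv_linear)
    (simp add: algebra_simps)
  then show ?case
   using total_degree_delta_inv[OF K_deg[OF WF_ops(2)[OF ItW ItW] Suc]] by simp
 qed
 have mono: "total_degree_ge d \<Psi> ==> e \<le> d ==> total_degree_ge e \<Psi>" for d e and \<Psi> :: "('m, 'n, 'f) wform"
  by (auto simp: total_degree_ge_def)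
 have steps: "total_degree_ge (Suc N) (It M - It N)" if "N \<le> M" for N M
  using that
 proof (induction M rule: dec_induct)
  case base show ?case by (simp add: total_degree_ge_def fun_ops)
 next
  case (step M)
  have "It (Suc M) - It N = (It (Suc M) - It M) + (It M - It N)" by simp
  then show ?case
   using total_degree_linear(1)[OF mono[OF \<open>!!N. total_degree_ge (Suc N) (It (Suc N) - It N)\<close>[of M], of "Suc N"] step.IH] step.hyps by simp
 qed
 \<comment> \<open>In total degree n the iterates are constant from \<open>It n\<close> on, so the
   limit is read off there degree by degree.\<close>
 define L where "L = (%k p ys vs. It (nat (2 * k + int (length ys))) k p ys vs)"
 have LN: "total_degree_ge (Suc N) (L - It N)" for N
  unfolding total_degree_ge_def
 proof (intro allI impI)
  fix k p and ys vs :: "(real ^ 'n) list" assume k: "2 * k + int (length ys) < int (Suc N)"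
  let ?n = "nat (2 * k + int (length ys))"
  have "?n \<le> N" "2 * k + int (length ys) < int (Suc ?n)" using k by auto
  from steps[OF this(1)] this(2) show "(L - It N) k p ys vs = 0"
   by (simp add: total_degree_ge_def fun_ops L_def)
 qed
 have LW: "L \<in> WF"
 proof (rule WF_I)
  show "lb 0 L" by (rule lb_fibI) (simp add: L_def lbD_fib[OF WF_D(1)[OF ItW]] fun_eq_iff fun_ops)
  show "wfib (L k p)" for k p
  proof (rule wfibI)
   note w = WF_D(2)[OF ItW, of _ k p]
   show "linear (%u. L k p (ys @ u # ys') vs)" for ys ys' vs unfolding L_def length_append list.size by (rule wfibD(1)[OF w])
   show "linear (%u. L k p ys (vs @ u # vs'))" for ys vs vs' unfolding L_def by (rule wfibD(2)[OF w])
   show "L k p (ys @ u # w # ys') vs = L k p (ys @ w # u # ys') vs" for ys u w ys' vs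
    unfolding L_def length_append list.size by (rule wfibD(3)[OF w])
   show "L k p ys (vs @ u # w # vs') = - L k p ys (vs @ w # u # vs')" for ys vs u w vs'
    unfolding L_def by (rule wfibD(4)[OF w])
  qed
  show "SF (fst c) (frame A c L k)" if c: "c \<in> A" for c k
   unfolding SF_def
  proof (intro allI)
   fix ys vs
   show "smF (fst c) (%q. frame A c L k q ys vs)"
    using SFD[OF WF_SF[OF ItW[of "nat (2 * k + int (length ys))"] c], of k ys vs] by (simp add: frame_def pull_def L_def)
  qed
 qed
 have L0: "form_degree 0 L" using It0 by (simp add: form_degree_def L_def)
 have fix_eq: "L = incl s + delta_inv (K L)"
 proof -
  have "L - (incl s + delta_inv (K L)) = 0"
  proof (rule total_degree_all)
   fix N
   have 1: "total_degree_ge N (L - It (Suc N))" by (rule mono[OF LN]) simp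
   have "It (Suc N) - (incl s + delta_inv (K L)) = delta_inv (K (It N - L))"
    by (simp add: It_simps K_diff[OF ItW LW] delta_inv_linear)
   moreover have "total_degree_ge (Suc N) (It N - L)" using LN[of N] by (simp add: total_degree_ge_def fun_ops)
   ultimately have 2: "total_degree_ge N (It (Suc N) - (incl s + delta_inv (K L)))"
    using mono[OF total_degree_delta_inv[OF K_deg[OF WF_ops(2)[OF ItW LW]]]] by simp
   have e: "L - (incl s + delta_inv (K L)) = (L - It (Suc N)) + (It (Suc N) - (incl s + delta_inv (K L)))" by simp
   show "total_degree_ge N (L - (incl s + delta_inv (K L)))"
    unfolding e by (rule total_degree_linear(1)[OF 1 2])
  qed
  then show ?thesis by simp
 qed
 \<comment> \<open>The defect of flatness. By the Hodge decomposition of \<open>K L\<close> it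
   equals \<open>delta_inv\<close> of \<open>delta (K L)\<close>, and \<open>delta (K L)\<close> is
   \<open>K\<close> of the defect by \<open>K_sq\<close>, so \<open>fixed_zero\<close> applies to
   it.\<close>
 let ?A = "K L - delta L"
 have AW: "?A \<in> WF" by (rule WF_ops(2)[OF K_WF[OF LW] WF_delta[OF LW]])
 have "delta L = delta (incl s) + delta (delta_inv (K L))" by (subst fix_eq) (rule delta_linear)
 then have dL: "delta L = delta (delta_inv (K L))" by (simp add: di)
 have "sig (K L) = 0" using K_form[OF LW L0] by (intro ext) (simp add: sig_def form_degree_def fun_ops)
 with wform_hodge[of "K L", OF WF_D(2)[OF K_WF[OF LW]]]
 have "K L = delta (delta_inv (K L)) + delta_inv (delta (K L))" by simp
 then have "?A = delta_inv (delta (K L))" unfolding dL by (metis add_diff_cancel_left')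
 also have "delta (K L) = delta ?A" by (simp add: delta_linear delta_delta[OF WF_D(3)[OF LW]])
 also have "delta ?A = K ?A" by (rule K_sq[OF LW, symmetric])
 finally have "?A = 0" by (rule fixed_zero[OF AW])
 then have "delta L = K L" by simp
 moreover have "sigma_proj L = s"
 proof (intro ext)
  fix k p
  show "sigma_proj L k p = s k p"
   unfolding sigma_proj_def by (subst fix_eq) (simp add: fun_ops incl_def cst_def delta_inv_def)
 qed
 ultimately show ?thesis using LW L0 by blast
qed

end

end

subsection \<open>The Fedosov derivative\<close>

lemma group_three: "x = a + b + c ==> x - a = c + (b :: 'x::ab_group_add)"
 by simp

lemma group_diff3: "(a + b + c) - (a' + b' + c') = (a - a') + (b - b') + (c - (c' :: 'x::ab_group_add))"
 by simp

lemma group_swap3: "s + (a + b) + (c + d) = s + a + c + (b + (d :: 'x::ab_group_add))"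
 by simp

text \<open>The bookkeeping for the square of the derivative with variables for the products; the
  hypothesis carries the cancellation that rests on associativity.\<close>

lemma group_square:
 fixes j1 :: "'x::ab_group_add"
 assumes "j1 - j2 = j3 - j4"
 shows "- (x1 + - a1 - (- b1 + x2)) + (x3 + - a2 - (- b2 + x4)) + ((- a1 + a2 + j1) - (- b1 + b2 + j2)) = (- x1 + x3 + j3) - (- x2 + x4 + j4)"
proof -
 have "j1 = j3 - j4 + j2" using assms by (simp add: diff_eq_eq)
 then show ?thesis by (simp add: algebra_simps)
qed

lemma group_square': "- (- a + j1) + (- a + d + j2) + j3 = d + (- j1 + j2 + (j3 :: 'x::ab_group_add))"
 by simp

lemma mat_mat: "mat x ** mat y = (mat (x * y) :: complex ^ 'k::finite ^ 'k)"
 by (simp add: mat_mm(1) mat_linear(5)[symmetric] scaleC_complex_def)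

lemma to_End_wprod: "wprod \<omega> (**) (to_End \<Phi>) (to_End \<Psi>) = (to_End (wprod \<omega> (*) \<Phi> \<Psi>) :: ('m, 'n::finite, complex ^ 'k::finite ^ 'k) wform)"
proof -
 have "wprod \<omega> (**) (to_End \<Phi>) (to_End \<Psi>) = wprod \<omega> (%x y. mat (x * y) :: complex ^ 'k ^ 'k) \<Phi> \<Psi>"
  by (subst wprod_to_End[where m'="%x y. mat x ** y"], rule refl,
    rule wprod_to_End_right) (rule mat_mat)
 also have "\<dots> = to_End (wprod \<omega> (*) \<Phi> \<Psi>)"
  by (simp add: wprod_def to_End_def mat_sum mat_linear Let_def case_prod_beta)
 finally show ?thesis .
qed

lemma mu_mat:
 fixes f :: "('n::finite, complex) fib" and g :: "('n, complex ^ 'k::finite ^ 'k) fib" and h :: "('n, complex ^ 'k) fib"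
 shows "mu (%x y. y ** x) g (%ys vs. mat (f ys vs)) = mu (**) g (%ys vs. mat (f ys vs))"
  "mu (*v) (%ys vs. mat (f ys vs)) h = mu (%c s. c *\<^sub>c s) f h"
 by (simp_all add: mu_def mat_mm mat_mv)

lemma wfib_mat: "wfib f ==> wfib (%ys vs. mat (f ys vs) :: complex ^ 'k::finite ^ 'k)"
proof (rule wfibI)
 assume f: "wfib f"
 have l: "linear (mat :: complex => complex ^ 'k ^ 'k)" by (rule linearI) (simp_all add: mat_linear)
 fix ys ys' vs vs' u w
 show "linear (%u. mat (f (ys @ u # ys') vs) :: complex ^ 'k ^ 'k)" by (rule linear_compose[OF wfibD(1)[OF f] l, unfolded o_def])
 show "linear (%u. mat (f ys (vs @ u # vs')) :: complex ^ 'k ^ 'k)" by (rule linear_compose[OF wfibD(2)[OF f] l, unfolded o_def])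
 show "mat (f (ys @ u # w # ys') vs) = (mat (f (ys @ w # u # ys') vs) :: complex ^ 'k ^ 'k)" by (simp only: wfibD(3)[OF f, of ys u w])
 show "mat (f ys (vs @ u # w # vs')) = - (mat (f ys (vs @ w # u # vs')) :: complex ^ 'k ^ 'k)" by (subst wfibD(4)[OF f]) (rule mat_linear)
qed

lemma i_over_lambda_linear:
 "i_over_lambda (\<Phi> + \<Psi>) = i_over_lambda \<Phi> + i_over_lambda \<Psi>" "i_over_lambda (\<Phi> - \<Psi>) = i_over_lambda \<Phi> - i_over_lambda \<Psi>"
 "i_over_lambda (- \<Phi>) = - i_over_lambda \<Phi>" "i_over_lambda 0 = (0 :: ('m, 'n::finite, 'f::complex_fibre) wform)"
 for \<Phi> \<Psi> :: "('m, 'n::finite, 'f::complex_fibre) wform"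
 by (simp_all add: cscale_add lambda_shift_add)

lemma wprod_i_over_lambda:
 fixes \<Phi> :: "('m, 'n::finite, 'f::complex_fibre) wform" and \<Psi> :: "('m, 'n, 'g::complex_fibre) wform"
 assumes m: "cbilin m" and l: "lb 0 \<Phi>" "lb 0 \<Psi>"
 shows "wprod \<omega> m (i_over_lambda \<Phi>) \<Psi> = i_over_lambda (wprod \<omega> m \<Phi> \<Psi>)"
  "wprod \<omega> m \<Phi> (i_over_lambda \<Psi>) = i_over_lambda (wprod \<omega> m \<Phi> \<Psi>)"
proof -
 have l': "lb (- 1) (lambda_shift (- 1) \<Phi>)" "lb (- 1) (lambda_shift (- 1) \<Psi>)"
  using lb_ops(8)[OF l(1), of "- 1"] lb_ops(8)[OF l(2), of "- 1"] by simp_all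
 have k: "lb (- 1) \<Phi>" "lb (- 1) \<Psi>" using l by (auto intro: lb_mono)
 show "wprod \<omega> m (i_over_lambda \<Phi>) \<Psi> = i_over_lambda (wprod \<omega> m \<Phi> \<Psi>)"
  by (simp add: wprod_cscale(1)[OF m l'(1) k(2)] wprod_shift(1)[OF m l])
 show "wprod \<omega> m \<Phi> (i_over_lambda \<Psi>) = i_over_lambda (wprod \<omega> m \<Phi> \<Psi>)"
  by (simp add: wprod_cscale(2)[OF m k(1) l'(2)] wprod_shift(2)[OF m l])
qed

lemma lb_i_over_lambda: "lb 0 \<Phi> ==> lb (- 1) (i_over_lambda (\<Phi> :: ('m, 'n::finite, 'f::complex_fibre) wform))"
 using lb_ops(5)[OF lb_ops(8)[of 0 \<Phi> "- 1"]] by simp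

lemma wprod_Fed:
 fixes A B C :: "('m, 'n::finite, 'f::complex_fibre) wform" and \<Psi> :: "('m, 'n, 'g::complex_fibre) wform"
 assumes m: "cbilin m" and l: "lb 0 A" "lb 0 B" "lb 0 C" "lb 0 \<Psi>"
 shows "wprod \<omega> m (- A + B + i_over_lambda C) \<Psi> = - wprod \<omega> m A \<Psi> + wprod \<omega> m B \<Psi> + i_over_lambda (wprod \<omega> m C \<Psi>)"
proof -
 have k: "lb (- 1) A" "lb (- 1) B" "lb (- 1) \<Psi>" using l by (auto intro: lb_mono)
 show ?thesis
  by (simp only: wprod_add(1)[OF m lb_ops(1)[OF lb_ops(3)[OF k(1)] k(2)] lb_i_over_lambda[OF l(3)] k(3) k(3)]
    wprod_add(1)[OF m lb_ops(3)[OF k(1)] k(2) k(3) k(3)] wprod_neg(1)[OF m k(1) k(3)] wprod_i_over_lambda(1)[OF m l(3,4)])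
qed

lemma wprod_Fed_right:
 fixes A B C :: "('m, 'n::finite, 'g::complex_fibre) wform" and \<Psi> :: "('m, 'n, 'f::complex_fibre) wform"
 assumes m: "cbilin m" and l: "lb 0 A" "lb 0 B" "lb 0 C" "lb 0 \<Psi>"
 shows "wprod \<omega> m \<Psi> (- A + B + i_over_lambda C) = - wprod \<omega> m \<Psi> A + wprod \<omega> m \<Psi> B + i_over_lambda (wprod \<omega> m \<Psi> C)"
proof -
 have k: "lb (- 1) A" "lb (- 1) B" "lb (- 1) \<Psi>" using l by (auto intro: lb_mono)
 show ?thesis
  by (simp only: wprod_add(2)[OF m k(3) k(3) lb_ops(1)[OF lb_ops(3)[OF k(1)] k(2)] lb_i_over_lambda[OF l(3)]]
    wprod_add(2)[OF m k(3) k(3) lb_ops(3)[OF k(1)] k(2)] wprod_neg(2)[OF m k(3) k(1)] wprod_i_over_lambda(2)[OF m l(4,3)])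
qed

locale fedosov = fedosov_bundle G
 for G :: "('m::{second_countable_topology, t2_space}, 'n::finite, 'k::finite) fedosov_data" +
 fixes \<Omega> :: "nat => 'm => real ^ 'n => real ^ 'n => complex"
  and r :: "('m, 'n, complex) wform" and r' :: "('m, 'n, complex ^ 'k ^ 'k) wform"
 assumes tf: "torsion_free (atlas G) (connM G)" and fr: "fedosov_r G \<Omega> r" and fr': "fedosov_r' G \<Omega> r'"
begin

abbreviation "lm \<equiv> wprod (sympl G) ((*v) :: complex ^ 'k ^ 'k => complex ^ 'k => complex ^ 'k)"
abbreviation "rm \<equiv> wprod (sympl G) (%s c. c *\<^sub>c s :: complex ^ 'k)"
abbreviation "mm \<equiv> wprod (sympl G) ((**) :: complex ^ 'k ^ 'k => complex ^ 'k ^ 'k => complex ^ 'k ^ 'k)"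
abbreviation "ww \<equiv> wprod (sympl G) ((*) :: complex => complex => complex)"
abbreviation "Om \<equiv> Omega_form \<Omega>"

lemma cb: "cbilin ((*v) :: complex ^ 'k ^ 'k => complex ^ 'k => complex ^ 'k)" "cbilin (%s c. c *\<^sub>c s :: complex ^ 'k)"
 "cbilin ((**) :: complex ^ 'k ^ 'k => complex ^ 'k ^ 'k => complex ^ 'k ^ 'k)" "cbilin ((*) :: complex => complex => complex)"
 by (rule cbilin_mv cbilin_sc' cbilin_mm cbilin_times)+

lemma r_facts:
 "r \<in> weyl_forms (atlas G) sfun" "form_degree 1 r" "total_degree_ge 3 r"
 "delta r = curv_R G + D_W G r + i_over_lambda (ww r r) + Om" "delta_inv r = 0"
 using fr by (simp_all add: fedosov_r_def weyl_W_def prod_W_def)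

lemma r'_facts:
 "r' \<in> weyl_forms (atlas G) endo" "form_degree 1 r'" "total_degree_ge 3 r'"
 "delta r' = to_End (curv_R G) - cscale \<i> (lambda_shift 1 (curv_RE G)) + D_End G r' + i_over_lambda (mm r' r') + to_End Om" "delta_inv r' = 0"
 using fr' by (simp_all add: fedosov_r'_def weyl_End_def prod_End_def)

lemma lb_r: "lb 0 r" and lb_r': "lb 0 r'" and sym_r: "sym2 (r k p)" and sym_r': "sym2 (r' k p)"
 using weyl_formsD(1)[OF r_facts(1)] weyl_formsD(1)[OF r'_facts(1)] wfib_sym2[OF weyl_formsD(2)[OF r_facts(1)]] wfib_sym2[OF weyl_formsD(2)[OF r'_facts(1)]] by auto

lemma lb_Om: "lb 0 Om"
 by (auto simp: lb_def Omega_form_def fun_eq_iff fun_ops)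

definition rho :: "('m, 'n, complex ^ 'k ^ 'k) wform" where "rho = r' - to_End r"

lemma lb_rho: "lb 0 rho" unfolding rho_def by (rule lb_ops(2)[OF lb_r' to_End_lb[OF lb_r]])

lemma wprod_one:
 assumes m: "cbilin m" and l: "lb 0 \<Phi>" "lb 0 \<Psi>"
 shows "wprod \<omega> m \<Phi> \<Psi> 1 p = smulC (\<i> / 2) (Bn (poisson \<omega> p) m 1 (\<Phi> 0 p) (\<Psi> 0 p)) + mu m (\<Phi> 0 p) (\<Psi> 1 p) + mu m (\<Phi> 1 p) (\<Psi> 0 p)"
proof -
 have "{0..1::int} = {0, 1}" by auto
 then show ?thesis
  unfolding wprod_range[OF m l order.refl] by (simp add: wterm_def)
qed

text \<open>At order zero in \<open>\<lambda>\<close> the equations for \<open>r\<close> and \<open>r'\<close> differ only by terms that are at least linear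
  in \<open>rho 0\<close>, and those of lowest order cancel since scalars are central.\<close>

lemma rho_zero: "rho 0 p = 0"
proof -
 let ?t = "to_End r :: ('m, 'n, complex ^ 'k ^ 'k) wform" and ?m = "(**) :: complex ^ 'k ^ 'k => complex ^ 'k ^ 'k => complex ^ 'k ^ 'k"
 note m = cbilin_mm[where 'k='k]
 have lt: "lb 0 ?t" by (rule to_End_lb[OF lb_r])
 have t1: "form_degree 1 ?t" using to_End_wsupp[of _ r] r_facts(2) unfolding wsupp_conv by blast
 have t3: "total_degree_ge 3 ?t" using to_End_wsupp[of _ r] r_facts(3) unfolding wsupp_conv by blast
 have rho1: "form_degree 1 rho" using t1 r'_facts(2) unfolding wsupp_conv rho_def by (intro wsupp_linear)
 have wt: "wfib (?t k p)" for k p unfolding to_End_def by (rule wfib_mat[OF weyl_formsD(2)[OF r_facts(1)]])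
 have wrho: "wfib (rho k p)" for k p unfolding rho_def wform_ops by (rule wfib_diff[OF weyl_formsD(2)[OF r'_facts(1)] wt])
 \<comment> \<open>The scalar curvature and the formal two-form cancel between the two equations,
   and the curvature of \<open>E\<close> carries a factor lambda. Division by lambda brings the
   order one of the products into play.\<close>
 have drho: "delta rho 0 p = (D_End G r' 0 p - D_End G ?t 0 p) + smulC \<i> (mm r' r' 1 p - mm ?t ?t 1 p)" for p
 proof -
  have "delta ?t = to_End (curv_R G) + D_End G ?t + i_over_lambda (mm ?t ?t) + to_End Om"
   unfolding to_End_delta r_facts(4) to_End_ops to_End_wprod D_End_to_End[OF r_facts(1)[folded weyl_W_def]] ..
  then have "delta rho = (D_End G r' - D_End G ?t) + i_over_lambda (mm r' r' - mm ?t ?t) - cscale \<i> (lambda_shift 1 (curv_RE G))"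
   unfolding rho_def delta_linear r'_facts(4) by (simp add: i_over_lambda_linear)
  moreover have "curv_RE G (- 1) p = 0" by (rule lbD_fib[OF lb_RE]) simp
  ultimately show ?thesis by (simp add: wform_ops cscale_fib lambda_shift_def)
 qed
 have r'0: "r' k p = ?t k p + rho k p" for k p by (simp add: rho_def wform_ops)
 \<comment> \<open>The normalisations give \<open>delta_inv rho = 0\<close>, and a one-form has no
   part of degree zero, so a single term of the Hodge decomposition survives.\<close>
 have hod: "rho = delta_inv (delta rho)"
 proof -
  have "delta_inv rho = 0" by (simp add: rho_def delta_inv_linear r'_facts(5) to_End_delta r_facts(5) to_End_ops)
  moreover have "sig rho = 0" using rho1 by (intro ext) (simp add: sig_def form_degree_def fun_ops)
  ultimately show ?thesis using wform_hodge[of rho, OF wrho] by (simp add: delta_zero)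
 qed
 \<comment> \<open>A lower bound on the symmetric degree at order zero in lambda. The right-hand
   side of \<open>drho\<close> preserves it and \<open>delta_inv\<close> in \<open>hod\<close>
   raises it by one.\<close>
 let ?Q = "%s (k::int) a (b::nat). k = 0 \<longrightarrow> s \<le> (a::nat)"
 have "wsupp (?Q s) rho" for s
 proof (induction s)
  case 0 show ?case by (simp add: wsupp_def fsupp_def)
 next
  case (Suc s)
  have IH: "fsupp (%a b. s \<le> a) (rho 0 p)" for p using wsuppD[OF Suc, of 0 p] by simp
  have D: "fsupp (%a b. s \<le> a) (D_End G r' 0 p - D_End G ?t 0 p)" for p
   unfolding fsupp_def
  proof (intro allI impI)
   fix ys vs :: "(real ^ 'n) list" assume s: "\<not> s \<le> length ys"
   have "cov_D (atlas G) (connM G) (conn_End (trivs G) (connE G)) r' 0 p ys vs = cov_D (atlas G) (connM G) (conn_End (trivs G) (connE G)) ?t 0 p ys vs"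
    by (rule cov_D_local[of "length ys"]) (use s in \<open>auto simp: r'0 fun_ops fsuppD[OF IH]\<close>)
   then show "(D_End G r' 0 p - D_End G ?t 0 p) ys vs = 0" by (simp add: D_End_def fun_ops)
  qed
  have X: "fsupp (%a b. s \<le> a) (mm r' r' 1 p - mm ?t ?t 1 p)" for p
  proof -
   let ?B = "Bn (poisson (sympl G) p) ?m 1"
   \<comment> \<open>The induction hypothesis says nothing about \<open>rho 1 p\<close>. It enters
     through its anticommutator with a scalar one-form, which is zero.\<close>
   have c: "mu ?m (?t 0 p) (rho 1 p) + mu ?m (rho 1 p) (?t 0 p) = 0"
   proof -
    have "fdeg 1 (?t 0 p)" using t1 unfolding form_degree_fdeg by blast
    from mu_comm[OF m this, of "rho 1 p"]
    have "mu ?m (?t 0 p) (rho 1 p) = mu ?m (par (rho 1 p)) (?t 0 p)"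
     by (simp add: parn_def to_End_def mu_mat)
    moreover have "par (rho 1 p) = - rho 1 p"
     using fdeg_par[of 1 "rho 1 p"] rho1 unfolding form_degree_fdeg by simp
    ultimately show ?thesis by (simp add: mu_linear[OF m])
   qed
   have "mm r' r' 1 p - mm ?t ?t 1 p = smulC (\<i> / 2) (?B (rho 0 p) (r' 0 p) + ?B (?t 0 p) (rho 0 p))
     + mu ?m (rho 0 p) (r' 1 p) + mu ?m (r' 1 p) (rho 0 p) + (mu ?m (?t 0 p) (rho 1 p) + mu ?m (rho 1 p) (?t 0 p))"
   proof -
    have "?B (r' 0 p) (r' 0 p) = ?B (?t 0 p) (?t 0 p) + ?B (?t 0 p) (rho 0 p) + ?B (rho 0 p) (r' 0 p)"
     by (simp only: r'0[of 0] Bn_linear(1)[OF m, of _ _ "?t 0 p" "rho 0 p" "?t 0 p + rho 0 p"] Bn_linear(2)[OF m, of _ _ "?t 0 p" "?t 0 p" "rho 0 p"])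
    then have 1: "?B (r' 0 p) (r' 0 p) - ?B (?t 0 p) (?t 0 p) = ?B (rho 0 p) (r' 0 p) + ?B (?t 0 p) (rho 0 p)"
     by (simp only: group_three)
    have "mu ?m (r' 0 p) (r' 1 p) = mu ?m (?t 0 p) (?t 1 p) + mu ?m (?t 0 p) (rho 1 p) + mu ?m (rho 0 p) (r' 1 p)"
     by (simp only: r'0[of 0] r'0[of 1] mu_linear(1)[OF m, of "?t 0 p" "rho 0 p" "?t 1 p + rho 1 p"] mu_linear(2)[OF m, of "?t 0 p" "?t 1 p" "rho 1 p"])
    then have 2: "mu ?m (r' 0 p) (r' 1 p) - mu ?m (?t 0 p) (?t 1 p) = mu ?m (rho 0 p) (r' 1 p) + mu ?m (?t 0 p) (rho 1 p)"
     by (simp only: group_three)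
    have "mu ?m (r' 1 p) (r' 0 p) = mu ?m (?t 1 p) (?t 0 p) + mu ?m (rho 1 p) (?t 0 p) + mu ?m (r' 1 p) (rho 0 p)"
     by (simp only: r'0[of 0] r'0[of 1] mu_linear(2)[OF m, of "?t 1 p + rho 1 p" "?t 0 p" "rho 0 p"] mu_linear(1)[OF m, of "?t 1 p" "rho 1 p" "?t 0 p"])
    then have 3: "mu ?m (r' 1 p) (r' 0 p) - mu ?m (?t 1 p) (?t 0 p) = mu ?m (r' 1 p) (rho 0 p) + mu ?m (rho 1 p) (?t 0 p)"
     by (simp only: group_three)
    show ?thesis
     unfolding wprod_one[OF m lb_r' lb_r'] wprod_one[OF m lt lt] group_diff3 1 2 3 smulC_diff_right[symmetric] group_swap3 ..
   qed
   \<comment> \<open>At order zero in lambda total degree at least 3 means symmetric degree at least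
     3, so the contraction leaves at least s + 3 - 2.\<close>
   moreover have "fsupp (%a b. s \<le> a) (?B (rho 0 p) (r' 0 p))"
    using r'_facts(3) by (intro fsupp_Bn[OF m IH, where Q="%a b. 3 \<le> a"]) (auto simp: fsupp_def total_degree_ge_def)
   moreover have "fsupp (%a b. s \<le> a) (?B (?t 0 p) (rho 0 p))"
    using t3 by (intro fsupp_Bn[OF m _ IH, where P="%a b. 3 \<le> a"]) (auto simp: fsupp_def total_degree_ge_def)
   moreover have "fsupp (%a b. s \<le> a) (mu ?m (rho 0 p) (r' 1 p))"
    by (rule fsupp_mu[OF m IH, where Q="%a b. True"]) (auto simp: fsupp_def)
   moreover have "fsupp (%a b. s \<le> a) (mu ?m (r' 1 p) (rho 0 p))"
    by (rule fsupp_mu[OF m _ IH, where P="%a b. True"]) (auto simp: fsupp_def)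
   ultimately show ?thesis unfolding c by (simp only: fsupp_linear)
  qed
  have "wsupp (?Q s) (delta rho)"
  proof (rule wsuppI)
   fix k p
   show "fsupp (?Q s k) (delta rho k p)"
   proof (cases "k = 0")
    case True
    have "fsupp (%a b. s \<le> a) (delta rho 0 p)" unfolding drho by (intro fsupp_linear D X)
    then show ?thesis using True by simp
   qed (simp add: fsupp_def)
  qed
  then show ?case by (subst hod) (erule wsupp_delta_inv, simp)
 qed
 then have "rho 0 p ys vs = 0" for ys vs
  using fsuppD[OF wsuppD, of "?Q (Suc (length ys))" rho 0 ys vs p] by simp
 then show ?thesis by (simp add: fun_eq_iff fun_ops)
qed

lemma r'_zero: "r' 0 p = to_End r 0 p"
 using rho_zero[of p] by (simp add: rho_def wform_ops)

section \<open>The derivative as a perturbation of the Koszul differential\<close>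

definition YY :: "('m, 'n, complex ^ 'k) wform => ('m, 'n, complex ^ 'k) wform"
 where "YY \<Psi> = lm r' \<Psi> - rm (parity \<Psi>) r"

definition KK :: "('m, 'n, complex ^ 'k) wform => ('m, 'n, complex ^ 'k) wform"
 where "KK \<Psi> = D_E G \<Psi> + i_over_lambda (YY \<Psi>)"

text \<open>\<open>r_E\<close> is \<open>r' - to_End r\<close> divided by lambda up to the factor
  \<i>, so adding its left multiplication to the super-commutator just replaces the left factor
  \<open>r\<close> by \<open>r'\<close>.\<close>

lemma Fed_E_eq:
 assumes l: "lb 0 \<Psi>" shows "Fed_E G r r' \<Psi> = - delta \<Psi> + D_E G \<Psi> + i_over_lambda (YY \<Psi>)"
proof -
 have "lm (r_E r r') \<Psi> = i_over_lambda (lm r' \<Psi> - lm (to_End r) \<Psi>)"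
  using wprod_i_over_lambda(1)[OF cb(1) lb_rho l] wprod_diff(1)[OF cb(1) lb_r' to_End_lb[OF lb_r] l l]
  by (simp add: r_E_def rho_def)
 then show ?thesis
  by (simp add: Fed_E_def ad_E_def lmult_E_def rmult_E_def YY_def i_over_lambda_linear)
qed

lemma Fed_KK: "lb 0 \<Psi> ==> Fed_E G r r' \<Psi> = KK \<Psi> - delta \<Psi>"
 by (simp add: Fed_E_eq KK_def)

lemma weyl_E_WF: "\<Psi> \<in> weyl_E G \<longleftrightarrow> \<Psi> \<in> E.WF"
 by (simp add: weyl_E_def)

lemmas WF_lm = E.WF_wprod[OF pairing_mv modsm(3,1)]
lemmas WF_rm = E.WF_wprod[OF pairing_sc modsm(1,2)]
lemmas D_lm = E.cov_D_wprod[OF pairing_mv modsm(3,1) _ _ conn_End_zero E.nabF_zero]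
lemmas D_rm = E.cov_D_wprod[OF pairing_sc modsm(1,2) _ _ E.nabF_zero tangent_deriv_zero]

lemma lb_D: "lb 0 \<Psi> ==> lb 0 (D_E G \<Psi>)" "lb 0 a ==> lb 0 (D_End G a)" "lb 0 b ==> lb 0 (D_W G b)"
 unfolding D_E_def D_End_def D_W_def
 by (rule E.cov_D_lb; (rule E.nabF_zero conn_End_zero tangent_deriv_zero | assumption))+

text \<open>Division by lambda is harmless because at order zero \<open>r'\<close> is scalar and
  equal to \<open>r\<close>, and a scalar one-form graded-commutes with the section.\<close>

lemma WF_YY:
 assumes W: "\<Psi> \<in> E.WF" shows "YY \<Psi> \<in> E.WF" "i_over_lambda (YY \<Psi>) \<in> E.WF"
proof -
 note l = E.WF_D(1)[OF W]
 show Y: "YY \<Psi> \<in> E.WF"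
  unfolding YY_def by (rule E.WF_ops(2)[OF WF_lm[OF r'_facts(1) W] WF_rm[OF E.WF_ops(5)[OF W] r_facts(1)]])
 have "YY \<Psi> 0 p = 0" for p
 proof -
  have "fdeg 1 (r 0 p)" using r_facts(2) unfolding form_degree_fdeg by blast
  from mu_comm[OF cbilin_sc this, of "\<Psi> 0 p"]
  have "mu (%c s. c *\<^sub>c s) (r 0 p) (\<Psi> 0 p) = mu (%s c. c *\<^sub>c s) (par (\<Psi> 0 p)) (r 0 p)" by (simp add: parn_def)
  then show ?thesis
   by (simp add: YY_def wform_ops wprod_zero_order[OF cb(1) lb_r' l] wprod_zero_order[OF cb(2) lb_ops(7)[OF l] lb_r]
     r'_zero parity_fib to_End_def mu_mat)
 qed
 then have "lb 0 (lambda_shift (- 1) (YY \<Psi>))"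
 proof (intro lb_fibI)
  fix k :: int and p assume "k < 0"
  then show "lambda_shift (- 1) (YY \<Psi>) k p = 0"
   using lbD_fib[OF E.WF_D(1)[OF Y], of "k + 1" p] \<open>!!p. YY \<Psi> 0 p = 0\<close>[of p]
   by (cases "k = - 1") (auto simp: lambda_shift_def)
 qed
 from E.WF_ops(4)[OF E.WF_ops(6)[OF Y this]] show "i_over_lambda (YY \<Psi>) \<in> E.WF" .
qed

lemma WF_KK: "\<Psi> \<in> E.WF ==> KK \<Psi> \<in> E.WF"
 unfolding KK_def D_E_def by (intro E.WF_ops(1) E.WF_cov_D WF_YY)

lemma WF_Fed: "\<Psi> \<in> E.WF ==> Fed_E G r r' \<Psi> \<in> E.WF"
 by (simp add: Fed_KK E.WF_D E.WF_ops(2) WF_KK E.WF_delta)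

lemma YY_linear:
 assumes l: "lb N \<Phi>" "lb N \<Psi>" "N \<le> 0"
 shows "YY (\<Phi> + \<Psi>) = YY \<Phi> + YY \<Psi>" "YY (\<Phi> - \<Psi>) = YY \<Phi> - YY \<Psi>" "YY (cscale c \<Psi>) = cscale c (YY \<Psi>)"
  "YY (lambda_shift n \<Psi>) = lambda_shift n (YY \<Psi>)"
proof -
 have r: "lb N r" "lb N r'" using lb_r lb_r' l(3) by (auto intro: lb_mono)
 note p = lb_ops(7)[OF l(1)] lb_ops(7)[OF l(2)]
 show "YY (\<Phi> + \<Psi>) = YY \<Phi> + YY \<Psi>"
  unfolding YY_def parity_linear wprod_add(2)[OF cb(1) r(2) r(2) l(1,2)] wprod_add(1)[OF cb(2) p r(1) r(1)] by simp
 show "YY (\<Phi> - \<Psi>) = YY \<Phi> - YY \<Psi>"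
  unfolding YY_def parity_linear wprod_diff(2)[OF cb(1) r(2) r(2) l(1,2)] wprod_diff(1)[OF cb(2) p r(1) r(1)] by simp
 show "YY (cscale c \<Psi>) = cscale c (YY \<Psi>)"
  unfolding YY_def parity_linear wprod_cscale(2)[OF cb(1) r(2) l(2)] wprod_cscale(1)[OF cb(2) p(2) r(1)] cscale_add ..
 show "YY (lambda_shift n \<Psi>) = lambda_shift n (YY \<Psi>)"
  unfolding YY_def parity_linear wprod_shift(2)[OF cb(1) r(2) l(2)] wprod_shift(1)[OF cb(2) p(2) r(1)] lambda_shift_add ..
qed

lemma form_degree_KK:
 assumes l: "lb 0 \<Psi>" and f: "form_degree d \<Psi>" shows "form_degree (Suc d) (KK \<Psi>)"
 unfolding wsupp_conv KK_def
proof (rule wsupp_linear(1))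
 note f' = f[unfolded wsupp_conv]
 show "wsupp (%k a b. b = Suc d) (D_E G \<Psi>)"
  unfolding D_E_def by (rule wsupp_cov_D[where nabg="connE G", OF E.nabF_zero f']) simp
 have "wsupp (%k a b. b = Suc d) (YY \<Psi>)"
  unfolding YY_def
  by (rule wsupp_linear(2)[OF wsupp_wprod[OF cb(1) lb_r' l r'_facts(2)[unfolded wsupp_conv] f']
   wsupp_wprod[OF cb(2) lb_ops(7)[OF l] lb_r wsupp_linear(6)[OF f'] r_facts(2)[unfolded wsupp_conv]]]) auto
 from wsupp_linear(4)[OF wsupp_shift[OF this, where R="%k a b. b = Suc d"]]
 show "wsupp (%k a b. b = Suc d) (i_over_lambda (YY \<Psi>))" by simp
qed

lemma total_degree_KK:
 assumes l: "lb 0 \<Psi>" and f: "total_degree_ge d \<Psi>" shows "total_degree_ge d (KK \<Psi>)"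
 unfolding wsupp_conv KK_def
proof (rule wsupp_linear(1))
 note f' = f[unfolded wsupp_conv]
 show "wsupp (%k a b. int d \<le> 2 * k + int a) (D_E G \<Psi>)"
  unfolding D_E_def by (rule wsupp_cov_D[where nabg="connE G", OF E.nabF_zero f']) simp
 \<comment> \<open>The elements \<open>r\<close> and \<open>r'\<close> contribute at least 3 and the
   division by lambda costs 2, so the degree bound survives.\<close>
 have "wsupp (%k a b. int d + 3 \<le> 2 * k + int a) (YY \<Psi>)"
  unfolding YY_def
  by (rule wsupp_linear(2)[OF wsupp_wprod[OF cb(1) lb_r' l r'_facts(3)[unfolded wsupp_conv] f']
   wsupp_wprod[OF cb(2) lb_ops(7)[OF l] lb_r wsupp_linear(6)[OF f'] r_facts(3)[unfolded wsupp_conv]]]) auto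
 then have "wsupp (%k a b. int d \<le> 2 * k + int a) (lambda_shift (- 1) (YY \<Psi>))"
  by (rule wsupp_shift) simp
 then show "wsupp (%k a b. int d \<le> 2 * k + int a) (i_over_lambda (YY \<Psi>))" by (rule wsupp_linear(4))
qed

lemma form_degree_Fed: "lb 0 \<Psi> ==> form_degree d \<Psi> ==> form_degree (Suc d) (Fed_E G r r' \<Psi>)"
proof -
 assume l: "lb 0 \<Psi>" and f: "form_degree d \<Psi>"
 have "form_degree (Suc d) (delta \<Psi>)"
  using f unfolding wsupp_conv by (rule wsupp_delta) simp
 with form_degree_KK[OF l f] show ?thesis unfolding Fed_KK[OF l] wsupp_conv by (intro wsupp_linear)
qed

lemma assoc:
 assumes "lb 0 a" "lb 0 a'" "lb 0 \<Psi>" "lb 0 b" "lb 0 b'"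
  "!!k p. sym2 (a k p)" "!!k p. sym2 (a' k p)" "!!k p. sym2 (\<Psi> k p)" "!!k p. sym2 (b k p)" "!!k p. sym2 (b' k p)"
 shows "lm a (lm a' \<Psi>) = lm (mm a a') \<Psi>" "rm (lm a \<Psi>) b = lm a (rm \<Psi> b)" "rm (rm \<Psi> b) b' = rm \<Psi> (ww b b')"
proof -
 show "lm a (lm a' \<Psi>) = lm (mm a a') \<Psi>"
  by (rule wprod_assoc[OF cb(1) cb(3) cb(1) cb(1), symmetric]) (simp_all add: assms matrix_vector_mul_assoc)
 show "rm (lm a \<Psi>) b = lm a (rm \<Psi> b)"
  by (rule wprod_assoc[OF cb(2) cb(1) cb(1) cb(2)]) (simp_all add: assms cbilinD[OF cb(1)])
 show "rm (rm \<Psi> b) b' = rm \<Psi> (ww b b')"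
  by (rule wprod_assoc[OF cb(2) cb(2) cb(2) cb(4)]) (simp_all add: assms scaleC_scaleC mult.commute)
qed

lemma sym2_parity: "(!!k p. sym2 (\<Psi> k p)) ==> sym2 (parity \<Psi> k p)" for \<Psi> :: "('m, 'n, 'f::complex_fibre) wform"
 unfolding parity_fib by (rule sym2_par)

text \<open>All three parts obey the rule separately. For \<open>YY\<close> the term of
  \<open>parity a\<close>, \<open>r'\<close> and the section is added and subtracted; associativity
  then groups one copy with the super-commutator and the other with \<open>YY\<close> of the
  section.\<close>

lemma Fed_lmult:
 assumes a: "a \<in> weyl_forms (atlas G) endo" and W: "\<Psi> \<in> E.WF" and d: "form_degree d a"
 shows "Fed_E G r r' (lm a \<Psi>) = lm (Fed_End G r' a) \<Psi> + cscale ((- 1) ^ d) (lm a (Fed_E G r r' \<Psi>))"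
proof -
 note la = weyl_formsD(1)[OF a] and sa = wfib_sym2[OF weyl_formsD(2)[OF a]] and l = E.WF_D(1)[OF W] and s = E.WF_D(3)[OF W]
 note lp = lb_ops(7)[OF la] lb_ops(7)[OF l] and sp = sym2_parity[of a, OF sa] sym2_parity[of \<Psi>, OF s]
 note as = assoc[OF _ _ _ lb_r lb_r _ _ _ sym_r sym_r]
 have YY: "YY (lm a \<Psi>) = lm (mm r' a - mm (parity a) r') \<Psi> + lm (parity a) (YY \<Psi>)"
  unfolding YY_def parity_wprod[OF cb(1) la l]
   wprod_diff(1)[OF cb(1) wprod_lb[OF cb(3) lb_r' la] wprod_lb[OF cb(3) lp(1) lb_r'] l l]
   wprod_diff(2)[OF cb(1) lp(1) lp(1) wprod_lb[OF cb(1) lb_r' l] wprod_lb[OF cb(2) lp(2) lb_r]]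
   as(1)[OF lb_r' la l sym_r' sa s] as(1)[OF lp(1) lb_r' l sp(1) sym_r' s] as(2)[OF lp(1) lp(1) lp(2) sp(1) sp(1) sp(2)] by simp
 have p: "parity a = cscale ((- 1) ^ d) a" by (rule parity_form_degree[OF d])
 have lk: "lb (- 1) a" "lb (- 1) (Fed_E G r r' \<Psi>)" using la E.WF_D(1)[OF WF_Fed[OF W]] by (auto intro: lb_mono)
 have 1: "cscale ((- 1) ^ d) (lm a (Fed_E G r r' \<Psi>)) = - lm (parity a) (delta \<Psi>) + lm (parity a) (D_E G \<Psi>) + i_over_lambda (lm (parity a) (YY \<Psi>))"
  unfolding p wprod_cscale(1)[OF cb(1) lk, symmetric] unfolding p[symmetric] Fed_E_eq[OF l]
  by (rule wprod_Fed_right[OF cb(1) lb_ops(6)[OF l] lb_D(1)[OF l] E.WF_D(1)[OF WF_YY(1)[OF W]] lp(1)])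
 have lad: "lb 0 (mm r' a - mm (parity a) r')" by (rule lb_ops(2)[OF wprod_lb[OF cb(3) lb_r' la] wprod_lb[OF cb(3) lp(1) lb_r']])
 have 2: "lm (Fed_End G r' a) \<Psi> = - lm (delta a) \<Psi> + lm (D_End G a) \<Psi> + i_over_lambda (lm (mm r' a - mm (parity a) r') \<Psi>)"
  unfolding Fed_End_def ad_End_def prod_End_def
  by (rule wprod_Fed[OF cb(1) lb_ops(6)[OF la] lb_D(2)[OF la] lad l])
 have D: "D_E G (lm a \<Psi>) = lm (D_End G a) \<Psi> + lm (parity a) (D_E G \<Psi>)"
  unfolding D_E_def D_End_def by (rule D_lm[OF a W])
 show ?thesis
  unfolding Fed_E_eq[OF wprod_lb[OF cb(1) la l]] delta_wprod[OF cb(1) la l sa s] D YY i_over_lambda_linear 1 2 by simp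
qed

text \<open>The intermediate term is now the product of the parity of the section, \<open>r\<close>
  and \<open>b\<close>, so the super-commutator of \<open>b\<close> is formed with
  \<open>r\<close>.\<close>

lemma Fed_rmult:
 assumes b: "b \<in> weyl_forms (atlas G) sfun" and W: "\<Psi> \<in> E.WF" and d: "form_degree d \<Psi>"
 shows "Fed_E G r r' (rm \<Psi> b) = rm (Fed_E G r r' \<Psi>) b + cscale ((- 1) ^ d) (rm \<Psi> (Fed_W G r b))"
proof -
 note lb = weyl_formsD(1)[OF b] and sb = wfib_sym2[OF weyl_formsD(2)[OF b]] and l = E.WF_D(1)[OF W] and s = E.WF_D(3)[OF W]
 note lp = lb_ops(7)[OF lb] lb_ops(7)[OF l] and sp = sym2_parity[of b, OF sb] sym2_parity[of \<Psi>, OF s]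
 note as = assoc[OF lb_r' lb_r' _ _ _ sym_r' sym_r']
 have YY: "YY (rm \<Psi> b) = rm (YY \<Psi>) b + rm (parity \<Psi>) (ww r b - ww (parity b) r)"
  unfolding YY_def parity_wprod[OF cb(2) l lb]
   wprod_diff(2)[OF cb(2) lp(2) lp(2) wprod_lb[OF cb(4) lb_r lb] wprod_lb[OF cb(4) lp(1) lb_r]]
   wprod_diff(1)[OF cb(2) wprod_lb[OF cb(1) lb_r' l] wprod_lb[OF cb(2) lp(2) lb_r] lb lb]
   as(2)[OF l lb lb s sb sb] as(3)[OF lp(2) lb_r lb sp(2) sym_r sb] as(3)[OF lp(2) lp(1) lb_r sp(2) sp(1) sym_r] by simp
 have p: "parity \<Psi> = cscale ((- 1) ^ d) \<Psi>" by (rule parity_form_degree[OF d])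
 have lad: "lb 0 (ww r b - ww (parity b) r)" by (rule lb_ops(2)[OF wprod_lb[OF cb(4) lb_r lb] wprod_lb[OF cb(4) lp(1) lb_r]])
 have lk: "lb (- 1) \<Psi>" "lb (- 1) (Fed_W G r b)"
  using l by (auto intro: lb_mono) (unfold Fed_W_def ad_W_def prod_W_def,
   intro lb_ops(1) lb_ops(3) lb_i_over_lambda lad; rule lb_mono[of 0], intro lb_ops(6) lb_D(3) lb, simp)
 have 1: "cscale ((- 1) ^ d) (rm \<Psi> (Fed_W G r b)) = - rm (parity \<Psi>) (delta b) + rm (parity \<Psi>) (D_W G b) + i_over_lambda (rm (parity \<Psi>) (ww r b - ww (parity b) r))"
  unfolding p wprod_cscale(1)[OF cb(2) lk, symmetric] unfolding p[symmetric] Fed_W_def ad_W_def prod_W_def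
  by (rule wprod_Fed_right[OF cb(2) lb_ops(6)[OF lb] lb_D(3)[OF lb] lad lp(2)])
 have 2: "rm (Fed_E G r r' \<Psi>) b = - rm (delta \<Psi>) b + rm (D_E G \<Psi>) b + i_over_lambda (rm (YY \<Psi>) b)"
  unfolding Fed_E_eq[OF l]
  by (rule wprod_Fed[OF cb(2) lb_ops(6)[OF l] lb_D(1)[OF l] E.WF_D(1)[OF WF_YY(1)[OF W]] lb])
 have D: "D_E G (rm \<Psi> b) = rm (D_E G \<Psi>) b + rm (parity \<Psi>) (D_W G b)"
  unfolding D_E_def D_W_def by (rule D_rm[OF W b])
 show ?thesis
  unfolding Fed_E_eq[OF wprod_lb[OF cb(2) l lb]] delta_wprod[OF cb(2) l lb s sb] D YY i_over_lambda_linear 1 2 by simp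
qed

lemma cov_D_i_over_lambda:
 assumes W: "\<Psi> \<in> E.WF" shows "D_E G (i_over_lambda \<Psi>) = i_over_lambda (D_E G \<Psi>)"
 by (simp only: lambda_shift_add(5)[symmetric] D_E_def E.cov_D_shift E.cov_D_ops(3)[OF W])

text \<open>Since \<open>delta\<close> squares to zero and anticommutes with the covariant
  derivative, what remains is the square of the latter plus terms linear in the left action of the
  curvature expression of \<open>r'\<close> and the right action of that of \<open>r\<close>. The
  Fedosov equations evaluate these two expressions.\<close>

lemma Fed_Fed:
 assumes W: "\<Psi> \<in> E.WF" shows "Fed_E G r r' (Fed_E G r r' \<Psi>) = 0"
proof -
 let ?X = "Fed_E G r r' \<Psi>" and ?D = "D_E G" and ?J = "i_over_lambda :: ('m, 'n, complex ^ 'k) wform => _" and ?P = "parity \<Psi>"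
 note l = E.WF_D(1)[OF W] and s = E.WF_D(3)[OF W] and WP = E.WF_ops(5)[OF W]
 note lP = E.WF_D(1)[OF WP] and sP = E.WF_D(3)[OF WP]
 note lX = E.WF_D(1)[OF WF_Fed[OF W]] and Y = WF_YY(1)[OF W]
 have WD: "\<Phi> \<in> E.WF ==> ?D \<Phi> \<in> E.WF" for \<Phi> unfolding D_E_def by (rule E.WF_cov_D)
 have addD: "?D (\<Phi> + \<Phi>') = ?D \<Phi> + ?D \<Phi>'" if "\<Phi> \<in> E.WF" "\<Phi>' \<in> E.WF" for \<Phi> \<Phi>'
  unfolding D_E_def by (rule E.cov_D_ops(1)[OF that])
 have negD: "?D (- \<Phi>) = - ?D \<Phi>" if "\<Phi> \<in> E.WF" for \<Phi>
  unfolding D_E_def by (rule E.cov_D_ops(2)[OF that])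
 note ldl = lb_ops(6)[OF l] and lD = lb_D(1)[OF l] and lY = E.WF_D(1)[OF Y]
 note lPdl = lb_ops(7)[OF ldl] and lPD = lb_ops(7)[OF lD] and lPY = lb_ops(7)[OF lY]
 have dX: "delta ?X = delta (?D \<Psi>) + ?J (delta (YY \<Psi>))"
  unfolding Fed_E_eq[OF l] by (simp only: delta_linear delta_delta[OF s]) simp
 have DX: "?D ?X = - ?D (delta \<Psi>) + ?D (?D \<Psi>) + ?J (?D (YY \<Psi>))"
 proof -
  have "?D ?X = ?D (- delta \<Psi> + ?D \<Psi>) + ?D (?J (YY \<Psi>))"
   unfolding Fed_E_eq[OF l] by (rule addD[OF E.WF_ops(1)[OF E.WF_ops(3)[OF E.WF_delta[OF W]] WD[OF W]] WF_YY(2)[OF W]])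
  also have "?D (- delta \<Psi> + ?D \<Psi>) = ?D (- delta \<Psi>) + ?D (?D \<Psi>)"
   by (rule addD[OF E.WF_ops(3)[OF E.WF_delta[OF W]] WD[OF W]])
  also have "?D (- delta \<Psi>) = - ?D (delta \<Psi>)"
   by (rule negD[OF E.WF_delta[OF W]])
  finally show ?thesis by (simp only: cov_D_i_over_lambda[OF Y])
 qed
 have YX: "YY ?X = (- lm r' (delta \<Psi>) + lm r' (?D \<Psi>) + ?J (lm r' (YY \<Psi>))) - (- rm (parity (delta \<Psi>)) r + rm (parity (?D \<Psi>)) r + ?J (rm (parity (YY \<Psi>)) r))"
  unfolding YY_def[of ?X] unfolding Fed_E_eq[OF l] parity_linear
  by (simp only: wprod_Fed_right[OF cb(1) ldl lD lY lb_r'] wprod_Fed[OF cb(2) lPdl lPD lPY lb_r])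
 have dY: "delta (YY \<Psi>) = lm (delta r') \<Psi> + lm (parity r') (delta \<Psi>) - (rm (delta ?P) r + rm \<Psi> (delta r))"
  unfolding YY_def delta_linear delta_wprod[OF cb(1) lb_r' l sym_r' s] delta_wprod[OF cb(2) lP lb_r sP sym_r] parity_linear ..
 have DY: "?D (YY \<Psi>) = lm (D_End G r') \<Psi> + lm (parity r') (?D \<Psi>) - (rm (?D ?P) r + rm \<Psi> (D_W G r))"
 proof -
  have "?D (YY \<Psi>) = ?D (lm r' \<Psi> + - rm ?P r)" by (simp add: YY_def)
  also have "\<dots> = ?D (lm r' \<Psi>) + ?D (- rm ?P r)"
   by (rule addD[OF WF_lm[OF r'_facts(1) W] E.WF_ops(3)[OF WF_rm[OF WP r_facts(1)]]])
  also have "?D (- rm ?P r) = - ?D (rm ?P r)"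
   by (rule negD[OF WF_rm[OF WP r_facts(1)]])
  also have "?D (lm r' \<Psi>) = lm (D_End G r') \<Psi> + lm (parity r') (?D \<Psi>)"
   unfolding D_E_def D_End_def by (rule D_lm[OF r'_facts(1) W])
  also have "?D (rm ?P r) = rm (?D ?P) r + rm (parity ?P) (D_W G r)"
   unfolding D_E_def D_W_def by (rule D_rm[OF WP r_facts(1)])
  finally show ?thesis by (simp add: parity_linear)
 qed
 have pr: "parity r' = - r'" "parity r = - r"
  using parity_form_degree[OF r'_facts(2)] parity_form_degree[OF r_facts(2)] by (simp_all add: cscale_neg_one)
 have dP: "delta ?P = - parity (delta \<Psi>)" by (rule delta_linear)
 have DP: "?D ?P = - parity (?D \<Psi>)" unfolding D_E_def by (rule E.cov_D_ops(4)[OF W])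
 have pY: "parity (YY \<Psi>) = - lm r' ?P + rm \<Psi> r"
  unfolding YY_def parity_linear parity_wprod[OF cb(1) lb_r' l] parity_wprod[OF cb(2) lP lb_r] pr
   wprod_neg(1)[OF cb(1) lb_r' lP] wprod_neg(2)[OF cb(2) l lb_r] by simp
 note as = assoc[OF lb_r' lb_r' _ lb_r lb_r sym_r' sym_r' _ sym_r sym_r]
 have rY: "lm r' (YY \<Psi>) - rm (parity (YY \<Psi>)) r = lm (mm r' r') \<Psi> - rm \<Psi> (ww r r)"
  unfolding pY wprod_add(1)[OF cb(2) lb_ops(3)[OF wprod_lb[OF cb(1) lb_r' lP]] wprod_lb[OF cb(2) l lb_r] lb_r lb_r]
   wprod_neg(1)[OF cb(2) wprod_lb[OF cb(1) lb_r' lP] lb_r]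
  unfolding YY_def wprod_diff(2)[OF cb(1) lb_r' lb_r' wprod_lb[OF cb(1) lb_r' l] wprod_lb[OF cb(2) lP lb_r]]
   as(1)[OF l s] as(3)[OF l s] as(2)[OF lP sP] by simp
 have neg: "lm (- r') \<Phi> = - lm r' \<Phi>" if "lb 0 \<Phi>" for \<Phi> by (rule wprod_neg(1)[OF cb(1) lb_r' that])
 have neg2: "rm (- \<Phi>) r = - rm \<Phi> r" if "lb 0 \<Phi>" for \<Phi> by (rule wprod_neg(1)[OF cb(2) that lb_r])
 let ?E' = "- lm (delta r') \<Psi> + lm (D_End G r') \<Psi> + ?J (lm (mm r' r') \<Psi>)"
 let ?E = "- rm \<Psi> (delta r) + rm \<Psi> (D_W G r) + ?J (rm \<Psi> (ww r r))"
 have dD: "delta (?D \<Psi>) = - ?D (delta \<Psi>)"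
  using E.delta_cov_D[OF W] unfolding D_E_def by (simp add: eq_neg_iff_add_eq_0)
 have "Fed_E G r r' ?X = ?D (?D \<Psi>) + ?J (?E' - ?E)"
 proof -
  have "- delta (YY \<Psi>) + ?D (YY \<Psi>) + YY ?X = ?E' - ?E"
  proof -
   have "?J (lm r' (YY \<Psi>)) - ?J (rm (parity (YY \<Psi>)) r) = ?J (lm (mm r' r') \<Psi>) - ?J (rm \<Psi> (ww r r))"
    unfolding i_over_lambda_linear(2)[symmetric] rY ..
   then show ?thesis
    unfolding dY DY YX pr dP DP neg[OF ldl] neg[OF lD] neg2[OF lPdl] neg2[OF lPD] by (rule group_square)
  qed
  from arg_cong[OF this, of ?J] show ?thesis
   unfolding Fed_E_eq[OF lX] dX DX dD group_square' by (simp only: i_over_lambda_linear)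
 qed
 moreover have "?J (?E' - ?E) = - ?D (?D \<Psi>)"
 proof -
  have lR: "lb 0 (to_End (curv_R G) :: ('m, 'n, complex ^ 'k ^ 'k) wform)" and lO: "lb 0 (to_End Om :: ('m, 'n, complex ^ 'k ^ 'k) wform)"
   by (rule to_End_lb[OF lb_R] to_End_lb[OF lb_Om])+
  have e': "- delta r' + D_End G r' + i_over_lambda (mm r' r') = - to_End (curv_R G) - to_End Om + cscale \<i> (lambda_shift 1 (curv_RE G))"
   unfolding r'_facts(4) by simp
  have e: "- delta r + D_W G r + i_over_lambda (ww r r) = - curv_R G - Om"
   unfolding r_facts(4) by simp
  have lRE: "lb 0 (lambda_shift 1 (curv_RE G))" using lb_mono[OF lb_ops(8)[OF lb_RE, of 1]] by simp
  have 1: "?E' = - lm (to_End (curv_R G)) \<Psi> - lm (to_End Om) \<Psi> + cscale \<i> (lambda_shift 1 (lm (curv_RE G) \<Psi>))"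
   unfolding wprod_Fed[OF cb(1) lb_ops(6)[OF lb_r'] lb_D(2)[OF lb_r'] wprod_lb[OF cb(3) lb_r' lb_r'] l, symmetric] e'
    wprod_add(1)[OF cb(1) lb_ops(2)[OF lb_ops(3)[OF lR] lO] lb_ops(5)[OF lRE] l l]
    wprod_diff(1)[OF cb(1) lb_ops(3)[OF lR] lO l l] wprod_neg(1)[OF cb(1) lR l] wprod_cscale(1)[OF cb(1) lRE l] wprod_shift(1)[OF cb(1) lb_RE l] ..
  have 2: "?E = - rm \<Psi> (curv_R G) - rm \<Psi> Om"
   unfolding wprod_Fed_right[OF cb(2) lb_ops(6)[OF lb_r] lb_D(3)[OF lb_r] wprod_lb[OF cb(4) lb_r lb_r] l, symmetric] e
    wprod_diff(2)[OF cb(2) l l lb_ops(3)[OF lb_R] lb_Om] wprod_neg(2)[OF cb(2) l lb_R] ..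
  have 4: "lm (to_End X) \<Psi> = wprod (sympl G) (%c s. c *\<^sub>c s) X \<Psi>" for X
   by (rule wprod_to_End) (rule mat_mv)
  \<comment> \<open>The formal two-form is scalar, even and without symmetric degree, hence central:
    its left action through \<open>r'\<close> and its right action through \<open>r\<close>
    cancel.\<close>
  have 3: "lm (to_End Om) \<Psi> = rm \<Psi> Om"
   unfolding 4
   by (rule wprod_comm_form[OF cbilin_sc lb_Om l]) (auto simp: wsupp_def fsupp_def Omega_form_def)
  \<comment> \<open>The factor \<i> lambda in front of the curvature of \<open>E\<close> meets \<i>
    / lambda, and their product is -1.\<close>
  have 5: "?J (cscale \<i> (lambda_shift 1 \<Phi>)) = - \<Phi>" for \<Phi>
   by (simp add: lambda_shift_add lambda_shift_shift cscale_cscale cscale_neg_one)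
  have J2: "?J (- X + C) = - ?J X + ?J C" for X C by (simp only: i_over_lambda_linear)
  have EE: "?E' - ?E = - (lm (to_End (curv_R G)) \<Psi> - rm \<Psi> (curv_R G)) + cscale \<i> (lambda_shift 1 (lm (curv_RE G) \<Psi>))"
   unfolding 1 2 3 by simp
  have "?J (?E' - ?E) = - ?J (lm (to_End (curv_R G)) \<Psi> - rm \<Psi> (curv_R G)) + - lm (curv_RE G) \<Psi>"
   by (simp only: EE J2 5)
  then show ?thesis
   using D_E_D_E[OF tf, of \<Psi>] W unfolding 4 weyl_E_WF rmult_E_def lmult_E_def by simp
 qed
 ultimately show ?thesis by simp
qed

end

subsection \<open>Flat sections\<close>

lemma sum_flip_atMost: "(\<Sum>i\<le>n. f i (n - i)) = (\<Sum>i\<le>n. f (n - i) i :: 'x::comm_monoid_add)" for n :: nat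
 by (rule sum.reindex_bij_witness[of _ "%i. n - i" "%i. n - i"]) auto

lemma i_over_lambda_sum: "i_over_lambda (\<Sum>i\<in>I. F i) = (\<Sum>i\<in>I. i_over_lambda (F i) :: ('m, 'n::finite, 'f::complex_fibre) wform)"
 by (induction I rule: infinite_finite_induct) (simp_all add: i_over_lambda_linear)

lemma fps_act_fib: "fps_act c \<Psi> k p = (\<Sum>i\<le>nat k. smulC (fps_nth c i) (\<Psi> (k - int i) p))"
 by (intro ext) (simp add: fps_act_def fun_ops smulC_apply)

text \<open>Writes a series as its constant term plus lambda times the shifted series, so that
  linearity over complex numbers and lambda shifts can be used in place of infinite sums.\<close>

lemma fps_act_rec:
 fixes \<Psi> :: "('m, 'n::finite, 'f::complex_fibre) wform"
 assumes l: "lb 0 \<Psi>"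
 shows "fps_act c \<Psi> = cscale (fps_nth c 0) \<Psi> + lambda_shift 1 (fps_act (fps_shift 1 c) \<Psi>)"
proof -
 have "fps_act c \<Psi> k p = smulC (fps_nth c 0) (\<Psi> k p) + fps_act (fps_shift 1 c) \<Psi> (k - 1) p" for k p
 proof (cases "1 \<le> k")
  case True
  then have n: "nat k = Suc (nat (k - 1))" by simp
  show ?thesis
   unfolding fps_act_fib n sum.atMost_Suc_shift by (simp add: algebra_simps)
 next
  case False
  then show ?thesis using lbD_fib[OF l, of "k - 1" p] by (simp add: fps_act_fib)
 qed
 then show ?thesis by (intro ext) (simp add: wform_ops cscale_fib lambda_shift_def)
qed

context fedosov
begin

lemma D_E_linear:
 assumes W: "\<Psi> \<in> E.WF"
 shows "\<Phi> \<in> E.WF ==> D_E G (\<Psi> + \<Phi>) = D_E G \<Psi> + D_E G \<Phi>" "\<Phi> \<in> E.WF ==> D_E G (\<Psi> - \<Phi>) = D_E G \<Psi> - D_E G \<Phi>"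
  "D_E G (cscale c \<Psi>) = cscale c (D_E G \<Psi>)" "D_E G (lambda_shift n \<Psi>) = lambda_shift n (D_E G \<Psi>)"
proof -
 show a: "D_E G (\<Psi> + \<Phi>) = D_E G \<Psi> + D_E G \<Phi>" if "\<Phi> \<in> E.WF" for \<Phi>
  unfolding D_E_def by (rule E.cov_D_ops(1)[OF W that])
 show "D_E G (\<Psi> - \<Phi>) = D_E G \<Psi> - D_E G \<Phi>" if F: "\<Phi> \<in> E.WF"
  using a[OF E.WF_ops(3)[OF F]] E.cov_D_ops(2)[OF F] by (simp add: D_E_def)
 show "D_E G (cscale c \<Psi>) = cscale c (D_E G \<Psi>)" unfolding D_E_def by (rule E.cov_D_ops(3)[OF W])
 show "D_E G (lambda_shift n \<Psi>) = lambda_shift n (D_E G \<Psi>)" unfolding D_E_def by (rule E.cov_D_shift)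
qed

lemma KK_linear:
 assumes W: "\<Psi> \<in> E.WF"
 shows "\<Phi> \<in> E.WF ==> KK (\<Psi> + \<Phi>) = KK \<Psi> + KK \<Phi>" "\<Phi> \<in> E.WF ==> KK (\<Psi> - \<Phi>) = KK \<Psi> - KK \<Phi>"
  "KK (cscale c \<Psi>) = cscale c (KK \<Psi>)" "KK (lambda_shift n \<Psi>) = lambda_shift n (KK \<Psi>)"
proof -
 note l = E.WF_D(1)[OF W]
 show "KK (\<Psi> + \<Phi>) = KK \<Psi> + KK \<Phi>" if F: "\<Phi> \<in> E.WF"
  by (simp add: KK_def D_E_linear(1)[OF W F] YY_linear(1)[OF l E.WF_D(1)[OF F]] i_over_lambda_linear)
 show "KK (\<Psi> - \<Phi>) = KK \<Psi> - KK \<Phi>" if F: "\<Phi> \<in> E.WF"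
  by (simp add: KK_def D_E_linear(2)[OF W F] YY_linear(2)[OF l E.WF_D(1)[OF F]] i_over_lambda_linear)
 show "KK (cscale c \<Psi>) = cscale c (KK \<Psi>)"
  by (simp add: KK_def D_E_linear(3)[OF W] YY_linear(3)[OF l l] lambda_shift_add cscale_add cscale_cscale mult.commute)
 show "KK (lambda_shift n \<Psi>) = lambda_shift n (KK \<Psi>)"
  by (simp add: KK_def D_E_linear(4)[OF W] YY_linear(4)[OF l l] lambda_shift_add lambda_shift_shift add.commute)
qed

lemma flat_iff: "\<Psi> \<in> flat_E G r r' \<longleftrightarrow> \<Psi> \<in> E.WF \<and> form_degree 0 \<Psi> \<and> delta \<Psi> = KK \<Psi>"
proof (cases "\<Psi> \<in> E.WF")
 case True
 then show ?thesis using Fed_KK[OF E.WF_D(1)[OF True]] by (auto simp: flat_E_def weyl_E_WF)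
qed (simp add: flat_E_def weyl_E_WF)

lemma form_degree_linear: "form_degree d \<Psi> ==> form_degree d \<Phi> ==> form_degree d (\<Psi> + \<Phi>)"
 "form_degree d \<Psi> ==> form_degree d \<Phi> ==> form_degree d (\<Psi> - \<Phi>)" for \<Psi> \<Phi> :: "('m, 'n, complex ^ 'k) wform"
 by (simp_all add: form_degree_def fun_ops)

lemma flat_linear:
 assumes "\<Psi> \<in> flat_E G r r'" "\<Phi> \<in> flat_E G r r'"
 shows "\<Psi> + \<Phi> \<in> flat_E G r r'" "\<Psi> - \<Phi> \<in> flat_E G r r'"
 using assms unfolding flat_iff
 by (simp_all add: E.WF_ops form_degree_linear KK_linear delta_linear)

lemma sigma_proj_linear: "sigma_proj (\<Psi> + \<Phi>) = sigma_proj \<Psi> + sigma_proj \<Phi>" "sigma_proj (\<Psi> - \<Phi>) = sigma_proj \<Psi> - sigma_proj \<Phi>"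
 for \<Psi> \<Phi> :: "('m, 'n, complex ^ 'k) wform"
 by (simp_all add: sigma_proj_def fun_eq_iff fun_ops)

lemma WF_fps_act:
 assumes W: "\<Psi> \<in> E.WF" shows "fps_act c \<Psi> \<in> E.WF"
proof (rule E.WF_I)
 show "lb 0 (fps_act c \<Psi>)"
  by (rule lb_fibI) (simp add: fps_act_fib lbD_fib[OF E.WF_D(1)[OF W]])
 show "wfib (fps_act c \<Psi> k p)" for k p
  unfolding fps_act_fib by (intro wfib_sum wfib_smulC E.WF_D(2)[OF W])
 fix ch k assume ch: "ch \<in> atlas G"
 have "frame (atlas G) ch (fps_act c \<Psi>) k = (%q. \<Sum>i\<le>nat k. smulC (fps_nth c i) (frame (atlas G) ch \<Psi> (k - int i) q))"
  by (intro ext[of "frame (atlas G) ch (fps_act c \<Psi>) k"]) (simp add: frame_def fps_act_fib pull_sum pull_linear)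
 then show "E.SF (fst ch) (frame (atlas G) ch (fps_act c \<Psi>) k)"
  by (simp only:) (intro E.SF_sum E.SF_ops(4) open_chart ch E.WF_SF[OF W])
qed

lemma flat_fps_act:
 assumes F: "\<Psi> \<in> flat_E G r r'" shows "fps_act c \<Psi> \<in> flat_E G r r'"
proof -
 have W: "\<Psi> \<in> E.WF" and f: "form_degree 0 \<Psi>" and e: "delta \<Psi> = KK \<Psi>" using F by (auto simp: flat_iff)
 note l = E.WF_D(1)[OF W]
 \<comment> \<open>The defect for \<open>c\<close> is lambda times the defect for the shifted
   series, so it vanishes below every power of lambda.\<close>
 have low: "(KK (fps_act c \<Psi>) - delta (fps_act c \<Psi>)) k p = 0" if "k < int N" for N c k p
  using that
 proof (induction N arbitrary: c k p)
  case 0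
  have "KK (fps_act c \<Psi>) - delta (fps_act c \<Psi>) \<in> E.WF"
   by (intro E.WF_ops(2) WF_KK E.WF_delta WF_fps_act W)
  from lbD_fib[OF E.WF_D(1)[OF this]] 0 show ?case by simp
 next
  case (Suc N)
  let ?c = "fps_shift 1 c"
  note X = WF_fps_act[OF W, of ?c]
  have sX: "lambda_shift 1 (fps_act ?c \<Psi>) \<in> E.WF"
   using E.WF_ops(6)[OF X, of 1] lb_mono[OF lb_ops(8)[OF E.WF_D(1)[OF X], of 1]] by simp
  have "KK (fps_act c \<Psi>) - delta (fps_act c \<Psi>) = lambda_shift 1 (KK (fps_act ?c \<Psi>) - delta (fps_act ?c \<Psi>))"
   unfolding fps_act_rec[OF l, of c] KK_linear(1)[OF E.WF_ops(4)[OF W] sX] KK_linear(3)[OF W] KK_linear(4)[OF X] delta_linear lambda_shift_add e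
   by simp
  then have "(KK (fps_act c \<Psi>) - delta (fps_act c \<Psi>)) k p = (KK (fps_act ?c \<Psi>) - delta (fps_act ?c \<Psi>)) (k - 1) p"
   by (simp only: lambda_shift_def)
  then show ?case using Suc.IH[of "k - 1" ?c p] Suc.prems by simp
 qed
 have z: "(KK (fps_act c \<Psi>) - delta (fps_act c \<Psi>)) k p = 0" for k p
 proof -
  have "k < int (nat k + 1)" by simp
  then show ?thesis by (rule low)
 qed
 have "KK (fps_act c \<Psi>) - delta (fps_act c \<Psi>) = 0" by (intro ext) (simp only: z zero_fun_apply)
 moreover have "form_degree 0 (fps_act c \<Psi>)" using f by (simp add: form_degree_def fps_act_def)
 ultimately show ?thesis using WF_fps_act[OF W] by (simp add: flat_iff)
qed

lemma sigma_fps_act: "sigma_proj (fps_act c \<Psi>) = fps_act_sections c (sigma_proj \<Psi>)" for \<Psi> :: "('m, 'n, complex ^ 'k) wform"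
 by (intro ext) (simp add: sigma_proj_def fps_act_def fps_act_sections_def of_nat_diff)

lemma KK_sq: "\<Psi> \<in> E.WF ==> KK (KK \<Psi> - delta \<Psi>) = delta (KK \<Psi> - delta \<Psi>)"
 using Fed_Fed[of \<Psi>] Fed_KK[OF E.WF_D(1)] WF_Fed[of \<Psi>] by (simp add: Fed_KK[OF E.WF_D(1)])

lemmas KK_solve = WF_KK KK_linear(2) total_degree_KK[OF E.WF_D(1)] form_degree_KK[OF E.WF_D(1)] KK_sq

lemma formal_iff: "s \<in> formal_sections G \<longleftrightarrow> (\<forall>k. sec UNIV (s k))"
 by (simp add: formal_sections_def)

lemma sigma_bij: "bij_betw sigma_proj (flat_E G r r') (formal_sections G)"
 unfolding bij_betw_def
proof
 show "inj_on sigma_proj (flat_E G r r')"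
 proof (rule inj_onI)
  fix \<Psi> \<Phi> assume F: "\<Psi> \<in> flat_E G r r'" "\<Phi> \<in> flat_E G r r'" and e: "sigma_proj \<Psi> = sigma_proj \<Phi>"
  have "\<Psi> - \<Phi> = 0"
  proof (rule E.flat_unique[of KK])
   show "\<Psi> - \<Phi> \<in> E.WF" "form_degree 0 (\<Psi> - \<Phi>)" "delta (\<Psi> - \<Phi>) = KK (\<Psi> - \<Phi>)"
    using flat_linear(2)[OF F] by (simp_all add: flat_iff)
   show "sigma_proj (\<Psi> - \<Phi>) = (%k p. 0)" by (intro ext) (simp add: sigma_proj_linear e fun_ops)
  qed (rule KK_solve; assumption)+
  then show "\<Psi> = \<Phi>" by simp
 qed
 show "sigma_proj ` flat_E G r r' = formal_sections G"
 proof (intro equalityI subsetI)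
  fix s assume "s \<in> sigma_proj ` flat_E G r r'"
  then obtain \<Psi> where F: "\<Psi> \<in> flat_E G r r'" and s: "s = sigma_proj \<Psi>" by blast
  have W: "\<Psi> \<in> E.WF" using F by (simp add: flat_iff)
  show "s \<in> formal_sections G"
   unfolding formal_iff
  proof (intro allI secI)
   fix k t assume t: "t \<in> trivs G"
   show "sfun (UNIV \<inter> fst t) (%q. snd t q *v s k q)"
    unfolding smooth_fun_def
   proof
    fix c assume c: "c \<in> atlas G"
    have "sec (fst c) (%q. s k q)"
     using E.SFD[OF E.WF_SF[OF W c], of "int k" "[]" "[]"] by (simp add: s sigma_proj_def frame_def pull_def)
    from smooth_funD[OF secD[OF this t] c]
    show "smooth_on (snd c ` (UNIV \<inter> fst t \<inter> fst c)) ((%q. snd t q *v s k q) \<circ> chart_inv c)"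
     by (simp add: Int_ac Int_absorb)
   qed
  qed
 next
  fix s assume s: "s \<in> formal_sections G"
  have "\<exists>\<Psi>\<in>E.WF. form_degree 0 \<Psi> \<and> delta \<Psi> = KK \<Psi> \<and> sigma_proj \<Psi> = s"
   by (rule E.flat_exists[of KK]; (rule KK_solve; assumption)?) (use s in \<open>simp add: formal_iff\<close>)
  then show "s \<in> sigma_proj ` flat_E G r r'" by (auto simp: flat_iff)
 qed
qed

subsection \<open>The recursion for \<open>\<tau>\<close>\<close>

lemma total_part_D: "total_part k (D_E G \<Psi>) = D_E G (total_part k \<Psi>)"
proof (intro ext)
 fix j p ys vs
 show "total_part k (D_E G \<Psi>) j p ys vs = D_E G (total_part k \<Psi>) j p ys vs"
 proof (cases "2 * j + int (length ys) = int k")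
  case True
  have "D_E G (total_part k \<Psi>) j p ys vs = D_E G \<Psi> j p ys vs"
   unfolding D_E_def by (rule cov_D_local[of "length ys"]) (simp_all add: total_part_def True)
  then show ?thesis using True by (simp add: total_part_def)
 next
  case False
  have "wsupp (%k' a b. 2 * k' + int a = int k) (D_E G (total_part k \<Psi>))"
   unfolding D_E_def by (rule wsupp_cov_D[where nabg="connE G", OF E.nabF_zero wsupp_total_part(1)])
  from fsuppD[OF wsuppD[OF this, of j p], of ys vs] False show ?thesis by (simp add: total_part_def)
 qed
qed

lemma total_part_to_End: "total_part i (to_End \<Phi>) = (to_End (total_part i \<Phi>) :: ('m, 'n, complex ^ 'k ^ 'k) wform)"
 by (simp add: total_part_def to_End_def fun_eq_iff mat_linear)

lemma total_part_parity: "total_part i (parity \<Psi>) = parity (total_part i \<Psi>)" for \<Psi> :: "('m, 'n, complex ^ 'k) wform"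
 by (simp add: total_part_def parity_def fun_eq_iff)

lemma total_part_ad:
 assumes l: "lb 0 \<Psi>"
 shows "total_part n (ad_E G r \<Psi>) = (\<Sum>i\<le>n. ad_E G (total_part i r) (total_part (n - i) \<Psi>))"
proof -
 have "total_part n (ad_E G r \<Psi>) = (\<Sum>i\<le>n. lm (total_part i (to_End r)) (total_part (n - i) \<Psi>)) - (\<Sum>i\<le>n. rm (total_part i (parity \<Psi>)) (total_part (n - i) r))"
  unfolding ad_E_def lmult_E_def rmult_E_def total_part_linear total_part_wprod[OF cb(1) to_End_lb[OF lb_r] l]
   total_part_wprod[OF cb(2) lb_ops(7)[OF l] lb_r] ..
 also have "(\<Sum>i\<le>n. rm (total_part i (parity \<Psi>)) (total_part (n - i) r)) = (\<Sum>i\<le>n. rm (total_part (n - i) (parity \<Psi>)) (total_part i r))"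
  by (rule sum_flip_atMost)
 finally show ?thesis
  by (simp add: ad_E_def lmult_E_def rmult_E_def sum_subtractf total_part_to_End total_part_parity)
qed

lemma total_part_low: "total_degree_ge d \<Phi> ==> i < d ==> total_part i \<Phi> = (0 :: ('m, 'n, 'f::complex_fibre) wform)"
 by (auto simp: total_degree_ge_def total_part_def fun_eq_iff fun_ops)

lemma lb_r_E: "lb 0 (r_E r r')" and total_degree_r_E: "total_degree_ge 1 (r_E r r')"
proof -
 have e: "r_E r r' = i_over_lambda rho" by (simp add: r_E_def rho_def)
 show "lb 0 (r_E r r')"
 proof (rule lb_fibI)
  fix k :: int and p assume "k < 0"
  then have "rho (k + 1) p = 0" using lbD_fib[OF lb_rho, of "k + 1"] rho_zero by (cases "k = - 1") auto
  then show "r_E r r' k p = 0" by (simp add: e cscale_fib lambda_shift_def)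
 qed
 have "wsupp (%k a b. int 3 \<le> 2 * k + int a) rho"
  unfolding rho_def by (intro wsupp_linear to_End_wsupp r'_facts(3)[unfolded wsupp_conv] r_facts(3)[unfolded wsupp_conv])
 then have "wsupp (%k a b. int 1 \<le> 2 * k + int a) (lambda_shift (- 1) rho)" by (rule wsupp_shift) simp
 then show "total_degree_ge 1 (r_E r r')" unfolding e wsupp_conv by (rule wsupp_linear(4))
qed

text \<open>Division by lambda lowers the total degree by 2, so the component of degree
  \<open>l + 2\<close> of \<open>r\<close> appears. The sum starts at 1 because \<open>r\<close>
  begins in degree 3 and \<open>r_E\<close> in degree 1.\<close>

lemma total_part_KK:
 assumes W: "\<Psi> \<in> E.WF"
 shows "total_part k (KK \<Psi>) = D_E G (total_part k \<Psi>) + (\<Sum>l = 1..k.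
   i_over_lambda (ad_E G (total_part (l + 2) r) (total_part (k - l) \<Psi>)) + lmult_E G (total_part l (r_E r r')) (total_part (k - l) \<Psi>))"
proof -
 note l = E.WF_D(1)[OF W]
 have "KK \<Psi> = D_E G \<Psi> + i_over_lambda (ad_E G r \<Psi>) + lm (r_E r r') \<Psi>"
  using Fed_KK[OF l] unfolding Fed_E_def lmult_E_def by (simp add: algebra_simps)
 then have 1: "total_part k (KK \<Psi>) = D_E G (total_part k \<Psi>) + i_over_lambda (total_part (k + 2) (ad_E G r \<Psi>)) + total_part k (lm (r_E r r') \<Psi>)"
  by (simp add: total_part_linear total_part_D total_part_lambda)
 have "ad_E G (total_part i r) (total_part j \<Psi>) = 0" if "i < 3" for i j
  using total_part_low[OF r_facts(3) that] by (simp add: ad_E_def lmult_E_def rmult_E_def to_End_ops wprod_zero)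
 then have "total_part (k + 2) (ad_E G r \<Psi>) = (\<Sum>i\<in>{3..k + 2}. ad_E G (total_part i r) (total_part (k + 2 - i) \<Psi>))"
  unfolding total_part_ad[OF l] by (intro sum.mono_neutral_right) auto
 also have "\<dots> = (\<Sum>l = 1..k. ad_E G (total_part (l + 2) r) (total_part (k - l) \<Psi>))"
 proof -
  have "{3..k + 2} = {1 + 2..k + 2}" by simp
  then show ?thesis by (simp only: sum.shift_bounds_cl_nat_ivl diff_cancel2)
 qed
 finally have 2: "i_over_lambda (total_part (k + 2) (ad_E G r \<Psi>)) = (\<Sum>l = 1..k. i_over_lambda (ad_E G (total_part (l + 2) r) (total_part (k - l) \<Psi>)))"
  by (simp only: i_over_lambda_sum)
 have "lm (total_part i (r_E r r')) (total_part j \<Psi>) = 0" if "i < 1" for i j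
  using total_part_low[OF total_degree_r_E that] by (simp add: wprod_zero)
 then have 3: "total_part k (lm (r_E r r') \<Psi>) = (\<Sum>l = 1..k. lmult_E G (total_part l (r_E r r')) (total_part (k - l) \<Psi>))"
  unfolding total_part_wprod[OF cb(1) lb_r_E l] lmult_E_def by (intro sum.mono_neutral_right) (auto simp: not_less_eq_eq)
 show ?thesis unfolding 1 2 3 sum.distrib by (simp only: add.assoc)
qed

lemma total_part_delta_inv: "total_part (k + 1) (delta_inv \<Phi>) = delta_inv (total_part k \<Phi>)" for \<Phi> :: "('m, 'n, complex ^ 'k) wform"
proof (rule total_part_commute)
 show "delta_inv \<Phi> = delta_inv (total_part k \<Phi>) + delta_inv (\<Phi> - total_part k \<Phi>)"
  by (simp add: delta_inv_linear)
 show "wsupp (%k' a b. 2 * k' + int a = int (k + 1)) (delta_inv (total_part k \<Phi>))"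
  by (rule wsupp_delta_inv[OF wsupp_total_part(1)]) simp
 show "wsupp (%k' a b. 2 * k' + int a \<noteq> int (k + 1)) (delta_inv (\<Phi> - total_part k \<Phi>))"
  by (rule wsupp_delta_inv[OF wsupp_rest]) simp
qed

lemma tau_E_recursion:
 assumes s: "sec UNIV s"
 shows "total_part 0 (tau_E G r r' s) = incl0 s"
  "total_part (k + 1) (tau_E G r r' s) = delta_inv (total_part k (KK (tau_E G r r' s)))"
  "tau_E G r r' s \<in> E.WF"
proof -
 let ?s = "%k. if k = 0 then s else 0" and ?T = "tau_E G r r' s"
 have fs: "?s \<in> formal_sections G"
  using s E.smF_zero[OF open_UNIV] by (simp add: formal_iff zero_fun_def)
 have F: "?T \<in> flat_E G r r'" and sg: "sigma_proj ?T = ?s"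
  unfolding tau_E_def using bij_betw_apply[OF bij_betw_the_inv_into[OF sigma_bij] fs] f_the_inv_into_f_bij_betw[OF sigma_bij fs] by simp_all
 have W: "?T \<in> E.WF" and f: "form_degree 0 ?T" and e: "delta ?T = KK ?T" using F by (auto simp: flat_iff)
 show "?T \<in> E.WF" by (rule W)
 have sig: "?T j p [] [] = (if j = 0 then s p else 0)" for j p
 proof (cases "0 \<le> j")
  case True
  then show ?thesis using fun_cong[OF fun_cong[OF sg, of "nat j"], of p] by (auto simp: sigma_proj_def fun_ops split: if_splits)
 next
  case False
  then show ?thesis using lbD_fib[OF E.WF_D(1)[OF W], of j p] by (simp add: fun_ops)
 qed
 show "total_part 0 ?T = incl0 s"
 proof (intro ext)
  fix j p ys vs
  show "total_part 0 ?T j p ys vs = incl0 s j p ys vs"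
  proof (cases "j < 0")
   case True
   then show ?thesis using lbD_fib[OF E.WF_D(1)[OF W], of j p] by (simp add: total_part_def incl0_def fun_ops)
  next
   case False
   then have "2 * j + int (length ys) = 0 \<longleftrightarrow> j = 0 \<and> ys = []" by (cases ys) auto
   then show ?thesis using f sig by (auto simp: total_part_def incl0_def form_degree_def)
  qed
 qed
 have "?T = delta_inv (KK ?T) + sig ?T"
  by (rule E.flat_expand[of KK, OF _ _ _ _ _ W f e]; rule KK_solve; assumption)
 \<comment> \<open>The section \<open>s\<close> carries no lambda, so the part of degree zero in
   both gradings sits in total degree 0.\<close>
 moreover have "total_part (k + 1) (sig ?T) = 0"
  by (auto simp: total_part_def sig_def sig fun_eq_iff fun_ops)
 ultimately have "total_part (k + 1) ?T = total_part (k + 1) (delta_inv (KK ?T))"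
  using total_part_linear(1)[of "k + 1" "delta_inv (KK ?T)" "sig ?T"] by simp
 then show "total_part (k + 1) ?T = delta_inv (total_part k (KK ?T))" by (simp only: total_part_delta_inv)
qed

end

theorem theorem3:
  fixes G :: "('m::{second_countable_topology, t2_space}, 'n::finite, 'k::finite) fedosov_data"
    and \<Omega> :: "nat \<Rightarrow> 'm \<Rightarrow> real ^ 'n \<Rightarrow> real ^ 'n \<Rightarrow> complex"
    and r :: "('m, 'n, complex) wform"
    and r' :: "('m, 'n, complex ^ 'k ^ 'k) wform"
  assumes "smooth_manifold (atlas G)"
    and "symplectic_form (atlas G) (sympl G)"
    and "connection (atlas G) (*\<^sub>R) (smooth_vf (atlas G)) (connM G)"
    and "torsion_free (atlas G) (connM G)"
    and "symplectic_conn (atlas G) (sympl G) (connM G)"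
    and "vector_bundle (atlas G) (trivs G)"
    and "connection (atlas G) (*\<^sub>c) (smooth_section (atlas G) (trivs G)) (connE G)"
    and "\<forall>i\<ge>1. closed_two_form (atlas G) (\<Omega> i)"
    and "fedosov_r G \<Omega> r"
    and "fedosov_r' G \<Omega> r'"
  shows
    "(\<forall>d. \<forall>\<Psi>\<in>weyl_E G. form_degree d \<Psi> \<longrightarrow>
        Fed_E G r r' \<Psi> \<in> weyl_E G \<and> form_degree (d + 1) (Fed_E G r r' \<Psi>)) \<and>
     (\<forall>d. \<forall>a\<in>weyl_End G. \<forall>\<Psi>\<in>weyl_E G. form_degree d a \<longrightarrow>
        Fed_E G r r' (lmult_E G a \<Psi>)
        = lmult_E G (Fed_End G r' a) \<Psi> + cscale ((- 1) ^ d) (lmult_E G a (Fed_E G r r' \<Psi>))) \<and>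
     (\<forall>d. \<forall>\<Psi>\<in>weyl_E G. \<forall>b\<in>weyl_W G. form_degree d \<Psi> \<longrightarrow>
        Fed_E G r r' (rmult_E G \<Psi> b)
        = rmult_E G (Fed_E G r r' \<Psi>) b + cscale ((- 1) ^ d) (rmult_E G \<Psi> (Fed_W G r b))) \<and>
     (\<forall>\<Psi>\<in>weyl_E G. Fed_E G r r' (Fed_E G r r' \<Psi>) = 0) \<and>
     (\<forall>\<Psi>\<in>flat_E G r r'. \<forall>\<Psi>'\<in>flat_E G r r'.
        \<Psi> + \<Psi>' \<in> flat_E G r r' \<and> sigma_proj (\<Psi> + \<Psi>') = sigma_proj \<Psi> + sigma_proj \<Psi>') \<and>
     (\<forall>c. \<forall>\<Psi>\<in>flat_E G r r'.
        fps_act c \<Psi> \<in> flat_E G r r' \<and> sigma_proj (fps_act c \<Psi>) = fps_act_sections c (sigma_proj \<Psi>)) \<and>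
     bij_betw sigma_proj (flat_E G r r') (formal_sections G) \<and>
     (\<forall>s. smooth_section (atlas G) (trivs G) UNIV s \<longrightarrow>
        total_part 0 (tau_E G r r' s) = incl0 s \<and>
        (\<forall>k. total_part (k + 1) (tau_E G r r' s) =
          delta_inv (D_E G (total_part k (tau_E G r r' s)) +
            (\<Sum>l = 1..k.
               i_over_lambda (ad_E G (total_part (l + 2) r) (total_part (k - l) (tau_E G r r' s))) +
               lmult_E G (total_part l (r_E r r')) (total_part (k - l) (tau_E G r r' s))))))"
proof -
 interpret fedosov G \<Omega> r r'
  by (intro fedosov.intro fedosov_bundle.intro manifold.intro fedosov_bundle_axioms.intro fedosov_axioms.intro; rule assms)
 show ?thesis
 proof (intro conjI allI ballI impI)
  fix d \<Psi> assume W: "\<Psi> \<in> weyl_E G" and d: "form_degree d \<Psi>"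
  show "Fed_E G r r' \<Psi> \<in> weyl_E G" using WF_Fed W by (simp add: weyl_E_WF)
  show "form_degree (d + 1) (Fed_E G r r' \<Psi>)"
   using form_degree_Fed[OF E.WF_D(1) d] W by (simp add: weyl_E_WF)
 next
  fix d a \<Psi> assume "a \<in> weyl_End G" "\<Psi> \<in> weyl_E G" "form_degree d a"
  then show "Fed_E G r r' (lmult_E G a \<Psi>) = lmult_E G (Fed_End G r' a) \<Psi> + cscale ((- 1) ^ d) (lmult_E G a (Fed_E G r r' \<Psi>))"
   unfolding lmult_E_def weyl_E_WF weyl_End_def by (rule Fed_lmult)
 next
  fix d \<Psi> b assume "\<Psi> \<in> weyl_E G" "b \<in> weyl_W G" "form_degree d \<Psi>"
  then show "Fed_E G r r' (rmult_E G \<Psi> b) = rmult_E G (Fed_E G r r' \<Psi>) b + cscale ((- 1) ^ d) (rmult_E G \<Psi> (Fed_W G r b))"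
   unfolding rmult_E_def weyl_E_WF weyl_W_def by (intro Fed_rmult)
 next
  fix \<Psi> assume "\<Psi> \<in> weyl_E G"
  then show "Fed_E G r r' (Fed_E G r r' \<Psi>) = 0" unfolding weyl_E_WF by (rule Fed_Fed)
 next
  fix \<Psi> \<Psi>' assume "\<Psi> \<in> flat_E G r r'" "\<Psi>' \<in> flat_E G r r'"
  then show "\<Psi> + \<Psi>' \<in> flat_E G r r'" by (rule flat_linear)
  show "sigma_proj (\<Psi> + \<Psi>') = sigma_proj \<Psi> + sigma_proj \<Psi>'" by (rule sigma_proj_linear)
 next
  fix c \<Psi> assume "\<Psi> \<in> flat_E G r r'"
  then show "fps_act c \<Psi> \<in> flat_E G r r'" by (rule flat_fps_act)
  show "sigma_proj (fps_act c \<Psi>) = fps_act_sections c (sigma_proj \<Psi>)" by (rule sigma_fps_act)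
 next
  show "bij_betw sigma_proj (flat_E G r r') (formal_sections G)" by (rule sigma_bij)
 next
  fix s k assume s: "smooth_section (atlas G) (trivs G) UNIV s"
  show "total_part 0 (tau_E G r r' s) = incl0 s" by (rule tau_E_recursion(1)[OF s])
  show "total_part (k + 1) (tau_E G r r' s) = delta_inv (D_E G (total_part k (tau_E G r r' s)) +
      (\<Sum>l = 1..k.
        i_over_lambda (ad_E G (total_part (l + 2) r) (total_part (k - l) (tau_E G r r' s))) +
        lmult_E G (total_part l (r_E r r')) (total_part (k - l) (tau_E G r r' s))))"
   unfolding tau_E_recursion(2)[OF s] total_part_KK[OF tau_E_recursion(3)[OF s]] ..
 qed
qed

end
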